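(* Let $N\in\{2,3\}$, let $\Omega\subset\mathbb{R}^N$ be a smooth bounded domain, and let $\omega_1,\omega_2\in\mathbb{R}$ be fixed constants. For every $\beta\in(0,+\infty)$ let $\lambda_\beta,\mu_\beta\in\mathbb{R}$, with $\{\lambda_\beta\}_{\beta>0}$ and $\{\mu_\beta\}_{\beta>0}$ bounded in $\mathbb{R}$, and let $u_\beta,v_\beta\in H^1_0(\Omega)$ be positive solutions of $$ \begin{cases} -\Delta u_\beta+\lambda_\beta u_\beta=\omega_1u_\beta^3-\beta u_\beta v_\beta^2 & \text{in }\Omega,\\ -\Delta v_\beta+\mu_\beta v_\beta=\omega_2v_\beta^3-\beta u_\beta^2v_\beta & \text{in }\Omega. \end{cases} $$ Assume that $u_\beta,v_\beta$ are bounded in $L^\infty(\Omega)$ uniformly in $\beta$. Then for every $\alpha\in(0,1)$ there exists $C>0$, independent of $\beta$, such that $$ \|(u_\beta,v_\beta)\|_{C^{0,\alpha}(\overline{\Omega})}\le C\qquad\text{for every }\beta>0. $$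
   Context: Solutions are understood in the weak ($H^1_0$) sense. $C^{0,\alpha}(\overline\Omega)$ is the space of $\alpha$-H\"older continuous functions on $\overline\Omega$ with its usual norm. *)

theory Defs
  imports "HOL-Analysis.Analysis"
begin

section \<open>Smooth functions and smooth bounded domains\<close>

text \<open>For open \<open>S\<close> this is the usual class \<open>C\<^sup>k(S)\<close>, via iterated partial derivatives.\<close>

primrec Ck_on :: "nat \<Rightarrow> 'a::euclidean_space set \<Rightarrow> ('a \<Rightarrow> real) \<Rightarrow> bool" where
  "Ck_on 0 S f \<longleftrightarrow> continuous_on S f"
| "Ck_on (Suc k) S f \<longleftrightarrow> (\<forall>x\<in>S. f differentiable (at x)) \<and>
     (\<forall>b\<in>Basis. Ck_on k S (\<lambda>x. frechet_derivative f (at x) b))"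

definition smooth_on :: "'a::euclidean_space set \<Rightarrow> ('a \<Rightarrow> real) \<Rightarrow> bool" where
  "smooth_on S f \<longleftrightarrow> (\<forall>k. Ck_on k S f)"

text \<open>Near each boundary point, after a rotation of the coordinate axes, the set is the region
  strictly above the graph of a smooth function of \<open>N - 1\<close> variables. The unit vector \<open>e\<close> is the
  direction of the last rotated axis; \<open>\<gamma>\<close> is only evaluated at orthogonal projections onto the
  hyperplane \<open>e\<^sup>\<bottom>\<close>, so it stands for a function of the remaining \<open>N - 1\<close> coordinates.\<close>

definition smooth_boundary :: "'a::euclidean_space set \<Rightarrow> bool" where
  "smooth_boundary \<Omega> \<longleftrightarrow>
     (\<forall>x0 \<in> frontier \<Omega>. \<exists>r>0. \<exists>e. \<exists>\<gamma>. norm e = 1 \<and> smooth_on UNIV \<gamma> \<and>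
        \<Omega> \<inter> ball x0 r = {x \<in> ball x0 r. x \<bullet> e > \<gamma> (x - (x \<bullet> e) *\<^sub>R e)})"

definition smooth_bounded_domain :: "'a::euclidean_space set \<Rightarrow> bool" where
  "smooth_bounded_domain \<Omega> \<longleftrightarrow>
     open \<Omega> \<and> connected \<Omega> \<and> \<Omega> \<noteq> {} \<and> bounded \<Omega> \<and> smooth_boundary \<Omega>"

section \<open>Sobolev spaces\<close>

text \<open>Elements of Lebesgue and Sobolev spaces on \<open>\<Omega>\<close> are represented by functions on the whole
  space, of which only the values almost everywhere on \<open>\<Omega>\<close> matter.\<close>

definition test_functions :: "'a::euclidean_space set \<Rightarrow> ('a \<Rightarrow> real) set" where
  "test_functions \<Omega> = {\<phi>. smooth_on UNIV \<phi> \<and>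
     compact (closure {x. \<phi> x \<noteq> 0}) \<and> closure {x. \<phi> x \<noteq> 0} \<subseteq> \<Omega>}"

definition L2 :: "'a::euclidean_space set \<Rightarrow> ('a \<Rightarrow> 'b::euclidean_space) set" where
  "L2 \<Omega> = {f. f \<in> borel_measurable (lebesgue_on \<Omega>) \<and>
     integrable (lebesgue_on \<Omega>) (\<lambda>x. (norm (f x))\<^sup>2)}"

definition is_weak_grad ::
    "'a::euclidean_space set \<Rightarrow> ('a \<Rightarrow> real) \<Rightarrow> ('a \<Rightarrow> 'a) \<Rightarrow> bool" where
  "is_weak_grad \<Omega> u g \<longleftrightarrow> g \<in> L2 \<Omega> \<and>
     (\<forall>\<phi>\<in>test_functions \<Omega>. \<forall>b\<in>Basis.
        (LINT x|lebesgue_on \<Omega>. u x * frechet_derivative \<phi> (at x) b)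
          = - (LINT x|lebesgue_on \<Omega>. (g x \<bullet> b) * \<phi> x))"

definition H1 :: "'a::euclidean_space set \<Rightarrow> ('a \<Rightarrow> real) set" where
  "H1 \<Omega> = {u \<in> L2 \<Omega>. \<exists>g. is_weak_grad \<Omega> u g}"

text \<open>For open \<open>\<Omega>\<close> and \<open>u \<in> H1 \<Omega>\<close> the weak gradient is unique up to null subsets of \<open>\<Omega>\<close>.\<close>

definition weak_grad :: "'a::euclidean_space set \<Rightarrow> ('a \<Rightarrow> real) \<Rightarrow> 'a \<Rightarrow> 'a" where
  "weak_grad \<Omega> u = (SOME g. is_weak_grad \<Omega> u g)"

definition H1_norm :: "'a::euclidean_space set \<Rightarrow> ('a \<Rightarrow> real) \<Rightarrow> real" where
  "H1_norm \<Omega> u = sqrt ((LINT x|lebesgue_on \<Omega>. (u x)\<^sup>2)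
                       + (LINT x|lebesgue_on \<Omega>. (norm (weak_grad \<Omega> u x))\<^sup>2))"

definition H1_0 :: "'a::euclidean_space set \<Rightarrow> ('a \<Rightarrow> real) set" where
  "H1_0 \<Omega> = {u \<in> H1 \<Omega>. \<exists>\<phi>::nat \<Rightarrow> 'a \<Rightarrow> real. (\<forall>n. \<phi> n \<in> test_functions \<Omega>) \<and>
     (\<lambda>n. H1_norm \<Omega> (\<lambda>x. \<phi> n x - u x)) \<longlonglongrightarrow> 0}"

section \<open>Weak solutions\<close>

text \<open>\<open>weak_solution \<Omega> c f u\<close>: the function \<open>u\<close> is a weak solution in \<open>H\<^sup>1\<^sub>0(\<Omega>)\<close> of
  \<open>- \<Delta>u + c u = f\<close>. Integrability of \<open>f \<phi>\<close> is required because the Bochner integral of a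
  non-integrable function is \<open>0\<close> by convention.\<close>

definition weak_solution ::
    "'a::euclidean_space set \<Rightarrow> real \<Rightarrow> ('a \<Rightarrow> real) \<Rightarrow> ('a \<Rightarrow> real) \<Rightarrow> bool" where
  "weak_solution \<Omega> c f u \<longleftrightarrow> u \<in> H1_0 \<Omega> \<and>
     (\<forall>\<phi>\<in>H1_0 \<Omega>. integrable (lebesgue_on \<Omega>) (\<lambda>x. f x * \<phi> x) \<and>
        (LINT x|lebesgue_on \<Omega>. weak_grad \<Omega> u x \<bullet> weak_grad \<Omega> \<phi> x + c * u x * \<phi> x)
          = (LINT x|lebesgue_on \<Omega>. f x * \<phi> x))"

section \<open>Hoelder norm\<close>

text \<open>Extended-valued, so the norm is finite exactly for the members of \<open>C\<^sup>0\<^sup>,\<^sup>\<alpha>(K)\<close>.\<close>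

definition holder_norm ::
    "'a::metric_space set \<Rightarrow> real \<Rightarrow> ('a \<Rightarrow> 'b::real_normed_vector) \<Rightarrow> ennreal" where
  "holder_norm K \<alpha> f = (SUP x\<in>K. ennreal (norm (f x))) +
     (SUP (x, y) \<in> {(x, y). x \<in> K \<and> y \<in> K \<and> x \<noteq> y}.
        ennreal (norm (f x - f y) / dist x y powr \<alpha>))"

end

theory Submission
 imports Defs "HOL-Complex_Analysis.Great_Picard"
begin

text \<open>Bounded weak solutions are made classical by mollification. For classical solutions in dimension
 \<open>N \<le> 4\<close> Almgren's frequency is almost monotone. A lower bound \<open>2 \<alpha>\<close> for it at the points where \<open>u = v\<close>,
 uniform in \<open>\<beta>\<close>, forces the growth \<open>r^\<alpha>\<close> there; away from such points the smaller component is
 controlled by the Keller-Osserman bound. Together they give a scale-invariant interior Hoelder estimate.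
 If the lower bound failed for some \<open>\<alpha> < 1\<close>, a blow-up at the smallest possible frequency would have a
 segregated limit, homogeneous of some degree \<open>d < 1\<close> and invariant under translations along its zero set.
 At a minimum point on the unit sphere of the orthogonal complement of that set, the limit is touched from
 below by a multiple of \<open>|p x|^d\<close>, where \<open>p\<close> is the projection onto a plane, or, if the complement is a line,
 it equals a multiple of \<open>(a \<bullet> x)^d\<close>. The Laplacians of these functions are positive and negative,
 respectively, whereas the limit is harmonic where it is positive. Exterior balls give barriers, hence
 linear decay at the boundary, which turns the scaled interior estimate into the global one.\<close>

text \<open>A frequency bound can only be asked at radii where the scale-invariant competition
  \<open>be*r^2*hgt u v x r\<close> exceeds a threshold: at a coincidence point both components are
  positive and of class C2, so the frequency tends to 0 with the radius. Below the threshold the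
  rescaled equations have bounded coefficients and ordinary elliptic estimates apply. This dichotomy
  also covers small \<open>be\<close>, so bounded competition needs no argument of its own. A
  blow-up needs compactness before any Hoelder bound is known. It comes from a small positive
  exponent, for which the frequency bound is proved directly, without a limit. The resulting
  equicontinuity is then used at the supremum of all admissible exponents: exponents slightly below
  it are still admissible, which bounds the frequency of the limit from below at coincidence points,
  and the failure slightly above it bounds the frequency from above at the origin.\<close>

notation scaleR (infixr "*." 75) and inner (infixl ".*" 70) and abs ("|_|")
 and LIMSEQ (infix "---->" 60) and tendsto (infixr "--->" 55)
abbreviation evs :: "(nat => bool) => bool" (binder "EV " 10) where
 "evs P == eventually P sequentially"
abbreviation "cont1 == continuous_on (cball 0 1)"
no_notation vector_scalar_mult (infixl "*s" 70) and matrix_vector_mult (infixl "*v" 70)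
 and vector_matrix_mult (infixl "v*" 70)

section \<open>Functions of class C2\<close>

definition grad :: "('a::euclidean_space => real) => 'a => 'a" where
 "grad f x = (SUM b:Basis. frechet_derivative f (at x) b*.b)"

definition hess :: "('a::euclidean_space => real) => 'a => 'a => 'a" where
 "hess f x = frechet_derivative (grad f) (at x)"

definition lap :: "('a::euclidean_space => real) => 'a => real" where
 "lap f x = (SUM b:Basis. hess f x b .* b)"

text \<open>Continuity of the second derivative is asked direction by direction; in finite dimension
  this amounts to continuity as an operator.\<close>

definition C2 :: "'a::euclidean_space set => ('a => real) => bool" where
 "C2 S f \<longleftrightarrow> open S & (ALL x:S. f differentiable (at x) & grad f differentiable (at x)) &
  (ALL h. continuous_on S (%x. hess f x h))"

lemma grad_works:
 assumes "f differentiable (at x)"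
 shows "(f has_derivative (%h. grad f x .* h)) (at x)"
proof -
 let ?D = "frechet_derivative f (at x)"
 have D: "(f has_derivative ?D) (at x)" using assms frechet_derivative_works by blast
 hence lin: "linear ?D" by (rule has_derivative_linear)
 have "?D h = grad f x .* h" for h
 proof -
  have "?D h = ?D (SUM b:Basis. (h .* b)*.b)" by (simp add: euclidean_representation)
  also have "... = (SUM b:Basis. (h .* b)*?D b)"
   using lin by (simp add: linear_sum linear_scale)
  also have "... = grad f x .* h"
   by (simp add: grad_def inner_sum_right inner_commute[of _ h] mult.commute)
  finally show ?thesis .
 qed
 hence "?D = (%h. grad f x .* h)" by blast
 thus ?thesis using D by simp
qed

lemma grad_eqI:
 assumes "(f has_derivative (%h. g .* h)) (at x)"
 shows "grad f x = g"
proof -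
 have "frechet_derivative f (at x) = (%h. g .* h)"
  using frechet_derivative_at[OF assms] by simp
 thus ?thesis by (simp add: grad_def euclidean_representation)
qed

lemma C2_open: "C2 S f ==> open S" by (simp add: C2_def)

lemma C2_grad: "C2 S f ==> x : S ==> (f has_derivative (%h. grad f x .* h)) (at x)"
 by (simp add: C2_def grad_works)

lemma C2_hess: "C2 S f ==> x : S ==> (grad f has_derivative hess f x) (at x)"
 by (simp add: C2_def hess_def frechet_derivative_works[symmetric])

lemma C2_cont: "C2 S f ==> continuous_on S f"
 by (meson C2_grad continuous_at_imp_continuous_on has_derivative_continuous)

lemma C2_cont_grad: "C2 S f ==> continuous_on S (grad f)"
 by (meson C2_hess continuous_at_imp_continuous_on has_derivative_continuous)

lemma C2_cont_hess: "C2 S f ==> continuous_on S (%x. hess f x h)" by (simp add: C2_def)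

lemma C2_cont_lap: "C2 S f ==> continuous_on S (lap f)"
 unfolding lap_def[abs_def] by (intro continuous_intros C2_cont_hess)

lemma C2_subset: "C2 S f ==> open T ==> T <= S ==> C2 T f"
 unfolding C2_def by (blast intro: continuous_on_subset)

lemma C2I:
 assumes S: "open S"
  and f: "!!x. x : S ==> (f has_derivative (%h. G x .* h)) (at x)"
  and G: "!!x. x : S ==> (G has_derivative K x) (at x)"
  and K: "!!h. continuous_on S (%x. K x h)"
 shows "C2 S f" "!!x. x : S ==> grad f x = G x" "!!x. x : S ==> hess f x = K x"
proof -
 show gr: "grad f x = G x" if "x : S" for x using f[OF that] by (rule grad_eqI)
 have gK: "(grad f has_derivative K x) (at x)" if "x : S" for x
  by (rule has_derivative_transform_within_open[OF G[OF that] S that]) (simp add: gr)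
 show he: "hess f x = K x" if "x : S" for x
  unfolding hess_def using frechet_derivative_at[OF gK[OF that]] by simp
 have "continuous_on S (%x. hess f x h)" for h
  using K[of h] he by (simp cong: continuous_on_cong)
 moreover have "f differentiable at x" "grad f differentiable at x" if "x : S" for x
  using f[OF that] gK[OF that] by (auto simp: differentiable_def)
 ultimately show "C2 S f" unfolding C2_def using S by simp
qed

lemma C2_mult:
 assumes f: "C2 S f" and g: "C2 S g"
 shows "C2 S (%x. f x*g x)"
  "!!x. x : S ==> grad (%x. f x*g x) x = f x*.grad g x + g x*.grad f x"
  "!!x. x : S ==> lap (%x. f x*g x) x = f x*lap g x + 2*(grad f x .* grad g x) + g x*lap f x"
proof -
 let ?G = "%x. f x*.grad g x + g x*.grad f x"
 let ?K = "%x h. (f x*.hess g x h + (grad f x .* h)*.grad g x)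
  + (g x*.hess f x h + (grad g x .* h)*.grad f x)"
 have 1: "((%x. f x*g x) has_derivative (%h. ?G x .* h)) (at x)" if "x : S" for x
  using has_derivative_mult[OF C2_grad[OF f that] C2_grad[OF g that]]
  by (simp add: inner_add_left algebra_simps)
 have 2: "(?G has_derivative ?K x) (at x)" if "x : S" for x
  by (intro has_derivative_add has_derivative_scaleR C2_grad[OF f that] C2_grad[OF g that]
    C2_hess[OF f that] C2_hess[OF g that])
 have 3: "continuous_on S (%x. ?K x h)" for h
  by (intro continuous_intros C2_cont[OF f] C2_cont[OF g] C2_cont_grad[OF f] C2_cont_grad[OF g]
    C2_cont_hess[OF f] C2_cont_hess[OF g])
 note A = C2I[OF C2_open[OF f] 1 2 3]
 show "C2 S (%x. f x*g x)" "!!x. x : S ==> grad (%x. f x*g x) x = ?G x" by (rule A; assumption)+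
 show "lap (%x. f x*g x) x = f x*lap g x + 2*(grad f x .* grad g x) + g x*lap f x"
  if "x : S" for x
  by (simp add: lap_def A(3)[OF _ _ that] inner_add_left sum.distrib sum_distrib_left
    euclidean_inner[of "grad f x" "grad g x"] algebra_simps)
qed

lemma C2_add:
 assumes f: "C2 S f" and g: "C2 S g"
 shows "C2 S (%x. f x + g x)"
  "!!x. x : S ==> grad (%x. f x + g x) x = grad f x + grad g x"
  "!!x. x : S ==> lap (%x. f x + g x) x = lap f x + lap g x"
proof -
 let ?G = "%x. grad f x + grad g x"
 let ?K = "%x h. hess f x h + hess g x h"
 have 1: "((%x. f x + g x) has_derivative (%h. ?G x .* h)) (at x)" if "x : S" for x
  using has_derivative_add[OF C2_grad[OF f that] C2_grad[OF g that]]
  by (simp add: inner_add_left)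
 have 2: "(?G has_derivative ?K x) (at x)" if "x : S" for x
  by (intro has_derivative_add C2_hess[OF f that] C2_hess[OF g that])
 have 3: "continuous_on S (%x. ?K x h)" for h
  by (intro continuous_intros C2_cont_hess[OF f] C2_cont_hess[OF g])
 note A = C2I[OF C2_open[OF f] 1 2 3]
 show "C2 S (%x. f x + g x)" "!!x. x : S ==> grad (%x. f x + g x) x = ?G x" by (rule A; assumption)+
 show "lap (%x. f x + g x) x = lap f x + lap g x"
  if "x : S" for x
  by (simp add: lap_def A(3)[OF _ _ that] inner_add_left sum.distrib)
qed

lemma C2_const:
 assumes "open S"
 shows "C2 S (%x. c)" "!!x. x : S ==> grad (%x. c) x = 0"
  "!!x. x : S ==> lap (%x. c) x = 0"
proof -
 have 1: "((%x. c) has_derivative (%h. 0 .* h)) (at x)" for x :: 'a by simp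
 have 2: "((%x. 0) has_derivative (%h. 0)) (at x)" for x :: 'a by simp
 note A = C2I[OF assms 1 2 continuous_on_const]
 show "C2 S (%x. c)" "!!x. x : S ==> grad (%x. c) x = 0" by (fact A)+
 show "lap (%x. c) x = 0" if "x : S" for x by (simp add: lap_def A(3)[OF that])
qed

lemma C2_inner:
 assumes "open S"
 shows "C2 S (%x. x .* e)" "!!x. x : S ==> grad (%x. x .* e) x = e"
  "!!x. x : S ==> lap (%x. x .* e) x = 0"
proof -
 have 1: "((%x. x .* e) has_derivative (%h. e .* h)) (at x)" for x
  by (auto intro!: derivative_eq_intros simp: inner_commute)
 have 2: "((%x. e) has_derivative (%h. 0)) (at x)" for x :: 'a by simp
 note A = C2I[OF assms 1 2 continuous_on_const]
 show "C2 S (%x. x .* e)" "!!x. x : S ==> grad (%x. x .* e) x = e" by (fact A)+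
 show "lap (%x. x .* e) x = 0" if "x : S" for x by (simp add: lap_def A(3)[OF that])
qed

lemma C2_norm2:
 fixes a :: "'a::euclidean_space"
 assumes "open S"
 shows "C2 S (%x. (norm (x - a))^2)" "!!x. x : S ==> grad (%x. (norm (x - a))^2) x = 2*.(x - a)"
  "!!x. x : S ==> lap (%x. (norm (x - a))^2) x = 2*DIM('a)"
proof -
 have 1: "((%x. (norm (x - a))^2) has_derivative (%h. (2*.(x - a)) .* h)) (at x)" for x
  unfolding power2_norm_eq_inner
  by (auto intro!: derivative_eq_intros simp: inner_commute algebra_simps)
 have 2: "((%x. 2*.(x - a)) has_derivative (%h. 2*.h)) (at x)" for x
  by (auto intro!: derivative_eq_intros)
 note A = C2I[OF assms 1 2 continuous_on_const]
 show "C2 S (%x. (norm (x - a))^2)" "!!x. x : S ==> grad (%x. (norm (x - a))^2) x = 2*.(x - a)" by (fact A)+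
 show "lap (%x. (norm (x - a))^2) x = 2*DIM('a)" if "x : S" for x
  by (simp add: lap_def A(3)[OF that])
qed

lemma C2_cmult:
 fixes c :: real
 assumes f: "C2 S f"
 shows "C2 S (%x. c*f x)" "!!x. x : S ==> grad (%x. c*f x) x = c*.grad f x"
  "!!x. x : S ==> lap (%x. c*f x) x = c*lap f x"
 using C2_mult[OF C2_const(1)[OF C2_open[OF f], of c] f] C2_const(2,3)[OF C2_open[OF f], of _ c]
 by simp_all

lemma C2_diff:
 assumes f: "C2 S f" and g: "C2 S g"
 shows "C2 S (%x. f x - g x)"
  "!!x. x : S ==> grad (%x. f x - g x) x = grad f x - grad g x"
  "!!x. x : S ==> lap (%x. f x - g x) x = lap f x - lap g x"
 using C2_add[OF f C2_cmult(1)[OF g, of "-1"]] C2_cmult(2,3)[OF g, of _ "-1"] by simp_all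

section \<open>Symmetry of second derivatives and conditions at extrema\<close>

lemma line_derivative:
 assumes "(f has_derivative D) (at (x + t*.b))"
 shows "((%t. f (x + t*.b)) has_real_derivative D b) (at t)"
proof -
 have "((%t. x + t*.b) has_derivative (%u. u*.b)) (at t)" by (auto intro!: derivative_eq_intros)
 from has_derivative_compose[OF this assms] show ?thesis
  unfolding has_field_derivative_def linear_scale[OF has_derivative_linear[OF assms]] by (simp add: mult.commute[of _ "D b"])
qed

lemma affine_derivative:
 assumes "(f has_derivative D) (at (x + r*.y))"
 shows "((%y. f (x + r*.y)) has_derivative (%h. D (r*.h))) (at y)"
proof -
 have "((%y. x + r*.y) has_derivative (%h. r*.h)) (at y)" by (auto intro!: derivative_eq_intros)
 from has_derivative_compose[OF this assms] show ?thesis .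
qed

lemma C2_affine:
 assumes f: "C2 S f" and T: "open T" "!!y. y : T ==> x + r*.y : S"
 shows "C2 T (%y. f (x + r*.y))"
  "!!y. y : T ==> grad (%y. f (x + r*.y)) y = r*.grad f (x + r*.y)"
  "!!y. y : T ==> lap (%y. f (x + r*.y)) y = r^2*lap f (x + r*.y)"
proof -
 let ?a = "%y. x + r*.y"
 have 1: "((%y. f (?a y)) has_derivative (%h. (r*.grad f (?a y)) .* h)) (at y)" if "y : T" for y
  using affine_derivative[OF C2_grad[OF f T(2)[OF that]]] by simp
 have 2: "((%y. r*.grad f (?a y)) has_derivative (%h. r*.hess f (?a y) (r*.h))) (at y)"
  if "y : T" for y
  using has_derivative_scaleR_right[OF affine_derivative[OF C2_hess[OF f T(2)[OF that]]]]
  by simp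
 have lin: "hess f (?a y) (r*.h) = r*.hess f (?a y) h" if "y : T" for y h
  using has_derivative_linear[OF C2_hess[OF f T(2)[OF that]]] by (rule linear_scale)
 have 3: "continuous_on T (%y. r*.hess f (?a y) (r*.h))" for h
  by (intro continuous_intros continuous_on_compose2[OF C2_cont_hess[OF f]])
   (use T in auto)
 note A = C2I[OF T(1) 1 2 3]
 show "C2 T (%y. f (?a y))" "!!y. y : T ==> grad (%y. f (x + r*.y)) y = r*.grad f (x + r*.y)" by (rule A; assumption)+
 show "lap (%y. f (x + r*.y)) y = r^2*lap f (x + r*.y)" if "y : T" for y
  using that by (simp add: lap_def A(3)[OF _ _ that] lin sum_distrib_left power2_eq_square mult.assoc)
qed

text \<open>The second difference of \<open>f\<close> over the parallelogram spanned by
  \<open>t*.h\<close> and \<open>t*.k\<close> is symmetric in \<open>h\<close> and \<open>k\<close>.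
  By the mean value theorem in one direction and differentiability of the gradient at
  \<open>x\<close>, it equals \<open>t^2*(hess f x k .* h)\<close> up to a remainder of smaller
  order than \<open>t^2\<close>; exchanging the directions gives the other mixed term.\<close>

lemma hess_symmetric:
 assumes f: "C2 S f" and x: "x : S"
 shows "hess f x h .* k = hess f x k .* h"
proof -
 obtain e where e: "e > 0" "ball x e <= S" using C2_open[OF f] x openE by blast
 define N where "N = norm h + norm k + 1"
 have N: "N > 0" unfolding N_def by (smt (verit) norm_ge_zero)
 have "|hess f x h .* k - hess f x k .* h| <= ep" if "ep > 0" for ep
 proof -
  \<comment> \<open>Each of the two expansions errs by at most \<open>2*c*N*N*t^2\<close>; with this
    \<open>c\<close> the errors add up to \<open>ep*t^2\<close>.\<close>
  define c where "c = ep/(4*N*N)"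
  have c: "c > 0" using that N by (simp add: c_def)
  then obtain d where d: "d > 0" "!!y. norm (y - x) < d ==> norm (grad f y - grad f x - hess f x (y - x)) <= c*norm (y - x)"
   using C2_hess[OF f x] unfolding has_derivative_at_alt by blast
  define t where "t = min d e/(2*N)"
  have t: "0 < t" "t*N < d" "t*N < e" using d(1) e(1) N by (auto simp: t_def min_def)
  have D: "|f (x + t*.h + t*.k) - f (x + t*.h) - f (x + t*.k) + f x - t*(t*(hess f x k .* h))| <= t*(2*(c*(t*N))*N)"
   if hk: "norm h + norm k < N" for h k
  proof -
   have n: "norm (s*.h + r*.k) <= t*N" if "0 <= s" "s <= t" "0 <= r" "r <= t" for s r
   proof -
    have "norm (s*.h + r*.k) <= s*norm h + r*norm k" using norm_triangle_ineq[of "s*.h" "r*.k"] that by simp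
    also have "... <= t*norm h + t*norm k" by (intro add_mono mult_right_mono that) auto
    also have "... <= t*N" unfolding distrib_left[symmetric] using hk t(1) by simp
    finally show ?thesis .
   qed
   let ?g = "%s r. grad f (x + r*.k + s*.h)"
   have e1: "x + r*.k + s*.h - x = s*.h + r*.k" for s r by simp
   have inS: "x + r*.k + s*.h : S" if "0 <= s" "s <= t" "0 <= r" "r <= t" for s r
    using le_less_trans[OF n[OF that] t(3)] unfolding e1[of r s, symmetric] dist_norm[symmetric]
    by (intro subsetD[OF e(2)]) (simp only: mem_ball dist_commute[of x])
   have p: "((%s. f (x + t*.k + s*.h) - f (x + 0*.k + s*.h)) has_real_derivative (?g s t - ?g s 0) .* h) (at s)"
    if "0 <= s" "s <= t" for s
    unfolding inner_diff_left using t(1) by (intro DERIV_diff line_derivative C2_grad[OF f] inS that) auto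
   obtain s where s: "0 < s" "s < t" and ps: "f (x + t*.k + t*.h) - f (x + 0*.k + t*.h)
     - (f (x + t*.k + 0*.h) - f (x + 0*.k + 0*.h)) = (t - 0)*((?g s t - ?g s 0) .* h)"
    using MVT2[OF t(1) p] by blast
   define E where "E r = ?g s r - grad f x - hess f x (s*.h + r*.k)" for r
   have E: "norm (E r) <= c*(t*N)" if "0 <= r" "r <= t" for r
   proof -
    have n: "norm (s*.h + r*.k) <= t*N" using n[of s r] s that by simp
    hence "norm (E r) <= c*norm (s*.h + r*.k)" using d(2)[of "x + r*.k + s*.h"] t(2) unfolding e1 E_def by simp
    also have "... <= c*(t*N)" using n c by simp
    finally show ?thesis .
   qed
   have "?g s t - ?g s 0 = t*.hess f x k + (E t - E 0)"
    using has_derivative_linear[OF C2_hess[OF f x]] by (simp add: linear_add linear_scale E_def)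
   hence "(?g s t - ?g s 0) .* h - t*(hess f x k .* h) = (E t - E 0) .* h" by (simp add: inner_add_left)
   also have "|...| <= norm (E t - E 0)*norm h" by (rule Cauchy_Schwarz_ineq2)
   also have "... <= 2*(c*(t*N))*N"
    using norm_triangle_ineq4[of "E t" "E 0"] E[OF _ order_refl] E[OF order_refl] t hk norm_ge_zero[of k] c N by (intro mult_mono; (linarith | simp))
   finally have "t*|(?g s t - ?g s 0) .* h - t*(hess f x k .* h)| <= t*(2*(c*(t*N))*N)" using t(1) by simp
   hence "|t*((?g s t - ?g s 0) .* h) - t*(t*(hess f x k .* h))| <= t*(2*(c*(t*N))*N)"
    unfolding right_diff_distrib[symmetric] abs_mult using t(1) by simp
   thus ?thesis using ps by (simp add: algebra_simps)
  qed
  have "|t*(t*(hess f x h .* k)) - t*(t*(hess f x k .* h))| <= 2*(t*(2*(c*(t*N))*N))"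
   using D[of h k] D[of k h] by (simp add: N_def add.commute add.left_commute)
  hence "(t*t)*|hess f x h .* k - hess f x k .* h| <= (t*t)*(4*N*N*c)"
   unfolding right_diff_distrib[symmetric] abs_mult using t(1) by (simp add: mult_ac)
  thus ?thesis using t(1) N by (simp add: c_def)
 qed
 hence "|hess f x h .* k - hess f x k .* h| <= 0" by (rule field_le_epsilon) simp
 thus ?thesis by simp
qed

text \<open>With a negative second derivative along some basis vector, the directional derivative,
  which is 0 at the minimum, would be negative just beyond it, and \<open>f\<close> would drop below
  its minimum.\<close>

lemma lap_nonneg_at_min:
 assumes f: "C2 S f" and x: "x : S" and e: "e > 0" and m: "!!y. y : ball x e ==> f x <= f y"
 shows "grad f x = 0" "lap f x >= 0"
proof -
 obtain e' where e': "e' > 0" "ball x e' <= S" using C2_open[OF f] x openE by blast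
 have g: "grad f x .* h = 0" for h
 proof -
  have "(%h. grad f x .* h) = (%h. 0)"
   by (rule has_derivative_local_min[OF C2_grad[OF f x]])
    (use e m in \<open>auto simp: eventually_at dist_commute\<close>)
  thus ?thesis by metis
 qed
 thus gx: "grad f x = 0" by (metis inner_eq_zero_iff)
 have "hess f x b .* b >= 0" if b: "b : Basis" for b
 proof (rule ccontr)
  assume neg: "~ hess f x b .* b >= 0"
  have q: "((%r. grad f (x + r*.b) .* b) has_real_derivative hess f x b .* b) (at 0)"
   by (rule line_derivative) (use has_derivative_inner_left[OF C2_hess[OF f x]] in simp)
  obtain d where d: "d > 0" "!!h. 0 < h ==> h < d ==> grad f (x + h*.b) .* b < 0"
   using DERIV_neg_dec_right[OF q] neg gx by auto
  define t where "t = Min {d, e, e'}/2"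
  have t: "t > 0" "t < d" "t < e" "t < e'" using d(1) e e'(1) by (auto simp: t_def)
  have p: "((%r. f (x + r*.b)) has_real_derivative grad f (x + r*.b) .* b) (at r)"
   if "0 <= r" "r <= t" for r
   using e' that t b by (intro line_derivative C2_grad[OF f]) (auto simp: subset_eq dist_norm)
  obtain s where s: "0 < s" "s < t" "f (x + t*.b) - f (x + 0*.b) = (t - 0)*(grad f (x + s*.b) .* b)"
   using MVT2[OF t(1), of "%r. f (x + r*.b)" "%r. grad f (x + r*.b) .* b"] p by force
  have "f (x + t*.b) < f x" using s d(2)[of s] t mult_pos_neg[OF t(1)] by force
  moreover have "x + t*.b : ball x e" using t b by (simp add: dist_norm)
  ultimately show False using m by force
 qed
 thus "lap f x >= 0" unfolding lap_def by (rule sum_nonneg)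
qed

lemma lap_nonpos_at_max:
 assumes f: "C2 S f" and x: "x : S" and e: "e > 0" and m: "!!y. y : ball x e ==> f y <= f x"
 shows "grad f x = 0" "lap f x <= 0"
 using lap_nonneg_at_min[OF C2_cmult(1)[OF f, of "-1"] x e] m
  C2_cmult(2,3)[OF f x, of "-1"] by auto

section \<open>Weighted integrals over the unit ball\<close>

lemma set_integrable_compact:
 fixes f :: "'a::euclidean_space => real"
 assumes "compact K" "continuous_on K f"
 shows "set_integrable lborel K f"
 using borel_integrable_compact[OF assms] by (simp add: set_integrable_def)

text \<open>The proof splits on measurability of the integrand: a non-measurable one stays so under
  the substitution, and both Bochner integrals are then 0 by convention.\<close>

lemma set_integral_affine:
 fixes f :: "'a::euclidean_space => real"
 assumes r: "r > 0"
 shows "(LINT y:K|lborel. f (x + r*.y)) = (LINT z:(%y. x + r*.y) ` K|lborel. f z)/r^DIM('a)"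
proof -
 let ?g = "%z. indicator ((%y. x + r*.y) ` K) z*.f z"
 have inj: "x + r*.y : (%y. x + r*.y) ` K \<longleftrightarrow> y : K" for y
  using r by auto
 have rd: "r^DIM('a) > 0" using r by simp
 have "integral\<^sup>L lborel ?g = integral\<^sup>L (density (distr lborel borel (%y. x + r*.y)) (%_. |r|^DIM('a))) ?g"
  using lborel_affine[of r x] r by simp
 also have "... = r^DIM('a)*(LINT y:K|lborel. f (x + r*.y))"
 proof (cases "?g : borel_measurable borel")
  case True
  have "integral\<^sup>L (density (distr lborel borel (%y. x + r*.y)) (%_. |r|^DIM('a))) ?g
    = integral\<^sup>L (distr lborel borel (%y. x + r*.y)) (%z. r^DIM('a)*?g z)"
   using r True by (subst integral_density) (auto simp: mult.assoc)
  also have "... = integral\<^sup>L lborel (%y. r^DIM('a)*?g (x + r*.y))"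
   using True by (subst integral_distr) auto
  also have "... = r^DIM('a)*(LINT y:K|lborel. f (x + r*.y))"
   unfolding set_lebesgue_integral_def integral_mult_right_zero
   by (intro arg_cong2[where f="(*)"] refl Bochner_Integration.integral_cong)
    (auto simp: inj indicator_def)
  finally show ?thesis .
 next
  case False
  have "~ (%y. indicator K y*.f (x + r*.y)) : borel_measurable borel"
  proof
   assume m: "(%y. indicator K y*.f (x + r*.y)) : borel_measurable borel"
   have "(%z. indicator K ((1/r)*.(z - x))*.f (x + r*.((1/r)*.(z - x)))) : borel_measurable borel"
    by (rule measurable_compose[OF _ m]) simp
   moreover have "(%z. indicator K ((1/r)*.(z - x))*.f (x + r*.((1/r)*.(z - x)))) = ?g"
   proof
    fix z
    have "z = x + r*.((1/r)*.(z - x))" using r by simp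
    thus "indicator K ((1/r)*.(z - x))*.f (x + r*.((1/r)*.(z - x))) = ?g z"
     using inj[of "(1/r)*.(z - x)"] by (simp add: indicator_def)
   qed
   ultimately show False using False by simp
  qed
  hence "(LINT y:K|lborel. f (x + r*.y)) = 0"
   unfolding set_lebesgue_integral_def
   by (intro not_integrable_integral_eq) (auto dest: borel_measurable_integrable)
  moreover have "integral\<^sup>L (density (distr lborel borel (%y. x + r*.y)) (%_. |r|^DIM('a))) ?g = 0"
   using False by (intro not_integrable_integral_eq) (auto dest: borel_measurable_integrable)
  ultimately show ?thesis by simp
 qed
 finally show ?thesis using rd r by (simp add: set_lebesgue_integral_def)
qed

lemma set_integral_translate:
 fixes f :: "'a::euclidean_space => real"
 shows "(LINT y|lborel. f (x + y)) = (LINT z|lborel. f z)"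
proof -
 have "range ((+) x) = (UNIV :: 'a set)" by (rule surj_plus)
 thus ?thesis
  using set_integral_affine[of 1 UNIV f x] by (simp add: set_lebesgue_integral_def)
qed

text \<open>Dominated convergence along sequences: \<open>F'\<close> is bounded on a compact
  interval around \<open>t0\<close> times \<open>K\<close>, and by the mean value inequality the
  same constant dominates the difference quotients.\<close>

lemma has_real_derivative_set_integral:
 fixes F :: "real => 'a::euclidean_space => real"
 assumes K: "compact K" and t0: "a < t0" "t0 < b"
  and F: "!!t y. t : {a<..<b} ==> y : K ==> ((%t. F t y) has_real_derivative F' t y) (at t)"
  and F': "continuous_on ({a<..<b} \<times> K) (%(t, y). F' t y)"
  and cont: "!!t. t : {a<..<b} ==> continuous_on K (F t)"
 shows "((%t. LINT y:K|lborel. F t y) has_real_derivative (LINT y:K|lborel. F' t0 y)) (at t0)"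
proof -
 define d where "d = min (t0 - a) (b - t0)/2"
 have d: "d > 0" "a < t0 - d" "t0 + d < b" using t0 by (auto simp: d_def min_def field_simps)
 let ?I = "{t0 - d..t0 + d}"
 have "compact (?I \<times> K)" using K by (intro compact_Times) auto
 moreover have "continuous_on (?I \<times> K) (%(t, y). F' t y)"
  using d by (intro continuous_on_subset[OF F']) auto
 ultimately have "bounded ((%(t, y). F' t y) ` (?I \<times> K))"
  by (intro compact_imp_bounded compact_continuous_image)
 then obtain B where B: "!!t y. t : ?I ==> y : K ==> |F' t y| <= B"
  unfolding bounded_iff by (force simp: image_iff)
 have lip: "|F t y - F t0 y| <= B*|t - t0|" if "t : ?I" "y : K" for t y
 proof -
  have "norm (F t y - F t0 y) <= B*norm (t - t0)"
  proof (rule field_differentiable_bound[where S = ?I and f' = "%t. F' t y"])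
   show "((%t. F t y) has_field_derivative F' s y) (at s within ?I)" if "s : ?I" for s
    using F[of s y] that d \<open>y \<in> K\<close> by (auto intro: has_field_derivative_at_within)
  qed (use B that d in auto)
  thus ?thesis by simp
 qed
 have "t0 : interior ?I" using d by simp
 hence I: "at t0 within ?I = at t0" by (rule at_within_interior)
 show ?thesis
  unfolding has_field_derivative_iff I[symmetric] tendsto_at_iff_sequentially o_def
 proof (intro allI impI)
  fix X :: "nat => real"
  assume X: "ALL i. X i : ?I - {t0}" "X ----> t0"
  have XI: "X i : ?I" "X i ~= t0" "X i : {a<..<b}" for i using X(1)[rule_format, of i] d by auto
  let ?G = "%i y. indicator K y*.((F (X i) y - F t0 y)/(X i - t0))"
  have c: "continuous_on K (%y. (F (X i) y - F t0 y)/(X i - t0))" for i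
   using XI[of i] t0 by (intro continuous_intros cont) auto
  have "continuous_on K (%y. (%(t, y). F' t y) (t0, y))"
   by (intro continuous_on_compose2[OF F'] continuous_intros) (use t0 in auto)
  hence c0: "continuous_on K (F' t0)" by simp
  have "(%i. LINT y|lborel. ?G i y) ----> (LINT y:K|lborel. F' t0 y)"
   unfolding set_lebesgue_integral_def
  proof (rule integral_dominated_convergence[where w = "%y. indicator K y*.B"])
   show "(%y. indicator K y*.F' t0 y) : borel_measurable lborel" "?G i : borel_measurable lborel"
    "integrable lborel (%y. indicator K y*.B)" for i
    by (intro borel_measurable_integrable borel_integrable_compact K c0 c continuous_intros)+
   show "AE y in lborel. (%i. ?G i y) ----> indicator K y*.F' t0 y"
   proof (rule AE_I2)
    fix y
    have "(%i. (F (X i) y - F t0 y)/(X i - t0)) ----> F' t0 y" if "y : K"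
     using F[of t0 y] t0 that X unfolding has_field_derivative_iff I[symmetric] tendsto_at_iff_sequentially o_def by auto
    thus "(%i. ?G i y) ----> indicator K y*.F' t0 y"
     by (cases "y : K") auto
   qed
   show "AE y in lborel. norm (?G i y) <= indicator K y*.B" for i
    using lip[OF XI(1)[of i]] XI(2)[of i] by (auto simp: divide_le_eq indicator_def)
  qed
  moreover have "(LINT y|lborel. ?G i y)
   = ((LINT y:K|lborel. F (X i) y) - (LINT y:K|lborel. F t0 y))/(X i - t0)" for i
   using XI[of i] t0 set_integral_diff(2)[OF set_integrable_compact[OF K cont] set_integrable_compact[OF K cont], of "X i" t0]
    set_integral_divide_zero[of lborel K "%y. F (X i) y - F t0 y" "X i - t0"]
   by (simp add: set_lebesgue_integral_def)
  ultimately show "(%i. ((LINT y:K|lborel. F (X i) y) - (LINT y:K|lborel. F t0 y))/(X i - t0))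
    ----> (LINT y:K|lborel. F' t0 y)"
   by (simp only:)
 qed
qed

text \<open>Solid means with the weight \<open>(1 - |y|^2)^k\<close> replace the usual spherical means, so that no surface
 measure is needed; integration by parts lowers \<open>k\<close> by one.\<close>

definition wint :: "nat => ('a::euclidean_space => real) => real" where
 "wint k g = (LINT y:cball 0 1|lborel. (1 - (norm y)^2)^k*g y)"

definition wmean :: "('a::euclidean_space => real) => 'a => real => real" where
 "wmean f x r = wint 1 (%y. f (x + r*.y))"

lemma wint_integrable:
 assumes "cont1 g"
 shows "set_integrable lborel (cball 0 1) (%y. (1 - (norm y)^2)^k*g y)"
 by (intro set_integrable_compact continuous_intros assms) auto

lemma wint_cong:
 assumes "!!y. norm y <= 1 ==> f y = g y"
 shows "wint k f = wint k g"
 unfolding wint_def set_lebesgue_integral_def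
 by (intro Bochner_Integration.integral_cong) (auto simp: indicator_def assms)

lemma wint_add:
 assumes "cont1 f" "cont1 g"
 shows "wint k (%y. f y + g y) = wint k f + wint k g"
 unfolding wint_def distrib_left by (intro set_integral_add wint_integrable assms)

lemma wint_diff:
 assumes "cont1 f" "cont1 g"
 shows "wint k (%y. f y - g y) = wint k f - wint k g"
 unfolding wint_def right_diff_distrib by (intro set_integral_diff wint_integrable assms)

lemma wint_cmult: "wint k (%y. c*f y) = c*wint k f"
proof -
 have "wint k (%y. c*f y) = (LINT y:cball 0 1|lborel. c*((1 - (norm y)^2)^k*f y))"
  unfolding wint_def by (simp add: mult_ac)
 thus ?thesis by (simp add: wint_def)
qed

lemma wint_sum:
 assumes "finite A" "!!a. a : A ==> cont1 (f a)"
 shows "wint k (%y. SUM a:A. f a y) = (SUM a:A. wint k (f a))"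
 using assms
proof (induction A rule: finite_induct)
 case empty
 show ?case using wint_cmult[of k 0] by simp
next
 case (insert a A)
 thus ?case by (simp add: wint_add continuous_on_sum)
qed

lemma one_minus_norm2_nonneg: "norm y <= 1 ==> 0 <= 1 - (norm y)^2"
 by (simp add: power_le_one)

lemma wint_mono:
 assumes "cont1 f" "cont1 g"
  and "!!y. norm y <= 1 ==> f y <= g y"
 shows "wint k f <= wint k g"
 unfolding wint_def using assms(3) one_minus_norm2_nonneg
 by (intro set_integral_mono wint_integrable assms(1,2) mult_left_mono zero_le_power) auto

lemma wint_const: "wint k (%y::'a::euclidean_space. c) = c*wint k (%y::'a. 1)"
 using wint_cmult[of k c "%y::'a. 1"] by simp

lemma wint_nonneg:
 assumes "!!y. norm y <= 1 ==> 0 <= f y"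
 shows "0 <= wint k f"
 unfolding wint_def set_lebesgue_integral_def
 by (intro Bochner_Integration.integral_nonneg)
  (auto simp: indicator_def intro!: mult_nonneg_nonneg zero_le_power assms one_minus_norm2_nonneg)

lemma wint_2_le_1:
 assumes c: "cont1 f" and "!!y. norm y <= 1 ==> 0 <= f y"
 shows "wint 2 f <= wint 1 f"
 unfolding wint_def
proof (intro set_integral_mono wint_integrable c mult_right_mono)
 fix y :: 'a assume "y : cball 0 1"
 thus "(1 - (norm y)^2)^2 <= (1 - (norm y)^2)^1"
  using one_minus_norm2_nonneg[of y] power_decreasing[of 1 2 "1 - (norm y)^2"] by simp
qed (use assms in auto)

text \<open>On the smaller ball the weight is at least \<open>(1 - r^2)^k\<close>; this is how
  weighted means control plain integrals.\<close>

lemma wint_0_ge: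
 assumes c: "cont1 f" and n: "!!y. norm y <= 1 ==> 0 <= f y"
  and r: "0 <= r" "r <= 1"
 shows "(1 - r^2)^k*(LINT y:cball 0 r|lborel. f y) <= wint k f"
proof -
 have r1: "0 <= 1 - r^2" using r by (simp add: power_le_one)
 have sub: "cball (0::'a) r <= cball 0 1" using r by auto
 have "(1 - r^2)^k*(LINT y:cball 0 r|lborel. f y) = (LINT y:cball 0 r|lborel. (1 - r^2)^k*f y)"
  by simp
 also have "... <= (LINT y:cball 0 1|lborel. (1 - (norm y)^2)^k*f y)"
  unfolding set_lebesgue_integral_def
 proof (rule integral_mono)
  show "integrable lborel (%y. indicator (cball 0 r) y*.((1 - r^2)^k*f y))"
   by (intro borel_integrable_compact continuous_intros continuous_on_subset[OF c sub]) auto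
  show "integrable lborel (%y. indicator (cball 0 1) y*.((1 - (norm y)^2)^k*f y))"
   using wint_integrable[OF c] by (simp add: set_integrable_def)
  fix y :: 'a
  show "indicator (cball 0 r) y*.((1 - r^2)^k*f y) <= indicator (cball 0 1) y*.((1 - (norm y)^2)^k*f y)"
   using r1 n[of y] one_minus_norm2_nonneg[of y] r
   by (auto simp: indicator_def intro!: mult_right_mono power_mono mult_nonneg_nonneg zero_le_power)
 qed
 finally show ?thesis by (simp add: wint_def)
qed

lemma set_integral_pos:
 fixes f :: "'a::euclidean_space => real"
 assumes c: "continuous_on (cball x r) f" and r: "r > 0" and n: "!!y. y : cball x r ==> 0 < f y"
 shows "0 < (LINT y:cball x r|lborel. f y)"
proof -
 obtain z where z: "z : cball x r" "!!y. y : cball x r ==> f z <= f y"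
  using continuous_attains_inf[OF compact_cball _ c] r by auto
 have "measure lborel (cball x r) > 0"
  using content_cball_pos[OF r, of x] by (simp add: measure_completion)
 hence "0 < f z*measure lborel (cball x r)" using n[OF z(1)] by simp
 also have "... = (LINT y:cball x r|lborel. f z)"
  by (simp add: set_lebesgue_integral_def mult.commute)
 also have "... <= (LINT y:cball x r|lborel. f y)"
  by (intro set_integral_mono set_integrable_compact c z) auto
 finally show ?thesis .
qed

lemma wint_one_pos: "wint k (%y::'a::euclidean_space. 1) > 0"
proof -
 have "0 < (1 - (1/2)^2)^k*(LINT y:cball (0::'a) (1/2)|lborel. (1::real))"
  by (intro mult_pos_pos set_integral_pos) (auto simp: power2_eq_square)
 also have "... <= wint k (%y::'a. 1)" by (rule wint_0_ge) auto
 finally show ?thesis .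
qed

lemma wint_has_derivative:
 fixes F :: "real => 'a::euclidean_space => real"
 assumes t0: "a < t0" "t0 < b"
  and F: "!!t y. t : {a<..<b} ==> y : cball 0 1 ==> ((%t. F t y) has_real_derivative F' t y) (at t)"
  and F': "continuous_on ({a<..<b} \<times> cball 0 1) (%(t, y). F' t y)"
  and cont: "!!t. t : {a<..<b} ==> cont1 (F t)"
 shows "((%t. wint k (F t)) has_real_derivative wint k (F' t0)) (at t0)"
 unfolding wint_def
proof (rule has_real_derivative_set_integral[OF compact_cball t0])
 show "((%t. (1 - (norm y)^2)^k*F t y) has_real_derivative (1 - (norm y)^2)^k*F' t y) (at t)"
  if "t : {a<..<b}" "y : cball 0 1" for t y
  using DERIV_cmult[OF F[OF that]] .
 have "continuous_on ({a<..<b} \<times> cball (0::'a) 1) (%p. (1 - (norm (snd p))^2)^k*(%(t, y). F' t y) p)"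
  by (intro continuous_intros F')
 thus "continuous_on ({a<..<b} \<times> cball 0 1) (%(t, y). (1 - (norm y)^2)^k*F' t y)"
  by (simp add: case_prod_unfold)
 show "cont1 (%y. (1 - (norm y)^2)^k*F t y)" if "t : {a<..<b}" for t
  by (intro continuous_intros cont that)
qed

section \<open>Integration by parts\<close>

text \<open>By translation invariance of Lebesgue measure, the integral of
  \<open>Ph (y + t*.b)\<close> does not depend on \<open>t\<close>. Its derivative at
  \<open>t = 0\<close> is the integral in question.\<close>

lemma integral_derivative_eq_0:
 fixes Ph :: "'a::euclidean_space => real"
 assumes Ph: "!!x. (Ph has_derivative (%h. g x .* h)) (at x)" and g: "continuous_on UNIV g"
  and supp: "!!x. norm x > R ==> Ph x = 0" "!!x. norm x > R ==> g x = 0"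
 shows "(LINT y|lborel. g y .* b) = 0"
proof -
 define K where "K = cball (0::'a) (R + norm b + 1)"
 have cPhi: "continuous_on UNIV Ph"
  by (meson Ph continuous_at_imp_continuous_on has_derivative_continuous)
 have out: "norm (y + t*.b) > R" if "y ~: K" "|t| < 1" for y t
 proof -
  have "norm y <= norm (y + t*.b) + norm (t*.b)"
   using norm_triangle_ineq4[of "y + t*.b" "t*.b"] by simp
  moreover have "norm (t*.b) <= norm b" using that by (simp add: mult_left_le_one_le)
  ultimately show ?thesis using that by (simp add: K_def)
 qed
 have "((%t. LINT y:K|lborel. Ph (y + t*.b)) has_real_derivative
   (LINT y:K|lborel. g (y + 0*.b) .* b)) (at 0)"
 proof (rule has_real_derivative_set_integral[where a = "-1" and b = 1])
  show "compact K" by (simp add: K_def)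
  show "((%t. Ph (y + t*.b)) has_real_derivative g (y + t*.b) .* b) (at t)" for t y by (rule line_derivative[OF Ph])
  show "continuous_on ({-1<..<1} \<times> K) (%(t, y). g (y + t*.b) .* b)"
   unfolding case_prod_unfold
   by (intro continuous_intros continuous_on_compose2[OF g]) auto
  show "continuous_on K (%y. Ph (y + t*.b))" for t
   by (intro continuous_intros continuous_on_compose2[OF cPhi]) auto
 qed auto
 moreover have "(LINT y:K|lborel. Ph (y + t*.b)) = (LINT y|lborel. Ph y)" if "|t| < 1" for t
 proof -
  have "(LINT y:K|lborel. Ph (y + t*.b)) = (LINT y|lborel. Ph (t*.b + y))"
   unfolding set_lebesgue_integral_def
   using out[OF _ that] supp(1)
   by (intro Bochner_Integration.integral_cong) (auto simp: indicator_def add.commute)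
  thus ?thesis by (simp add: set_integral_translate)
 qed
 hence "eventually (%t. (LINT y:K|lborel. Ph (y + t*.b)) = (LINT y|lborel. Ph y)) (nhds 0)"
  unfolding eventually_nhds_metric by (intro exI[of _ 1]) auto
 ultimately have "((%t. LINT y|lborel. Ph y) has_real_derivative (LINT y:K|lborel. g (y + 0*.b) .* b)) (at 0)"
  by (subst (asm) DERIV_cong_ev[OF refl _ refl])
 hence "(LINT y:K|lborel. g (y + 0*.b) .* b) = 0"
  using DERIV_unique DERIV_const by blast
 moreover have "(LINT y:K|lborel. g (y + 0*.b) .* b) = (LINT y|lborel. g y .* b)"
  unfolding set_lebesgue_integral_def
  using out[of _ 0] supp(2)
  by (intro Bochner_Integration.integral_cong) (auto simp: indicator_def)
 ultimately show ?thesis by simp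
qed

text \<open>The square of the truncated weight \<open>max 0 (1 - (norm y)^2)\<close> is of class C1
  on the whole space, with gradient -4 times the truncated weight times \<open>y\<close>. So the
  weighted function extends by 0 to a C1 function of compact support, whose derivative has integral
  0.\<close>

lemma wint_by_parts:
 fixes f :: "'a::euclidean_space => real"
 assumes S: "open S" "cball 0 1 <= S"
  and f: "!!x. x : S ==> (f has_derivative (%h. g x .* h)) (at x)"
  and g: "continuous_on S g"
 shows "wint 2 (%y. g y .* b) = 4*wint 1 (%y. (y .* b)*f y)"
proof -
 let ?m = "%y::'a. max 0 (1 - (norm y)^2)"
 define Ph where "Ph y = (if norm y <= 1 then (?m y)\<^sup>2*f y else 0)" for y
 define G where "G y = (if norm y <= 1 then (?m y)\<^sup>2*.g y - (4*?m y*f y)*.y else 0)" for y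
 have m0: "?m y = 0" if "norm y >= 1" for y :: 'a using that one_le_power[of "norm y" 2] by simp
 have PhiS: "Ph y = (?m y)^2*f y" and GS: "G y = (?m y)^2*.g y - (4*?m y*f y)*.y" for y
  using m0[of y] by (auto simp: Ph_def G_def)
 have cf: "continuous_on S f"
  by (meson f continuous_at_imp_continuous_on has_derivative_continuous)
 \<comment> \<open>Squaring removes the corner of the positive part; this is why the weight enters
   with exponent 2 on the left.\<close>
 have sq: "((%t. (max 0 t)^2) has_real_derivative 2*max 0 t) (at t)" for t :: real
 proof -
  have b: "norm ((max 0 s)^2 - (max 0 t)^2 - 2*max 0 t*(s - t)) <= norm (s - t)*norm (s - t)" for s
   using mult_nonpos_nonneg[of s t] mult_nonneg_nonpos[of s t] zero_le_square[of "s - t"] zero_le_square[of s] mult_right_mono[of s t t]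
   by (cases "0 <= s"; cases "0 <= t") (auto simp: max_def abs_if power2_eq_square algebra_simps)
  have "EX d>0. ALL s. norm (s - t) < d --> norm ((max 0 s)^2 - (max 0 t)^2 - 2*max 0 t*(s - t)) <= ep*norm (s - t)" if "ep > 0" for ep
   using that by (intro exI[of _ ep]) (auto intro!: order_trans[OF b] mult_right_mono simp del: real_norm_def)
  thus ?thesis unfolding has_field_derivative_def has_derivative_at_alt by (auto intro: bounded_linear_mult_right)
 qed
 have msq: "((%y. (?m y)^2) has_derivative (%h. (- (4*?m y))*(y .* h))) (at y)" for y :: 'a
 proof -
  have "((%y. 1 - (norm y)^2) has_derivative (%h. - 2*(y .* h))) (at y)"
   unfolding power2_norm_eq_inner by (auto intro!: derivative_eq_intros simp: inner_commute)
  from has_derivative_compose[OF this sq[unfolded has_field_derivative_def]]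
  show ?thesis by (simp add: mult_ac)
 qed
 have D: "(Ph has_derivative (%h. G y .* h)) (at y)" for y
 proof (cases "y : S")
  case True
  have "((%y. (?m y)^2*f y) has_derivative (%h. (?m y)^2*(g y .* h) + (- (4*?m y))*(y .* h)*f y)) (at y)"
   using has_derivative_mult[OF msq f[OF True]] by simp
  moreover have "(%h. (?m y)^2*(g y .* h) + (- (4*?m y))*(y .* h)*f y) = (%h. G y .* h)"
   by (rule ext) (simp add: GS inner_diff_left algebra_simps)
  ultimately show ?thesis by (simp add: PhiS[abs_def])
 next
  case False
  hence "y : - cball 0 1" using S(2) by auto
  have "((%y. 0) has_derivative (%h. G y .* h)) (at y)"
   using False S(2) by (auto simp: G_def)
  thus ?thesis
   by (rule has_derivative_transform_within_open[OF _ open_Compl[OF closed_cball] \<open>y \<in> - cball 0 1\<close>])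
    (auto simp: Ph_def)
 qed
 have cS: "continuous_on S G"
  unfolding GS[abs_def] by (intro continuous_intros g cf)
 have cC: "continuous_on (- cball 0 1) G"
 proof -
  have "continuous_on (- cball (0::'a) 1) (%y. 0 :: 'a)" by (rule continuous_on_const)
  thus ?thesis by (rule continuous_on_eq) (auto simp: G_def)
 qed
 have "continuous_on (S \<union> - cball 0 1) G"
  by (rule continuous_on_open_Un[OF S(1) open_Compl[OF closed_cball] cS cC])
 moreover have "S \<union> - cball 0 1 = UNIV" using S(2) by auto
 ultimately have "continuous_on UNIV G" by simp
 from integral_derivative_eq_0[OF D this, of 1 b]
 have "0 = (LINT y|lborel. G y .* b)" by (simp add: Ph_def G_def)
 also have "... = (LINT y:cball 0 1|lborel. (1 - (norm y)^2)^2*(g y .* b) - (1 - (norm y)^2)^1*(4*((y .* b)*f y)))"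
  unfolding set_lebesgue_integral_def
 proof (intro Bochner_Integration.integral_cong refl)
  fix y :: 'a
  show "G y .* b = indicator (cball 0 1) y*.((1 - (norm y)^2)^2*(g y .* b) - (1 - (norm y)^2)^1*(4*((y .* b)*f y)))"
  proof (cases "norm y <= 1")
   case True
   hence "?m y = 1 - (norm y)^2" by (intro max_absorb2 one_minus_norm2_nonneg)
   thus ?thesis using True by (simp add: GS inner_diff_left algebra_simps)
  qed (simp add: G_def)
 qed
 also have "... = wint 2 (%y. g y .* b) - wint 1 (%y. 4*((y .* b)*f y))"
  unfolding wint_def
  by (intro set_integral_diff wint_integrable continuous_intros continuous_on_subset[OF g S(2)]
    continuous_on_subset[OF cf S(2)])
 finally show ?thesis by (simp add: wint_cmult)
qed

text \<open>Integration by parts is applied to \<open>(y .* b)*f y\<close> and summed over the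
  basis; the dimension counts the derivatives of the factors \<open>y .* b\<close>.\<close>

lemma wint_by_parts_radial:
 fixes f :: "'a::euclidean_space => real"
 assumes S: "open S" "cball 0 1 <= S"
  and f: "!!x. x : S ==> (f has_derivative (%h. g x .* h)) (at x)"
  and g: "continuous_on S g"
 shows "wint 2 (%y. g y .* y) = 4*wint 1 (%y. (norm y)^2*f y) - DIM('a)*wint 2 f"
proof -
 have cf: "continuous_on S f"
  by (meson f continuous_at_imp_continuous_on has_derivative_continuous)
 note c = continuous_on_subset[OF cf S(2)] continuous_on_subset[OF g S(2)]
 have 1: "wint 2 (%y. (g y .* b)*(y .* b) + f y) = 4*wint 1 (%y. (y .* b)^2*f y)" if b: "b : Basis" for b
 proof -
  have "wint 2 (%y. ((y .* b)*.g y + f y*.b) .* b) = 4*wint 1 (%y. (y .* b)*((y .* b)*f y))"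
  proof (rule wint_by_parts[OF S])
   fix x assume x: "x : S"
   have i: "((%y. y .* b) has_derivative (%h. h .* b)) (at x)"
    by (auto intro!: derivative_eq_intros)
   have "(%h. x .* b*(g x .* h) + h .* b*f x) = (%h. ((x .* b)*.g x + f x*.b) .* h)"
    by (rule ext) (simp add: inner_add_left inner_commute[of b])
   with has_derivative_mult[OF i f[OF x]]
   show "((%y. (y .* b)*f y) has_derivative (%h. ((x .* b)*.g x + f x*.b) .* h)) (at x)"
    by simp
  next
   show "continuous_on S (%x. (x .* b)*.g x + f x*.b)" by (intro continuous_intros g cf)
  qed
  thus ?thesis using b by (simp add: inner_add_left power2_eq_square mult_ac)
 qed
 have sq: "(SUM b:Basis. (y .* b)^2) = (norm y)^2" for y :: 'a
  by (subst power2_norm_eq_inner, subst euclidean_inner) (simp add: power2_eq_square)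
 have "wint 2 (%y. g y .* y) + DIM('a)*wint 2 f = wint 2 (%y. SUM b:Basis. (g y .* b)*(y .* b) + f y)"
  by (simp add: sum.distrib euclidean_inner[symmetric] wint_add wint_cmult c continuous_intros)
 also have "... = (SUM b:Basis. 4*wint 1 (%y. (y .* b)^2*f y))"
  using 1 by (subst wint_sum) (auto intro!: continuous_intros c)
 also have "... = 4*wint 1 (%y. SUM b:Basis. (y .* b)^2*f y)"
  by (subst wint_sum) (auto intro!: continuous_intros c simp: sum_distrib_left)
 also have "... = 4*wint 1 (%y. (norm y)^2*f y)"
  unfolding sum_distrib_right[symmetric] sq ..
 finally show ?thesis by simp
qed

lemma in_ball_scaled:
 fixes x :: "'a::real_normed_vector"
 assumes "|t| < R" "norm y <= 1"
 shows "x + t*.y : ball x R"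
proof -
 have "norm (t*.y) <= |t|" using assms by (simp add: mult_left_le)
 hence "dist x (x + t*.y) < R" using assms by (simp add: dist_norm)
 thus ?thesis by simp
qed

lemma C2_cont_cball:
 assumes f: "C2 (ball x R) f" and r: "|r| < R"
 shows "cont1 (%y. f (x + r*.y))" "cont1 (%y. grad f (x + r*.y))"
  "cont1 (%y. hess f (x + r*.y) h)" "cont1 (%y. lap f (x + r*.y))"
proof -
 have *: "cont1 (%y. g (x + r*.y))" if "continuous_on (ball x R) g" for g :: "'a => 'b::topological_space"
  by (intro continuous_on_compose2[OF that] continuous_intros) (use in_ball_scaled[OF r, where 'a='a] in auto)
 show "cont1 (%y. f (x + r*.y))" "cont1 (%y. grad f (x + r*.y))"
  "cont1 (%y. hess f (x + r*.y) h)" "cont1 (%y. lap f (x + r*.y))"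
  by (rule * C2_cont[OF f] C2_cont_grad[OF f] C2_cont_hess[OF f] C2_cont_lap[OF f])+
qed

lemma wint_radial_derivative:
 assumes f: "!!y. y : ball x R ==> (f has_derivative (%h. g y .* h)) (at y)" and g: "continuous_on (ball x R) g"
  and w: "cont1 w" and r: "|r| < R"
 shows "((%r. wint k (%y. f (x + r*.y)*w y)) has_real_derivative wint k (%y. (g (x + r*.y) .* y)*w y)) (at r)"
proof (rule wint_has_derivative[where a = "-R" and b = R])
 have inb: "x + t*.y : ball x R" if "t : {-R<..<R}" "norm y <= 1" for t y
  using in_ball_scaled[of t R y] that by auto
 have cf: "continuous_on (ball x R) f"
  by (meson f continuous_at_imp_continuous_on has_derivative_continuous)
 show "((%t. f (x + t*.y)*w y) has_real_derivative (g (x + t*.y) .* y)*w y) (at t)"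
  if "t : {-R<..<R}" "y : cball 0 1" for t y
  using that by (intro DERIV_cmult_right line_derivative f inb) auto
 have "continuous_on ({-R<..<R} \<times> cball 0 1) (%p. (g (x + fst p*.snd p) .* snd p)*w (snd p))"
  by (intro continuous_intros continuous_on_compose2[OF g] continuous_on_compose2[OF w]) (use inb in auto)
 thus "continuous_on ({-R<..<R} \<times> cball 0 1) (%(t, y). (g (x + t*.y) .* y)*w y)"
  by (simp add: case_prod_unfold)
 show "cont1 (%y. f (x + t*.y)*w y)" if "t : {-R<..<R}" for t
  by (intro continuous_intros w continuous_on_compose2[OF cf]) (use inb that in auto)
qed (use r in auto)

text \<open>The field \<open>(1 - (norm y)^2)*.y\<close> is -1/4 times the gradient of
  \<open>(1 - (norm y)^2)^2\<close>. Integrating the radial derivative by parts therefore turns it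
  into the Laplacian with the weight of exponent 2. Symmetry of the Hessian identifies the
  derivative of each component of the gradient.\<close>

lemma wmean_has_derivative:
 fixes f :: "'a::euclidean_space => real"
 assumes f: "C2 (ball x R) f" and r: "|r| < R"
 shows "(wmean f x has_real_derivative (r/4)*wint 2 (%y. lap f (x + r*.y))) (at r)"
proof -
 have inr: "x + r*.y : ball x R" if "norm y <= 1" for y
  using in_ball_scaled[OF r that] .
 have 1: "(wmean f x has_real_derivative wint 1 (%y. grad f (x + r*.y) .* y)) (at r)"
  using wint_radial_derivative[OF C2_grad[OF f] C2_cont_grad[OF f] continuous_on_const r, of 1 1] by (simp add: wmean_def[abs_def])
 define S where "S = (%y. x + r*.y) -` ball x R"
 have S: "open S" unfolding S_def by (intro open_vimage continuous_intros) auto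
 have SB: "cball 0 1 <= S" using inr unfolding S_def by auto
 have 2: "wint 2 (%y. (r*.hess f (x + r*.y) b) .* b) = 4*wint 1 (%y. (y .* b)*(grad f (x + r*.y) .* b))"
  for b
 proof (rule wint_by_parts[OF S SB])
  fix y assume y: "y : S"
  hence y': "x + r*.y : ball x R" by (simp add: S_def)
  note H = C2_hess[OF f y']
  have "((%y. grad f (x + r*.y) .* b) has_derivative (%h. hess f (x + r*.y) (r*.h) .* b)) (at y)"
   by (rule has_derivative_inner_left[OF affine_derivative[OF H]])
  moreover have "hess f (x + r*.y) (r*.h) .* b = (r*.hess f (x + r*.y) b) .* h" for h
   using hess_symmetric[OF f y', of h b] linear_scale[OF has_derivative_linear[OF H]] by simp
  ultimately show "((%y. grad f (x + r*.y) .* b) has_derivative (%h. (r*.hess f (x + r*.y) b) .* h)) (at y)"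
   by simp
 next
  show "continuous_on S (%y. r*.hess f (x + r*.y) b)"
   by (intro continuous_intros continuous_on_compose2[OF C2_cont_hess[OF f]]) (auto simp: S_def)
 qed
 note c = C2_cont_cball[OF f r]
 have "wint 1 (%y. grad f (x + r*.y) .* y) = wint 1 (%y. SUM b:Basis. (y .* b)*(grad f (x + r*.y) .* b))"
  by (rule wint_cong, subst euclidean_inner) (simp add: mult.commute)
 also have "... = (SUM b:Basis. wint 1 (%y. (y .* b)*(grad f (x + r*.y) .* b)))"
  by (rule wint_sum) (auto intro!: continuous_intros c)
 also have "... = (SUM b:Basis. (1/4)*wint 2 (%y. r*(hess f (x + r*.y) b .* b)))"
  using 2 by simp
 also have "... = (r/4)*(SUM b:Basis. wint 2 (%y. hess f (x + r*.y) b .* b))"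
  unfolding wint_cmult by (simp add: sum_distrib_left)
 also have "(SUM b:Basis. wint 2 (%y. hess f (x + r*.y) b .* b)) = wint 2 (%y. lap f (x + r*.y))"
  unfolding lap_def by (rule wint_sum[symmetric]) (auto intro!: continuous_intros c)
 finally show ?thesis using 1 by (simp only:)
qed

lemma wmean_0:
 fixes x :: "'a::euclidean_space"
 shows "wmean f x 0 = f x*wint 1 (%y::'a. 1)"
 unfolding wmean_def by (simp add: wint_const[of _ "f x"])

section \<open>Interior estimates\<close>

text \<open>The sign \<open>si\<close> treats supersolutions (\<open>si = 1\<close>) and
  subsolutions (\<open>si = -1\<close>) at once. The exponent \<open>La*r^2/8\<close> is the
  integral of the factor \<open>La*r/4\<close> in the derivative of the mean.\<close>

lemma wmean_exp_decreasing:
 fixes f :: "'a::euclidean_space => real"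
 assumes f: "C2 (ball x R) f" and n: "!!y. y : ball x R ==> 0 <= f y" and si: "si*si = 1"
  and L: "!!y. y : ball x R ==> si*lap f y <= La*f y" and La: "La >= 0" and r: "0 <= s" "s <= r" "r < R"
 shows "si*(wmean f x r*exp (- (si*La)*r^2/8)) <= si*(wmean f x s*exp (- (si*La)*s^2/8))"
proof (rule DERIV_nonpos_imp_nonincreasing[OF r(2)])
 fix t assume t: "s <= t" "t <= r"
 hence t': "|t| < R" using r by auto
 note c = C2_cont_cball[OF f t'] and inb = in_ball_scaled[OF t', of _ x]
 have "((%r. si*(wmean f x r*exp (- (si*La)*r^2/8))) has_real_derivative
  exp (- (si*La)*t^2/8)*(t/4)*(si*wint 2 (%y. lap f (x + t*.y)) - (si*si)*La*wmean f x t)) (at t)"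
  by (auto intro!: derivative_eq_intros wmean_has_derivative[OF f t'] simp: field_simps)
 moreover have "si*wint 2 (%y. lap f (x + t*.y)) <= wint 2 (%y. La*f (x + t*.y))"
  unfolding wint_cmult[symmetric] by (intro wint_mono c continuous_intros L inb)
 hence "si*wint 2 (%y. lap f (x + t*.y)) <= La*wmean f x t"
  using mult_left_mono[OF wint_2_le_1[OF c(1)] La] n inb unfolding wmean_def wint_cmult by fastforce
 hence "exp (- (si*La)*t^2/8)*(t/4)*(si*wint 2 (%y. lap f (x + t*.y)) - (si*si)*La*wmean f x t) <= 0"
  using t r si by (intro mult_nonneg_nonpos) auto
 ultimately show "EX y. ((%r. si*(wmean f x r*exp (- (si*La)*r^2/8))) has_real_derivative y) (at t) & y <= 0"
  by blast
qed

lemma wmean_le_exp: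
 fixes f :: "'a::euclidean_space => real"
 assumes f: "C2 (ball x R) f" and n: "!!y. y : ball x R ==> 0 <= f y"
  and L: "!!y. y : ball x R ==> lap f y <= La*f y" and "La >= 0" and r: "0 <= r" "r < R"
 shows "wmean f x r <= exp (La*r^2/8)*(f x*wint 1 (%y::'a. 1))"
 using wmean_exp_decreasing[OF f n, of 1 La 0 r] assms by (simp add: exp_minus field_simps wmean_0)

lemma wmean_mono_exp:
 fixes f :: "'a::euclidean_space => real"
 assumes f: "C2 (ball x R) f" and n: "!!y. y : ball x R ==> 0 <= f y"
  and L: "!!y. y : ball x R ==> lap f y >= - La*f y" and "La >= 0" and r: "0 <= s" "s <= r" "r < R"
 shows "wmean f x s*exp (La*s^2/8) <= wmean f x r*exp (La*r^2/8)"
 using wmean_exp_decreasing[OF f n, of "-1" La s r] assms by (simp add: minus_le_iff)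

section \<open>Comparison of means with different centres\<close>

lemma image_affine_cball:
 fixes x :: "'a::real_normed_vector"
 assumes "r > 0"
 shows "(%y. x + r*.y) ` cball 0 t = cball x (r*t)"
proof -
 have "z : (%y. x + r*.y) ` cball 0 t" if "z : cball x (r*t)" for z
 proof
  show "z = x + r*.((1/r)*.(z - x))" using assms by simp
  have "norm (z - x) <= r*t" using that by (simp add: dist_norm norm_minus_commute)
  thus "(1/r)*.(z - x) : cball 0 t"
   using assms by (simp add: divide_le_eq mult.commute)
 qed
 thus ?thesis using assms by (auto simp: dist_norm)
qed

text \<open>The ball of radius \<open>s\<close> about \<open>z\<close> lies in the ball of radius
  \<open>th*r\<close> about \<open>x\<close>, where the weight of the larger mean is at least
  \<open>1 - th^2\<close>; nonnegativity of \<open>f\<close> allows the enlargement.\<close>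

lemma wmean_compare:
 fixes f :: "'a::euclidean_space => real"
 assumes f: "continuous_on (ball x R) f" and n: "!!y. y : ball x R ==> 0 <= f y"
  and r: "0 < r" "r < R" and s: "0 < s" "dist z x + s <= th*r" and th: "th < 1"
 shows "wmean f z s <= (r/s)^DIM('a)/(1 - th^2)*wmean f x r"
proof -
 have "0 < th*r" using s by (smt (verit) zero_le_dist)
 hence th0: "th > 0" using r by (simp add: zero_less_mult_iff)
 hence th2: "1 - th^2 > 0" using th by (simp add: power_less_one_iff)
 have tr: "th*r < R" using r th th0 by (smt (verit) mult_less_cancel_right2)
 have sub: "cball z s <= cball x (th*r)" "cball x (th*r) <= ball x R"
  using s tr by (auto simp: cball_subset_cball_iff cball_subset_ball_iff dist_commute)
 have inb: "x + r*.y : ball x R" if "norm y <= 1" for y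
  using in_ball_scaled[OF _ that, of r R x] r by auto
 have inz: "z + s*.y : ball x R" if "norm y <= 1" for y
 proof -
  have "z + s*.y : cball z s" using that s by (simp add: dist_norm)
  thus ?thesis using sub by blast
 qed
 have cz: "cont1 (%y. f (z + s*.y))"
  by (intro continuous_intros continuous_on_compose2[OF f]) (use inz in auto)
 have cx: "cont1 (%y. f (x + r*.y))"
  by (intro continuous_intros continuous_on_compose2[OF f]) (use inb in auto)
 have "wmean f z s <= (LINT y:cball 0 1|lborel. f (z + s*.y))"
  unfolding wmean_def wint_def
 proof (intro set_integral_mono wint_integrable set_integrable_compact cz compact_cball)
  fix y :: 'a assume y: "y : cball 0 1"
  hence "1 - (norm y)^2 <= 1" "0 <= f (z + s*.y)" using n inz by auto
  thus "(1 - (norm y)^2)^1*f (z + s*.y) <= f (z + s*.y)"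
   using mult_right_mono[of "1 - (norm y)^2" 1 "f (z + s*.y)"] by simp
 qed
 also have "... = (LINT y:cball z s|lborel. f y)/s^DIM('a)"
  using set_integral_affine[OF s(1), of "cball 0 1" f z] image_affine_cball[OF s(1), of z 1] by simp
 also have "... <= (LINT y:cball x (th*r)|lborel. f y)/s^DIM('a)"
 proof (intro divide_right_mono)
  show "(LINT y:cball z s|lborel. f y) <= (LINT y:cball x (th*r)|lborel. f y)"
   unfolding set_lebesgue_integral_def
  proof (rule integral_mono)
   fix y show "indicat_real (cball z s) y*.f y <= indicat_real (cball x (th*r)) y*.f y"
    using n[of y] sub by (auto simp: indicator_def)
  qed (intro borel_integrable_compact compact_cball continuous_on_subset[OF f] subset_trans[OF sub(1)] sub(2))+
 qed (use s in auto)
 also have "(LINT y:cball x (th*r)|lborel. f y) = r^DIM('a)*(LINT y:cball 0 th|lborel. f (x + r*.y))"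
  using set_integral_affine[OF r(1), of "cball 0 th" f x] image_affine_cball[OF r(1), of x th] r
  by (simp add: mult.commute)
 also have "(LINT y:cball 0 th|lborel. f (x + r*.y)) <= wmean f x r/(1 - th^2)"
  using wint_0_ge[OF cx, of th 1] n inb th th0 th2
  by (simp add: wmean_def pos_le_divide_eq mult.commute)
 finally show ?thesis using r s by (simp add: power_divide mult_left_mono divide_right_mono field_simps)
qed

text \<open>The translation is moved from \<open>g\<close>, which is merely continuous, onto the
  weight, which is Lipschitz with constant 4 for both exponents. When \<open>norm k > r\<close> the
  two integrals are bounded separately.\<close>

lemma wint_shift_le:
 fixes g :: "'a::euclidean_space => real"
 assumes g: "continuous_on (ball x (3*rh)) g" and B: "!!y. y : ball x (3*rh) ==> |g y| <= B"
  and r: "0 < r" "r <= rh" and k: "norm k <= rh" and m: "m : {1, 2}"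
 shows "|wint m (%y. g (x + k + r*.y)) - wint m (%y. g (x + r*.y))|
  <= (4*measure lborel (cball (0::'a) 2) + 2*wint 1 (%y::'a. 1))*(norm k/r)*B"
proof -
 define ph where "ph y = (max 0 (1 - (norm y)^2))^m" for y :: 'a
 have B0: "B >= 0" using B[of x] r by force
 have in1: "x + k + r*.y : ball x (3*rh)" if "norm y <= 1" for y
 proof -
  have "norm (k + r*.y) <= norm k + r*norm y" using norm_triangle_ineq[of k "r*.y"] r by simp
  also have "... <= rh + rh*1" using k r that by (intro add_mono mult_mono) auto
  finally have "dist x (x + (k + r*.y)) < 3*rh"
   using r norm_minus_cancel[of "k + r*.y"] by (simp add: dist_norm del: norm_minus_cancel)
  thus ?thesis by (simp add: add.assoc)
 qed
 have in2: "x + r*.y : ball x (3*rh)" if "norm y <= 2" for y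
 proof -
  have "r*norm y <= rh*2" using r that by (intro mult_mono) auto
  hence "dist x (x + r*.y) < 3*rh" using r by (simp add: dist_norm)
  thus ?thesis by simp
 qed
 have c1: "cont1 (%y. g (x + k + r*.y))"
  by (intro continuous_intros continuous_on_compose2[OF g]) (use in1 in auto)
 have c2: "continuous_on (cball 0 2) (%y. g (x + r*.y))"
  by (intro continuous_intros continuous_on_compose2[OF g]) (use in2 in auto)
 have w0: "0 <= wint 1 (%y::'a. 1)" by (rule less_imp_le[OF wint_one_pos])
 have v0: "0 <= measure lborel (cball (0::'a) 2)" by simp
 show ?thesis
 proof (cases "norm k <= r")
  case False
  have wm1: "wint m (%y::'a. 1) <= wint 1 (%y::'a. 1)"
   using m wint_2_le_1[of "%y::'a. 1"] by auto
  have b: "|wint m h| <= B*wint 1 (%y::'a. 1)" if "cont1 h" "!!y. norm y <= 1 ==> |h y| <= B"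
   for h :: "'a => real"
  proof -
   have "wint m h <= wint m (%y::'a. B)" "wint m (%y::'a. - B) <= wint m h"
    by (intro wint_mono that continuous_intros; use that in force)+
   hence "|wint m h| <= B*wint m (%y::'a. 1)"
    by (simp add: wint_const[of m B] wint_const[of m "-B"] abs_le_iff)
   thus ?thesis using mult_left_mono[OF wm1 B0] by linarith
  qed
  have "|wint m (%y. g (x + k + r*.y)) - wint m (%y. g (x + r*.y))| <= 2*(B*wint 1 (%y::'a. 1))"
   using b[OF c1] b[OF continuous_on_subset[OF c2]] B in1 in2 by (smt (verit) cball_subset_cball_iff dist_self)
  also have "... <= 2*(B*wint 1 (%y::'a. 1))*(norm k/r)"
  proof -
   have "1 <= norm k/r" using False r by simp
   thus ?thesis using B0 w0 mult_left_mono[of 1 "norm k/r" "2*(B*wint 1 (%y::'a. 1))"] by simp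
  qed
  also have "... <= (4*measure lborel (cball (0::'a) 2) + 2*wint 1 (%y::'a. 1))*(norm k/r)*B"
   using r B0 v0 by (simp add: algebra_simps)
  finally show ?thesis .
 next
  case True
  define h where "h = (1/r)*.k"
  have h: "norm h = norm k/r" "norm h <= 1" "r*.h = k" using True r by (auto simp: h_def)
  have ph0: "ph y = 0" if "norm y >= 1" for y
   using that one_le_power[of "norm y" 2] m by (auto simp: ph_def)
  have ph1: "ph y = (1 - (norm y)^2)^m" if "norm y <= 1" for y
   using one_minus_norm2_nonneg[OF that] by (simp add: ph_def)
  have lip: "|ph a - ph b| <= 4*norm (a - b)" for a b
  proof -
   let ?p = "%y::'a. max 0 (1 - (norm y)^2)" and ?s = "%y::'a. min 1 (norm y)"
   have ps: "?p y = 1 - (?s y)^2" for y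
    using one_le_power[of "norm y" 2] one_minus_norm2_nonneg[of y] by (cases "norm y <= 1") auto
   have pr: "0 <= ?p y" "?p y <= 1" for y by auto
   have "?p a - ?p b = (?s b - ?s a)*(?s b + ?s a)" unfolding ps by (simp add: power2_eq_square algebra_simps)
   hence "|?p a - ?p b| = |?s b - ?s a|*(?s b + ?s a)" by (simp add: abs_mult)
   also have "... <= norm (a - b)*2"
    using norm_triangle_ineq3[of a b] by (intro mult_mono) (auto simp: min_def)
   finally have p: "|?p a - ?p b| <= 2*norm (a - b)" by simp
   have "|(?p a)\<^sup>2 - (?p b)^2| = |?p a - ?p b|*(?p a + ?p b)"
    by (simp add: power2_eq_square square_diff_square_factored abs_mult mult.commute)
   also have "... <= (2*norm (a - b))*2" using p pr(2)[of a] pr(2)[of b] by (intro mult_mono) linarith+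
   finally show ?thesis using m p by (auto simp: ph_def)
  qed
  have cph: "continuous_on A ph" for A unfolding ph_def[abs_def] by (intro continuous_intros)
  have "wint m (%y. g (x + k + r*.y)) = (LINT y|lborel. ph y*g (x + k + r*.y))"
   unfolding wint_def set_lebesgue_integral_def
   by (intro Bochner_Integration.integral_cong) (auto simp: indicator_def ph0 ph1)
  also have "... = (LINT y|lborel. ph (- h + y)*g (x + k + r*.(- h + y)))"
   by (rule set_integral_translate[symmetric])
  also have "... = (LINT y:cball 0 2|lborel. ph (y - h)*g (x + r*.y))"
   unfolding set_lebesgue_integral_def
  proof (intro Bochner_Integration.integral_cong refl)
   fix y :: 'a
   have "norm (y - h) >= 1" if "norm y > 2" using norm_triangle_ineq2[of y h] that h by simp
   thus "ph (- h + y)*g (x + k + r*.(- h + y)) = indicator (cball 0 2) y*.(ph (y - h)*g (x + r*.y))"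
    using h(3) ph0[of "y - h"] by (simp add: indicator_def algebra_simps) argo
  qed
  finally have e1: "wint m (%y. g (x + k + r*.y)) = (LINT y:cball 0 2|lborel. ph (y - h)*g (x + r*.y))" .
  have e2: "wint m (%y. g (x + r*.y)) = (LINT y:cball 0 2|lborel. ph y*g (x + r*.y))"
   unfolding wint_def set_lebesgue_integral_def
   by (intro Bochner_Integration.integral_cong) (auto simp: indicator_def ph0 ph1)
  have ch: "continuous_on (cball 0 2) (%y. ph (y - h))"
   by (intro continuous_on_compose2[OF cph[of UNIV]] continuous_intros) auto
  have i1: "set_integrable lborel (cball 0 2) (%y. ph (y - h)*g (x + r*.y))"
   "set_integrable lborel (cball 0 2) (%y. ph y*g (x + r*.y))"
   by (intro set_integrable_compact compact_cball continuous_intros ch cph c2)+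
  have "|wint m (%y. g (x + k + r*.y)) - wint m (%y. g (x + r*.y))|
   = |LINT y:cball 0 2|lborel. (ph (y - h) - ph y)*g (x + r*.y)|"
   unfolding e1 e2 left_diff_distrib by (simp add: set_integral_diff i1)
  also have "... <= (LINT y:cball 0 2|lborel. |(ph (y - h) - ph y)*g (x + r*.y)| )"
   unfolding set_lebesgue_integral_def
   using integral_abs_bound[of lborel "%y. indicator (cball 0 2) y*.((ph (y - h) - ph y)*g (x + r*.y))"]
   by (simp add: abs_mult)
  also have "... <= (LINT y:cball (0::'a) 2|lborel. 4*(norm k/r)*B)"
  proof (intro set_integral_mono set_integrable_compact compact_cball continuous_intros ch cph c2)
   fix y :: 'a assume "y : cball 0 2"
   thus "|(ph (y - h) - ph y)*g (x + r*.y)| <= 4*(norm k/r)*B"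
    unfolding abs_mult using lip[of "y - h" y] h B in2[of y] B0
    by (intro mult_mono) auto
  qed
  also have "... = 4*measure lborel (cball (0::'a) 2)*(norm k/r)*B"
   by (simp add: set_lebesgue_integral_def)
  also have "... <= (4*measure lborel (cball (0::'a) 2) + 2*wint 1 (%y::'a. 1))*(norm k/r)*B"
   using r B0 w0 by (intro mult_right_mono) auto
  finally show ?thesis .
 qed
qed

definition lip_const :: "'a::euclidean_space itself => real" where
 "lip_const _ = (4*measure lborel (cball (0::'a) 2) + 2*wint 1 (%y::'a. 1))/wint 1 (%y::'a. 1)"

lemma lip_const_pos: "lip_const TYPE('a::euclidean_space) > 0"
 using wint_one_pos[of 1, where 'a='a] measure_nonneg[of lborel "cball (0::'a) 2"]
 unfolding lip_const_def by (intro divide_pos_pos add_nonneg_pos) auto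

text \<open>The two weighted means of radius \<open>rh\<close> centred at \<open>x\<close> and \<open>x + k\<close> differ by \<open>O( |k|/rh)\<close>,
 and so do their derivatives in the radius; shrinking the radius to \<open>0\<close> recovers \<open>w\<close> itself.\<close>

lemma lipschitz_estimate:
 fixes w :: "'a::euclidean_space => real"
 assumes w: "C2 (ball x (3*rh)) w" and A: "!!y. y : ball x (3*rh) ==> |w y| <= A"
  and B: "!!y. y : ball x (3*rh) ==> |lap w y| <= B" and rh: "rh > 0" and k: "norm k <= rh"
 shows "|w (x + k) - w x| <= lip_const TYPE('a)*norm k*(A/rh + B*rh)"
proof -
 define L where "L = 4*measure lborel (cball (0::'a) 2) + 2*wint 1 (%y::'a. 1)"
 have wp: "wint 1 (%y::'a. 1) > 0" by (rule wint_one_pos)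
 have Lp: "L >= 0" using wp unfolding L_def by simp
 have B0: "B >= 0" using B[of x] rh by force
 have sub: "ball (x + k) (2*rh) <= ball x (3*rh)" "ball x (2*rh) <= ball x (3*rh)"
  using k rh by (auto simp: ball_subset_ball_iff dist_norm)
 have w1: "C2 (ball (x+k) (2*rh)) w" "C2 (ball x (2*rh)) w" using C2_subset[OF w] sub by auto
 define f where "f r = wmean w (x + k) r - wmean w x r" for r
 let ?f' = "%r. (r/4)*(wint 2 (%y. lap w (x + k + r*.y)) - wint 2 (%y. lap w (x + r*.y)))"
 have D: "(f has_real_derivative ?f' r) (at r)" if "0 <= r" "r <= rh" for r
  unfolding f_def right_diff_distrib
  using that rh by (intro DERIV_diff wmean_has_derivative[OF w1(1)] wmean_has_derivative[OF w1(2)]) auto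
 obtain z where z: "0 < z" "z < rh" "f rh - f 0 = (rh - 0)*?f' z"
  using MVT2[OF rh, of f ?f'] D by blast
 \<comment> \<open>The factor \<open>z/4\<close> of the radial derivative cancels the
   \<open>1/z\<close> of the translation bound, so the unknown radius \<open>z\<close> from the mean
   value theorem disappears.\<close>
 have "|?f' z| <= (z/4)*(L*(norm k/z)*B)"
  using wint_shift_le[OF C2_cont_lap[OF w] B z(1) _ k, of 2] z Lp unfolding L_def abs_mult
  by (intro mult_mono) auto
 also have "... = L*norm k*B/4" using z by simp
 also have "... <= L*norm k*B" using Lp B0 by simp
 finally have "rh*|?f' z| <= rh*(L*norm k*B)" using rh by (intro mult_left_mono) auto
 moreover have "|f rh - f 0| = rh*|?f' z|" using z(3) rh by (simp only: abs_mult) simp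
 ultimately have 1: "|f rh - f 0| <= rh*(L*norm k*B)" by linarith
 have 2: "|f rh| <= L*(norm k/rh)*A"
  using wint_shift_le[OF C2_cont[OF w] A rh _ k, of 1] unfolding f_def wmean_def L_def by simp
 have "wint 1 (%y::'a. 1)*|w (x + k) - w x| = |f 0|"
  using wp unfolding f_def wmean_0 by (simp add: abs_mult mult.commute left_diff_distrib[symmetric])
 also have "... <= L*norm k*(A/rh + B*rh)" using 1 2 by (simp add: algebra_simps)
 finally show ?thesis
  using wp unfolding lip_const_def L_def[symmetric] by (simp add: field_simps)
qed

lemma norm_grad_le:
 fixes f :: "'a::euclidean_space => real"
 assumes f: "(f has_derivative (%h. g .* h)) (at x)" and e: "e > 0"
  and L: "!!k. norm k <= e ==> |f (x + k) - f x| <= M*norm k"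
 shows "norm g <= M"
proof (cases "g = 0")
 case True
 obtain b :: 'a where "b : Basis" using nonempty_Basis by blast
 hence "0 <= M*e" using L[of "e*.b"] e by simp
 thus ?thesis using True e by (simp add: zero_le_mult_iff)
next
 case False
 have "((%t. f (x + t*.g)) has_real_derivative (g .* g)) (at 0)" by (rule line_derivative) (use f in simp)
 hence lim: "((%t. (f (x + t*.g) - f x)/t) ---> g .* g) (at 0)"
  by (simp add: DERIV_def)
 have "g .* g <= M*norm g"
 proof (rule tendsto_upperbound[OF lim])
  show "\<forall>\<^sub>F t in at 0. (f (x + t*.g) - f x)/t <= M*norm g"
   unfolding eventually_at
  proof (intro exI[of _ "e/norm g"] conjI ballI impI)
   show "0 < e/norm g" using e False by simp
   fix t :: real assume t: "t ~= 0 & dist t 0 < e/norm g"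
   hence "norm (t*.g) <= e" using False by (simp add: dist_real_def less_divide_eq)
   from L[OF this] have "|(f (x + t*.g) - f x)/t| <= M*norm g"
    using t by (simp add: abs_div divide_le_eq mult_ac)
   thus "(f (x + t*.g) - f x)/t <= M*norm g" by linarith
  qed
 qed simp
 thus ?thesis using False by (simp add: power2_norm_eq_inner[symmetric] power2_eq_square)
qed

lemma gradient_estimate:
 fixes w :: "'a::euclidean_space => real"
 assumes w: "C2 (ball x (3*rh)) w" and A: "!!y. y : ball x (3*rh) ==> |w y| <= A"
  and B: "!!y. y : ball x (3*rh) ==> |lap w y| <= B" and rh: "rh > 0"
 shows "norm (grad w x) <= lip_const TYPE('a)*(A/rh + B*rh)"
proof (rule norm_grad_le[OF C2_grad[OF w] rh])
 show "x : ball x (3*rh)" using rh by simp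
 fix k :: 'a assume "norm k <= rh"
 from lipschitz_estimate[OF w A B rh this]
 show "|w (x + k) - w x| <= lip_const TYPE('a)*(A/rh + B*rh)*norm k"
  by (simp add: mult_ac)
qed

text \<open>The product of \<open>v\<close> with \<open>d^2 - (norm (y - x))^2\<close> vanishes on
  the sphere and has an interior maximum. The first and second order conditions there bound the
  product by a constant that depends on no bound for \<open>v\<close>.\<close>

lemma keller_osserman:
 fixes v :: "'a::euclidean_space => real" and d ka be :: real
 assumes v: "C2 S v" and S: "cball x d <= S" and d: "d > 0" and vp: "!!y. y : S ==> 0 < v y"
  and L: "!!y. y : ball x d ==> lap v y >= be*v y^3 - ka*v y" and be: "be > 0" and ka: "ka >= 0" and y: "y : ball x d"
 shows "be*(v y*(d^2 - (norm (y - x))^2))^2 <= (8 + 2*DIM('a))*d^2 + ka*d^4"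
proof -
 define p where "p y = d^2 - (norm (y - x))^2" for y
 have oS: "open S" using v by (rule C2_open)
 note N = C2_norm2(1)[OF oS, of x] C2_norm2(2,3)[OF oS, of _ x]
 have p: "C2 S p" "!!y. y : S ==> grad p y = - (2*.(y - x))" "!!y. y : S ==> lap p y = - (2*real DIM('a))"
  unfolding p_def[abs_def]
  using C2_diff[OF C2_const(1)[OF oS] N(1)] C2_const(2,3)[OF oS] N(2,3) by simp_all
 define z where "z y = v y*p y" for y
 have z: "C2 S z" "!!y. y : S ==> grad z y = v y*.grad p y + p y*.grad v y"
  "!!y. y : S ==> lap z y = v y*lap p y + 2*(grad v y .* grad p y) + p y*lap v y"
  unfolding z_def[abs_def] using C2_mult[OF v p(1)] by auto
 obtain m where m: "m : cball x d" "!!y. y : cball x d ==> z y <= z m"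
  using continuous_attains_sup[OF compact_cball _ continuous_on_subset[OF C2_cont[OF z(1)] S]] d by auto
 have pp: "p y > 0" if "y : ball x d" for y
  using that d by (simp add: p_def dist_norm norm_minus_commute power_strict_mono)
 have "x : S" using subsetD[OF S, of x] d by simp
 hence "z x > 0" unfolding z_def using vp[of x] pp[of x] d by (intro mult_pos_pos) auto
 hence zm: "z m > 0" using m(2)[of x] d by simp
 have mS: "m : S" using m S by auto
 have "p m ~= 0" using zm by (auto simp: z_def)
 hence mb: "m : ball x d" using m(1) d by (auto simp: p_def dist_norm norm_minus_commute le_less)
 then obtain e where e: "e > 0" "ball m e <= ball x d" using openE[OF open_ball] by blast
 have mx: "!!y. y : ball m e ==> z y <= z m" using m(2) e by (meson ball_subset_cball subsetD)
 note M = lap_nonpos_at_max[OF z(1) mS e(1) mx]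
 have vm: "v m > 0" and pm: "p m > 0" using vp mS pp mb by auto
 \<comment> \<open>The vanishing gradient of the product eliminates the unknown gradient of
   \<open>v\<close> from the second order condition.\<close>
 have "p m*.grad v m = - (v m*.grad p m)"
  using M(1) z(2)[OF mS] by (simp add: eq_neg_iff_add_eq_0 add.commute)
 hence "p m*(grad v m .* grad p m) = - (v m*(grad p m .* grad p m))"
  by (metis inner_minus_left inner_scaleR_left)
 also have "grad p m .* grad p m = 4*(norm (m - x))^2"
  using p(2)[OF mS] by (simp add: power2_norm_eq_inner)
 finally have g: "p m*(grad v m .* grad p m) = - (4*v m*(norm (m - x))^2)" by simp
 have "p m*lap z m <= 0" using M(2) pm by (simp add: mult_le_0_iff)
 hence "- (p m*v m*(2*real DIM('a))) - 8*v m*(norm (m - x))^2 + (p m)^2*lap v m <= 0"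
  using z(3)[OF mS] p(3)[OF mS] g by (simp add: algebra_simps power2_eq_square)
 moreover have "(p m)^2*(be*v m^3 - ka*v m) <= (p m)^2*lap v m"
  using L[OF mb] by (intro mult_left_mono) auto
 ultimately have "v m*(be*(v m*p m)^2) <= v m*(p m*(2*DIM('a)) + 8*(norm (m - x))^2 + ka*(p m)^2)"
  by (simp add: algebra_simps power2_eq_square power3_eq_cube)
 hence "be*(z m)^2 <= p m*(2*DIM('a)) + 8*(norm (m - x))^2 + ka*(p m)^2"
  using vm by (simp add: z_def)
 also have "... <= d^2*(2*DIM('a)) + 8*d^2 + ka*(d^2)^2"
 proof (intro add_mono mult_mono power_mono)
  show "norm (m - x) <= d" using m(1) by (simp add: dist_norm norm_minus_commute)
 qed (use pm ka in \<open>auto simp: p_def\<close>)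
 finally have "be*(z m)^2 <= (8 + 2*DIM('a))*d^2 + ka*d^4" by (simp add: algebra_simps)
 moreover have "0 <= z y" "z y <= z m" using m(2)[of y] y vp[of y] pp[of y] subsetD[OF S, of y] unfolding z_def by auto
 hence "be*(z y)^2 <= be*(z m)^2" using be by (simp add: power_mono)
 ultimately show ?thesis unfolding z_def p_def by simp
qed

text \<open>Comparison with the paraboloid \<open>(s/d^2)*(norm (y - x))^2\<close>: on the sphere it
  equals the bound \<open>s\<close>, and at an interior maximum of the difference its Laplacian
  bounds \<open>La*v\<close>. Decay like \<open>1/La\<close> is enough later, because the coupling
  is quadratic in the small component.\<close>

lemma subsolution_decay:
 fixes v :: "'a::euclidean_space => real" and d s La :: real
 assumes v: "C2 S v" and S: "cball x d <= S" and d: "d > 0"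
  and s: "!!y. y : cball x d ==> v y <= s" "s >= 0"
  and L: "!!y. y : ball x d ==> lap v y >= La*v y" and La: "La > 0"
 shows "v x <= 2*DIM('a)*s/(La*d^2)"
proof -
 have oS: "open S" using v by (rule C2_open)
 define c where "c = 2*DIM('a)*s/(La*d^2)"
 have c0: "c >= 0" using s La by (simp add: c_def)
 define q where "q y = (s/d^2)*(norm (y - x))^2" for y
 note N = C2_norm2(1)[OF oS, of x] C2_norm2(2,3)[OF oS, of _ x]
 have q: "C2 S q" "!!y. y : S ==> lap q y = (s/d^2)*(2*DIM('a))"
  unfolding q_def[abs_def] by (rule C2_cmult(1)[OF N(1)]) (simp only: C2_cmult(3)[OF N(1)] N(3))
 define z where "z y = v y - q y" for y
 have z: "C2 S z" "!!y. y : S ==> lap z y = lap v y - (s/d^2)*(2*DIM('a))"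
  unfolding z_def[abs_def] using C2_diff[OF v q(1)] q(2) by simp_all
 obtain m where m: "m : cball x d" "!!y. y : cball x d ==> z y <= z m"
  using continuous_attains_sup[OF compact_cball _ continuous_on_subset[OF C2_cont[OF z(1)] S]] d by auto
 have mS: "m : S" using m S by auto
 have "z m <= c"
 proof (cases "m : ball x d")
  case True
  then obtain e where e: "e > 0" "ball m e <= ball x d" using openE[OF open_ball] by blast
  have mx: "!!y. y : ball m e ==> z y <= z m" using m(2) e by (meson ball_subset_cball subsetD)
  have "lap v m <= (s/d^2)*(2*DIM('a))"
   using lap_nonpos_at_max(2)[OF z(1) mS e(1) mx] z(2)[OF mS] by simp
  hence "La*v m <= (s/d^2)*(2*DIM('a))" using L[OF True] by simp
  hence "v m <= c" using La d by (simp add: c_def field_simps)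
  moreover have "0 <= q m" using s by (simp add: q_def)
  ultimately show ?thesis by (simp add: z_def)
 next
  case False
  hence "norm (m - x) = d" using m(1) by (auto simp: dist_norm norm_minus_commute)
  hence "q m = s" using d by (simp add: q_def)
  thus ?thesis using s(1)[OF m(1)] c0 by (simp add: z_def)
 qed
 moreover have "z x = v x" by (simp add: z_def q_def)
 ultimately show ?thesis using m(2)[of x] d unfolding c_def by simp
qed

section \<open>Solutions and their frequency function\<close>

text \<open>The cubic coefficients are measured by \<open>|b|*(u x)^2\<close> instead of
  \<open>|b|\<close>, which makes the class invariant under scaling: all lower order terms are
  controlled by the single number \<open>ka\<close>, and \<open>ka\<close> becomes
  \<open>ka*r^2\<close> under a zoom by \<open>r\<close>, whatever the division of the functions by
  \<open>s\<close> does to \<open>b\<close>.\<close>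

definition Sol :: "'a::euclidean_space set => real => real => ('a => real) => ('a => real) => bool" where
 "Sol S ka be u v \<longleftrightarrow> C2 S u & C2 S v & be > 0 & ka >= 0 & (ALL x:S. u x > 0 & v x > 0) &
  (EX a b a' b'. |a| <= ka & |a'| <= ka & (ALL x:S. |b|*(u x)^2 <= ka & |b'|*(v x)^2 <= ka &
    lap u x = be*u x*(v x)^2 + a*u x + b*u x^3 &
    lap v x = be*(u x)^2*v x + a'*v x + b'*v x^3))"

lemma Sol_C2: assumes "Sol S ka be u v" shows "C2 S u" "C2 S v" "open S" "be > 0" "ka >= 0"
 using assms C2_open unfolding Sol_def by blast+

lemma Sol_pos: assumes "Sol S ka be u v" "x : S" shows "u x > 0" "v x > 0"
 using assms unfolding Sol_def by blast+

lemma SolE: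
 assumes "Sol S ka be u v"
 obtains a b a' b' where "|a| <= ka" "|a'| <= ka"
  "!!x. x : S ==> |b|*(u x)^2 <= ka" "!!x. x : S ==> |b'|*(v x)^2 <= ka"
  "!!x. x : S ==> lap u x = be*u x*(v x)^2 + a*u x + b*u x^3"
  "!!x. x : S ==> lap v x = be*(u x)^2*v x + a'*v x + b'*v x^3"
 using assms unfolding Sol_def by blast

lemma SolI:
 assumes "C2 S u" "C2 S v" "be > 0" "!!x. x : S ==> u x > 0" "!!x. x : S ==> v x > 0"
  "|a| <= ka" "|a'| <= ka"
  "!!x. x : S ==> |b|*(u x)^2 <= ka" "!!x. x : S ==> |b'|*(v x)^2 <= ka"
  "!!x. x : S ==> lap u x = be*u x*(v x)^2 + a*u x + b*u x^3"
  "!!x. x : S ==> lap v x = be*(u x)^2*v x + a'*v x + b'*v x^3"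
 shows "Sol S ka be u v"
proof -
 have "EX a b a' b'. |a| <= ka & |a'| <= ka & (ALL x:S. |b|*(u x)^2 <= ka & |b'|*(v x)^2 <= ka &
    lap u x = be*u x*(v x)^2 + a*u x + b*u x^3 &
    lap v x = be*(u x)^2*v x + a'*v x + b'*v x^3)"
  by (rule exI[of _ a], rule exI[of _ b], rule exI[of _ a'], rule exI[of _ b']) (use assms(6-) in simp)
 moreover have "ka >= 0" using assms(6) by linarith
 ultimately show ?thesis unfolding Sol_def using assms(1-5) by simp
qed

lemma Sol_sym:
 assumes "Sol S ka be u v" shows "Sol S ka be v u"
proof (rule SolE[OF assms])
 fix a b a' b'
 assume *: "|a| <= ka" "|a'| <= ka"
  "!!x. x : S ==> |b|*(u x)^2 <= ka" "!!x. x : S ==> |b'|*(v x)^2 <= ka"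
  "!!x. x : S ==> lap u x = be*u x*(v x)^2 + a*u x + b*u x^3"
  "!!x. x : S ==> lap v x = be*(u x)^2*v x + a'*v x + b'*v x^3"
 show ?thesis
  by (rule SolI[where a = a' and b = b' and a' = a and b' = b])
   (use * Sol_C2[OF assms] Sol_pos[OF assms] in \<open>auto simp: mult_ac\<close>)
qed

lemma Sol_subset:
 assumes "Sol S ka be u v" "open T" "T <= S" shows "Sol T ka be u v"
 using assms C2_subset[of S u T] C2_subset[of S v T] unfolding Sol_def by blast

lemma Sol_rescale:
 fixes x :: "'a::euclidean_space" and r s :: real
 assumes sol: "Sol S ka be u v" and r: "r > 0" "s > 0" and T: "open T" "!!y. y : T ==> x + r*.y : S"
 shows "Sol T (ka*r^2) (be*r^2*s^2) (%y. u (x + r*.y)/s) (%y. v (x + r*.y)/s)"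
proof -
 obtain a b a' b' where ab: "|a| <= ka" "|a'| <= ka"
  "!!x. x : S ==> |b|*(u x)^2 <= ka" "!!x. x : S ==> |b'|*(v x)^2 <= ka"
  "!!x. x : S ==> lap u x = be*u x*(v x)^2 + a*u x + b*u x^3"
  "!!x. x : S ==> lap v x = be*(u x)^2*v x + a'*v x + b'*v x^3"
  using SolE[OF sol] by metis
 note C = C2_affine[OF Sol_C2(1)[OF sol] T] C2_affine[OF Sol_C2(2)[OF sol] T]
 have k: "|c*r^2| <= ka*r^2" if "|c| <= ka" for c
  using that by (simp add: abs_mult mult_right_mono)
 have k2: "|c*r^2*s^2|*(w/s)^2 <= ka*r^2" if "|c|*w^2 <= ka" for c w
 proof -
  have "|c*r^2*s^2|*(w/s)^2 = ( |c|*w^2)*r^2" using r by (simp add: abs_mult power_divide)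
  thus ?thesis using that by (simp add: mult_right_mono)
 qed
 have L: "lap (%y. w (x + r*.y)/s) y = r^2*lap w (x + r*.y)/s" "C2 T (%y. w (x + r*.y)/s)"
  if "C2 S w" "y : T" for w y
  using C2_cmult(1)[OF C2_affine(1)[OF that(1) T], of "1/s"] C2_cmult(3)[OF C2_affine(1)[OF that(1) T], of _ "1/s"]
   C2_affine(3)[OF that(1) T] that(2) by simp_all
 show ?thesis
  unfolding Sol_def
 proof (intro conjI exI ballI)
  show "|a*r^2| <= ka*r^2" "|a'*r^2| <= ka*r^2" using k ab by auto
  fix y assume y: "y : T"
  note z = T(2)[OF y]
  show "|b*r^2*s^2|*(u (x + r*.y)/s)^2 <= ka*r^2"
   "|b'*r^2*s^2|*(v (x + r*.y)/s)^2 <= ka*r^2" using k2 ab z by auto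
  show "0 < u (x + r*.y)/s" "0 < v (x + r*.y)/s" using Sol_pos[OF sol z] r by auto
  show "lap (%y. u (x + r*.y)/s) y = be*r^2*s^2*(u (x + r*.y)/s)*(v (x + r*.y)/s)^2
   + a*r^2*(u (x + r*.y)/s) + b*r^2*s^2*(u (x + r*.y)/s)^3"
   using r unfolding L(1)[OF Sol_C2(1)[OF sol] y] ab(5)[OF z]
   by (simp add: field_simps power2_eq_square power3_eq_cube)
  show "lap (%y. v (x + r*.y)/s) y = be*r^2*s^2*(u (x + r*.y)/s)^2*(v (x + r*.y)/s)
   + a'*r^2*(v (x + r*.y)/s) + b'*r^2*s^2*(v (x + r*.y)/s)^3"
   using r unfolding L(1)[OF Sol_C2(2)[OF sol] y] ab(6)[OF z]
   by (simp add: field_simps power2_eq_square power3_eq_cube)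
 qed (use r Sol_C2[OF sol] C2_cmult(1)[OF C(1), of "1/s"] C2_cmult(1)[OF C(4), of "1/s"] in auto)
qed

lemma Sol_lap_ge:
 assumes sol: "Sol S ka be u v" and x: "x : S"
 shows "|lap u x - be*u x*(v x)^2| <= 2*ka*u x" "|lap v x - be*(u x)^2*v x| <= 2*ka*v x"
proof -
 have *: "|l - m| <= 2*ka*w" if "l = m + a*w + b*w^3" "|a| <= ka" "|b|*w^2 <= ka" "w > 0" for l m a b w
 proof -
  have "|a*w| <= ka*w" using that by (simp add: abs_mult)
  moreover have "|b*w^3| = ( |b|*w^2)*w" using that by (simp add: abs_mult power3_eq_cube power2_eq_square)
  hence "|b*w^3| <= ka*w" using that by simp
  ultimately show ?thesis using that(1) by (simp add: abs_le_iff)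
 qed
 show "|lap u x - be*u x*(v x)^2| <= 2*ka*u x" "|lap v x - be*(u x)^2*v x| <= 2*ka*v x"
  using sol x Sol_pos[OF sol x] unfolding Sol_def by (auto intro!: *)
qed

section \<open>Height, energy and frequency\<close>

definition hgt :: "('a::euclidean_space => real) => ('a => real) => 'a => real => real" where
 "hgt u v x r = wmean (%y. (u y)^2 + (v y)^2) x r"

text \<open>This is \<open>r\<close> times the derivative of the height; half of the Laplacian of
  the sum of squares is the density of the usual Almgren energy, including coupling and lower order
  terms. So \<open>freq\<close> is the logarithmic derivative of the height, and a pair homogeneous
  of degree \<open>d\<close> has height proportional to \<open>r powr (2*d)\<close> and frequency
  \<open>2*d\<close>.\<close>

definition eng :: "('a::euclidean_space => real) => ('a => real) => 'a => real => real" where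
 "eng u v x r = (r^2/4)*wint 2 (%y. lap (%y. (u y)^2 + (v y)^2) (x + r*.y))"

definition freq :: "('a::euclidean_space => real) => ('a => real) => 'a => real => real" where
 "freq u v x r = eng u v x r/hgt u v x r"

lemma C2_sum_squares:
 assumes "C2 S u" "C2 S v"
 shows "C2 S (%y. (u y)^2 + (v y)^2)"
  "!!y. y : S ==> lap (%y. (u y)^2 + (v y)^2) y
    = 2*((norm (grad u y))^2 + (norm (grad v y))^2 + u y*lap u y + v y*lap v y)"
proof -
 have sq: "C2 S (%y. (w y)^2)" "!!y. y : S ==> lap (%y. (w y)^2) y = 2*((norm (grad w y))^2 + w y*lap w y)"
  if "C2 S w" for w
  using C2_mult(1,3)[OF that that] by (auto simp: power2_eq_square power2_norm_eq_inner[symmetric])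
 show "C2 S (%y. (u y)^2 + (v y)^2)" using C2_add(1)[OF sq(1) sq(1)] assms by blast
 show "lap (%y. (u y)^2 + (v y)^2) y
    = 2*((norm (grad u y))^2 + (norm (grad v y))^2 + u y*lap u y + v y*lap v y)" if "y : S" for y
  using C2_add(3)[OF sq(1)[OF assms(1)] sq(1)[OF assms(2)] that] sq(2)[OF assms(1) that] sq(2)[OF assms(2) that]
  by simp
qed

lemma Sol_lap_sum_squares:
 assumes sol: "Sol S ka be u v" and y: "y : S"
 shows "lap (%y. (u y)^2 + (v y)^2) y >= 4*be*(u y)^2*(v y)^2 - 4*ka*((u y)^2 + (v y)^2)"
proof -
 note b = Sol_lap_ge[OF sol y] Sol_pos[OF sol y]
 have "u y*(be*u y*(v y)^2 - 2*ka*u y) <= u y*lap u y"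
  "v y*(be*(u y)^2*v y - 2*ka*v y) <= v y*lap v y"
  using b by (intro mult_left_mono; simp add: abs_le_iff)+
 moreover have "0 <= (norm (grad u y))^2" "0 <= (norm (grad v y))^2" by auto
 ultimately have "u y*(be*u y*(v y)^2 - 2*ka*u y) + v y*(be*(u y)^2*v y - 2*ka*v y)
  <= lap (%y. (u y)^2 + (v y)^2) y/2"
  unfolding C2_sum_squares(2)[OF Sol_C2(1,2)[OF sol] y] by argo
 thus ?thesis by (simp add: algebra_simps power2_eq_square)
qed

context
 fixes u v :: "'a::euclidean_space => real" and x :: 'a and R ka be :: real
 assumes sol: "Sol (ball x R) ka be u v"
begin

lemma Sol_in_ball: "|r| < R ==> norm y <= 1 ==> x + r*.y : ball x R"
 by (rule in_ball_scaled)

lemma Sol_cont: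
 assumes "|r| < R"
 shows "cont1 (%y. u (x + r*.y))" "cont1 (%y. v (x + r*.y))"
  "cont1 (%y. grad u (x + r*.y))" "cont1 (%y. grad v (x + r*.y))"
  "cont1 (%y. lap u (x + r*.y))" "cont1 (%y. lap v (x + r*.y))"
  "cont1 (%y. hess u (x + r*.y) h)" "cont1 (%y. hess v (x + r*.y) h)"
 using C2_cont_cball[OF Sol_C2(1)[OF sol] assms] C2_cont_cball[OF Sol_C2(2)[OF sol] assms] by auto

lemma hgt_pos: assumes "|r| < R" shows "hgt u v x r > 0"
proof -
 let ?f = "%y. (u (x + r*.y))^2 + (v (x + r*.y))^2"
 have c: "cont1 ?f" by (intro continuous_intros Sol_cont assms)
 have p: "0 < ?f y" if "norm y <= 1" for y
  using Sol_pos[OF sol Sol_in_ball[OF assms that]] by (simp add: add_pos_pos)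
 have "0 < (1 - (1/2)^2)^1*(LINT y:cball 0 (1/2)|lborel. ?f y)"
  by (intro mult_pos_pos set_integral_pos continuous_on_subset[OF c]) (use p in \<open>auto simp: power_divide\<close>)
 also have "... <= wint 1 ?f" using p by (intro wint_0_ge c) (auto intro: less_imp_le)
 finally show ?thesis by (simp add: hgt_def wmean_def)
qed

lemma hgt_has_derivative:
 assumes "0 < r" "r < R"
 shows "(hgt u v x has_real_derivative eng u v x r/r) (at r)"
proof -
 have "|r| < R" using assms by auto
 from wmean_has_derivative[OF C2_sum_squares(1)[OF Sol_C2(1,2)[OF sol]] this]
 show ?thesis using assms unfolding hgt_def[abs_def] eng_def by (simp add: power2_eq_square)
qed

lemma hgt_mono:
 assumes "0 <= s" "s <= r" "r < R"
 shows "hgt u v x s*exp (ka*s^2/2) <= hgt u v x r*exp (ka*r^2/2)"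
proof -
 have "lap (%y. (u y)^2 + (v y)^2) y >= - (4*ka)*((u y)^2 + (v y)^2)" if "y : ball x R" for y
 proof -
  have "0 <= be*(u y)^2*(v y)^2" using Sol_C2(4)[OF sol] by simp
  thus ?thesis using Sol_lap_sum_squares[OF sol that] by (simp add: algebra_simps)
 qed
 from wmean_mono_exp[OF C2_sum_squares(1)[OF Sol_C2(1,2)[OF sol]] _ this _ assms]
 show ?thesis using Sol_C2(5)[OF sol] by (simp add: hgt_def)
qed

text \<open>Here \<open>r*(grad u (x + r*.y) .* y)\<close> is the radial
 derivative \<open>d/dt\<close> of \<open>u (x + r*.y)\<close> for \<open>r = e^t\<close>.\<close>

lemma eng_eq_radial:
 assumes r: "0 < r" "r < R"
 shows "eng u v x r = 2*(wint 1 (%y. u (x + r*.y)*(r*(grad u (x + r*.y) .* y)))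
  + wint 1 (%y. v (x + r*.y)*(r*(grad v (x + r*.y) .* y))))"
proof -
 have r': "|r| < R" using r by auto
 let ?f = "%y. (u y)^2 + (v y)^2" and ?g = "%y. (2*u y)*.grad u y + (2*v y)*.grad v y"
 have sq: "((%y. (w y)^2) has_derivative (%h. ((2*w y)*.grad w y) .* h)) (at y)"
  if "C2 (ball x R) w" "y : ball x R" for w y
  using has_derivative_mult[OF C2_grad[OF that] C2_grad[OF that]] by (simp add: power2_eq_square mult_ac)
 have f: "(?f has_derivative (%h. ?g y .* h)) (at y)" if "y : ball x R" for y
  using has_derivative_add[OF sq[OF Sol_C2(1)[OF sol] that] sq[OF Sol_C2(2)[OF sol] that]]
  by (simp add: inner_add_left)
 have g: "continuous_on (ball x R) ?g"
  by (intro continuous_intros C2_cont[OF Sol_C2(1)[OF sol]] C2_cont[OF Sol_C2(2)[OF sol]]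
    C2_cont_grad[OF Sol_C2(1)[OF sol]] C2_cont_grad[OF Sol_C2(2)[OF sol]])
 have "(hgt u v x has_real_derivative wint 1 (%y. ?g (x + r*.y) .* y)) (at r)"
  using wint_radial_derivative[OF f g continuous_on_const r', of 1 1]
  by (simp add: hgt_def[abs_def] wmean_def)
 with hgt_has_derivative[OF r] have "eng u v x r/r = wint 1 (%y. ?g (x + r*.y) .* y)"
  by (rule DERIV_unique)
 hence "eng u v x r = r*wint 1 (%y. ?g (x + r*.y) .* y)" using r by (simp add: field_simps)
 also have "... = wint 1 (%y. 2*(u (x + r*.y)*(r*(grad u (x + r*.y) .* y))
   + v (x + r*.y)*(r*(grad v (x + r*.y) .* y))))"
  unfolding wint_cmult[symmetric] by (rule wint_cong) (simp add: inner_add_left algebra_simps)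
 also have "... = 2*(wint 1 (%y. u (x + r*.y)*(r*(grad u (x + r*.y) .* y)))
  + wint 1 (%y. v (x + r*.y)*(r*(grad v (x + r*.y) .* y))))"
  unfolding wint_cmult by (subst wint_add) (auto intro!: continuous_intros Sol_cont r')
 finally show ?thesis .
qed

end

text \<open>The Hessian applied to the gradient, hence half of the gradient of
  \<open>(norm (grad u z))^2\<close>; the expansion in the basis makes continuity evident.\<close>

definition hgrad :: "('a::euclidean_space => real) => 'a => 'a" where
 "hgrad u z = (SUM b:Basis. (grad u z .* b)*.hess u z b)"

lemma hgrad:
 assumes u: "C2 S u" and z: "z : S"
 shows "grad u z .* hess u z h = hgrad u z .* h"
  "((%z. (norm (grad u z))^2) has_derivative (%h. (2*.hgrad u z) .* h)) (at z)"
  "continuous_on S (hgrad u)"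
proof -
 have lin: "linear (hess u z)" using C2_hess[OF u z] by (rule has_derivative_linear)
 have "hess u z (grad u z) = hess u z (SUM b:Basis. (grad u z .* b)*.b)" by (simp add: euclidean_representation)
 also have "... = hgrad u z" unfolding hgrad_def using lin by (simp add: linear_sum linear_scale)
 finally have "hess u z (grad u z) = hgrad u z" .
 thus *: "grad u z .* hess u z h = hgrad u z .* h" for h
  using hess_symmetric[OF u z, of h "grad u z"] by (simp add: inner_commute)
 show "((%z. (norm (grad u z))^2) has_derivative (%h. (2*.hgrad u z) .* h)) (at z)"
  unfolding power2_norm_eq_inner
  using has_derivative_inner[OF C2_hess[OF u z] C2_hess[OF u z]] * by (simp add: inner_commute)
 show "continuous_on S (hgrad u)"
  unfolding hgrad_def[abs_def] by (intro continuous_intros C2_cont_grad[OF u] C2_cont_hess[OF u])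
qed

text \<open>Integration by parts of the field \<open>(grad u .* y)*.grad u\<close>. Its divergence
  is the left integrand, and the derivative of the squared weight produces the square of the radial
  derivative, in place of a boundary term on a sphere.\<close>

lemma rellich_pohozaev:
 fixes u :: "'a::euclidean_space => real"
 assumes u: "C2 (ball x R) u" and r: "0 < r" "r < R"
 shows "wint 2 (%y. lap u (x + r*.y)*(r*(grad u (x + r*.y) .* y)) + r*(hgrad u (x + r*.y) .* y)
   + (norm (grad u (x + r*.y)))^2)
  = (4/r^2)*wint 1 (%y. (r*(grad u (x + r*.y) .* y))^2)"
proof -
 define S where "S = (%y. x + r*.y) -` ball x R"
 have r': "|r| < R" using r by auto
 have S: "open S" unfolding S_def by (intro open_vimage continuous_intros) auto
 have SB: "cball 0 1 <= S" using in_ball_scaled[OF r'] unfolding S_def by auto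
 let ?g = "%y. grad u (x + r*.y)" and ?h = "%y. hess u (x + r*.y)"
 have cg: "continuous_on S ?g" and ch: "!!h. continuous_on S (%y. ?h y h)"
  by (intro continuous_intros continuous_on_compose2[OF C2_cont_hess[OF u]] continuous_on_compose2[OF C2_cont_grad[OF u]];
    auto simp: S_def)+
 note cgB = continuous_on_subset[OF cg SB] and chB = continuous_on_subset[OF ch SB]
 define F where "F b y = (r*(?h y b .* b))*(?g y .* y) + (?g y .* b)*(r*(?h y b .* y) + ?g y .* b)" for b y
 have F: "wint 2 (F b) = 4*wint 1 (%y. (y .* b)*((?g y .* b)*(?g y .* y)))" if b: "b : Basis" for b
 proof -
  let ?G = "%y. (?g y .* y)*.(r*.?h y b) + (?g y .* b)*.((SUM c:Basis. (y .* c)*.(r*.?h y c)) + ?g y)"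
  have sumhess: "(SUM c:Basis. (y .* c)*.?h y c) = ?h y y" if "y : S" for y
  proof -
   have "linear (?h y)" using that by (intro has_derivative_linear[OF C2_hess[OF u]]) (simp add: S_def)
   hence "?h y (SUM c:Basis. (y .* c)*.c) = (SUM c:Basis. (y .* c)*.?h y c)"
    by (simp add: linear_sum linear_scale)
   thus ?thesis by (simp add: euclidean_representation)
  qed
  have "wint 2 (%y. ?G y .* b) = 4*wint 1 (%y. (y .* b)*((?g y .* b)*(?g y .* y)))"
  proof (rule wint_by_parts[OF S SB])
   fix y assume y: "y : S"
   hence y': "x + r*.y : ball x R" by (simp add: S_def)
   note H = C2_hess[OF u y']
   note dg = affine_derivative[OF H]
   have d1: "((%y. ?g y .* b) has_derivative (%h. ?h y (r*.h) .* b)) (at y)"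
    by (rule has_derivative_inner_left[OF dg])
   have d2: "((%y. ?g y .* y) has_derivative (%h. ?g y .* h + ?h y (r*.h) .* y)) (at y)"
    by (rule has_derivative_inner[OF dg has_derivative_ident])
   have lin: "?h y (r*.h) = r*.?h y h" for h using linear_scale[OF has_derivative_linear[OF H]] .
   have sy: "?h y h .* k = ?h y k .* h" for h k by (rule hess_symmetric[OF u y'])
   have sm: "(SUM c:Basis. (y .* c)*.(r*.?h y c)) = r*.?h y y"
    using sumhess[OF y] by (simp add: scaleR_left_commute[of _ r] scaleR_sum_right[symmetric] del: scaleR_scaleR)
   have "(%h. (?g y .* b)*(?g y .* h + ?h y (r*.h) .* y) + (?h y (r*.h) .* b)*(?g y .* y)) = (%h. ?G y .* h)"
   proof (rule ext)
    fix h
    show "(?g y .* b)*(?g y .* h + ?h y (r*.h) .* y) + (?h y (r*.h) .* b)*(?g y .* y) = ?G y .* h"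
     unfolding sm lin using sy[of h y] sy[of h b] by (simp add: inner_add_left algebra_simps)
   qed
   with has_derivative_mult[OF d1 d2]
   show "((%y. (?g y .* b)*(?g y .* y)) has_derivative (%h. ?G y .* h)) (at y)" by simp
  next
   show "continuous_on S ?G" by (intro continuous_intros cg ch)
  qed
  moreover have "wint 2 (F b) = wint 2 (%y. ?G y .* b)"
  proof (rule wint_cong)
   fix y :: 'a assume "norm y <= 1"
   hence y: "y : S" using SB by auto
   hence y': "x + r*.y : ball x R" by (simp add: S_def)
   have "(SUM c:Basis. (y .* c)*.(r*.?h y c)) = r*.?h y y"
    using sumhess[OF y] by (simp add: scaleR_left_commute[of _ r] scaleR_sum_right[symmetric] del: scaleR_scaleR)
   thus "F b y = ?G y .* b"
    unfolding F_def using hess_symmetric[OF u y', of b y] by (simp add: inner_add_left algebra_simps)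
  qed
  ultimately show ?thesis by simp
 qed
 have cF: "cont1 (F b)" for b
  unfolding F_def[abs_def] by (intro continuous_intros cgB chB)
 have "wint 2 (%y. r*(lap u (x + r*.y)*(?g y .* y)) + r*(hgrad u (x + r*.y) .* y) + (norm (?g y))^2)
  = wint 2 (%y. SUM b:Basis. F b y)"
 proof (rule wint_cong)
  fix y :: 'a
  have n: "(norm (?g y))^2 = (SUM b:Basis. (?g y .* b)*(?g y .* b))"
   by (subst power2_norm_eq_inner, subst euclidean_inner) simp
  show "r*(lap u (x + r*.y)*(?g y .* y)) + r*(hgrad u (x + r*.y) .* y) + (norm (?g y))^2
   = (SUM b:Basis. F b y)"
   unfolding F_def n lap_def hgrad_def
   by (simp add: inner_sum_left sum.distrib sum_distrib_left sum_distrib_right distrib_left mult_ac)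
 qed
 also have "... = (SUM b:Basis. 4*wint 1 (%y. (y .* b)*((?g y .* b)*(?g y .* y))))"
  using F by (subst wint_sum) (auto intro!: cF)
 also have "... = wint 1 (%y. 4*(SUM b:Basis. (y .* b)*((?g y .* b)*(?g y .* y))))"
  unfolding wint_cmult by (subst wint_sum) (auto intro!: continuous_intros cgB simp: sum_distrib_left)
 also have "... = wint 1 (%y. (4/r^2)*(r*(?g y .* y))^2)"
 proof (rule wint_cong)
  fix y :: 'a
  have "(SUM b:Basis. (y .* b)*((?g y .* b)*(?g y .* y))) = (SUM b:Basis. (?g y .* b)*(y .* b))*(?g y .* y)"
   unfolding sum_distrib_right by (intro sum.cong) (simp_all add: mult_ac)
  also have "... = (?g y .* y)^2" using euclidean_inner[of "?g y" y] by (simp add: power2_eq_square)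
  finally show "4*(SUM b:Basis. (y .* b)*((?g y .* b)*(?g y .* y))) = (4/r^2)*(r*(?g y .* y))^2"
   using r by (simp add: power_mult_distrib)
 qed
 also have "... = (4/r^2)*wint 1 (%y. (r*(?g y .* y))^2)" by (rule wint_cmult)
 finally show ?thesis by (simp add: mult_ac)
qed

section \<open>Monotonicity of the frequency\<close>

context
 fixes u v :: "'a::euclidean_space => real" and x :: 'a and R ka be :: real
 assumes sol: "Sol (ball x R) ka be u v" and dim: "DIM('a) <= 4"
begin

abbreviation (input) "radial r == wint 1 (%y. (r*(grad u (x + r*.y) .* y))^2)
  + wint 1 (%y. (r*(grad v (x + r*.y) .* y))^2)"

text \<open>Almgren's identity. The restriction \<open>DIM('a) <= 4\<close> makes the contribution
 \<open>(2 - N/2) be u^2 v^2\<close> of the coupling nonnegative.\<close>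

lemma eng_has_derivative:
 assumes r: "0 < r" "r < R"
 shows "EX E'. (eng u v x has_real_derivative E') (at r) & r*E' >= 4*radial r - 3*ka*r^2*hgt u v x r"
proof -
 obtain a b a' b' where ab: "|a| <= ka" "|a'| <= ka"
  "!!z. z : ball x R ==> |b|*(u z)^2 <= ka" "!!z. z : ball x R ==> |b'|*(v z)^2 <= ka"
  and lu: "!!z. z : ball x R ==> lap u z = be*u z*(v z)^2 + a*u z + b*u z^3"
  and lv: "!!z. z : ball x R ==> lap v z = be*(u z)^2*v z + a'*v z + b'*v z^3"
  using SolE[OF sol] by metis
 note u = Sol_C2(1)[OF sol] and v = Sol_C2(2)[OF sol] and be = Sol_C2(4)[OF sol] and ka = Sol_C2(5)[OF sol]
 let ?B = "ball x R"
 \<comment> \<open>\<open>P\<close> is \<open>u*lap u + v*lap v\<close>. \<open>Q\<close> is chosen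
   so that \<open>gQ\<close> is \<open>gP\<close> minus twice
   \<open>lap u*.grad u + lap v*.grad v\<close>: the subtracted terms are consumed by the Rellich
   identity, and only \<open>Q\<close> remains to be integrated by parts radially.\<close>
 define P where "P z = 2*be*((u z)^2*(v z)^2) + a*(u z)^2 + b*u z^4 + a'*(v z)^2 + b'*v z^4" for z
 define Q where "Q z = be*((u z)^2*(v z)^2) + (b*u z^4 + b'*v z^4)/2" for z
 define gP where "gP z = (4*be*u z*(v z)^2 + 2*a*u z + 4*b*u z^3)*.grad u z
  + (4*be*(u z)^2*v z + 2*a'*v z + 4*b'*v z^3)*.grad v z" for z
 define gQ where "gQ z = (2*be*u z*(v z)^2 + 2*b*u z^3)*.grad u z
  + (2*be*(u z)^2*v z + 2*b'*v z^3)*.grad v z" for z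
 define q where "q z = (norm (grad u z))^2 + (norm (grad v z))^2 + P z" for z
 define gq where "gq z = 2*.hgrad u z + 2*.hgrad v z + gP z" for z
 have dP: "(P has_derivative (%h. gP z .* h)) (at z)" and dQ: "(Q has_derivative (%h. gQ z .* h)) (at z)"
  if "z : ?B" for z
  unfolding P_def[abs_def] Q_def[abs_def] gP_def gQ_def
  by (auto intro!: derivative_eq_intros C2_grad[OF u that] C2_grad[OF v that] ext
    simp: inner_add_left algebra_simps power2_eq_square power3_eq_cube numeral_eq_Suc)
 have dq: "(q has_derivative (%h. gq z .* h)) (at z)" if "z : ?B" for z
  using has_derivative_add[OF has_derivative_add[OF hgrad(2)[OF u that] hgrad(2)[OF v that]] dP[OF that]]
  unfolding q_def[abs_def] gq_def by (simp add: inner_add_left)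
 note cu = C2_cont[OF u] C2_cont[OF v] C2_cont_grad[OF u] C2_cont_grad[OF v]
 have cP: "continuous_on ?B P" "continuous_on ?B Q" "continuous_on ?B gP" "continuous_on ?B gQ"
  unfolding P_def[abs_def] Q_def[abs_def] gP_def[abs_def] gQ_def[abs_def]
  by (intro continuous_intros cu; simp)+
 have hc: "continuous_on ?B (hgrad u)" "continuous_on ?B (hgrad v)"
  using hgrad(3)[OF u] hgrad(3)[OF v] r by (metis centre_in_ball less_trans)+
 have cq: "continuous_on ?B gq" unfolding gq_def[abs_def] by (intro continuous_intros hc cP)
 have engq: "eng u v x t = (t^2/2)*wint 2 (%y. q (x + t*.y))" if "|t| < R" for t
 proof -
  have "wint 2 (%y. lap (%y. (u y)^2 + (v y)^2) (x + t*.y)) = wint 2 (%y. 2*q (x + t*.y))"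
  proof (rule wint_cong)
   fix y :: 'a assume "norm y <= 1"
   hence z: "x + t*.y : ?B" using in_ball_scaled that by blast
   have "u z*lap u z + v z*lap v z = P z" if "z : ?B" for z
    unfolding lu[OF that] lv[OF that] P_def by (simp add: algebra_simps power2_eq_square power3_eq_cube power4_eq_xxxx)
   from this[OF z] show "lap (%y. (u y)^2 + (v y)^2) (x + t*.y) = 2*q (x + t*.y)"
    unfolding C2_sum_squares(2)[OF u v z] q_def by simp
  qed
  thus ?thesis by (simp add: eng_def wint_cmult)
 qed
 have r': "|r| < R" using r by auto
 define E' where "E' = r*wint 2 (%y. q (x + r*.y)) + (r^2/2)*wint 2 (%y. gq (x + r*.y) .* y)"
 have "((%r. wint 2 (%y. q (x + r*.y))) has_real_derivative wint 2 (%y. gq (x + r*.y) .* y)) (at r)"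
  using wint_radial_derivative[OF dq cq continuous_on_const r', of 2 1] by simp
 hence "((%t. (t^2/2)*wint 2 (%y. q (x + t*.y))) has_real_derivative E') (at r)"
  unfolding E'_def by (auto intro!: derivative_eq_intros)
 hence D: "(eng u v x has_real_derivative E') (at r)"
  by (rule has_field_derivative_transform_within_open[where S = "{-R<..<R}"]) (use r engq in auto)
 have inb: "x + r*.y : ?B" if "norm y <= 1" for y using in_ball_scaled[OF r' that] .
 have comp: "cont1 (%y. f (x + r*.y))" if "continuous_on ?B f" for f :: "'a => 'b::real_normed_vector"
  by (intro continuous_intros continuous_on_compose2[OF that]) (use inb in auto)
 note cc = comp[OF cu(1)] comp[OF cu(2)] comp[OF cu(3)] comp[OF cu(4)] comp[OF cP(1)] comp[OF cP(2)] comp[OF cP(3)] comp[OF cP(4)]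
  comp[OF cq] comp[OF hc(1)] comp[OF hc(2)] comp[OF C2_cont_lap[OF u]] comp[OF C2_cont_lap[OF v]]
 have cqq: "cont1 (%y. q (x + r*.y))" unfolding q_def by (intro continuous_intros cc)
 let ?z = "%y. x + r*.y"
 let ?I = "%w y. lap w (?z y)*(r*(grad w (?z y) .* y)) + r*(hgrad w (?z y) .* y) + (norm (grad w (?z y)))^2"
 have "r*E' = wint 2 (%y. r^2*q (?z y) + (r^3/2)*(gq (?z y) .* y))"
 proof -
  have "wint 2 (%y. r^2*q (?z y) + (r^3/2)*(gq (?z y) .* y))
   = r^2*wint 2 (%y. q (?z y)) + (r^3/2)*wint 2 (%y. gq (?z y) .* y)"
   by (subst wint_add wint_cmult; (intro continuous_intros cc cqq)?)+ simp
  thus ?thesis unfolding E'_def by (simp only:) (simp add: algebra_simps power2_eq_square power3_eq_cube)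
 qed
 also have "... = wint 2 (%y. r^2*(?I u y + ?I v y) + (r^2*P (?z y) + (r^2/2)*((r*.gQ (?z y)) .* y)))"
 proof (rule wint_cong)
  fix y :: 'a assume "norm y <= 1"
  note z = inb[OF this]
  show "r^2*q (?z y) + (r^3/2)*(gq (?z y) .* y)
   = r^2*(?I u y + ?I v y) + (r^2*P (?z y) + (r^2/2)*((r*.gQ (?z y)) .* y))"
   unfolding q_def gq_def gP_def gQ_def lu[OF z] lv[OF z]
   by (simp add: inner_add_left algebra_simps power2_eq_square power3_eq_cube)
 qed
 also have "... = r^2*(wint 2 (?I u) + wint 2 (?I v)) + (r^2*wint 2 (%y. P (?z y)) + (r^2/2)*wint 2 (%y. (r*.gQ (?z y)) .* y))"
  by (subst wint_add wint_cmult; (intro continuous_intros cc)?)+ simp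
 also have "r^2*(wint 2 (?I u) + wint 2 (?I v)) = 4*radial r"
  using rellich_pohozaev[OF u r] rellich_pohozaev[OF v r] r by (simp add: field_simps)
 also have "wint 2 (%y. (r*.gQ (?z y)) .* y) = 4*wint 1 (%y. (norm y)^2*Q (?z y)) - DIM('a)*wint 2 (%y. Q (?z y))"
 proof (rule wint_by_parts_radial)
  define S where "S = (%y. x + r*.y) -` ?B"
  show "open S" unfolding S_def by (intro open_vimage continuous_intros) auto
  show "cball 0 1 <= S" using inb unfolding S_def by auto
  show "((%y. Q (?z y)) has_derivative (%h. (r*.gQ (?z y)) .* h)) (at y)" if "y : S" for y
   using affine_derivative[OF dQ] that by (simp add: S_def)
  show "continuous_on S (%y. r*.gQ (?z y))"
   by (intro continuous_intros continuous_on_compose2[OF cP(4)]) (auto simp: S_def)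
 qed
 finally have rE0: "r*E' = 4*radial r + (r^2*wint 2 (%y. P (?z y)) + (r^2/2) *
   (4*wint 1 (%y. (norm y)^2*Q (?z y)) - DIM('a)*wint 2 (%y. Q (?z y))))" .
 have w1: "wint 2 (%y. P (?z y) - (DIM('a)/2)*Q (?z y)) = wint 2 (%y. P (?z y)) - (DIM('a)/2)*wint 2 (%y. Q (?z y))"
  by (subst wint_diff wint_cmult; (intro continuous_intros cc)?)+ simp
 have w2: "wint 1 (%y. 2*((norm y)^2*Q (?z y))) = 2*wint 1 (%y. (norm y)^2*Q (?z y))"
  by (rule wint_cmult)
 have rE: "r*E' = 4*radial r + r^2*(wint 2 (%y. P (?z y) - (DIM('a)/2)*Q (?z y)) + wint 1 (%y. 2*((norm y)^2*Q (?z y))))"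
  unfolding rE0 w1 w2 by (simp add: field_simps)
 let ?U = "%y. (u (?z y))^2 + (v (?z y))^2"
 have b4: "|c*w^4| <= ka*w^2" if "|c|*w^2 <= ka" for c w :: real
 proof -
  have "|c*w^4| = ( |c|*w^2)*w^2" by (simp add: abs_mult power4_eq_xxxx power2_eq_square)
  thus ?thesis using that by (simp add: mult_right_mono)
 qed
 have b2: "|c*w^2| <= ka*w^2" if "|c| <= ka" for c w :: real
  using that by (simp add: abs_mult mult_right_mono)
 have cU: "cont1 ?U" by (intro continuous_intros cc)
 have hU: "hgt u v x r = wint 1 ?U" by (simp add: hgt_def wmean_def)
 \<comment> \<open>The constant 3 in the error consists of 2 from the integrand with weight exponent
   2 and 1 from the term with \<open>(norm y)^2*Q\<close>.\<close>
 have "- 2*ka*hgt u v x r <= - 2*ka*wint 2 ?U"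
  unfolding hU using ka by (intro mult_left_mono_neg wint_2_le_1 cU) auto
 also have "... = wint 2 (%y. - 2*ka*?U y)" by (rule wint_cmult[symmetric])
 also have "... <= wint 2 (%y. P (?z y) - (DIM('a)/2)*Q (?z y))"
 proof (rule wint_mono)
  fix y :: 'a assume "norm y <= 1"
  note z = inb[OF this]
  define n where "n = real DIM('a)"
  have n: "1 - n/4 >= 0" "1 - n/4 <= 1" "2 - n/2 >= 0" using dim by (auto simp: n_def)
  define B where "B = b*u (?z y)^4 + b'*v (?z y)^4"
  have B: "|B| <= ka*?U y"
   using b4[OF ab(3)[OF z]] b4[OF ab(4)[OF z]] unfolding B_def by (simp add: algebra_simps abs_le_iff)
  have "|(1 - n/4)*B| <= 1*(ka*?U y)"
   unfolding abs_mult using n B by (intro mult_mono) auto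
  moreover have "0 <= (2 - n/2)*(be*((u (?z y))^2*(v (?z y))^2))" using n be by simp
  moreover have "P (?z y) - (n/2)*Q (?z y) = (2 - n/2)*(be*((u (?z y))^2*(v (?z y))^2))
    + a*(u (?z y))^2 + a'*(v (?z y))^2 + (1 - n/4)*B"
   unfolding P_def Q_def B_def by (simp add: field_simps)
  moreover have "- (ka*?U y) <= a*(u (?z y))^2 + a'*(v (?z y))^2"
   using b2[OF ab(1), of "u (?z y)"] b2[OF ab(2), of "v (?z y)"] by (simp add: abs_le_iff algebra_simps)
  ultimately show "- 2*ka*?U y <= P (?z y) - (DIM('a)/2)*Q (?z y)"
   unfolding n_def[symmetric] by (simp add: abs_le_iff algebra_simps)
 qed (intro continuous_intros cc)+
 finally have e1: "- 2*ka*hgt u v x r <= wint 2 (%y. P (?z y) - (DIM('a)/2)*Q (?z y))" .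
 have "- ka*hgt u v x r = wint 1 (%y. - ka*?U y)" unfolding hU by (rule wint_cmult[symmetric])
 also have "... <= wint 1 (%y. 2*((norm y)^2*Q (?z y)))"
 proof (rule wint_mono)
  fix y :: 'a assume y: "norm y <= 1"
  note z = inb[OF y]
  have "- (ka*?U y) <= 2*Q (?z y)"
  proof -
   have "0 <= be*((u (?z y))^2*(v (?z y))^2)" using be by simp
   thus ?thesis
    using b4[OF ab(3)[OF z]] b4[OF ab(4)[OF z]] unfolding Q_def distrib_left abs_le_iff by argo
  qed
  hence "(norm y)^2*(- (ka*?U y)) <= (norm y)^2*(2*Q (?z y))" by (intro mult_left_mono) auto
  moreover have "(norm y)^2*(ka*?U y) <= 1*(ka*?U y)"
   using y ka by (intro mult_right_mono) (auto simp: power_le_one)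
  ultimately show "- ka*?U y <= 2*((norm y)^2*Q (?z y))" by simp
 qed (intro continuous_intros cc)+
 finally have e2: "- ka*hgt u v x r <= wint 1 (%y. 2*((norm y)^2*Q (?z y)))" .
 have "r^2*(- 3*ka*hgt u v x r) <= r^2*(wint 2 (%y. P (?z y) - (DIM('a)/2)*Q (?z y)) + wint 1 (%y. 2*((norm y)^2*Q (?z y))))"
  using e1 e2 by (intro mult_left_mono) auto
 thus ?thesis using D rE by (intro exI[of _ E']) (simp add: algebra_simps)
qed

text \<open>Nonnegativity of the Gram form of three functions. With suitable coefficients it yields
  the Cauchy-Schwarz deficit in the frequency derivative and the bound on the motion of the
  profile.\<close>

lemma wint_square3:
 fixes f g h :: "'a => real"
 assumes "cont1 f" "cont1 g" "cont1 h"
 shows "0 <= al^2*wint 1 (%y. (f y)^2) + ga^2*wint 1 (%y. (g y)^2) + de^2*wint 1 (%y. (h y)^2)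
  + 2*al*ga*wint 1 (%y. g y*f y) + 2*al*de*wint 1 (%y. f y*h y) + 2*ga*de*wint 1 (%y. g y*h y)"
proof -
 have "0 <= wint 1 (%y. (al*f y + ga*g y + de*h y)^2)" by (rule wint_nonneg) simp
 also have "... = wint 1 (%y. al^2*(f y)^2 + ga^2*(g y)^2 + de^2*(h y)^2
  + 2*al*ga*(g y*f y) + 2*al*de*(f y*h y) + 2*ga*de*(g y*h y))"
  by (rule wint_cong) (simp add: power2_eq_square algebra_simps)
 also have "... = al^2*wint 1 (%y. (f y)^2) + ga^2*wint 1 (%y. (g y)^2) + de^2*wint 1 (%y. (h y)^2)
  + 2*al*ga*wint 1 (%y. g y*f y) + 2*al*de*wint 1 (%y. f y*h y) + 2*ga*de*wint 1 (%y. g y*h y)"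
  by (subst wint_add wint_cmult; (intro continuous_intros assms)?)+ simp
 finally show ?thesis .
qed

text \<open>The Cauchy-Schwarz deficit \<open>radial r/hgt u v x r - (freq u v x r)^2/4\<close> is
  kept explicit instead of being discarded as nonnegative: it is the squared logarithmic speed of
  the normalised profile, which is needed to prove homogeneity of limits.\<close>

lemma freq_has_derivative:
 assumes r: "0 < r" "r < R"
 shows "EX F'. (freq u v x has_real_derivative F') (at r) &
   r*F' >= 4*(radial r/hgt u v x r - (freq u v x r)^2/4) - 3*ka*r^2 &
   0 <= radial r/hgt u v x r - (freq u v x r)^2/4"
proof -
 have r': "|r| < R" using r by auto
 obtain E' where E': "(eng u v x has_real_derivative E') (at r)" "r*E' >= 4*radial r - 3*ka*r^2*hgt u v x r"
  using eng_has_derivative[OF r] by blast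
 define H E where "H = hgt u v x r" and "E = eng u v x r"
 have H: "H > 0" unfolding H_def by (rule hgt_pos[OF sol r'])
 have F: "freq u v x r = E/H" by (simp add: freq_def H_def E_def)
 define F' where "F' = (E'*H - E*(E/r))/(H*H)"
 have D: "(freq u v x has_real_derivative F') (at r)"
  unfolding freq_def[abs_def] F'_def H_def E_def
  by (rule DERIV_divide[OF E'(1) hgt_has_derivative[OF sol r]]) (use H in \<open>auto simp: H_def\<close>)
 have "r*F' = (r*E'*H - E^2)/(H*H)"
 proof -
  have "r*(E'*H - E*(E/r)) = r*E'*H - E^2" using r by (simp add: right_diff_distrib power2_eq_square)
  thus ?thesis unfolding F'_def by (simp only: times_divide_eq_right)
 qed
 also have "... = r*E'/H - E^2/H^2" using H by (simp add: diff_divide_distrib power2_eq_square)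
 finally have rF: "r*F' = r*E'/H - (E/H)^2" by (simp add: power_divide)
 have "(4*radial r - 3*ka*r^2*H)/H <= r*E'/H"
  using E'(2) H by (intro divide_right_mono) (auto simp: H_def)
 moreover have "(4*radial r - 3*ka*r^2*H)/H = 4*(radial r/H) - 3*ka*r^2"
  using H by (simp add: field_simps)
 ultimately have 1: "r*F' >= 4*(radial r/H - (E/H)^2/4) - 3*ka*r^2"
  using rF by simp
 let ?du = "%w y. r*(grad w (x + r*.y) .* y)"
 note c = Sol_cont[OF sol r']
 have cd: "cont1 (?du u)" "cont1 (?du v)"
  by (intro continuous_intros c)+
 \<comment> \<open>The minimiser of the quadratic \<open>radial r + t^2*H + t*E\<close>, which is an
   integral of squares.\<close>
 define t where "t = - E/(2*H)"
 have "0 <= radial r + t^2*H + t*E"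
  using wint_square3[OF cd(1) c(1) c(1), of 1 t 0] wint_square3[OF cd(2) c(2) c(2), of 1 t 0]
   eng_eq_radial[OF sol r]
  unfolding H_def E_def hgt_def wmean_def
  by (simp add: wint_add c continuous_intros algebra_simps)
 also have "t^2*H + t*E = - (E^2/(4*H))" using H by (simp add: t_def field_simps power2_eq_square)
 hence "radial r + t^2*H + t*E = radial r - E^2/(4*H)" by linarith
 also have "... = H*(radial r/H - (E/H)^2/4)"
  using H by (simp add: field_simps power2_eq_square)
 finally have "0 <= radial r/H - (E/H)^2/4" using H by (simp add: zero_le_mult_iff)
 with D 1 show ?thesis unfolding F H_def[symmetric] by blast
qed

lemma freq_has_derivative_ge:
 assumes "0 < r" "r < R"
 shows "EX F' W. (freq u v x has_real_derivative F') (at r) & r*F' >= 4*W - 3*ka*r^2 & 0 <= W"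
 using freq_has_derivative[OF assms] by blast

lemma freq_almost_mono:
 assumes "0 < s" "s <= r" "r < R"
 shows "freq u v x s + (3/2)*ka*s^2 <= freq u v x r + (3/2)*ka*r^2"
proof (rule DERIV_nonneg_imp_nondecreasing[OF assms(2)])
 fix t assume t: "s <= t" "t <= r"
 hence t': "0 < t" "t < R" using assms by auto
 obtain F' W where F': "(freq u v x has_real_derivative F') (at t)" "t*F' >= 4*W - 3*ka*t^2" "0 <= W"
  using freq_has_derivative_ge[OF t'] by blast
 have "((%r. freq u v x r + (3/2)*ka*r^2) has_real_derivative F' + 3*ka*t) (at t)"
  by (auto intro!: derivative_eq_intros F'(1))
 moreover have "0 <= t*(F' + 3*ka*t)" using F'(2,3) by (simp add: algebra_simps power2_eq_square)
 hence "0 <= F' + 3*ka*t" using t' by (simp add: zero_le_mult_iff)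
 ultimately show "EX y. ((%r. freq u v x r + (3/2)*ka*r^2) has_real_derivative y) (at t) & 0 <= y" by blast
qed

text \<open>Since the frequency is the logarithmic derivative of the height,
  \<open>ln (hgt u v x t) - c*ln t\<close> has derivative
  \<open>(freq u v x t - c)/t\<close>.\<close>

lemma hgt_growth:
 assumes sr: "0 < s" "s <= r" "r < R"
 shows "(!!t. s <= t ==> t <= r ==> c <= freq u v x t) ==> (r/s) powr c*hgt u v x s <= hgt u v x r"
  "(!!t. s <= t ==> t <= r ==> freq u v x t <= c) ==> hgt u v x r <= (r/s) powr c*hgt u v x s"
proof -
 have D: "((%t. ln (hgt u v x t) - c*ln t) has_real_derivative (freq u v x t - c)/t) (at t)"
  if "s <= t" "t <= r" for t
 proof -
  have t: "0 < t" "t < R" using that sr by auto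
  hence H: "hgt u v x t > 0" using hgt_pos[OF sol] by simp
  show ?thesis
   by (rule derivative_eq_intros hgt_has_derivative[OF sol t] refl H t)+
    (use t H in \<open>simp add: freq_def field_simps\<close>)
 qed
 have H: "hgt u v x s > 0" "hgt u v x r > 0" using hgt_pos[OF sol] sr by simp_all
 have conv: "ln (hgt u v x r) - c*ln r - (ln (hgt u v x s) - c*ln s) = ln (hgt u v x r) - ln ((r/s) powr c*hgt u v x s)"
  using sr H by (simp add: ln_mult ln_div ln_powr algebra_simps)
 show "(r/s) powr c*hgt u v x s <= hgt u v x r" if c: "!!t. s <= t ==> t <= r ==> c <= freq u v x t"
 proof -
  have "ln (hgt u v x s) - c*ln s <= ln (hgt u v x r) - c*ln r"
   by (rule DERIV_nonneg_imp_nondecreasing[OF sr(2)]) (use D c sr in \<open>fastforce intro: divide_nonneg_pos\<close>)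
  with conv have "ln ((r/s) powr c*hgt u v x s) <= ln (hgt u v x r)" by linarith
  thus ?thesis using H sr by (subst (asm) ln_le_cancel_iff) auto
 qed
 show "hgt u v x r <= (r/s) powr c*hgt u v x s" if c: "!!t. s <= t ==> t <= r ==> freq u v x t <= c"
 proof -
  have "ln (hgt u v x r) - c*ln r <= ln (hgt u v x s) - c*ln s"
   by (rule DERIV_nonpos_imp_nonincreasing[OF sr(2)]) (use D c sr in \<open>fastforce intro: divide_nonpos_pos\<close>)
  with conv have "ln (hgt u v x r) <= ln ((r/s) powr c*hgt u v x s)" by linarith
  thus ?thesis using H sr by (subst (asm) ln_le_cancel_iff) auto
 qed
qed

text \<open>The normalised profile \<open>(u, v)(x + r y)/sqrt H(r)\<close> moves slowly in \<open>L^2\<close> when the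
 frequency is almost constant.\<close>

lemma profile_variation:
 assumes sr: "0 < s" "s <= r" "r < R"
 defines "H == hgt u v x"
 shows "wint 1 (%y. (u (x + r*.y)/sqrt (H r) - u (x + s*.y)/sqrt (H s))^2)
   + wint 1 (%y. (v (x + r*.y)/sqrt (H r) - v (x + s*.y)/sqrt (H s))^2)
   <= (r/s)*(freq u v x r - freq u v x s + (3/2)*ka*(r^2 - s^2))/4"
proof -
 have s': "|s| < R" using sr by auto
 note cs = Sol_cont[OF sol s']
 have Hs: "H s > 0" unfolding H_def by (rule hgt_pos[OF sol s'])
 define K where "K t = wint 1 (%y. u (x + t*.y)*u (x + s*.y)) + wint 1 (%y. v (x + t*.y)*v (x + s*.y))" for t
 \<comment> \<open>The squared distance between the profiles at radii \<open>t\<close> and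
   \<open>s\<close>, expanded with both norms equal to 1.\<close>
 define ph where "ph t = 2 - 2*K t/sqrt (H t*H s)" for t
 have hH: "H t = wint 1 (%y. (u (x + t*.y))^2) + wint 1 (%y. (v (x + t*.y))^2)" if "|t| < R" for t
  unfolding H_def hgt_def wmean_def using Sol_cont[OF sol that] by (simp add: wint_add continuous_intros)
 have phi: "wint 1 (%y. (u (x + t*.y)/sqrt (H t) - u (x + s*.y)/sqrt (H s))^2)
   + wint 1 (%y. (v (x + t*.y)/sqrt (H t) - v (x + s*.y)/sqrt (H s))^2) = ph t" if t: "0 < t" "t < R" for t
 proof -
  have t': "|t| < R" using t by auto
  note ct = Sol_cont[OF sol t']
  have Ht: "H t > 0" unfolding H_def by (rule hgt_pos[OF sol t'])
  have e: "wint 1 (%y. (f y/sqrt (H t) - g y/sqrt (H s))^2)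
   = wint 1 (%y. (f y)^2)/H t + wint 1 (%y. (g y)^2)/H s - 2*wint 1 (%y. f y*g y)/sqrt (H t*H s)"
   if c: "cont1 f" "cont1 g" for f g :: "'a => real"
  proof -
   have "wint 1 (%y. (f y/sqrt (H t) - g y/sqrt (H s))^2)
    = wint 1 (%y. (1/H t)*(f y)^2 + (1/H s)*(g y)^2 + (- 2/sqrt (H t*H s))*(f y*g y))"
    using Ht Hs by (intro wint_cong) (simp add: power2_diff power_divide real_sqrt_mult)
   also have "... = (1/H t)*wint 1 (%y. (f y)^2) + (1/H s)*wint 1 (%y. (g y)^2) + (- 2/sqrt (H t*H s))*wint 1 (%y. f y*g y)"
    by (subst wint_add wint_cmult; (intro continuous_intros c)?)+ simp
   finally show ?thesis by simp
  qed
  have "wint 1 (%y. (u (x + t*.y))^2)/H t + wint 1 (%y. (v (x + t*.y))^2)/H t = 1"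
   "wint 1 (%y. (u (x + s*.y))^2)/H s + wint 1 (%y. (v (x + s*.y))^2)/H s = 1"
   using hH[OF t'] hH[OF s'] Ht Hs by (simp_all add: add_divide_distrib[symmetric])
  thus ?thesis unfolding e[OF ct(1) cs(1)] e[OF ct(2) cs(2)] ph_def K_def
   by (simp add: add_divide_distrib distrib_left)
 qed
 have phis: "ph s = 0" using phi[of s] sr wint_const[of 1 0, where 'a='a] by simp
 \<comment> \<open>Dividing by \<open>t\<close> absorbs the term \<open>ph t\<close> in the
   differential inequality \<open>t*p <= ph t + W\<close>; what is left is the deficit, which the
   derivative of the frequency dominates.\<close>
 define Ps where "Ps t = ph t/t - (freq u v x t + (3/2)*ka*t^2)/(4*s)" for t
 have "Ps r <= Ps s"
 proof (rule DERIV_nonpos_imp_nonincreasing[OF sr(2)])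
  fix t assume st: "s <= t" "t <= r"
  hence t: "0 < t" "t < R" and t': "|t| < R" using sr by auto
  note ct = Sol_cont[OF sol t']
  have Ht: "H t > 0" unfolding H_def by (rule hgt_pos[OF sol t'])
  let ?du = "%w y. t*(grad w (x + t*.y) .* y)"
  have cd: "cont1 (?du u)" "cont1 (?du v)"
   by (intro continuous_intros ct)+
  define A where "A = wint 1 (%y. ?du u y*u (x + s*.y)) + wint 1 (%y. ?du v y*v (x + s*.y))"
  define E where "E = eng u v x t"
  define W where "W = radial t/H t - (freq u v x t)^2/4"
  obtain F' where F': "(freq u v x has_real_derivative F') (at t)" "t*F' >= 4*W - 3*ka*t^2" "0 <= W"
   using freq_has_derivative[OF t] unfolding W_def H_def by blast
  have DK: "(K has_real_derivative A/t) (at t)"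
  proof -
   have "wint 1 (%y. ?du w y*g y) = t*wint 1 (%y. (grad w (x + t*.y) .* y)*g y)" for w g
    unfolding wint_cmult[symmetric] by (simp add: mult.assoc)
   hence "A/t = wint 1 (%y. (grad u (x + t*.y) .* y)*u (x + s*.y)) + wint 1 (%y. (grad v (x + t*.y) .* y)*v (x + s*.y))"
    unfolding A_def using t by (simp add: field_simps)
   thus ?thesis unfolding K_def[abs_def]
    using DERIV_add[OF wint_radial_derivative[OF C2_grad[OF Sol_C2(1)[OF sol]] C2_cont_grad[OF Sol_C2(1)[OF sol]] cs(1) t']
     wint_radial_derivative[OF C2_grad[OF Sol_C2(2)[OF sol]] C2_cont_grad[OF Sol_C2(2)[OF sol]] cs(2) t']] by simp
  qed
  define si where "si = sqrt (H t*H s)"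
  have si: "si > 0" "si^2 = H t*H s" using Ht Hs by (auto simp: si_def)
  have DH: "(H has_real_derivative E/t) (at t)" unfolding H_def E_def by (rule hgt_has_derivative[OF sol t])
  have Dsi: "((%t. sqrt (H t*H s)) has_real_derivative (E/t*H s)/(2*si)) (at t)"
  proof -
   have "H t*H s > 0" using Ht Hs by simp
   thus ?thesis unfolding si_def
    by (auto intro!: derivative_eq_intros DH simp: field_simps)
  qed
  define p where "p = - 2*(A/t)/si + K t*(E/t)/(H t*si)"
  have Dph: "(ph has_real_derivative p) (at t)"
  proof -
   have "((%t. 2 - 2*K t/sqrt (H t*H s)) has_real_derivative
    0 - (2*(A/t)*si - 2*K t*((E/t*H s)/(2*si)))/(si*si)) (at t)"
    unfolding si_def
    by (rule DERIV_diff[OF DERIV_const DERIV_divide[OF DERIV_cmult[OF DK, of 2] Dsi[unfolded si_def]]])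
     (use Ht Hs in simp)
   moreover have "0 - (2*(A/t)*si - 2*K t*((E/t*H s)/(2*si)))/(si*si) = p"
   proof -
    have "2*K t*((E/t*H s)/(2*si))/(si*si) = K t*(E/t)*(H s/(si*si))/si"
     using si by (simp add: field_simps)
    also have "H s/(si*si) = 1/H t" using si(2) Ht Hs by (simp add: power2_eq_square)
    finally show ?thesis unfolding p_def using si by (simp add: diff_divide_distrib mult.commute)
   qed
   ultimately show ?thesis unfolding ph_def[abs_def] by simp
  qed
  have key: "t*p <= ph t + W"
  proof -
   \<comment> \<open>With these coefficients the combination of the radial derivative, the function
     at radius \<open>t\<close> and the function at radius \<open>s\<close> is the logarithmic
     derivative of the normalised profile minus the difference of the two profiles. Expanding its
     squared norm gives \<open>W - t*p + ph t\<close>.\<close>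
   define a m c d where "a = 1/sqrt (H t)" and "m = E/(2*H t) + 1" and "c = - (m/sqrt (H t))" and "d = 1/sqrt (H s)"
   have E2: "2*(wint 1 (%y. u (x + t*.y)*?du u y) + wint 1 (%y. v (x + t*.y)*?du v y)) = E"
    unfolding E_def using eng_eq_radial[OF sol t] by simp
   have "0 <= a^2*radial t + c^2*H t + d^2*H s + a*c*E + 2*a*d*A + 2*c*d*K t"
    using wint_square3[OF cd(1) ct(1) cs(1), of a c d] wint_square3[OF cd(2) ct(2) cs(2), of a c d]
    unfolding hH[OF t'] hH[OF s'] A_def K_def E2[symmetric] by (simp only: distrib_left distrib_right mult_ac)
   also have "a^2*radial t = radial t/H t" using Ht by (simp add: a_def power_divide)
   also have "c^2*H t = m^2" using Ht by (simp add: c_def power_divide)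
   also have "d^2*H s = 1" using Hs by (simp add: d_def power_divide)
   also have "a*c*E = - (m*E/H t)" using Ht by (simp add: a_def c_def)
   also have "2*a*d*A = 2*A/si" by (simp add: a_def d_def si_def real_sqrt_mult)
   also have "2*c*d*K t = - (2*m*K t/si)" by (simp add: c_def d_def si_def real_sqrt_mult)
   finally have 1: "0 <= radial t/H t + m^2 + 1 + - (m*E/H t) + 2*A/si + - (2*m*K t/si)" .
   define e where "e = E/H t"
   have fe: "freq u v x t = e" by (simp add: freq_def e_def E_def H_def)
   have m: "m = e/2 + 1" by (simp add: m_def e_def)
   have "0 <= radial t/H t + (e/2 + 1)^2 + 1 - (e/2 + 1)*e + 2*A/si - (e + 2)*K t/si"
    using 1 unfolding m by (simp add: e_def distrib_right)
   also have "... = W + 2 + 2*A/si - (e + 2)*K t/si"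
    unfolding W_def fe by (simp add: power2_eq_square algebra_simps)
   finally have 2: "0 <= W + 2 + 2*A/si - (e + 2)*K t/si" .
   have "t*p = - 2*A/si + K t*e/si" unfolding p_def e_def using t by (simp add: field_simps)
   moreover have "ph t = 2 - 2*K t/si" by (simp add: ph_def si_def)
   ultimately show ?thesis using 2 by (simp add: algebra_simps add_divide_distrib)
  qed
  have DPs: "(Ps has_real_derivative (p*t - ph t)/(t*t) - (F' + 3*ka*t)/(4*s)) (at t)"
  proof -
   have 1: "((%t. ph t/t) has_real_derivative (p*t - ph t*1)/(t*t)) (at t)"
    by (rule DERIV_divide[OF Dph DERIV_ident]) (use t in simp)
   have 2: "((%t. freq u v x t + (3/2)*ka*t^2) has_real_derivative F' + 3*ka*t) (at t)"
    by (auto intro!: derivative_eq_intros F')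
   show ?thesis unfolding Ps_def[abs_def] using DERIV_diff[OF 1 DERIV_cdivide[OF 2, of "4*s"]] by simp
  qed
  have "(p*t - ph t)/(t*t) <= W/(t*t)" using key by (intro divide_right_mono) (auto simp: mult.commute)
  also have "... <= ((F' + 3*ka*t)*t/4)/(t*t)"
   using F'(2) by (intro divide_right_mono) (auto simp: algebra_simps power2_eq_square)
  also have "... = (F' + 3*ka*t)/(4*t)" using t by (simp add: field_simps)
  also have "... <= (F' + 3*ka*t)/(4*s)"
  proof -
   have "0 <= (F' + 3*ka*t)*t" using F'(2,3) by (simp add: algebra_simps power2_eq_square)
   hence "0 <= F' + 3*ka*t" using t by (simp add: zero_le_mult_iff)
   thus ?thesis using st sr by (intro divide_left_mono) auto
  qed
  finally show "EX y. (Ps has_real_derivative y) (at t) & y <= 0" using DPs by force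
 qed
 hence "ph r/r <= (freq u v x r - freq u v x s + (3/2)*ka*(r^2 - s^2))/(4*s)"
  unfolding Ps_def phis using sr by (simp add: diff_divide_distrib add_divide_distrib algebra_simps)
 hence "ph r <= r*((freq u v x r - freq u v x s + (3/2)*ka*(r^2 - s^2))/(4*s))"
  using sr by (simp add: divide_le_eq mult.commute)
 thus ?thesis using phi[of r] sr by (simp add: mult.commute)
qed

end

section \<open>Scaling, and pointwise bounds by the height\<close>

lemma hgt_rescale:
 assumes "s > 0"
 shows "hgt (%y. u (x + rh*.y)/s) (%y. v (x + rh*.y)/s) z r = hgt u v (x + rh*.z) (rh*r)/s^2"
proof -
 have "hgt (%y. u (x + rh*.y)/s) (%y. v (x + rh*.y)/s) z r
  = wint 1 (%y. (1/s^2)*((u (x + rh*.z + (rh*r)*.y))^2 + (v (x + rh*.z + (rh*r)*.y))^2))"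
  unfolding hgt_def wmean_def by (simp add: power_divide scaleR_add_right add.assoc add_divide_distrib)
 thus ?thesis unfolding hgt_def wmean_def wint_cmult by simp
qed

lemma eng_rescale:
 fixes x z :: "'a::euclidean_space" and rh r s :: real
 assumes C: "C2 S u" "C2 S v" and s: "s > 0" and z: "!!y. norm y <= 1 ==> x + rh*.(z + r*.y) : S"
 shows "eng (%y. u (x + rh*.y)/s) (%y. v (x + rh*.y)/s) z r = eng u v (x + rh*.z) (rh*r)/s^2"
proof -
 define T where "T = (%y. x + rh*.y) -` S"
 have T: "open T" "!!y. y : T ==> x + rh*.y : S"
  unfolding T_def using C2_open[OF C(1)] by (auto intro!: open_vimage continuous_intros)
 let ?f = "%y. (u y)^2 + (v y)^2"
 note f = C2_sum_squares(1)[OF C]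
 have "lap (%y. (u (x + rh*.y)/s)^2 + (v (x + rh*.y)/s)^2) y = (1/s^2)*(rh^2*lap ?f (x + rh*.y))"
  if "y : T" for y
 proof -
  have "(%y. (u (x + rh*.y)/s)^2 + (v (x + rh*.y)/s)^2) = (%y. (1/s^2)*?f (x + rh*.y))"
   by (simp add: power_divide add_divide_distrib)
  thus ?thesis
   using C2_cmult(3)[OF C2_affine(1)[OF f T] that, of "1/s^2"] C2_affine(3)[OF f T that] by simp
 qed
 hence "wint 2 (%y. lap (%y. (u (x + rh*.y)/s)^2 + (v (x + rh*.y)/s)^2) (z + r*.y))
  = wint 2 (%y. (rh^2/s^2)*lap ?f (x + rh*.z + (rh*r)*.y))"
  using z by (intro wint_cong) (simp add: T_def scaleR_add_right add.assoc)
 thus ?thesis unfolding eng_def wint_cmult by (simp add: power_mult_distrib field_simps)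
qed

lemma freq_rescale:
 fixes x z :: "'a::euclidean_space" and rh r s :: real
 assumes C: "C2 S u" "C2 S v" and s: "s > 0" and z: "!!y. norm y <= 1 ==> x + rh*.(z + r*.y) : S"
 shows "freq (%y. u (x + rh*.y)/s) (%y. v (x + rh*.y)/s) z r = freq u v (x + rh*.z) (rh*r)"
 unfolding freq_def hgt_rescale[OF s] using eng_rescale[OF C s z] s by simp

definition sup_const :: "'a::euclidean_space itself => real" where
 "sup_const _ = 1 + exp 1*4^DIM('a)/(1 - (3/4)^2)/wint 1 (%y::'a. 1)"

lemma sup_const_ge: "sup_const TYPE('a::euclidean_space) >= 1"
 using wint_one_pos[of 1, where 'a='a] unfolding sup_const_def
 by (simp add: power_divide)

text \<open>The sum of squares is almost subharmonic, so its value at \<open>y\<close> is controlled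
  by its mean over the ball of radius \<open>r/4\<close>. That ball lies within distance
  \<open>3/4*r\<close> of \<open>x\<close>, whence the factors in \<open>sup_const\<close>; the
  summand 1 there makes the constant at least 1.\<close>

lemma Sol_sup_bound:
 fixes u v :: "'a::euclidean_space => real"
 assumes sol: "Sol (ball x R) ka be u v" and r: "0 < r" "r < R" "ka*r^2 <= 1" and y: "dist y x <= r/2"
 shows "u y <= sup_const TYPE('a)*sqrt (hgt u v x r)" "v y <= sup_const TYPE('a)*sqrt (hgt u v x r)"
proof -
 define f where "f y = (u y)^2 + (v y)^2" for y
 let ?S = "sup_const TYPE('a)"
 let ?W = "wint 1 (%y::'a. 1)"
 have W: "?W > 0" by (rule wint_one_pos)
 have sub: "ball y (r/2) <= ball x R" using y r by (auto simp: ball_subset_ball_iff)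
 have soly: "Sol (ball y (r/2)) ka be u v" by (rule Sol_subset[OF sol _ sub]) simp
 have k: "0 <= ka" using Sol_C2(5)[OF sol] .
 have H: "hgt u v x r > 0" using hgt_pos[OF sol] r by simp
 have "f y*?W = hgt u v y 0" unfolding hgt_def f_def[symmetric] by (simp add: wmean_0)
 also have "... <= hgt u v y (r/4)*exp (ka*(r/4)^2/2)" using hgt_mono[OF soly, of 0 "r/4"] r by simp
 also have "... <= hgt u v y (r/4)*exp 1"
 proof (intro mult_left_mono)
  have "ka*(r/4)^2/2 <= ka*r^2" using k by (simp add: power_divide field_simps)
  thus "exp (ka*(r/4)^2/2) <= exp 1" using r(3) by simp
  show "0 <= hgt u v y (r/4)" using hgt_pos[OF soly, of "r/4"] r by simp
 qed
 also have "hgt u v y (r/4) <= (r/(r/4))^DIM('a)/(1 - (3/4)^2)*hgt u v x r"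
  unfolding hgt_def f_def[symmetric]
 proof (rule wmean_compare)
  show "continuous_on (ball x R) f" unfolding f_def
   by (intro continuous_intros C2_cont[OF Sol_C2(1)[OF sol]] C2_cont[OF Sol_C2(2)[OF sol]])
 qed (use y r in \<open>auto simp: f_def\<close>)
 also have "r/(r/4) = 4" using r by simp
 finally have "f y*?W <= 4^DIM('a)/(1 - (3/4)^2)*hgt u v x r*exp 1" by simp
 hence "f y <= (?S - 1)*hgt u v x r"
  unfolding sup_const_def using W by (simp add: field_simps)
 also have "... <= ?S^2*hgt u v x r"
 proof (intro mult_right_mono)
  have "?S <= ?S^2" using sup_const_ge[where 'a='a] by (simp add: power2_eq_square)
  thus "?S - 1 <= ?S^2" by simp
 qed (use H in simp)
 also have "... = (?S*sqrt (hgt u v x r))^2" using H by (simp add: power_mult_distrib)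
 finally have 1: "f y <= (?S*sqrt (hgt u v x r))^2" .
 have "0 <= ?S*sqrt (hgt u v x r)" using sup_const_ge[where 'a='a] H by simp
 moreover have "(u y)^2 <= (?S*sqrt (hgt u v x r))^2" "(v y)^2 <= (?S*sqrt (hgt u v x r))^2"
  using 1 zero_le_power2[of "u y"] zero_le_power2[of "v y"] unfolding f_def by linarith+
 ultimately show "u y <= ?S*sqrt (hgt u v x r)" "v y <= ?S*sqrt (hgt u v x r)"
  by (meson power2_le_imp_le)+
qed

section \<open>Estimates away from the coincidence set\<close>

definition ko_const :: "'a::euclidean_space itself => real" where
 "ko_const _ = 6*(10 + 2*real DIM('a))"

text \<open>Where \<open>v < u\<close> the coupling satisfies \<open>be*u^2*v >= be*v^3\<close>, so
  the smaller component alone obeys a Keller-Osserman inequality.\<close>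

lemma Sol_keller_osserman:
 fixes u v :: "'a::euclidean_space => real"
 assumes sol: "Sol (ball x d) ka be u v" and d: "d > 0" "ka*d^2 <= 1"
  and uv: "!!y. y : ball x d ==> v y < u y" and y: "dist y x <= d/2"
 shows "be*(v y)^2 <= ko_const TYPE('a)/d^2"
proof -
 note ka = Sol_C2(5)[OF sol] and be = Sol_C2(4)[OF sol]
 \<comment> \<open>A closed ball inside the open domain that still contains the half ball with room:
   there the factor \<open>?d^2 - (norm (y - x))^2\<close> is at least
   \<open>5/16*d^2\<close>.\<close>
 let ?d = "3/4*d"
 have sub: "cball x ?d <= ball x d" using d by (auto simp: cball_subset_ball_iff)
 have L: "lap v z >= be*v z^3 - (2*ka)*v z" if "z : ball x ?d" for z
 proof -
  have z: "z : ball x d" using that d by auto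
  have p: "0 < v z" "v z < u z" using Sol_pos[OF sol z] uv[OF z] by auto
  have "(v z)^2 <= (u z)^2" using p by (intro power_mono) auto
  hence "be*(v z)^2*v z <= be*(u z)^2*v z" using p be by simp
  thus ?thesis using Sol_lap_ge(2)[OF sol z] by (simp add: abs_le_iff power3_eq_cube power2_eq_square)
 qed
 have yb: "y : ball x ?d" using y d by (simp add: dist_commute)
 have "be*(v y*(?d^2 - (norm (y - x))^2))^2 <= (8 + 2*DIM('a))*?d^2 + (2*ka)*?d^4"
  by (rule keller_osserman[OF Sol_C2(2)[OF sol] sub _ _ L be _ yb]) (use d ka Sol_pos[OF sol] in auto)
 also have "(2*ka)*?d^4 = 2*(ka*d^2)*(81/256*d^2)"
  by (simp add: power_mult_distrib power_divide power4_eq_xxxx power2_eq_square)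
 also have "... <= 2*1*(81/256*d^2)" using d by (intro mult_right_mono mult_left_mono) auto
 also have "(8 + 2*DIM('a))*?d^2 + 2*1*(81/256*d^2) <= (10 + 2*real DIM('a))*(9/16)*d^2"
 proof -
  have "(8 + 2*DIM('a))*?d^2 + 2*1*(81/256*d^2) = ((8 + 2*real DIM('a))*(9/16) + 81/128)*d^2"
   by (simp add: power_mult_distrib power_divide field_simps)
  also have "... <= ((10 + 2*real DIM('a))*(9/16))*d^2"
   by (intro mult_right_mono) (simp_all add: field_simps)
  finally show ?thesis by simp
 qed
 finally have 1: "be*(v y*(?d^2 - (norm (y - x))^2))^2 <= (10 + 2*real DIM('a))*(9/16)*d^2" by simp
 have "(norm (y - x))^2 <= (d/2)^2" using y by (intro power_mono) (auto simp: dist_norm)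
 hence 2: "5/16*d^2 <= ?d^2 - (norm (y - x))^2" by (simp add: power_mult_distrib power_divide)
 have vp: "0 < v y" using Sol_pos(2)[OF sol] y d by (simp add: dist_commute)
 have "be*(v y)^2*(25/256)*d^4 = be*(v y*(5/16*d^2))^2"
  by (simp add: power_mult_distrib power_divide)
 also have "... <= be*(v y*(?d^2 - (norm (y - x))^2))^2"
  using 2 vp be d by (intro mult_left_mono power_mono) auto
 also note 1
 finally have "be*(v y)^2*(25/256)*d^2*d^2 <= ((10 + 2*real DIM('a))*(9/16))*d^2"
  by (simp add: power4_eq_xxxx power2_eq_square mult_ac)
 hence "be*(v y)^2*(25/256)*d^2 <= (10 + 2*real DIM('a))*(9/16)" using d by (subst (asm) mult_le_cancel_right_pos) auto
 thus ?thesis using d unfolding ko_const_def by (simp add: field_simps)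
qed

definition noz_const :: "'a::euclidean_space itself => real" where
 "noz_const _ = (18*lip_const TYPE('a) + 6)*ko_const TYPE('a)"

lemma ko_const_ge: "ko_const TYPE('a::euclidean_space) >= 1" by (simp add: ko_const_def)

lemma noz_const_pos: "noz_const TYPE('a::euclidean_space) > 0"
 unfolding noz_const_def using lip_const_pos[where 'a='a] ko_const_ge[where 'a='a]
 by (intro add_pos_pos mult_pos_pos) auto

text \<open>For the larger component the potential \<open>be*(v y)^2\<close> is at most of order
  \<open>1/d^2\<close>, and the interior estimate applies at scale \<open>d\<close>. For the smaller
  one the potential \<open>be*(u y)^2\<close> is not bounded on that scale, so the estimate is used
  at a smaller radius; the smallness of \<open>v\<close> compensates for the loss.\<close>

lemma Sol_lipschitz_noz:
 fixes u v :: "'a::euclidean_space => real"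
 assumes sol: "Sol (ball x d) ka be u v" and d: "d > 0" "ka*d^2 <= 1"
  and uv: "!!y. y : ball x d ==> v y < u y" and S: "!!y. y : ball x d ==> u y <= S"
  and k: "norm k <= d/6"
 shows "|u (x + k) - u x| <= noz_const TYPE('a)*norm k*S/d"
  "|v (x + k) - v x| <= noz_const TYPE('a)*norm k*S/d"
proof -
 note ka = Sol_C2(5)[OF sol] and be = Sol_C2(4)[OF sol]
 define L K where "L = lip_const TYPE('a)" and "K = ko_const TYPE('a)"
 have L: "L > 0" and K: "K >= 1" using lip_const_pos ko_const_ge unfolding L_def K_def by auto
 have sK: "sqrt K <= K" using K by (simp add: real_sqrt_le_iff' real_le_lsqrt power2_eq_square)
 have Sp: "S > 0" using Sol_pos(1)[OF sol, of x] S[of x] d by simp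
 have kd: "ka <= 1/d^2" using d by (simp add: field_simps)
 have in2: "y : ball x d" "dist y x <= d/2" if "y : ball x (d/2)" for y
  using that d by (auto simp: dist_commute)
 have bv: "be*(v y)^2 <= K/d^2" if "y : ball x (d/2)" for y
  unfolding K_def by (rule Sol_keller_osserman[OF sol d uv in2(2)[OF that]])
 have C: "C2 (ball x (3*rh)) u" "C2 (ball x (3*rh)) v" "ball x (3*rh) <= ball x (d/2)" if "rh <= d/6" for rh
 proof -
  show s: "ball x (3*rh) <= ball x (d/2)" using that by (intro subset_ball) simp
  have "ball x (d/2) <= ball x d" using d by (intro subset_ball) simp
  with s show "C2 (ball x (3*rh)) u" "C2 (ball x (3*rh)) v"
   using C2_subset[OF Sol_C2(1)[OF sol]] C2_subset[OF Sol_C2(2)[OF sol]] by auto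
 qed
 have Lu: "|lap u y| <= (K + 2)*S/d^2" if y: "y : ball x (d/2)" for y
 proof -
  note z = in2(1)[OF y]
  have "|lap u y| <= (be*(v y)^2 + 2*ka)*u y"
  proof -
   have "0 <= be*u y*(v y)^2" using be Sol_pos(1)[OF sol z] by simp
   thus ?thesis using Sol_lap_ge(1)[OF sol z] by (simp add: abs_le_iff algebra_simps)
  qed
  also have "... <= (K/d^2 + 2*(1/d^2))*S"
   using bv[OF y] kd S[OF z] Sol_pos(1)[OF sol z] ka be K by (intro mult_mono add_mono) auto
  also have "... = (K + 2)*S/d^2" by (simp add: add_divide_distrib[symmetric])
  finally show ?thesis .
 qed
 have e1: "L*(18*K) <= noz_const TYPE('a)" unfolding noz_const_def L_def[symmetric] K_def[symmetric] using K by (simp add: distrib_right)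
 have e2: "6*K <= noz_const TYPE('a)" unfolding noz_const_def L_def[symmetric] K_def[symmetric] using K L by (simp add: distrib_right)
 have fin: "c*norm k*S/d <= noz_const TYPE('a)*norm k*S/d" if "c <= noz_const TYPE('a)" for c
  using that Sp d by (intro divide_right_mono mult_right_mono) auto
 have "|u (x + k) - u x| <= L*norm k*(S/(d/6) + (K + 2)*S/d^2*(d/6))"
  unfolding L_def
 proof (rule lipschitz_estimate)
  show "|u y| <= S" if "y : ball x (3*(d/6))" for y
  proof -
   have "y : ball x d" using that d by simp
   thus ?thesis using S[of y] Sol_pos(1)[OF sol, of y] by simp
  qed
 qed (use C[of "d/6"] Lu d k in auto)
 also have "... = (L*(6 + (K + 2)/6))*norm k*S/d" using d by (simp add: field_simps power2_eq_square)
 also have "... <= noz_const TYPE('a)*norm k*S/d"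
  by (rule fin, rule order_trans[OF _ e1], rule mult_left_mono) (use L K in \<open>auto simp: field_simps\<close>)
 finally show "|u (x + k) - u x| <= noz_const TYPE('a)*norm k*S/d" .
 have vS: "0 < v y" "v y <= S" if "y : ball x d" for y
  using S[OF that] uv[OF that] Sol_pos(2)[OF sol that] by auto
 \<comment> \<open>The second alternative is the Keller-Osserman bound for \<open>v\<close> on the
   half ball.\<close>
 define A where "A = min S (sqrt (K/be)/d)"
 have A0: "0 <= A" using Sp K be d by (auto simp: A_def)
 have vA: "0 < v y" "v y <= A" if y: "y : ball x (d/2)" for y
 proof -
  have "(v y)^2 <= (sqrt (K/be)/d)^2"
   using bv[OF y] K be d by (simp add: power_divide field_simps)
  hence "v y <= sqrt (K/be)/d" by (rule power2_le_imp_le) (use K be d in simp)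
  thus "v y <= A" "0 < v y" using vS[OF in2(1)[OF y]] by (auto simp: A_def)
 qed
 have Lv: "|lap v y| <= (be*S^2 + 2/d^2)*A" if y: "y : ball x (d/2)" for y
 proof -
  note z = in2(1)[OF y]
  have "|lap v y| <= (be*(u y)^2 + 2*ka)*v y"
  proof -
   have "0 <= be*(u y)^2*v y" using be Sol_pos(2)[OF sol z] by simp
   thus ?thesis using Sol_lap_ge(2)[OF sol z] by (simp add: abs_le_iff algebra_simps)
  qed
  also have "... <= (be*S^2 + 2*(1/d^2))*A"
   using kd S[OF z] Sol_pos[OF sol z] ka be vA[OF y]
   by (intro mult_mono add_mono mult_left_mono power_mono) auto
  finally show ?thesis by simp
 qed
 have est: "|v (x + k) - v x| <= L*norm k*(A/rh + (be*S^2 + 2/d^2)*A*rh)"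
  if "0 < rh" "rh <= d/6" "norm k <= rh" for rh
  unfolding L_def
 proof (rule lipschitz_estimate)
  show "|v y| <= A" if "y : ball x (3*rh)" for y
   using vA[of y] C(3)[OF \<open>rh \<le> d/6\<close>] that by auto
  show "|lap v y| <= (be*S^2 + 2/d^2)*A" if "y : ball x (3*rh)" for y
   using Lv[of y] C(3)[OF \<open>rh \<le> d/6\<close>] that by auto
 qed (use C[of rh] that in auto)
 define si where "si = sqrt be*S"
 have si: "si > 0" "be*S^2 = si^2" using be Sp by (auto simp: si_def power_mult_distrib)
 \<comment> \<open>At radius \<open>1/(sqrt be*S)\<close> the potential \<open>be*S^2\<close>
   becomes comparable to \<open>1/rh^2\<close>. The amplitude \<open>A\<close> shrinks with
   \<open>be\<close> at the same rate as \<open>rh\<close>, so \<open>A/rh\<close> is bounded by a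
   multiple of \<open>S/d\<close>.\<close>
 define rh where "rh = min (d/6) (1/si)"
 have rh: "0 < rh" "rh <= d/6" using si d by (auto simp: rh_def)
 have Arh: "A <= 6*K*S*rh/d"
 proof (cases "d/6 <= 1/si")
  case True
  have "A <= K*S" using mult_right_mono[OF K, of S] Sp unfolding A_def by linarith
  also have "... = 6*K*S*rh/d" using True d by (simp add: rh_def)
  finally show ?thesis .
 next
  case False
  have "A <= sqrt K/(sqrt be*d)" unfolding A_def using be d by (simp add: real_sqrt_divide)
  also have "... <= 6*K/(sqrt be*d)" using sK K be d by (intro divide_right_mono) auto
  also have "... = 6*K*S*rh/d" using False Sp by (simp add: rh_def si_def)
  finally show ?thesis .
 qed
 show "|v (x + k) - v x| <= noz_const TYPE('a)*norm k*S/d"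
 proof (cases "norm k <= rh")
  case True
  have "rh*si <= 1" using si(1) unfolding rh_def by (simp add: min_def field_simps)
  hence "be*S^2 <= 1/rh^2" unfolding si using power_mono[of "rh*si" 1 2] rh si by (simp add: field_simps power_mult_distrib)
  moreover have "(2*rh)^2 <= d^2" using rh by (intro power_mono) auto
  hence "4*rh^2 <= d^2" by (simp add: power_mult_distrib)
  hence "2*rh^2 <= d^2" using zero_le_power2[of rh] by linarith
  hence "2/d^2 <= 1/rh^2" using rh d(1) by (simp add: divide_simps)
  ultimately have "(be*S^2 + 2/d^2)*A*rh <= (2/rh^2)*A*rh" using A0 rh by (intro mult_right_mono) auto
  also have "... = 2*(A/rh)" using rh by (simp add: power2_eq_square)
  also have "A/rh <= 6*K*S/d" using Arh rh d(1) by (simp add: field_simps)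
  finally have "A/rh + (be*S^2 + 2/d^2)*A*rh <= 18*K*S/d"
   using \<open>A / rh \<le> _\<close> by simp
  hence "L*norm k*(A/rh + (be*S^2 + 2/d^2)*A*rh) <= L*norm k*(18*K*S/d)"
   using L by (intro mult_left_mono) auto
  hence "|v (x + k) - v x| <= (L*(18*K))*norm k*S/d"
   using est[OF rh True] by (simp add: mult_ac)
  also have "... <= noz_const TYPE('a)*norm k*S/d" by (rule fin[OF e1])
  finally show ?thesis .
 next
  case False
  have "x + k : ball x (d/2)" "x : ball x (d/2)" using k d by (auto simp: dist_norm)
  hence "|v (x + k) - v x| <= A" using vA[of "x + k"] vA[of x] by linarith
  also have "... <= 6*K*S*norm k/d" using Arh False K Sp d
   by (smt (verit) divide_right_mono mult_left_mono mult_nonneg_nonneg)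
  also have "... = (6*K)*norm k*S/d" by simp
  also have "... <= noz_const TYPE('a)*norm k*S/d" by (rule fin[OF e2])
  finally show ?thesis .
 qed
qed

lemma Sol_ordered:
 fixes u v :: "'a::euclidean_space => real"
 assumes sol: "Sol (ball x d) ka be u v" and ne: "!!y. y : ball x d ==> u y ~= v y"
 shows "(ALL y:ball x d. v y < u y) \<or> (ALL y:ball x d. u y < v y)"
proof (rule ccontr)
 assume "~ ?thesis"
 then obtain y z where yz: "y : ball x d" "z : ball x d" "u y - v y <= 0" "0 <= u z - v z"
  by (auto simp: not_less)
 have c: "continuous_on (ball x d) (%y. u y - v y)"
  by (intro continuous_intros C2_cont[OF Sol_C2(1)[OF sol]] C2_cont[OF Sol_C2(2)[OF sol]])
 have "connected ((%y. u y - v y) ` ball x d)" by (intro connected_continuous_image c connected_ball)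
 hence "0 : (%y. u y - v y) ` ball x d"
  using connectedD_interval[of _ "u y - v y" "u z - v z" 0] yz by auto
 thus False using ne by auto
qed

section \<open>Frequency at coincidence points\<close>

text \<open>The quantity \<open>be*r^2*hgt u v x r\<close> is invariant under rescaling and becomes
  the competition parameter once the radius and the height are normalised to 1.\<close>

definition freq_bound :: "'a::euclidean_space itself => real => real => real => bool" where
 "freq_bound _ al K ka0 \<longleftrightarrow> (ALL (x::'a) R r ka be u v. Sol (ball x R) ka be u v --> 0 < r --> r < R --> u x = v x -->
  be*r^2*hgt u v x r >= K --> ka*r^2 <= ka0 --> 2*al <= freq u v x r)"

text \<open>A normalised solution with tiny frequency has height comparable to \<open>1\<close> on a small ball,
 hence \<open>u 0 = v 0\<close> is bounded from below; but then the coupling energy is not tiny.\<close>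

lemma freq_lower_normalised:
 assumes dim: "DIM('a::euclidean_space) <= 4"
 obtains c0 ka0 where "c0 > 0" "ka0 > 0" "ka0 <= 1"
  "!!(u::'a => real) v R ka. Sol (ball 0 R) ka 1 u v ==> 1 < R ==> ka <= ka0 ==> u 0 = v 0 ==>
   hgt u v 0 1 = 1 ==> c0 <= freq u v 0 1"
proof -
 define S W L where "S = sup_const TYPE('a)" and "W = wint 1 (%y::'a. 1)" and "L = lip_const TYPE('a)"
 have pos: "S >= 1" "W > 0" "L > 0"
  unfolding S_def W_def L_def using sup_const_ge wint_one_pos lip_const_pos by auto
 define M where "M = L*(6*S + (S^3 + 2*S)/6)"
 have M: "M > 0" unfolding M_def using pos by (intro mult_pos_pos add_pos_pos divide_pos_pos) auto
 \<comment> \<open>So small that the oscillation of \<open>u\<close> and \<open>v\<close>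
   contributes at most 1/4 to the height at radius \<open>r1\<close>; the remaining 1/4 must come
   from \<open>u 0\<close>, giving \<open>s0 <= u 0\<close>.\<close>
 define r1 where "r1 = min (1/6) (1/(4*M*sqrt W))"
 have r1: "0 < r1" "r1 <= 1/6" using M pos by (auto simp: r1_def)
 have r1': "4*W*(M*r1)^2 <= 1/4"
 proof -
  have "M*r1 <= 1/(4*sqrt W)" using M pos by (simp add: r1_def min_def field_simps)
  hence "(M*r1)^2 <= (1/(4*sqrt W))^2" using M r1 by (intro power_mono) auto
  also have "... = 1/(16*W)" using pos by (simp add: power_divide power_mult_distrib)
  finally show ?thesis using pos by (simp add: field_simps)
 qed
 define s0 where "s0 = 1/(4*sqrt W)"
 have s0: "s0 > 0" "s0^2 = 1/(16*W)" using pos by (auto simp: s0_def power_divide power_mult_distrib)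
 \<comment> \<open>On the ball of radius \<open>de\<close> both components stay above
   \<open>s0/2\<close>, and \<open>c1\<close> is the resulting lower bound for the weighted integral
   of \<open>u^2*v^2\<close>.\<close>
 define de where "de = min (1/6) (s0/(2*M))"
 have de: "0 < de" "de <= 1/6" "M*de <= s0/2" using M s0 by (auto simp: de_def min_def field_simps)
 define c1 where "c1 = (1 - de^2)^2*(LINT y:cball (0::'a) de|lborel. (s0/2)^4)"
 have c1: "c1 > 0"
 proof -
  have "de^2 < 1" using de by (simp add: power_less_one_iff)
  thus ?thesis unfolding c1_def using s0 de by (intro mult_pos_pos set_integral_pos) auto
 qed
 \<comment> \<open>With frequency at most \<open>2*ep\<close>, the height grows from
   \<open>r1\<close> to 1 by a factor of at most 2.\<close>
 define ep where "ep = ln 2/ln (1/r1)/2"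
 have lr: "ln (1/r1) > 0" using r1 by simp
 hence ep: "ep > 0" by (simp add: ep_def)
 define ka0 c0 where "ka0 = Min {1, c1/2, ep/2}" and "c0 = min ep (c1/2)"
 have k0: "ka0 > 0" "ka0 <= 1" "ka0 <= c1/2" "ka0 <= ep/2" using c1 ep by (auto simp: ka0_def)
 have c0: "c0 > 0" using c1 ep by (auto simp: c0_def)
 show thesis
 proof (rule that[OF c0 k0(1,2)])
  fix u v :: "'a => real" and R ka
  assume sol: "Sol (ball 0 R) ka 1 u v" and R: "1 < R" and ka: "ka <= ka0" and uv: "u 0 = v 0" and H1: "hgt u v 0 1 = 1"
  note ka0 = Sol_C2(5)[OF sol]
  have sub: "ball (0::'a) (3*(1/6)) <= ball 0 R" using R by auto
  have b: "0 < u y" "u y <= S" "0 < v y" "v y <= S" if "y : ball 0 (3*(1/6))" for y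
  proof -
   have "dist y 0 <= 1/2" "y : ball 0 R" using that sub by auto
   thus "0 < u y" "u y <= S" "0 < v y" "v y <= S"
    using Sol_sup_bound[OF sol zero_less_one R, of y] ka k0 H1 Sol_pos[OF sol] by (auto simp: S_def)
  qed
  have lb: "|l| <= S^3 + 2*S" if "|l - p*q^2| <= 2*ka*p" "0 < p" "p <= S" "0 < q" "q <= S" for l p q
  proof -
   have "p*q^2 <= S*S^2" using that by (intro mult_mono power_mono) auto
   moreover have "2*ka*p <= 2*1*S" using that ka k0 ka0 by (intro mult_mono) auto
   moreover have "0 <= p*q^2" using that by simp
   ultimately show ?thesis using that(1) by (simp add: power3_eq_cube power2_eq_square abs_le_iff)
  qed
  have lu: "|lap u y| <= S^3 + 2*S" "|lap v y| <= S^3 + 2*S" if "y : ball 0 (3*(1/6))" for y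
  proof -
   have y: "y : ball 0 R" using that sub by auto
   show "|lap u y| <= S^3 + 2*S"
    using Sol_lap_ge(1)[OF sol y] b[OF that] by (intro lb[of _ "u y" "v y"]) auto
   show "|lap v y| <= S^3 + 2*S"
    using Sol_lap_ge(2)[OF sol y] b[OF that] by (intro lb[of _ "v y" "u y"]) (auto simp: mult.commute)
  qed
  have lip: "|u k - u 0| <= M*norm k" "|v k - v 0| <= M*norm k" if "norm k <= 1/6" for k
  proof -
   have *: "|w k - w 0| <= M*norm k"
    if "C2 (ball 0 R) w" "!!y. y : ball 0 (3*(1/6)) ==> |w y| <= S" "!!y. y : ball 0 (3*(1/6)) ==> |lap w y| <= S^3 + 2*S" for w
   proof -
    have "|w (0 + k) - w 0| <= L*norm k*(S/(1/6) + (S^3 + 2*S)*(1/6))"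
     unfolding L_def by (rule lipschitz_estimate[OF C2_subset[OF that(1) _ sub]]) (use that \<open>norm k \<le> 1/6\<close> in auto)
    thus ?thesis by (simp add: M_def mult_ac)
   qed
   show "|u k - u 0| <= M*norm k" by (rule *[OF Sol_C2(1)[OF sol] _ lu(1)]) (use b in \<open>metis abs_of_pos\<close>)
   show "|v k - v 0| <= M*norm k" by (rule *[OF Sol_C2(2)[OF sol] _ lu(2)]) (use b in \<open>metis abs_of_pos\<close>)
  qed
  show "c0 <= freq u v 0 1"
  proof (rule ccontr)
   assume "~ c0 <= freq u v 0 1"
   hence f: "freq u v 0 1 < ep" "freq u v 0 1 < c1/2" by (auto simp: c0_def)
   have u0: "u 0 > 0" using b[of 0] by simp
   have "freq u v 0 t <= 2*ep" if "r1 <= t" "t <= 1" for t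
   proof -
    have "freq u v 0 t + 3/2*ka*t^2 <= freq u v 0 1 + 3/2*ka*1^2"
     using freq_almost_mono[OF sol dim, of t 1] that r1 R by simp
    moreover have "0 <= 3/2*ka*t^2" using ka0 by simp
    ultimately show ?thesis using f ka k0 by simp
   qed
   hence "hgt u v 0 1 <= (1/r1) powr (2*ep)*hgt u v 0 r1"
    using r1 R by (intro hgt_growth(2)[OF sol dim]) auto
   also have "(1/r1) powr (2*ep) = 2"
   proof -
    have "(1/r1) powr (2*ep) = exp (2*ep*ln (1/r1))" using r1 by (simp add: powr_def)
    also have "2*ep*ln (1/r1) = ln 2" using lr by (simp add: ep_def)
    finally show ?thesis by simp
   qed
   finally have "1/2 <= hgt u v 0 r1" using H1 by simp
   also have "hgt u v 0 r1 <= wint 1 (%y::'a. 4*(u 0)^2 + 4*(M*r1)^2)"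
    unfolding hgt_def wmean_def
   proof (rule wint_mono)
    have r1R: "|r1| < R" using r1 R by auto
    show "cont1 (%y. (u (0 + r1*.y))^2 + (v (0 + r1*.y))^2)"
     by (intro continuous_intros Sol_cont[OF sol r1R])
    fix y :: 'a assume y: "norm y <= 1"
    have n: "norm (r1*.y) <= r1" using y r1 by (simp add: mult_left_le)
    have n6: "norm (r1*.y) <= 1/6" using n r1 by linarith
    hence "r1*.y : ball 0 (3*(1/6))" by (simp del: norm_scaleR)
    note bb = b[OF this]
    have "M*norm (r1*.y) <= M*r1" using n M by (intro mult_left_mono) auto
    hence "u (r1*.y) <= u 0 + M*r1" "v (r1*.y) <= u 0 + M*r1"
     using lip[OF n6] uv by linarith+
    hence "(u (r1*.y))^2 <= (u 0 + M*r1)^2" "(v (r1*.y))^2 <= (u 0 + M*r1)^2"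
     using bb by (auto intro!: power_mono)
    moreover have "(u 0 + M*r1)^2 <= 2*(u 0)^2 + 2*(M*r1)^2"
     using zero_le_power2[of "u 0 - M*r1"] by (simp add: power2_eq_square algebra_simps)
    ultimately show "(u (0 + r1*.y))^2 + (v (0 + r1*.y))^2 <= 4*(u 0)^2 + 4*(M*r1)^2" by simp
   qed simp
   also have "... = 4*W*(u 0)^2 + 4*W*(M*r1)^2"
    unfolding wint_const[of 1 "4*(u 0)^2 + 4*(M*r1)^2"] W_def by (simp add: algebra_simps)
   finally have "1/4 <= 4*W*(u 0)^2" using r1' by simp
   hence "s0^2 <= (u 0)^2" unfolding s0(2) using pos by (simp add: field_simps)
   hence us: "s0 <= u 0" using u0 by (intro power2_le_imp_le[of s0 "u 0"]) auto
   have low: "s0/2 <= u y" "s0/2 <= v y" if y: "norm y <= de" for y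
   proof -
    have "M*norm y <= s0/2" using y M de(3) mult_left_mono[of "norm y" de M] by linarith
    thus "s0/2 <= u y" "s0/2 <= v y" using lip[of y] y de us uv by (auto simp: abs_le_iff)
   qed
   have R1: "|1::real| < R" using R by auto
   let ?f = "%y. (u y)^2*(v y)^2" and ?g = "%y. (u y)^2 + (v y)^2"
   note c = Sol_cont[OF sol R1, simplified]
   have cb: "cball 0 1 <= ball (0::'a) R" using R by auto
   have "c1 <= (1 - de^2)^2*(LINT y:cball (0::'a) de|lborel. ?f y)"
    unfolding c1_def
   proof (intro mult_left_mono set_integral_mono set_integrable_compact)
    have s: "cball 0 de <= cball (0::'a) 1" using de by auto
    show "continuous_on (cball 0 de) ?f"
     by (intro continuous_intros continuous_on_subset[OF c(1) s] continuous_on_subset[OF c(2) s])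
    fix y :: 'a assume "y : cball 0 de"
    hence l: "s0/2 <= u y" "s0/2 <= v y" using low by auto
    have "(s0/2)^4 = (s0/2)^2*(s0/2)^2" by (simp add: power4_eq_xxxx power2_eq_square)
    also have "... <= ?f y" using l s0 by (intro mult_mono power_mono) auto
    finally show "(s0/2)^4 <= ?f y" .
   qed auto
   also have "... <= wint 2 ?f" using de by (intro wint_0_ge continuous_intros c) auto
   finally have 1: "c1 <= wint 2 ?f" .
   have "wint 2 ?g <= wint 1 ?g" by (intro wint_2_le_1 continuous_intros c) auto
   also have "... = 1" using H1 by (simp add: hgt_def wmean_def)
   finally have 2: "wint 2 ?g <= 1" .
   have "4*(wint 2 ?f - ka*wint 2 ?g) = wint 2 (%y. 4*(?f y - ka*?g y))"
    unfolding wint_cmult by (subst wint_diff) (auto intro!: continuous_intros c simp: wint_cmult)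
   also have "... <= wint 2 (%y. lap ?g y)"
   proof (rule wint_mono)
    show "cont1 (lap ?g)"
     by (rule continuous_on_subset[OF C2_cont_lap[OF C2_sum_squares(1)[OF Sol_C2(1,2)[OF sol]]] cb])
    fix y :: 'a assume "norm y <= 1"
    hence "y : ball 0 R" using R by simp
    from Sol_lap_sum_squares[OF sol this] show "4*(?f y - ka*?g y) <= lap ?g y" by (simp add: algebra_simps)
   qed (intro continuous_intros c)
   finally have "wint 2 ?f - ka*wint 2 ?g <= freq u v 0 1" by (simp add: freq_def H1 eng_def)
   moreover have "ka*wint 2 ?g <= ka*1" using 2 ka0 by (intro mult_left_mono) auto
   ultimately show False using 1 f ka k0 by simp
  qed
 qed
qed

lemma hgt_threshold:
 fixes u v :: "'a::euclidean_space => real"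
 assumes sol: "Sol (ball x R) ka be u v" and r: "0 <= s" "s <= r" "r < R"
  and K: "be*s^2*hgt u v x s <= K" "K <= be*r^2*hgt u v x r"
 shows "EX t. s <= t & t <= r & be*t^2*hgt u v x t = K"
proof -
 have "isCont (hgt u v x) t" if "s <= t" "t <= r" for t
 proof -
  have "|t| < R" using that r by auto
  from DERIV_isCont[OF wmean_has_derivative[OF C2_sum_squares(1)[OF Sol_C2(1,2)[OF sol]] this]]
  show ?thesis by (simp add: hgt_def[abs_def])
 qed
 thus ?thesis by (intro IVT[OF K r(2)]) (auto intro!: continuous_intros)
qed

text \<open>By continuity some radius \<open>t <= r\<close> has competition exactly 1. Rescaling
  there produces a normalised solution with \<open>be = 1\<close>, and almost monotonicity carries
  its frequency bound from \<open>t\<close> up to \<open>r\<close>.\<close>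

lemma freq_bound_small:
 assumes dim: "DIM('a::euclidean_space) <= 4"
 obtains c ka0 where "c > 0" "ka0 > 0" "ka0 <= 1" "freq_bound TYPE('a) c 1 ka0"
proof -
 obtain c0 ka0 where c0: "c0 > 0" "ka0 > 0" "ka0 <= 1"
  and main: "!!(u::'a => real) v R ka. Sol (ball 0 R) ka 1 u v ==> 1 < R ==> ka <= ka0 ==> u 0 = v 0 ==>
   hgt u v 0 1 = 1 ==> c0 <= freq u v 0 1"
  using freq_lower_normalised[OF dim] by metis
 \<comment> \<open>The monotonicity error \<open>(3/2)*ka*r^2\<close> then costs at most half of
   \<open>c0\<close>, which leaves \<open>2*(c0/4)\<close>.\<close>
 define ka1 where "ka1 = min ka0 (c0/3)"
 have k1: "ka1 > 0" "ka1 <= ka0" "ka1 <= c0/3" using c0 by (auto simp: ka1_def)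
 have "freq_bound TYPE('a) (c0/4) 1 ka1"
  unfolding freq_bound_def
 proof (intro allI impI)
  fix x :: 'a and R r ka be :: real and u v
  assume sol: "Sol (ball x R) ka be u v" and r: "0 < r" "r < R" and uv: "u x = v x"
   and H: "1 <= be*r^2*hgt u v x r" and k: "ka*r^2 <= ka1"
  note be = Sol_C2(4)[OF sol] and ka = Sol_C2(5)[OF sol]
  obtain t where t: "0 <= t" "t <= r" "be*t^2*hgt u v x t = 1"
   using hgt_threshold[OF sol order_refl _ r(2) _ H] r by auto
  have t0: "t > 0" using t by (cases "t = 0") auto
  have tR: "t < R" using t r by simp
  define s where "s = sqrt (hgt u v x t)"
  have Ht: "hgt u v x t > 0" using hgt_pos[OF sol] t0 tR by simp
  have s: "s > 0" "s^2 = hgt u v x t" using Ht by (auto simp: s_def)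
  let ?u = "%y. u (x + t*.y)/s" and ?v = "%y. v (x + t*.y)/s"
  have inb: "x + t*.y : ball x R" if "y : ball 0 (R/t)" for y
   using that t0 by (simp add: dist_norm field_simps)
  have sol': "Sol (ball 0 (R/t)) (ka*t^2) (be*t^2*s^2) ?u ?v"
   by (rule Sol_rescale[OF sol t0 s(1) open_ball inb])
  have "be*t^2*s^2 = 1" using t s by simp
  with sol' have sol': "Sol (ball 0 (R/t)) (ka*t^2) 1 ?u ?v" by simp
  have t2: "ka*t^2 <= ka*r^2" using t ka by (intro mult_left_mono power_mono) auto
  have "hgt ?u ?v 0 1 = 1" using hgt_rescale[OF s(1), of u x t v 0 1] s Ht by simp
  hence "c0 <= freq ?u ?v 0 1"
   using t0 tR t2 k k1 uv by (intro main[OF sol']) auto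
  also have "freq ?u ?v 0 1 = freq u v x t"
   using freq_rescale[OF Sol_C2(1,2)[OF sol] s(1), of x t 0 1] in_ball_scaled[of t R _ x] t0 tR by simp
  finally have "c0 <= freq u v x t" .
  moreover have "freq u v x t + (3/2)*ka*t^2 <= freq u v x r + (3/2)*ka*r^2"
   by (rule freq_almost_mono[OF sol dim t0 t(2) r(2)])
  moreover have "0 <= (3/2)*ka*t^2" using ka by simp
  ultimately show "2*(c0/4) <= freq u v x r" using k k1 by simp
 qed
 with that[of "c0/4" ka1] k1 c0 show thesis by simp
qed

section \<open>From a frequency bound to a Hoelder estimate\<close>

definition holder_est :: "'a::euclidean_space itself => real => real => real => bool" where
 "holder_est _ al ka0 C \<longleftrightarrow> (ALL ka be u v. Sol (ball (0::'a) 1) ka be u v --> ka <= ka0 -->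
  (ALL y:ball 0 1. u y <= 1 & v y <= 1) -->
  (ALL x:ball 0 (1/4). ALL y:ball 0 (1/4). |u x - u y| <= C*dist x y powr al & |v x - v y| <= C*dist x y powr al))"

text \<open>Turns a Lipschitz bound with constant of order \<open>t powr al/t\<close>, valid at
  distances up to \<open>t\<close>, into a Hoelder bound.\<close>

lemma mult_powr_le:
 fixes k t al :: real
 assumes "0 <= k" "k <= t" "0 < t" "0 < al" "al <= 1"
 shows "k*t powr al/t <= k powr al"
proof (cases "k = 0")
 case False
 hence k: "k > 0" using assms by simp
 have "k*t powr al/t = k powr al*((k/t) powr (1 - al))"
  using k assms by (simp add: powr_divide powr_diff field_simps)
 also have "... <= k powr al*1" using k assms by (intro mult_left_mono powr_le1) auto
 finally show ?thesis by simp
qed simp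

lemma four_powr_le: "0 <= (c::real) ==> 1 <= c ==> al <= 1 ==> c powr al <= c"
 using powr_mono[of al 1 c] by simp

definition near_const :: "'a::euclidean_space itself => real" where
 "near_const _ = sup_const TYPE('a)*(4*sqrt (2*wint 1 (%y::'a. 1)))"

lemma near_const_pos: "near_const TYPE('a::euclidean_space) > 0"
 unfolding near_const_def using sup_const_ge[where 'a='a] wint_one_pos[of 1, where 'a='a]
 by (intro mult_pos_pos) auto

section \<open>Solutions near a coincidence point\<close>

context
 fixes u v :: "'a::euclidean_space => real" and z :: 'a and al K ka0 ka be :: real
 assumes dim: "DIM('a) <= 4" and fb: "freq_bound TYPE('a) al K ka0" and al: "0 < al" "al <= 1" and K: "K > 0" and ka01: "ka0 <= 1"
  and sol: "Sol (ball z (1/2)) ka be u v" and k: "ka <= ka0"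
  and b1: "!!y. y : ball z (1/2) ==> u y <= 1 & v y <= 1" and uvz: "u z = v z"
begin

lemma kt: "0 <= t ==> t <= 1 ==> ka*t^2 <= ka0"
 using Sol_C2(5)[OF sol] k mult_left_mono[of "t^2" 1 ka] by (simp add: power_le_one)

text \<open>Competition at least \<open>2*K\<close> at radius \<open>t\<close> stays at least
  \<open>K\<close> at all larger radii, so the frequency bound holds on the whole interval from
  \<open>t\<close> to \<open>1/4\<close> and forces the decay of the height. At
  \<open>t = 1/4\<close> the bound \<open>u, v <= 1\<close> is enough.\<close>

lemma near_hgt:
 assumes t: "0 < t" "t <= 1/4" and H: "t = 1/4 \<or> 2*K <= be*t^2*hgt u v z t"
 shows "hgt u v z t <= (4*t) powr (2*al)*(2*wint 1 (%y::'a. 1))"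
proof -
 note ka = Sol_C2(5)[OF sol] and be = Sol_C2(4)[OF sol]
 have q: "|1/4::real| < 1/2" by simp
 have in4: "z + (1/4)*.y : ball z (1/2)" if "norm y <= 1" for y :: 'a
  using in_ball_scaled[OF q that] .
 have "hgt u v z (1/4) <= wint 1 (%y::'a. 2)"
  unfolding hgt_def wmean_def
 proof (rule wint_mono)
  show "cont1 (%y. (u (z + (1/4)*.y))^2 + (v (z + (1/4)*.y))^2)"
   by (intro continuous_intros Sol_cont[OF sol q])
  fix y :: 'a assume "norm y <= 1"
  note y = in4[OF this]
  have "(u (z + (1/4)*.y))^2 <= 1" "(v (z + (1/4)*.y))^2 <= 1"
   using b1[OF y] Sol_pos[OF sol y] by (auto intro!: power_le_one)
  thus "(u (z + (1/4)*.y))^2 + (v (z + (1/4)*.y))^2 <= 2" by simp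
 qed simp
 also have "... = 2*wint 1 (%y::'a. 1)" by (rule wint_const)
 finally have H4: "hgt u v z (1/4) <= 2*wint 1 (%y::'a. 1)" .
 show ?thesis
 proof (cases "t = 1/4")
  case True
  show ?thesis using H4 by (simp add: True)
 next
  case False
  hence Ht: "2*K <= be*t^2*hgt u v z t" using H by simp
  have "2*al <= freq u v z s" if s: "t <= s" "s <= 1/4" for s
  proof -
   have sp: "0 < s" "s < 1/2" using s t by auto
   have Hp: "0 < hgt u v z s" "0 < hgt u v z t" using hgt_pos[OF sol] sp s t by auto
   have "hgt u v z t*1 <= hgt u v z t*exp (ka*t^2/2)" using Hp ka by (intro mult_left_mono) auto
   also have "... <= hgt u v z s*exp (ka*s^2/2)" using s sp t by (intro hgt_mono[OF sol]) auto
   also have "... <= hgt u v z s*2"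
   proof (intro mult_left_mono)
    have "ka*s^2 <= 1*(1/4)^2" using s sp k ka01 ka by (intro mult_mono power_mono) auto
    hence "ka*s^2/2 <= 1/32" by (simp add: power_divide)
    hence "exp (ka*s^2/2) <= exp (1/2)" by simp
    also have "... <= 2" by (rule exp_half_le2)
    finally show "exp (ka*s^2/2) <= 2" .
   qed (use Hp in auto)
   \<comment> \<open>The height is only almost increasing; the factor 2 lost here is the 2 in the
     threshold \<open>2*K\<close>.\<close>
   finally have h2: "hgt u v z t <= 2*hgt u v z s" by simp
   have "2*K <= be*t^2*hgt u v z t" by (rule Ht)
   also have "... <= be*s^2*(2*hgt u v z s)"
    using h2 be s t Hp by (intro mult_mono power_mono) auto
   finally have "K <= be*s^2*hgt u v z s" by simp
   thus ?thesis
    using fb[unfolded freq_bound_def, rule_format, OF sol sp uvz] kt[of s] s sp by auto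
  qed
  hence "((1/4)/t) powr (2*al)*hgt u v z t <= hgt u v z (1/4)"
   using t by (intro hgt_growth(1)[OF sol dim]) auto
  also note H4
  finally have "hgt u v z t <= 2*wint 1 (%y::'a. 1)/((1/4)/t) powr (2*al)"
   using t by (simp add: field_simps)
  also have "((1/4)/t) powr (2*al) = 1/(4*t) powr (2*al)"
   using t by (simp add: powr_divide powr_mult)
  finally show ?thesis by (simp add: mult.commute)
 qed
qed

lemma near_sup:
 assumes t: "0 < t" "t <= 1/4" and H: "t = 1/4 \<or> 2*K <= be*t^2*hgt u v z t"
 shows "sup_const TYPE('a)*sqrt (hgt u v z t) <= near_const TYPE('a)*t powr al"
proof -
 let ?W = "wint 1 (%y::'a. 1)"
 have W: "?W > 0" by (rule wint_one_pos)
 have "sqrt (hgt u v z t) <= sqrt ((4*t) powr (2*al)*(2*?W))"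
  using near_hgt[OF assms] by simp
 also have "... = (4*t) powr al*sqrt (2*?W)"
 proof -
  have "(4*t) powr (2*al) = ((4*t) powr al)^2" unfolding power2_eq_square powr_add[symmetric] by simp
  thus ?thesis by (simp add: real_sqrt_mult)
 qed
 also have "(4*t) powr al = 4 powr al*t powr al" using t by (simp add: powr_mult)
 also have "... * sqrt (2*?W) <= 4*t powr al*sqrt (2*?W)"
  using al W by (intro mult_right_mono four_powr_le) auto
 finally have "sup_const TYPE('a)*sqrt (hgt u v z t) <= sup_const TYPE('a)*(4*t powr al*sqrt (2*?W))"
  using sup_const_ge[where 'a='a] by (intro mult_left_mono) auto
 thus ?thesis by (simp add: near_const_def mult_ac)
qed

text \<open>When the competition at radius \<open>t\<close> is at most \<open>2*K\<close>, the
  equations rescaled to that radius have bounded coefficients. The interior Lipschitz estimate at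
  scale \<open>t\<close> then has constant of order \<open>t powr al/t\<close>, because the
  amplitude is of order \<open>t powr al\<close>.\<close>

lemma near_lipschitz:
 assumes t: "0 < t" "t <= 1/4" and H: "t = 1/4 \<or> 2*K <= be*t^2*hgt u v z t"
  and H2: "be*t^2*hgt u v z t <= 2*K" and p: "dist p z <= t/32" and q: "dist q z <= t/32"
 defines "C == lip_const TYPE('a)*(14 + 2*K*(sup_const TYPE('a))^2)*near_const TYPE('a)"
 shows "|u q - u p| <= C*dist p q powr al" "|v q - v p| <= C*dist p q powr al"
proof -
 note ka = Sol_C2(5)[OF sol] and be = Sol_C2(4)[OF sol]
 define S L where "S = sup_const TYPE('a)" and "L = lip_const TYPE('a)"
 have S: "S >= 1" and L: "L > 0" using sup_const_ge lip_const_pos by (auto simp: S_def L_def)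
 define m where "m = S*sqrt (hgt u v z t)"
 have t2: "t < 1/2" using t by simp
 have Hp: "hgt u v z t > 0" using hgt_pos[OF sol] t t2 by simp
 have m: "0 < m" "m <= near_const TYPE('a)*t powr al" using near_sup[OF t H] S Hp by (auto simp: m_def S_def)
 have kt1: "ka*t^2 <= 1" using kt[of t] t ka01 by simp
 have bm: "be*m^2 <= 2*K*S^2/t^2"
 proof -
  have "be*m^2*t^2 = (be*t^2*hgt u v z t)*S^2" using Hp by (simp add: m_def power_mult_distrib)
  also have "... <= 2*K*S^2" using H2 by (intro mult_right_mono) auto
  finally show ?thesis using t by (simp add: field_simps)
 qed
 have k2: "2*ka <= 2/t^2" using kt1 t by (simp add: field_simps)
 have sub: "dist y z <= t/2" "y : ball z (1/2)" if "y : ball p (3*(t/12))" for y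
 proof -
  have "dist y z <= dist y p + dist p z" by (rule dist_triangle)
  thus "dist y z <= t/2" using that p t by (simp add: dist_commute)
  thus "y : ball z (1/2)" using t by (simp add: dist_commute)
 qed
 have bd: "0 < u y" "u y <= m" "0 < v y" "v y <= m" if "y : ball p (3*(t/12))" for y
  using Sol_sup_bound[OF sol t(1) t2 kt1 sub(1)[OF that]] Sol_pos[OF sol sub(2)[OF that]] by (auto simp: m_def S_def)
 define B where "B = (2*K*S^2/t^2 + 2/t^2)*m"
 have lb: "|l| <= B" if "|l - be*p*q^2| <= 2*ka*p" "0 < p" "p <= m" "0 < q" "q <= m" for l p q
 proof -
  have "be*p*q^2 <= be*m*m^2" using that be by (intro mult_mono power_mono) auto
  also have "... = (be*m^2)*m" by simp
  also have "... <= (2*K*S^2/t^2)*m" using bm m by (intro mult_right_mono) auto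
  finally have 1: "be*p*q^2 <= (2*K*S^2/t^2)*m" .
  have 2: "2*ka*p <= 2/t^2*m" using k2 that ka by (intro mult_mono) auto
  have "0 <= be*p*q^2" using that be by simp
  thus ?thesis using that(1) 1 2 unfolding B_def distrib_right by linarith
 qed
 have lu: "|lap u y| <= B" "|lap v y| <= B" if "y : ball p (3*(t/12))" for y
 proof -
  note y = sub(2)[OF that]
  show "|lap u y| <= B" using Sol_lap_ge(1)[OF sol y] bd[OF that] by (intro lb[of _ "u y" "v y"]) auto
  show "|lap v y| <= B" using Sol_lap_ge(2)[OF sol y] bd[OF that] by (intro lb[of _ "v y" "u y"]) (auto simp: mult_ac)
 qed
 have C2p: "C2 (ball p (3*(t/12))) u" "C2 (ball p (3*(t/12))) v"
  by (rule C2_subset[OF Sol_C2(1)[OF sol]] C2_subset[OF Sol_C2(2)[OF sol]]; use sub(2) in blast)+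
 have dpq: "dist p q <= t/16" using dist_triangle2[of p q z] p q by simp
 hence nk: "norm (q - p) <= t/12" using t by (simp add: dist_norm norm_minus_commute)
 have fin: "|w q - w p| <= C*dist p q powr al"
  if w: "C2 (ball p (3*(t/12))) w" "!!y. y : ball p (3*(t/12)) ==> |w y| <= m" "!!y. y : ball p (3*(t/12)) ==> |lap w y| <= B" for w
 proof -
  have "|w (p + (q - p)) - w p| <= L*norm (q - p)*(m/(t/12) + B*(t/12))"
   unfolding L_def by (rule lipschitz_estimate[OF w _ nk]) (use t in auto)
  also have "m/(t/12) + B*(t/12) = (12 + (2*K*S^2 + 2)/12)*(m/t)"
   unfolding B_def using t by (simp add: field_simps power2_eq_square)
  also have "L*norm (q - p)*((12 + (2*K*S^2 + 2)/12)*(m/t)) <= L*norm (q - p)*((14 + 2*K*S^2)*(near_const TYPE('a)*t powr al/t))"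
   using L K m t S by (intro mult_left_mono mult_mono divide_right_mono) (auto simp: field_simps)
  also have "... = C*(norm (q - p)*t powr al/t)" by (simp add: C_def L_def S_def mult_ac)
  also have "... <= C*norm (q - p) powr al"
  proof (intro mult_left_mono mult_powr_le)
   show "0 <= C" unfolding C_def using lip_const_pos[where 'a='a] near_const_pos[where 'a='a] K by (intro mult_nonneg_nonneg add_nonneg_nonneg) auto
  qed (use nk t al in auto)
  finally show ?thesis by (simp add: dist_norm norm_minus_commute)
 qed
 show "|u q - u p| <= C*dist p q powr al"
  by (rule fin[OF C2p(1) _ lu(1)]) (use bd in \<open>auto simp: abs_of_pos\<close>)
 show "|v q - v p| <= C*dist p q powr al"
  by (rule fin[OF C2p(2) _ lu(2)]) (use bd in \<open>auto simp: abs_of_pos\<close>)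
qed

text \<open>If the competition is strong at radius \<open>32*r\<close>, frequency decay makes both
  components small there. Otherwise a radius between \<open>32*r\<close> and \<open>1/4\<close> is
  found at which it equals \<open>2*K\<close>, or it is still below \<open>2*K\<close> at
  \<open>1/4\<close>; the equations have bounded coefficients at that scale, which covers the ball
  of radius \<open>r\<close>.\<close>

lemma near_coincidence:
 assumes r: "0 < r" "r <= 1/128"
 shows "(ALL y. dist y z <= r --> u y <= 32*near_const TYPE('a)*r powr al & v y <= 32*near_const TYPE('a)*r powr al) \<or>
  (ALL p q. dist p z <= r --> dist q z <= r -->
   |u q - u p| <= lip_const TYPE('a)*(14 + 2*K*(sup_const TYPE('a))^2)*near_const TYPE('a)*dist p q powr al &
   |v q - v p| <= lip_const TYPE('a)*(14 + 2*K*(sup_const TYPE('a))^2)*near_const TYPE('a)*dist p q powr al)"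
proof -
 define rh where "rh = 32*r"
 have rh: "0 < rh" "rh <= 1/4" using r by (auto simp: rh_def)
 show ?thesis
 proof (cases "2*K <= be*rh^2*hgt u v z rh")
  case True
  have "ka*rh^2 <= 1" using kt[of rh] rh ka01 by simp
  note sb = Sol_sup_bound[OF sol rh(1) _ this]
  have "near_const TYPE('a)*rh powr al <= 32*near_const TYPE('a)*r powr al"
  proof -
   have "rh powr al = 32 powr al*r powr al" using r by (simp add: rh_def powr_mult)
   also have "... <= 32*r powr al" using al by (intro mult_right_mono four_powr_le) auto
   finally show ?thesis using near_const_pos[where 'a='a] by (simp add: mult.left_commute mult_left_mono)
  qed
  hence "u y <= 32*near_const TYPE('a)*r powr al & v y <= 32*near_const TYPE('a)*r powr al" if "dist y z <= r" for y
   using sb[of y] that near_sup[OF rh] True rh by (force simp: rh_def)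
  thus ?thesis by blast
 next
  case False
  have "EX t. rh <= t & t <= 1/4 & (t = 1/4 \<or> 2*K <= be*t^2*hgt u v z t) & be*t^2*hgt u v z t <= 2*K"
  proof (cases "2*K <= be*(1/4)^2*hgt u v z (1/4)")
   case True
   have "be*rh^2*hgt u v z rh <= 2*K" using \<open>\<not> 2 * K \<le> be * rh\<^sup>2 * hgt u v z rh\<close> by simp
   from hgt_threshold[OF sol less_imp_le[OF rh(1)] rh(2) _ this True]
   obtain t where "rh <= t" "t <= 1/4" "be*t^2*hgt u v z t = 2*K" by auto
   thus ?thesis by (intro exI[of _ t]) auto
  next
   case False
   thus ?thesis using rh by (intro exI[of _ "1/4"]) auto
  qed
  then obtain t where t: "rh <= t" "t <= 1/4" "t = 1/4 \<or> 2*K <= be*t^2*hgt u v z t" "be*t^2*hgt u v z t <= 2*K"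
   by blast
  have t0: "0 < t" "r <= t/32" using t(1) rh by (auto simp: rh_def)
  show ?thesis using near_lipschitz[OF t0(1) t(2-4)] t0(2) by (meson order_trans)
 qed
qed

end

text \<open>The distance \<open>h\<close> of the two points is compared with the distance
  \<open>d\<close> from \<open>x\<close> to the coincidence set. If \<open>d\<close> is at most a
  multiple of \<open>h\<close>, the dichotomy near a coincidence point is used directly. Otherwise
  the components are ordered on \<open>ball x d\<close>, and the same dichotomy at radius
  \<open>4*d\<close> either is already a Hoelder bound or provides the amplitude for the Lipschitz
  estimate at scale \<open>d\<close>.\<close>

theorem holder_est_of_freq_bound:
 assumes dim: "DIM('a::euclidean_space) <= 4" and fb: "freq_bound TYPE('a) al K ka0" and al: "0 < al" "al <= 1" and K: "K > 0" and ka01: "ka0 <= 1"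
 obtains C where "C > 0" "holder_est TYPE('a) al ka0 C"
proof -
 define CA CB N where "CA = 32*near_const TYPE('a)"
  and "CB = lip_const TYPE('a)*(14 + 2*K*(sup_const TYPE('a))^2)*near_const TYPE('a)"
  and "N = noz_const TYPE('a)"
 have pos: "CA > 0" "CB > 0" "N > 0"
  unfolding CA_def CB_def N_def using near_const_pos[where 'a='a] lip_const_pos[where 'a='a] K noz_const_pos[where 'a='a]
  by (auto intro!: mult_pos_pos add_pos_nonneg)
 define C where "C = 4096 + 8*CA + CB + 512*N + 4*N*CA"
 have C: "C > 0" "CB <= C" "8*CA <= C" "4096 <= C" "512*N <= C" "4*N*CA <= C"
  unfolding C_def using pos mult_pos_pos[of N CA] by linarith+
 have "holder_est TYPE('a) al ka0 C"
  unfolding holder_est_def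
 proof (intro allI impI ballI)
  fix ka be u v and x y :: 'a
  assume sol: "Sol (ball (0::'a) 1) ka be u v" and k: "ka <= ka0" and b: "ALL y:ball 0 1. u y <= 1 & v y <= 1"
   and x: "x : ball 0 (1/4)" and y: "y : ball 0 (1/4)"
  note ka = Sol_C2(5)[OF sol]
  define h where "h = dist x y"
  have up: "0 < u w" "u w <= 1" "0 < v w" "v w <= 1" if "w : ball 0 1" for w
   using Sol_pos[OF sol that] b that by auto
  have x1: "x : ball 0 1" "y : ball 0 1" using x y by auto
  have goal: "|u x - u y| <= C*h powr al & |v x - v y| <= C*h powr al"
  proof (cases "h = 0")
   case True
   thus ?thesis by (simp add: h_def)
  next
   case hn: False
   hence h: "h > 0" by (simp add: h_def)
   have hp: "h powr al > 0" using h by simp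
   have conv: "c*h powr al <= C*h powr al" if "c <= C" for c using that hp by (simp add: mult_right_mono)
   have nr: "(ALL y. dist y z <= r --> u y <= CA*r powr al & v y <= CA*r powr al) \<or>
     (ALL p q. dist p z <= r --> dist q z <= r --> |u q - u p| <= CB*dist p q powr al & |v q - v p| <= CB*dist p q powr al)"
    if "z : ball 0 (1/2)" "u z = v z" "0 < r" "r <= 1/128" for z r
   proof -
    have sub: "ball z (1/2) <= ball 0 1" using that(1) by (auto simp: ball_subset_ball_iff)
    show ?thesis unfolding CA_def CB_def
     by (rule near_coincidence[OF dim fb al K ka01 Sol_subset[OF sol open_ball sub] k _ that(2) that(3,4)])
      (use b sub in auto)
   qed
   have nz: "|u x - u y| <= N*h*s/d & |v x - v y| <= N*h*s/d"
    if d: "0 < d" "d <= 1/512" "6*h <= d" and nz: "!!z. z : ball x d ==> u z ~= v z"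
     and s: "!!z. z : ball x d ==> u z <= s & v z <= s" for d s
   proof -
    have sub: "ball x d <= ball 0 1" using x d by (auto simp: ball_subset_ball_iff)
    have sold: "Sol (ball x d) ka be u v" by (rule Sol_subset[OF sol open_ball sub])
    have kd: "ka*d^2 <= 1"
     using k ka01 ka d mult_mono[of ka 1 "d^2" 1] by (simp add: power_le_one)
    have nk: "norm (y - x) <= d/6" using d by (simp add: h_def dist_norm norm_minus_commute)
    have hk: "norm (y - x) = h" by (simp add: h_def dist_norm norm_minus_commute)
    from Sol_ordered[OF sold nz] show ?thesis
    proof
     assume "ALL y:ball x d. v y < u y"
     thus ?thesis using Sol_lipschitz_noz[OF sold d(1) kd _ _ nk, of s] s hk
      by (simp add: N_def abs_minus_commute)
    next
     assume "ALL y:ball x d. u y < v y"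
     thus ?thesis using Sol_lipschitz_noz[OF Sol_sym[OF sold] d(1) kd _ _ nk, of s] s hk
      by (simp add: N_def abs_minus_commute)
    qed
   qed
   \<comment> \<open>The cut-off ensures \<open>6*h <= 1/512\<close> and
     \<open>8*h <= 1/128\<close>, the ranges of the two tools; above it the bounds
     \<open>u, v <= 1\<close> suffice.\<close>
   consider "h >= 1/4096" | "h < 1/4096" "EX z:ball 0 (1/2). u z = v z & dist z x <= 6*h"
    | "h < 1/4096" "ALL z:ball 0 (1/2). u z = v z --> 6*h < dist z x" by force
   thus ?thesis
   proof cases
    case 1
    have "1 <= 4096*h powr al"
    proof -
     have "1/4096 <= (1/4096) powr al" using powr_mono'[of al 1 "1/4096"] al by simp
     also have "... <= h powr al" using 1 al by (intro powr_mono2) auto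
     finally show ?thesis by simp
    qed
    also have "... <= C*h powr al" by (rule conv[OF C(4)])
    finally show ?thesis using up[OF x1(1)] up[OF x1(2)] by linarith
   next
    case 2
    then obtain z where z: "z : ball 0 (1/2)" "u z = v z" "dist z x <= 6*h" by blast
    have dx: "dist x z <= 8*h" "dist y z <= 8*h"
     using z(3) h dist_triangle[of y z x] dist_commute[of x z] dist_commute[of x y] unfolding h_def by linarith+
    have "0 < 8*h" "8*h <= 1/128" using 2 h by simp_all
    from nr[OF z(1,2) this] show ?thesis
    proof (elim disjE)
     assume A: "ALL y. dist y z <= 8*h --> u y <= CA*(8*h) powr al & v y <= CA*(8*h) powr al"
     have "CA*(8*h) powr al <= C*h powr al"
     proof -
      have "(8*h) powr al = 8 powr al*h powr al" using h by (simp add: powr_mult)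
      also have "... <= 8*h powr al" using al by (intro mult_right_mono four_powr_le) auto
      finally have "CA*(8*h) powr al <= (8*CA)*h powr al" using pos by simp
      also have "... <= C*h powr al" by (rule conv[OF C(3)])
      finally show ?thesis .
     qed
     moreover have "u x <= CA*(8*h) powr al" "v x <= CA*(8*h) powr al" "u y <= CA*(8*h) powr al" "v y <= CA*(8*h) powr al"
      using A dx by auto
     ultimately show ?thesis using up[OF x1(1)] up[OF x1(2)] by linarith
    next
     assume B: "ALL p q. dist p z <= 8*h --> dist q z <= 8*h --> |u q - u p| <= CB*dist p q powr al & |v q - v p| <= CB*dist p q powr al"
     hence "|u x - u y| <= CB*h powr al & |v x - v y| <= CB*h powr al"
      using dx by (auto simp: h_def dist_commute)
     thus ?thesis using conv[OF C(2)] by linarith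
    qed
   next
    case 3
    define D where "D = (%z. dist z x) ` {z : ball 0 (1/2). u z = v z}"
    have D6: "6*h < d" if "d : D" for d using that 3(2) unfolding D_def by auto
    show ?thesis
    proof (cases "EX d:D. d < 1/512")
     case False
     have "u z ~= v z" if "z : ball x (1/512)" for z
     proof
      assume "u z = v z"
      moreover have "z : ball 0 (1/2)" using that x norm_triangle_sub[of z x] by (simp add: dist_norm norm_minus_commute)
      ultimately have "dist z x : D" unfolding D_def by blast
      thus False using False that by (auto simp: dist_commute)
     qed
     moreover have "u z <= 1 & v z <= 1" if "z : ball x (1/512)" for z
     proof -
      have "z : ball 0 1" using that x norm_triangle_sub[of z x] by (simp add: dist_norm norm_minus_commute)
      thus ?thesis using up by simp
     qed
     ultimately have "|u x - u y| <= N*h*1/(1/512) & |v x - v y| <= N*h*1/(1/512)"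
      using 3 by (intro nz) auto
     moreover have "N*h*1/(1/512) <= C*h powr al"
     proof -
      have "h <= h powr al" using h 3(1) al powr_mono'[of al 1 h] by simp
      hence "(512*N)*h <= (512*N)*h powr al" using pos by (intro mult_left_mono) auto
      also have "... <= C*h powr al" by (rule conv[OF C(5)])
      finally show ?thesis by simp
     qed
     ultimately show ?thesis by linarith
    next
     case True
     hence Dne: "D ~= {}" by auto
     have bb: "bdd_below D" using D6 by (intro bdd_belowI[of _ "6*h"]) (auto intro: less_imp_le)
     \<comment> \<open>No coincidence point is closer than \<open>d\<close>, and one lies within
       \<open>2*d\<close>; \<open>ball x d\<close> is therefore inside the ball of radius
       \<open>4*d\<close> about that point.\<close>
     define d where "d = Inf D"
     have d6: "6*h <= d" unfolding d_def using D6 Dne by (intro cInf_greatest) (auto intro: less_imp_le)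
     hence d0: "0 < d" using h by linarith
     have d5: "d <= 1/512" using True cInf_lower[OF _ bb] unfolding d_def by force
     obtain d' where d': "d' : D" "d' < 2*d" using cInf_lessD[OF Dne, of "2*d"] d0 by (auto simp: d_def)
     then obtain z where z: "z : ball 0 (1/2)" "u z = v z" "dist z x < 2*d" unfolding D_def by auto
     have noz: "u w ~= v w" if "w : ball x d" for w
     proof
      assume "u w = v w"
      moreover have "w : ball 0 (1/2)" using that x d5 norm_triangle_sub[of w x] by (simp add: dist_norm norm_minus_commute)
      ultimately have "dist w x : D" unfolding D_def by blast
      hence "d <= dist w x" unfolding d_def by (rule cInf_lower[OF _ bb])
      thus False using that by (simp add: dist_commute)
     qed
     have dz: "dist w z <= 4*d" if "dist w x <= d" for w
      using dist_triangle[of w z x] that z(3) d0 by (simp add: dist_commute)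
     have "0 < 4*d" "4*d <= 1/128" using d5 d0 by simp_all
     from nr[OF z(1,2) this] show ?thesis
     proof (elim disjE)
      assume A: "ALL y. dist y z <= 4*d --> u y <= CA*(4*d) powr al & v y <= CA*(4*d) powr al"
      have "|u x - u y| <= N*h*(CA*(4*d) powr al)/d & |v x - v y| <= N*h*(CA*(4*d) powr al)/d"
       using A dz by (intro nz[OF d0 d5 d6 noz]) (auto simp: dist_commute)
      moreover have "N*h*(CA*(4*d) powr al)/d <= C*h powr al"
      proof -
       have "(4*d) powr al = 4 powr al*d powr al" using d0 by (simp add: powr_mult)
       also have "... <= 4*d powr al" using al by (intro mult_right_mono four_powr_le) auto
       finally have "N*h*(CA*(4*d) powr al)/d <= N*h*(CA*(4*d powr al))/d"
        using pos h d0 by (intro divide_right_mono mult_left_mono) auto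
       also have "... = (4*N*CA)*(h*d powr al/d)" by simp
       also have "... <= (4*N*CA)*h powr al"
        using pos h d0 d6 al by (intro mult_left_mono mult_powr_le) auto
       also have "... <= C*h powr al" by (rule conv[OF C(6)])
       finally show ?thesis .
      qed
      ultimately show ?thesis by linarith
     next
      assume B: "ALL p q. dist p z <= 4*d --> dist q z <= 4*d --> |u q - u p| <= CB*dist p q powr al & |v q - v p| <= CB*dist p q powr al"
      have "dist y x <= d" using d6 h dist_commute[of x y] unfolding h_def by linarith
      hence "dist x z <= 4*d" "dist y z <= 4*d" using dz[of x] dz[of y] d0 by auto
      hence "|u x - u y| <= CB*h powr al & |v x - v y| <= CB*h powr al"
       using B by (auto simp: h_def dist_commute)
      thus ?thesis using conv[OF C(2)] by linarith
     qed
    qed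
   qed
  qed
  thus "|u x - u y| <= C*dist x y powr al & |v x - v y| <= C*dist x y powr al"
   by (simp add: h_def)
 qed
 with C(1) that show thesis by blast
qed

lemma holder_est_scaled:
 fixes u v :: "'a::euclidean_space => real"
 assumes he: "holder_est TYPE('a) al ka0 C" and sol: "Sol (ball x d) ka be u v" and d: "d > 0" "ka*d^2 <= ka0" and A: "A > 0"
  and b: "!!y. y : ball x d ==> u y <= A & v y <= A" and y: "y : ball x (d/4)" "z : ball x (d/4)"
 shows "|u y - u z| <= C*A*(dist y z/d) powr al" "|v y - v z| <= C*A*(dist y z/d) powr al"
proof -
 let ?u = "%y. u (x + d*.y)/A" and ?v = "%y. v (x + d*.y)/A"
 have inb: "x + d*.w : ball x d" if "w : ball 0 1" for w using that d by (simp add: dist_norm)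
 have sol': "Sol (ball 0 1) (ka*d^2) (be*d^2*A^2) ?u ?v"
  by (rule Sol_rescale[OF sol d(1) A open_ball inb])
 have b': "ALL w:ball 0 1. ?u w <= 1 & ?v w <= 1" using b[OF inb] A by auto
 let ?y = "(1/d)*.(y - x)" and ?z = "(1/d)*.(z - x)"
 have yz: "?y : ball 0 (1/4)" "?z : ball 0 (1/4)" "x + d*.?y = y" "x + d*.?z = z"
 proof -
  have n: "norm ((1/d)*.(w - x)) < 1/4" if "w : ball x (d/4)" for w
   using that d by (simp add: dist_norm norm_minus_commute divide_less_eq del: scaleR_diff_right)
  thus "?y : ball 0 (1/4)" "?z : ball 0 (1/4)" using y by (auto simp del: scaleR_diff_right norm_scaleR)
 qed (use d in auto)
 have "?y - ?z = (1/d)*.(y - z)" by (simp add: scaleR_diff_right)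
 hence dist: "dist ?y ?z = dist y z/d" using d by (simp add: dist_norm)
 from he[unfolded holder_est_def, rule_format, OF sol' d(2) _ yz(1,2)] b'
 have "|?u ?y - ?u ?z| <= C*(dist y z/d) powr al" "|?v ?y - ?v ?z| <= C*(dist y z/d) powr al"
  unfolding dist by auto
 hence "|u y - u z|/A <= C*(dist y z/d) powr al" "|v y - v z|/A <= C*(dist y z/d) powr al"
  unfolding yz using A by (simp_all add: diff_divide_distrib[symmetric] abs_div)
 thus "|u y - u z| <= C*A*(dist y z/d) powr al" "|v y - v z| <= C*A*(dist y z/d) powr al"
  using A by (simp_all add: divide_le_eq mult_ac)
qed

section \<open>Limits of solutions\<close>

lemma C2_compose:
 fixes f :: "'a::euclidean_space => real" and ph ph1 ph2 :: "real => real"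
 assumes f: "C2 S f" and d1: "!!x. x : S ==> (ph has_real_derivative ph1 (f x)) (at (f x))"
  and d2: "!!x. x : S ==> (ph1 has_real_derivative ph2 (f x)) (at (f x))" and c2: "continuous_on (f ` S) ph2"
 shows "C2 S (%x. ph (f x))"
  "!!x. x : S ==> lap (%x. ph (f x)) x = ph2 (f x)*(norm (grad f x))^2 + ph1 (f x)*lap f x"
proof -
 let ?G = "%x. ph1 (f x)*.grad f x"
 let ?K = "%x h. ph1 (f x)*.hess f x h + (ph2 (f x)*(grad f x .* h))*.grad f x"
 have ch: "((%x. py (f x)) has_derivative (%h. py'*(grad f x .* h))) (at x)"
  if "x : S" "(py has_real_derivative py') (at (f x))" for x py py'
  using has_derivative_compose[OF C2_grad[OF f that(1)] that(2)[unfolded has_field_derivative_def]] .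
 have 1: "((%x. ph (f x)) has_derivative (%h. ?G x .* h)) (at x)" if "x : S" for x
  using ch[OF that d1[OF that]] by simp
 have 2: "(?G has_derivative ?K x) (at x)" if "x : S" for x
  by (intro has_derivative_scaleR ch[OF that d2[OF that]] C2_hess[OF f that])
 have c1: "continuous_on (f ` S) ph1"
  using d2 DERIV_isCont by (intro continuous_at_imp_continuous_on) blast
 have 3: "continuous_on S (%x. ?K x h)" for h
  by (intro continuous_intros continuous_on_compose2[OF c1 C2_cont[OF f]] continuous_on_compose2[OF c2 C2_cont[OF f]]
    C2_cont_grad[OF f] C2_cont_hess[OF f]) auto
 note A = C2I[OF C2_open[OF f] 1 2 3]
 show "C2 S (%x. ph (f x))" by (rule A)
 show "lap (%x. ph (f x)) x = ph2 (f x)*(norm (grad f x))^2 + ph1 (f x)*lap f x" if "x : S" for x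
 proof -
  have n: "(norm (grad f x))^2 = (SUM b:Basis. (grad f x .* b)*(grad f x .* b))"
   by (subst power2_norm_eq_inner, subst euclidean_inner) simp
  show ?thesis
   by (simp add: lap_def A(3)[OF _ _ that] n inner_add_left sum.distrib sum_distrib_left mult.assoc)
 qed
qed

lemma wint_tendsto:
 fixes f :: "nat => 'a::euclidean_space => real"
 assumes c: "!!n. cont1 (f n)" "cont1 g"
  and u: "uniform_limit (cball 0 1) f g sequentially"
 shows "(%n. wint k (f n)) ----> wint k g"
proof (rule metric_LIMSEQ_I)
 fix e :: real assume e: "0 < e"
 let ?W = "wint k (%y::'a. 1)"
 have W: "?W > 0" by (rule wint_one_pos)
 obtain N where N: "!!n y. n >= N ==> y : cball 0 1 ==> dist (f n y) (g y) < e/(2*?W)"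
  using uniform_limitD[OF u, of "e/(2*?W)"] e W unfolding eventually_sequentially
  by (metis divide_pos_pos mult_pos_pos zero_less_numeral)
 show "EX N. ALL n>=N. dist (wint k (f n)) (wint k g) < e"
 proof (intro exI allI impI)
  fix n assume n: "N <= n"
  have le: "wint k p - wint k q <= e/2"
   if "cont1 p" "cont1 q" "!!y. norm y <= 1 ==> p y <= q y + e/(2*?W)" for p q :: "'a => real"
  proof -
   have "wint k p <= wint k (%y. q y + e/(2*?W))" using that by (intro wint_mono continuous_intros) auto
   also have "... = wint k q + e/(2*?W)*?W"
    using that(2) wint_const[of k "e/(2*?W)", where 'a='a] by (simp add: wint_add)
   finally show ?thesis using W by simp
  qed
  have a: "|f n y - g y| < e/(2*?W)" if "norm y <= 1" for y
   using N[OF n, of y] that by (simp add: dist_real_def)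
  have "wint k (f n) - wint k g <= e/2" "wint k g - wint k (f n) <= e/2"
   by (intro le c; use a in \<open>force simp: abs_less_iff\<close>)+
  thus "dist (wint k (f n)) (wint k g) < e" using e by (simp add: dist_real_def abs_if)
 qed
qed

lemma wint_eq_0_imp:
 fixes f :: "'a::euclidean_space => real"
 assumes c: "cont1 f" and n: "!!y. norm y <= 1 ==> 0 <= f y" and z: "wint 1 f = 0" and y: "norm y < 1"
 shows "f y = 0"
proof (rule ccontr)
 assume "f y ~= 0"
 hence fy: "f y > 0" using n[of y] y by simp
 have "continuous_on (ball 0 1) f" by (rule continuous_on_subset[OF c]) auto
 hence "isCont f y" using y by (simp add: continuous_on_eq_continuous_at)
 then obtain d where d: "d > 0" "!!w. dist w y < d ==> dist (f w) (f y) < f y/2"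
  using fy unfolding continuous_at_eps_delta by (meson half_gt_zero)
 define e where "e = min (d/2) ((1 - norm y)/2)"
 have e: "0 < e" "e < d" "norm y + e < 1" using d(1) y by (auto simp: e_def min_def field_simps)
 define r where "r = norm y + e"
 have r: "0 < r" "r < 1" using e norm_ge_zero[of y] unfolding r_def by linarith+
 have sub: "cball y e <= cball 0 r"
 proof
  fix w assume "w : cball y e"
  thus "w : cball 0 r" using norm_triangle_ineq2[of w y] by (simp add: r_def dist_norm norm_minus_commute)
 qed
 have pos: "0 < f w" if "w : cball y e" for w
  using d(2)[of w] that e fy by (simp add: dist_commute dist_real_def abs_if split: if_splits)
 have s1: "cball 0 r <= cball (0::'a) 1" using r by auto
 have "0 < (1 - r^2)^1*(LINT w:cball y e|lborel. f w)"
  using r e pos by (intro mult_pos_pos set_integral_pos continuous_on_subset[OF c]) (use sub s1 in \<open>auto simp: power_less_one_iff\<close>)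
 also have "... <= (1 - r^2)^1*(LINT w:cball 0 r|lborel. f w)"
 proof (intro mult_left_mono)
  show "(LINT w:cball y e|lborel. f w) <= (LINT w:cball 0 r|lborel. f w)"
   unfolding set_lebesgue_integral_def
  proof (rule integral_mono)
   fix w show "indicat_real (cball y e) w*.f w <= indicat_real (cball 0 r) w*.f w"
    using sub n[of w] s1 by (auto simp: indicator_def)
  qed (intro borel_integrable_compact compact_cball continuous_on_subset[OF c] subset_trans[OF sub] s1)+
  show "0 <= (1 - r^2)^1" using r by (simp add: power_le_one)
 qed
 also have "... <= wint 1 f" using r by (intro wint_0_ge c n) auto
 finally show False using z by simp
qed

lemma uniform_limit_compose_affine:
 fixes f :: "nat => 'a::euclidean_space => real"
 assumes u: "uniform_limit K f g sequentially" and K: "compact K" and g: "continuous_on K g"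
  and x: "x ----> x0" and r: "!!n y. norm y <= 1 ==> x n + r*.y : K" "!!y. norm y <= 1 ==> x0 + r*.y : K"
 shows "uniform_limit (cball 0 1) (%n y. f n (x n + r*.y)) (%y. g (x0 + r*.y)) sequentially"
proof (rule uniform_limitI)
 fix e :: real assume e: "0 < e"
 have "uniformly_continuous_on K g" using compact_uniformly_continuous[OF g K] .
 then obtain d where d: "d > 0" "!!y z. y : K ==> z : K ==> dist z y < d ==> dist (g z) (g y) < e/2"
  using e unfolding uniformly_continuous_on_def by (meson half_gt_zero)
 have "EV n. ALL y:K. dist (f n y) (g y) < e/2"
  by (rule uniform_limitD[OF u]) (use e in simp)
 moreover have "EV n. dist (x n) x0 < d" using x d(1) by (rule tendstoD)
 ultimately show "EV n. ALL y:cball 0 1. dist (f n (x n + r*.y)) (g (x0 + r*.y)) < e"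
 proof eventually_elim
  case (elim n)
  show ?case
  proof
   fix y :: 'a assume "y : cball 0 1"
   hence y: "norm y <= 1" by simp
   have "dist (f n (x n + r*.y)) (g (x n + r*.y)) < e/2" using elim r y by blast
   moreover have "dist (g (x n + r*.y)) (g (x0 + r*.y)) < e/2"
    using r y elim by (intro d(2)) auto
   ultimately show "dist (f n (x n + r*.y)) (g (x0 + r*.y)) < e"
    using dist_triangle_half_l[of _ _ e] by (meson dist_commute_lessI dist_triangle_half_r)
  qed
 qed
qed

lemma uniform_limit_square:
 fixes f :: "nat => 'a::euclidean_space => real"
 assumes "uniform_limit K f g sequentially" "compact K" "continuous_on K g"
 shows "uniform_limit K (%n y. (f n y)^2) (%y. (g y)^2) sequentially"
proof -
 have "bounded (g ` K)" using compact_continuous_image[OF assms(3,2)] compact_imp_bounded by blast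
 from uniform_lim_mult[OF assms(1) assms(1) this this] show ?thesis by (simp add: power2_eq_square)
qed

text \<open>A limit of functions whose Laplacians tend to \<open>0\<close> is a supersolution in the viscosity sense.\<close>

lemma no_touching_below:
 fixes w :: "nat => 'a::euclidean_space => real"
 assumes w: "!!n. C2 S (w n)" and rh: "rh > 0" "ball x rh <= S"
  and conv: "uniform_limit (ball x rh) w g sequentially"
  and lapw: "!!ep. ep > 0 ==> EV n. ALL y:ball x rh. lap (w n) y <= ep"
  and ph: "C2 T ph" "x : T" and below: "!!y. y : ball x rh ==> y : T ==> ph y <= g y" and eq: "g x = ph x" and pos: "lap ph x > 0"
 shows False
proof -
 define N where "N = real DIM('a)"
 have N: "N > 0" by (simp add: N_def)
 define l where "l = lap ph x"
 define et where "et = l/(8*N)"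
 have et: "et > 0" using pos N by (simp add: et_def l_def)
 have "isCont (lap ph) x" using C2_cont_lap[OF ph(1)] ph(2) C2_open[OF ph(1)] by (simp add: continuous_on_eq_continuous_at)
 then obtain d1 where d1: "d1 > 0" "!!y. dist y x < d1 ==> dist (lap ph y) (lap ph x) < l/2"
  using pos unfolding continuous_at_eps_delta l_def by (meson half_gt_zero)
 obtain d2 where d2: "d2 > 0" "ball x d2 <= T" using ph C2_open openE by blast
 define d where "d = Min {d1, d2, rh}/2"
 have d: "0 < d" "d < d1" "d < d2" "d < rh" using d1(1) d2(1) rh(1) by (auto simp: d_def)
 have sub: "cball x d <= ball x rh" "cball x d <= T" using d d2 by auto
 let ?q = "%y. (norm (y - x))^2"
 \<comment> \<open>Subtracting a paraboloid makes the contact strict, so that it survives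
   approximation; \<open>et\<close> is small enough that the Laplacian keeps a positive lower
   bound.\<close>
 define py where "py y = ph y - et*?q y" for y
 have oT: "open T" using ph C2_open by blast
 have py: "C2 T py" unfolding py_def[abs_def] by (intro C2_diff(1) C2_cmult(1) C2_norm2(1) ph oT)
 have lappy: "lap py y > l/4" if y: "y : ball x d" for y
 proof -
  have yT: "y : T" using y sub by auto
  have "lap py y = lap ph y - et*(2*N)"
   unfolding py_def[abs_def] N_def
   using C2_diff(3)[OF ph(1) C2_cmult(1)[OF C2_norm2(1)[OF oT, of x]] yT] C2_cmult(3)[OF C2_norm2(1)[OF oT, of x] yT]
    C2_norm2(3)[OF oT yT, of x] by simp
  moreover have "lap ph y > l/2"
  proof -
   have "dist y x < d1" using y d by (simp add: dist_commute)
   from d1(2)[OF this] have "|lap ph y - l| < l/2" by (simp only: dist_real_def l_def)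
   thus ?thesis by linarith
  qed
  moreover have "et*(2*N) = l/4" using N by (simp add: et_def)
  ultimately show ?thesis by simp
 qed
 \<comment> \<open>A third of the gap on the sphere of radius \<open>d\<close>: approximation within
   \<open>de\<close> still keeps the minimum of the difference in the interior.\<close>
 define de where "de = et*d^2/3"
 have de: "de > 0" using et d by (simp add: de_def)
 have "EV n. ALL y:ball x rh. dist (w n y) (g y) < de" using uniform_limitD[OF conv de] .
 moreover have "EV n. ALL y:ball x rh. lap (w n) y <= l/8" using lapw[of "l/8"] pos by (simp add: l_def)
 ultimately have "EV n. (ALL y:ball x rh. dist (w n y) (g y) < de) & (ALL y:ball x rh. lap (w n) y <= l/8)"
  by (rule eventually_conj)
 then obtain n where n1: "!!y. y : ball x rh ==> |w n y - g y| < de" and n2: "!!y. y : ball x rh ==> lap (w n) y <= l/8"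
  unfolding eventually_sequentially dist_real_def by blast
 define z where "z y = w n y - py y" for y
 have cw: "continuous_on (cball x d) (w n)" using continuous_on_subset[OF C2_cont[OF w]] sub(1) rh(2) by blast
 have cpy: "continuous_on (cball x d) py" using continuous_on_subset[OF C2_cont[OF py] sub(2)] .
 have "continuous_on (cball x d) z" unfolding z_def by (intro continuous_intros cw cpy)
 then obtain m where m: "m : cball x d" "!!y. y : cball x d ==> z m <= z y"
  using continuous_attains_inf[of "cball x d" z] d by auto
 have "z x < de" using n1[of x] rh eq by (simp add: z_def py_def abs_less_iff)
 hence zm: "z m < de" using m(2)[of x] d by simp
 have mb: "m : ball x d"
 proof (rule ccontr)
  assume "m ~: ball x d"
  hence nm: "norm (m - x) = d" using m(1) by (auto simp: dist_norm norm_minus_commute)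
  have "w n m > g m - de" using n1[of m] m(1) sub by (force simp: abs_less_iff)
  moreover have "ph m <= g m" using below m(1) sub by blast
  ultimately have "z m > et*d^2 - de" by (simp add: z_def py_def nm)
  thus False using zm de by (simp add: de_def)
 qed
 obtain e where e: "e > 0" "ball m e <= ball x d" using mb openE[OF open_ball] by blast
 have oD: "open (ball x d)" by simp
 have C: "C2 (ball x d) (w n)" "C2 (ball x d) py"
  using C2_subset[OF w oD] C2_subset[OF py oD] sub rh(2) by (meson ball_subset_cball subset_trans)+
 have "lap z m >= 0"
  unfolding z_def[abs_def]
  by (rule lap_nonneg_at_min(2)[OF C2_diff(1)[OF C] mb e(1)]) (use m(2) e in \<open>force simp: z_def\<close>)
 moreover have "lap z m = lap (w n) m - lap py m" unfolding z_def[abs_def] by (rule C2_diff(3)[OF C mb])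
 moreover have "lap (w n) m <= l/8" using n2[of m] mb d by auto
 ultimately show False using lappy[OF mb] pos by (simp add: l_def)
qed

section \<open>Blow-up limits of minimal frequency\<close>

text \<open>A sequence of solutions with strong competition converging uniformly to \<open>(ue, ve)\<close> on the
 ball of radius \<open>1/4\<close>. The number \<open>2*d\<close> is the smallest possible frequency at coincidence points,
 and it is attained in the limit at the origin.\<close>

locale blowup =
 fixes u v :: "nat => 'a::euclidean_space => real" and ka be :: "nat => real" and ue ve :: "'a => real" and d :: real
 assumes dim: "DIM('a) <= 4" and d: "0 < d" "d < 1"
  and sol: "!!n. Sol (ball 0 1) (ka n) (be n) (u n) (v n)"
  and ka1: "!!n. ka n <= 1" and ka0: "ka ----> 0" and beinf: "filterlim be at_top sequentially"
  and cue: "continuous_on (cball 0 (1/4)) ue" and cve: "continuous_on (cball 0 (1/4)) ve"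
  and limu: "uniform_limit (cball 0 (1/4)) u ue sequentially" and limv: "uniform_limit (cball 0 (1/4)) v ve sequentially"
  and up: "!!s ep. 0 < s ==> s < 1 ==> 0 < ep ==> EV n. freq (u n) (v n) 0 s <= 2*d + ep"
  and low: "!!ep. 0 < ep ==> EX K ka0. ka0 > 0 & freq_bound TYPE('a) (d - ep) K ka0"
  and H0: "!!s n. 0 < s ==> s < 1 ==> s^6 <= hgt (u n) (v n) 0 s"
  and uv0: "!!n. u n 0 = v n 0"
begin

abbreviation "H n x r == hgt (u n) (v n) x r"
abbreviation "F n x r == freq (u n) (v n) x r"
abbreviation "He x r == hgt ue ve x r"
abbreviation "B4 == cball (0::'a) (1/4)"

lemma hgt_swap: "hgt f g = hgt g (f :: 'a => real)" by (intro ext) (simp add: hgt_def add.commute)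

lemma freq_swap: "freq f g = freq g (f :: 'a => real)"
 by (intro ext) (simp add: freq_def hgt_swap eng_def add.commute)

lemma blowup_swap: "blowup v u ka be ve ue d"
 unfolding blowup_def hgt_swap[of "v _"] freq_swap[of "v _"]
 using dim d Sol_sym[OF sol] ka1 ka0 beinf cue cve limu limv up low H0 uv0 by auto

text \<open>Coincidence points near a given point may exist for infinitely many indices only; this
  lets the results on convergent centres be applied along those indices.\<close>

lemma blowup_subseq:
 assumes k: "strict_mono k"
 shows "blowup (%n. u (k n)) (%n. v (k n)) (%n. ka (k n)) (%n. be (k n)) ue ve d"
proof -
 have fk: "filterlim k sequentially sequentially" using k by (rule filterlim_subseq)
 show ?thesis
  unfolding blowup_def
 proof (intro conjI allI impI)
  show "(%n. ka (k n)) ----> 0" using filterlim_compose[OF ka0 fk] .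
  show "filterlim (%n. be (k n)) at_top sequentially" using filterlim_compose[OF beinf fk] .
  show "uniform_limit B4 (%n. u (k n)) ue sequentially" using filterlim_compose[OF limu fk] .
  show "uniform_limit B4 (%n. v (k n)) ve sequentially" using filterlim_compose[OF limv fk] .
  show "EV n. F (k n) 0 s <= 2*d + ep" if "0 < s" "s < 1" "0 < ep" for s ep
   using eventually_compose_filterlim[OF up[OF that] fk] .
 qed (use dim d sol ka1 cue cve low H0 uv0 in auto)
qed

lemma in_B4: "norm x + r <= 1/4 ==> 0 <= r ==> norm y <= 1 ==> x + r*.y : B4"
proof -
 assume a: "norm x + r <= 1/4" "0 <= r" "norm y <= 1"
 have "norm (x + r*.y) <= norm x + r*norm y" using norm_triangle_ineq[of x "r*.y"] a by simp
 also have "... <= norm x + r" using a by (simp add: mult_left_le)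
 finally show ?thesis using a by simp
qed

lemma solx: "norm x <= 1/2 ==> Sol (ball x (1/2)) (ka n) (be n) (u n) (v n)"
 by (rule Sol_subset[OF sol]) (auto simp: ball_subset_ball_iff)

lemma ue_nonneg: assumes "x : B4" shows "0 <= ue x" "0 <= ve x"
proof -
 have x1: "x : ball 0 1" using assms by auto
 have "(%n. u n x) ----> ue x" "(%n. v n x) ----> ve x"
  using tendsto_uniform_limitI[OF limu assms] tendsto_uniform_limitI[OF limv assms] by auto
 thus "0 <= ue x" "0 <= ve x"
  using Sol_pos[OF sol x1] by (meson LIMSEQ_le_const less_imp_le)+
qed

lemma comp_cont:
 assumes "norm x + r <= 1/4" "0 <= r"
 shows "cont1 (%y. ue (x + r*.y))" "cont1 (%y. ve (x + r*.y))"
 by (intro continuous_intros continuous_on_compose2[OF cue] continuous_on_compose2[OF cve]; use in_B4[OF assms] in auto)+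

lemma comp_lim:
 assumes x: "z ----> x" "!!n. norm (z n) + r <= 1/4" "norm x + r <= 1/4" "0 <= r"
 shows "uniform_limit (cball 0 1) (%n y. u n (z n + r*.y)) (%y. ue (x + r*.y)) sequentially"
  "uniform_limit (cball 0 1) (%n y. v n (z n + r*.y)) (%y. ve (x + r*.y)) sequentially"
 using in_B4[OF x(2) x(4)] in_B4[OF x(3) x(4)]
 by (intro uniform_limit_compose_affine[OF limu compact_cball cue x(1)]
   uniform_limit_compose_affine[OF limv compact_cball cve x(1)]; blast)+

lemma conv_H:
 assumes x: "z ----> x" "!!n. norm (z n) + r <= 1/4" "norm x + r <= 1/4" "0 <= r"
 shows "(%n. H n (z n) r) ----> He x r"
 unfolding hgt_def wmean_def
proof (rule wint_tendsto)
 show "uniform_limit (cball 0 1) (%n y. (u n (z n + r*.y))^2 + (v n (z n + r*.y))^2)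
  (%y. (ue (x + r*.y))^2 + (ve (x + r*.y))^2) sequentially"
  by (intro uniform_limit_add uniform_limit_square comp_lim comp_cont x compact_cball)
 show "cont1 (%y. (ue (x + r*.y))^2 + (ve (x + r*.y))^2)"
  by (intro continuous_intros comp_cont x)
 fix n
 have "norm (z n) <= 1/2" "|r| < 1/2" using x(2)[of n] x(4) norm_ge_zero[of "z n"] by linarith+
 from Sol_cont[OF solx[OF this(1)] this(2)]
 show "cont1 (%y. (u n (z n + r*.y))^2 + (v n (z n + r*.y))^2)"
  by (intro continuous_intros)
qed

lemma He_nonneg: "0 <= He x r"
 unfolding hgt_def wmean_def by (rule wint_nonneg) simp

lemma He0_pos: assumes "0 < r" "r <= 1/4" shows "0 < He 0 r"
proof -
 have "r^6 <= He 0 r"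
  by (rule LIMSEQ_le_const[OF conv_H[of "%n. 0" 0 r]]) (use assms H0 in auto)
 thus ?thesis using assms by (smt (verit) zero_less_power)
qed

lemma He_pos_large:
 assumes r: "0 < r" "norm x < r/4" "norm x + r < 1/4"
 shows "0 < He x r"
proof -
 define R where "R = 1/4 - norm x"
 have sub: "ball x R <= B4"
 proof
  fix y assume "y : ball x R"
  thus "y : B4" using norm_triangle_ineq2[of y x] by (simp add: R_def dist_norm norm_minus_commute)
 qed
 have "0 < He 0 (r/4)" using r norm_ge_zero[of x] by (intro He0_pos; linarith)
 also have "He 0 (r/4) <= (r/(r/4))^DIM('a)/(1 - (1/2)^2)*He x r"
  unfolding hgt_def
  by (rule wmean_compare[where R = R])
   (use r in \<open>auto simp: R_def intro!: continuous_intros continuous_on_subset[OF cue sub[unfolded R_def]] continuous_on_subset[OF cve sub[unfolded R_def]]\<close>)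
 finally show ?thesis using He_nonneg[of x r] by (cases "He x r = 0") auto
qed

lemma freq_mono_n:
 assumes "norm z <= 1/2" "0 < s" "s <= r" "r < 1/2"
 shows "F n z s <= F n z r + 3/2*ka n*r^2"
proof -
 have "0 <= 3/2*ka n*s^2" using Sol_C2(5)[OF sol] by simp
 thus ?thesis using freq_almost_mono[OF solx[OF assms(1)] dim assms(2-4), of n] by linarith
qed

lemma growth_n:
 assumes z: "norm z <= 1/2" and sr: "0 < s" "s <= r" "r < 1/2"
 shows "H n z r <= (r/s) powr (F n z r + 3/2*ka n*r^2)*H n z s"
  "(r/s) powr (F n z s - 3/2*ka n*r^2)*H n z s <= H n z r"
proof -
 have k0: "0 <= ka n" using Sol_C2(5)[OF sol] .
 show "H n z r <= (r/s) powr (F n z r + 3/2*ka n*r^2)*H n z s"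
  by (rule hgt_growth(2)[OF solx[OF z] dim sr]) (use freq_mono_n[OF z] sr in auto)
 show "(r/s) powr (F n z s - 3/2*ka n*r^2)*H n z s <= H n z r"
 proof (rule hgt_growth(1)[OF solx[OF z] dim sr])
  fix t assume t: "s <= t" "t <= r"
  have "F n z s <= F n z t + 3/2*ka n*t^2" using freq_mono_n[OF z, of s t n] t sr by simp
  moreover have "ka n*t^2 <= ka n*r^2" using t sr k0 by (intro mult_left_mono power_mono) auto
  ultimately show "F n z s - 3/2*ka n*r^2 <= F n z t" by simp
 qed
qed

section \<open>Homogeneity of the blow-up limit\<close>

lemma kappa_lim: "(%n. 3/2*ka n*c) ----> 0"
 using tendsto_mult_right[OF tendsto_mult_left[OF ka0, of "3/2"], of c] by simp

text \<open>If the frequencies at the centres converge to the same number at all small radii, the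
  height of the limit is an exact power of the radius and the bound on the motion of the profile
  tends to 0. The normalised profiles of the limit at two radii therefore agree.\<close>

lemma center:
 assumes z: "z ----> x" "!!n. norm (z n) <= 1/8" "norm x <= 1/8"
  and pos: "!!s. 0 < s ==> s < rh ==> 0 < He x s" and rh: "rh <= 1/32"
  and fr: "!!s. 0 < s ==> s < rh ==> (%n. F n (z n) s) ----> 2*d"
  and sr: "0 < s" "s <= r" "r < rh" and y: "norm y < 1"
 shows "ue (x + r*.y) = (r/s) powr d*ue (x + s*.y) & ve (x + r*.y) = (r/s) powr d*ve (x + s*.y)"
proof -
 have r0: "0 < r" and srh: "s < rh" using sr by auto
 have b: "norm (z n) + r <= 1/4" "norm (z n) + s <= 1/4" "norm x + r <= 1/4" "norm x + s <= 1/4" "norm (z n) <= 1/2" for n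
  using z(2)[of n] z(3) sr rh by auto
 have r2: "r < 1/2" using sr rh by simp
 note Hr = conv_H[OF z(1) b(1,3) less_imp_le[OF r0]] and Hs = conv_H[OF z(1) b(2,4) less_imp_le[OF sr(1)]]
 note Fr = fr[OF r0 sr(3)] and Fs = fr[OF sr(1) srh]
 have rs: "r/s > 0" using sr by simp
 have "(%n. (r/s) powr (F n (z n) r + 3/2*ka n*r^2)*H n (z n) s) ----> (r/s) powr (2*d + 0)*He x s"
  using rs by (intro tendsto_intros Fr kappa_lim Hs) auto
 from LIMSEQ_le[OF Hr this] growth_n(1)[OF b(5) sr(1,2) r2]
 have le: "He x r <= (r/s) powr (2*d)*He x s" by auto
 have "(%n. (r/s) powr (F n (z n) s - 3/2*ka n*r^2)*H n (z n) s) ----> (r/s) powr (2*d - 0)*He x s"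
  using rs by (intro tendsto_intros Fs kappa_lim Hs) auto
 from LIMSEQ_le[OF this Hr] growth_n(2)[OF b(5) sr(1,2) r2]
 have "(r/s) powr (2*d)*He x s <= He x r" by auto
 with le have Hrs: "He x r = (r/s) powr (2*d)*He x s" by simp
 note Hrp = pos[OF r0 sr(3)] and Hsp = pos[OF sr(1) srh]
 let ?Du = "%n y. (u n (z n + r*.y)/sqrt (H n (z n) r) - u n (z n + s*.y)/sqrt (H n (z n) s))^2"
 let ?Dv = "%n y. (v n (z n + r*.y)/sqrt (H n (z n) r) - v n (z n + s*.y)/sqrt (H n (z n) s))^2"
 let ?eu = "%y. (ue (x + r*.y)/sqrt (He x r) - ue (x + s*.y)/sqrt (He x s))^2"
 let ?ev = "%y. (ve (x + r*.y)/sqrt (He x r) - ve (x + s*.y)/sqrt (He x s))^2"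
 have ul: "uniform_limit (cball 0 1) (%n y. f n y/sqrt (h n)) (%y. g y/sqrt c) sequentially"
  if "uniform_limit (cball 0 1) f g sequentially" "cont1 g" "h ----> c" "0 < c"
  for f :: "nat => 'a => real" and g h c
 proof -
  have "(%n. inverse (sqrt (h n))) ----> inverse (sqrt c)" using that by (intro tendsto_intros) auto
  hence "uniform_limit (cball (0::'a) 1) (%n y. inverse (sqrt (h n))) (%y. inverse (sqrt c)) sequentially"
   by (intro uniform_limitI) (auto dest: tendstoD)
  moreover have "bounded (g ` cball 0 1)"
   using compact_continuous_image[OF that(2) compact_cball] compact_imp_bounded by blast
  moreover have "bounded ((%y::'a. inverse (sqrt c)) ` cball 0 1)" by (auto simp: bounded_iff intro: exI[of _ "|inverse (sqrt c)|"])
  ultimately show ?thesis using uniform_lim_mult[OF that(1)] by (simp add: divide_inverse)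
 qed
 note ccx = comp_cont[OF b(3) less_imp_le[OF r0]] comp_cont[OF b(4) less_imp_le[OF sr(1)]]
 note clx = comp_lim[OF z(1) b(1,3) less_imp_le[OF r0]] comp_lim[OF z(1) b(2,4) less_imp_le[OF sr(1)]]
 have ce: "cont1 ?eu" "cont1 ?ev"
  using Hrp Hsp by (auto intro!: continuous_intros ccx)
 have cn: "cont1 (?Du n)" "cont1 (?Dv n)" for n
 proof -
  have a: "|r| < 1/2" "|s| < 1/2" using r2 r0 sr by auto
  have "H n (z n) r > 0" "H n (z n) s > 0" using hgt_pos[OF solx[OF b(5)]] a by auto
  thus "cont1 (?Du n)" "cont1 (?Dv n)"
   by (auto intro!: continuous_intros Sol_cont[OF solx[OF b(5)] a(1)] Sol_cont[OF solx[OF b(5)] a(2)])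
 qed
 have c1: "cont1 (%y. ue (x + r*.y)/sqrt (He x r) - ue (x + s*.y)/sqrt (He x s))"
  "cont1 (%y. ve (x + r*.y)/sqrt (He x r) - ve (x + s*.y)/sqrt (He x s))"
  using Hrp Hsp by (auto intro!: continuous_intros ccx)
 have "(%n. wint 1 (?Du n) + wint 1 (?Dv n)) ----> wint 1 ?eu + wint 1 ?ev"
  by (intro tendsto_add wint_tendsto cn ce uniform_limit_square compact_cball c1 uniform_limit_minus ul clx ccx Hr Hs Hrp Hsp)
 moreover have "(%n. (r/s)*(F n (z n) r - F n (z n) s + 3/2*ka n*(r^2 - s^2))/4) ----> (r/s)*(2*d - 2*d + 0)/4"
  using sr by (intro tendsto_intros Fr Fs kappa_lim) auto
 ultimately have "wint 1 ?eu + wint 1 ?ev <= (r/s)*(2*d - 2*d + 0)/4"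
  by (rule LIMSEQ_le) (use profile_variation[OF solx[OF b(5)] dim sr(1,2) r2] in auto)
 moreover have "0 <= wint 1 ?eu" "0 <= wint 1 ?ev" by (intro wint_nonneg; simp)+
 ultimately have "wint 1 ?eu = 0" "wint 1 ?ev = 0" by simp_all
 hence "?eu y = 0" "?ev y = 0" using wint_eq_0_imp[OF ce(1) _ _ y] wint_eq_0_imp[OF ce(2) _ _ y] by auto
 hence "ue (x + r*.y) = (sqrt (He x r)/sqrt (He x s))*ue (x + s*.y)" "ve (x + r*.y) = (sqrt (He x r)/sqrt (He x s))*ve (x + s*.y)"
  using Hrp Hsp by (auto simp: field_simps)
 moreover have "sqrt (He x r)/sqrt (He x s) = (r/s) powr d"
 proof -
  have "(r/s) powr (2*d) = ((r/s) powr d)^2" unfolding power2_eq_square powr_add[symmetric] by simp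
  thus ?thesis using Hrs Hsp by (simp add: real_sqrt_mult)
 qed
 ultimately show ?thesis by simp
qed

text \<open>Because \<open>be\<close> tends to infinity while the height stays away from 0, every
  competition threshold is eventually passed, and the bound for the exponent \<open>d - ep/2\<close>
  applies.\<close>

lemma freq_lower_at:
 assumes z: "z ----> x" "!!n. norm (z n) <= 1/8" "norm x <= 1/8" and c: "!!n. u n (z n) = v n (z n)"
  and s: "0 < s" "s < 1/16" and pos: "0 < He x s" and ep: "0 < ep"
 shows "EV n. 2*d - ep <= F n (z n) s"
proof -
 obtain K ka' where K: "ka' > 0" "freq_bound TYPE('a) (d - ep/2) K ka'" using low[of "ep/2"] ep by auto
 have b: "norm (z n) + s <= 1/4" "norm x + s <= 1/4" for n using z(2)[of n] z(3) s by auto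
 have "(%n. H n (z n) s) ----> He x s" by (rule conv_H[OF z(1) b]) (use s in simp)
 hence e1: "EV n. He x s/2 < H n (z n) s" by (rule order_tendstoD(1)) (use pos in simp)
 have e2: "EV n. max 0 K/(s^2*(He x s/2)) <= be n"
  using beinf unfolding filterlim_at_top by blast
 have e3: "EV n. ka n < ka'" using ka0 K(1) by (rule order_tendstoD(2))
 show ?thesis
  using e1 e2 e3
 proof eventually_elim
  case (elim n)
  have p: "0 < s^2*(He x s/2)" using s pos by simp
  have "max 0 K <= be n*(s^2*(He x s/2))" using elim(2) p by (simp add: divide_le_eq)
  also have "... <= be n*(s^2*H n (z n) s)"
   using elim(1) Sol_C2(4)[OF sol] by (intro mult_left_mono) (auto intro: less_imp_le)
  finally have "K <= be n*s^2*H n (z n) s" by (simp add: mult.assoc)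
  moreover have "ka n*s^2 <= ka n*1"
   using s Sol_C2(5)[OF sol] by (intro mult_left_mono) (auto simp: power_le_one)
  ultimately have "2*(d - ep/2) <= F n (z n) s"
   using K(2)[unfolded freq_bound_def, rule_format, OF solx _ _ c] z(2)[of n] s elim(3) by auto
  thus ?case by simp
 qed
qed

lemma freq_tendsto:
 fixes f :: "nat => real"
 assumes "!!ep. 0 < ep ==> EV n. l - ep <= f n" "!!ep. 0 < ep ==> EV n. f n <= l + ep"
 shows "f ----> l"
proof (rule tendstoI)
 fix e :: real assume "0 < e"
 hence "EV n. l - e/2 <= f n" "EV n. f n <= l + e/2" using assms[of "e/2"] by auto
 thus "EV n. dist (f n) l < e"
  by eventually_elim (use \<open>0 < e\<close> in \<open>auto simp: dist_real_def abs_if\<close>)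
qed

lemma homogeneous_0:
 assumes "0 < s" "s <= r" "r < 1/32" "norm y < 1"
 shows "ue (r*.y) = (r/s) powr d*ue (s*.y) & ve (r*.y) = (r/s) powr d*ve (s*.y)"
proof -
 have "(%n. F n 0 s) ----> 2*d" if s: "0 < s" "s < 1/32" for s
 proof (rule freq_tendsto)
  show "EV n. 2*d - ep <= F n 0 s" if "0 < ep" for ep
   using freq_lower_at[of "%n. 0" 0 s ep] uv0 s that He0_pos by simp
  show "EV n. F n 0 s <= 2*d + ep" if "0 < ep" for ep
   using up[of s ep] s that by simp
 qed
 thus ?thesis using center[of "%n. 0" 0 "1/32" s r y] He0_pos assms by simp
qed

lemma ue_scale:
 assumes "0 < l" "l <= 1" "norm w < 1/32"
 shows "ue (l*.w) = l powr d*ue w" "ve (l*.w) = l powr d*ve w"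
proof -
 define t where "t = (norm w + 1/32)/2"
 have t: "norm w < t" "t < 1/32" "0 < t" using assms(3) norm_ge_zero[of w] unfolding t_def by (auto intro: add_nonneg_pos)
 have y: "norm ((1/t)*.w) < 1" using t by simp
 have "ue (t*.(1/t)*.w) = (t/(l*t)) powr d*ue ((l*t)*.(1/t)*.w) & ve (t*.(1/t)*.w) = (t/(l*t)) powr d*ve ((l*t)*.(1/t)*.w)"
  by (rule homogeneous_0[OF _ _ t(2) y]) (use t assms in \<open>auto simp: mult_le_cancel_right1\<close>)
 hence "ue w = (1/l) powr d*ue (l*.w)" "ve w = (1/l) powr d*ve (l*.w)" using t by auto
 thus "ue (l*.w) = l powr d*ue w" "ve (l*.w) = l powr d*ve w"
  using assms by (auto simp: powr_divide)
qed

lemma He_scale: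
 assumes l: "0 < l" "l <= 1" and x: "norm x + r < 1/32" "0 <= r"
 shows "He (l*.x) (l*r) = l powr (2*d)*He x r"
proof -
 have "He (l*.x) (l*r) = wint 1 (%y. l powr (2*d)*((ue (x + r*.y))^2 + (ve (x + r*.y))^2))"
  unfolding hgt_def wmean_def
 proof (rule wint_cong)
  fix y :: 'a assume y: "norm y <= 1"
  have "norm (x + r*.y) <= norm x + r*norm y" using norm_triangle_ineq[of x "r*.y"] x by simp
  also have "... <= norm x + r" using y x by (simp add: mult_left_le)
  finally have w: "norm (x + r*.y) < 1/32" using x by simp
  have e: "l*.x + (l*r)*.y = l*.(x + r*.y)" by (simp add: scaleR_add_right)
  have p: "l powr (2*d) = (l powr d)^2" unfolding power2_eq_square powr_add[symmetric] by simp
  show "(ue (l*.x + (l*r)*.y))^2 + (ve (l*.x + (l*r)*.y))^2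
   = l powr (2*d)*((ue (x + r*.y))^2 + (ve (x + r*.y))^2)"
   unfolding e ue_scale[OF l w] p by (simp add: power_mult_distrib distrib_left)
 qed
 thus ?thesis unfolding wint_cmult by (simp add: hgt_def wmean_def)
qed

lemma He_bound: obtains B where "!!x r. norm x + r <= 1/4 ==> 0 <= r ==> He x r <= B"
proof -
 have "continuous_on B4 (%y. (ue y)^2 + (ve y)^2)" by (intro continuous_intros cue cve)
 hence "bounded ((%y. (ue y)^2 + (ve y)^2) ` B4)"
  using compact_continuous_image compact_cball compact_imp_bounded by blast
 then obtain b where b: "!!y. y : B4 ==> (ue y)^2 + (ve y)^2 <= b"
  unfolding bounded_iff by (metis (no_types, lifting) imageI real_norm_def abs_le_D1)
 show thesis
 proof (rule that)
  fix x :: 'a and r :: real assume x: "norm x + r <= 1/4" "0 <= r"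
  show "He x r <= wint 1 (%y::'a. b)"
   unfolding hgt_def wmean_def using b in_B4[OF x]
   by (intro wint_mono continuous_intros comp_cont x) auto
 qed
qed

text \<open>Centres \<open>l*.x\<close> with small \<open>l\<close> see the growth of the homogeneous limit at infinity, so the
 monotone frequency at \<open>x\<close> never exceeds \<open>2*d\<close>.\<close>

lemma He_upper:
 assumes sr: "0 < s" "s <= r" and x: "norm x + r < 1/32"
 shows "He x r <= (r/s) powr (2*d)*He x s"
proof (rule ccontr)
 assume "~ ?thesis"
 hence gt: "(r/s) powr (2*d)*He x s < He x r" by simp
 have rs: "r/s > 0" using sr by simp
 have "((%ep. (r/s) powr (2*d + ep)*He x s) ---> (r/s) powr (2*d + 0)*He x s) (at_right 0)"
  using rs by (intro tendsto_intros) auto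
 hence "\<forall>\<^sub>F ep in at_right 0. (r/s) powr (2*d + ep)*He x s < He x r"
  using gt by (auto dest: order_tendstoD(2))
 then obtain ep where ep: "ep > 0" "(r/s) powr (2*d + ep)*He x s < He x r"
  unfolding eventually_at_right_field by (metis dense field_lbound_gt_zero)
 have Hxr: "He x r > 0" using gt He_nonneg[of x s] by (smt (verit) mult_nonneg_nonneg powr_ge_zero)
 have r0: "0 < r" using sr by simp
 obtain B where B: "!!x r. norm x + r <= 1/4 ==> 0 <= r ==> He x r <= B" using He_bound by blast
 define T where "T = (1/16::real)"
 \<comment> \<open>An excess \<open>ep\<close> in the growth at \<open>x\<close> is copied by
   homogeneity to the centre \<open>l*.x\<close> at radius \<open>l*r\<close>, and monotonicity
   keeps it up to the fixed radius \<open>T\<close>. The factor \<open>l powr (- ep)\<close> is what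
   is left after the height at \<open>l*r\<close> has been scaled back.\<close>
 have key: "(T/r) powr (2*d + ep)*l powr (- ep)*He x r <= B" if l: "0 < l" "l <= 1" for l
 proof -
  let ?x = "l*.x"
  have nx: "norm ?x <= norm x" using l by (simp add: mult_left_le_one_le)
  have x32: "norm x < 1/32" "r < 1/32" "0 <= norm x" using x r0 norm_ge_zero[of x] by linarith+
  have lr: "l*r <= r" "l*s <= l*r" "0 < l*s" "0 < l*r" using l sr r0 by (auto simp: mult_left_le_one_le)
  have b: "norm ?x + l*r <= 1/4" "norm ?x + l*s <= 1/4" "norm ?x + T <= 1/4" "norm ?x <= 1/2"
   using nx x32 lr by (auto simp: T_def)
  have c: "(%n. H n ?x t) ----> He ?x t" if "norm ?x + t <= 1/4" "0 <= t" for t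
   by (rule conv_H[OF tendsto_const that(1) that])
  have "(l*r)/(l*s) = r/s" using l by simp
  have lim1: "(%n. (r/s) powr (2*d + ep)*H n ?x (l*s)) ----> (r/s) powr (2*d + ep)*He ?x (l*s)"
   by (intro tendsto_mult_left c b) (use lr in auto)
  have "He ?x (l*s) = l powr (2*d)*He x s" "He ?x (l*r) = l powr (2*d)*He x r"
   using x sr by (auto intro!: He_scale l)
  hence "(r/s) powr (2*d + ep)*He ?x (l*s) < He ?x (l*r)" and Hl: "He ?x (l*r) = l powr (2*d)*He x r"
   using ep(2) l by (auto simp: mult.left_commute)
  hence ev: "EV n. (r/s) powr (2*d + ep)*H n ?x (l*s) < H n ?x (l*r)"
   using tendsto_diff[OF c[OF b(1)] lim1] lr
    order_tendstoD(1)[of "%n. H n ?x (l*r) - (r/s) powr (2*d + ep)*H n ?x (l*s)" _ sequentially 0] by simp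
  have ev2: "EV n. (T/(l*r)) powr (2*d + ep - 3*ka n*T^2)*H n ?x (l*r) <= H n ?x T"
   using ev
  proof eventually_elim
   case (elim n)
   have k0: "0 <= ka n" using Sol_C2(5)[OF sol] .
   have lrT: "l*r <= T" "T < 1/2" "l*r < 1/2" using lr x32 by (auto simp: T_def)
   have Hs: "H n ?x (l*s) > 0" "H n ?x (l*r) > 0" using hgt_pos[OF solx[OF b(4)]] lr lrT by auto
   have rs1: "1 <= r/s" using sr by simp
   have kT: "3/2*ka n*(l*r)^2 <= 3/2*ka n*T^2" using k0 lr lrT by (intro mult_left_mono power_mono) auto
   \<comment> \<open>Otherwise the growth bound between \<open>l*s\<close> and \<open>l*r\<close>
     would contradict the strict inequality inherited from the limit.\<close>
   have f: "2*d + ep <= F n ?x (l*r) + 3/2*ka n*T^2"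
   proof (rule ccontr)
    assume "~ ?thesis"
    hence "F n ?x (l*r) + 3/2*ka n*(l*r)^2 <= 2*d + ep" using kT by linarith
    hence "(r/s) powr (F n ?x (l*r) + 3/2*ka n*(l*r)^2) <= (r/s) powr (2*d + ep)"
     using rs1 by (rule powr_mono)
    hence "(r/s) powr (F n ?x (l*r) + 3/2*ka n*(l*r)^2)*H n ?x (l*s) <= (r/s) powr (2*d + ep)*H n ?x (l*s)"
     using Hs by (intro mult_right_mono) auto
    moreover have "H n ?x (l*r) <= (r/s) powr (F n ?x (l*r) + 3/2*ka n*(l*r)^2)*H n ?x (l*s)"
     using growth_n(1)[OF b(4) lr(3,2) lrT(3), of n] l by simp
    ultimately show False using elim by linarith
   qed
   have "(T/(l*r)) powr (2*d + ep - 3*ka n*T^2) <= (T/(l*r)) powr (F n ?x (l*r) - 3/2*ka n*T^2)"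
    using f lr lrT by (intro powr_mono) (auto simp: le_divide_eq)
   hence "(T/(l*r)) powr (2*d + ep - 3*ka n*T^2)*H n ?x (l*r) <= (T/(l*r)) powr (F n ?x (l*r) - 3/2*ka n*T^2)*H n ?x (l*r)"
    using Hs by (intro mult_right_mono) auto
   also have "... <= H n ?x T" by (rule growth_n(2)[OF b(4) lr(4) lrT(1,2)])
   finally show ?case .
  qed
  have Tlr: "T/(l*r) > 0" using lr by (simp add: T_def)
  have k3: "(%n. 3*ka n*T^2) ----> 0"
   using tendsto_mult_right[OF tendsto_mult_left[OF ka0, of 3], of "T^2"] by simp
  have "(%n. (T/(l*r)) powr (2*d + ep - 3*ka n*T^2)*H n ?x (l*r)) ----> (T/(l*r)) powr (2*d + ep - 0)*He ?x (l*r)"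
   using Tlr lr by (intro tendsto_intros k3 c b) auto
  from tendsto_le[OF sequentially_bot c[OF b(3)] this ev2]
  have "(T/(l*r)) powr (2*d + ep)*He ?x (l*r) <= He ?x T" by (simp add: T_def)
  also have "... <= B" using b by (intro B) (auto simp: T_def)
  also have "(T/(l*r)) powr (2*d + ep)*He ?x (l*r) = (T/r) powr (2*d + ep)*l powr (- ep)*He x r"
  proof -
   have "(T/(l*r)) powr (2*d + ep) = (T/r) powr (2*d + ep)*l powr (- (2*d + ep))"
   proof -
    have "(T/(l*r)) = (T/r)/l" by simp
    thus ?thesis using powr_divide[of "T/r" l "2*d + ep"] unfolding powr_minus_divide by (simp add: mult.commute)
   qed
   moreover have "l powr (- (2*d + ep))*l powr (2*d) = l powr (- ep)" by (simp add: powr_add[symmetric])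
   ultimately show ?thesis unfolding Hl by (simp add: mult_ac)
  qed
  finally show ?thesis .
 qed
 define A where "A = (T/r) powr (2*d + ep)*He x r"
 have A: "A > 0" unfolding A_def using Hxr r0 by (simp add: T_def)
 have B0: "0 <= B" using key[of 1] Hxr order_trans[OF _ key[of 1]] by simp
 \<comment> \<open>The value with \<open>l powr (- ep) = B/A + 1\<close>, just beyond what the bound
   \<open>B\<close> permits.\<close>
 define l where "l = (B/A + 1) powr (- 1/ep)"
 have BA: "1 <= B/A + 1" using A B0 by simp
 hence l: "0 < l" "l <= 1" using ep(1) powr_mono[of "- 1/ep" 0 "B/A + 1"] by (auto simp: l_def)
 have "l powr (- ep) = B/A + 1" using BA ep(1) by (simp add: l_def powr_powr)
 hence "A*(B/A + 1) <= B" using key[OF l] by (simp add: A_def mult_ac)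
 hence False using A by (simp add: distrib_left)
 thus False by simp
qed

text \<open>The doubling inequality transports positivity from radius \<open>1/64\<close> down to
  every smaller one, so the limit vanishes identically near no point.\<close>

lemma He_pos:
 assumes "norm x < 1/256" "0 < s" "s <= 1/64"
 shows "0 < He x s"
proof -
 have "0 < He x (1/64)" using assms by (intro He_pos_large) auto
 also have "... <= ((1/64)/s) powr (2*d)*He x s" using assms by (intro He_upper) auto
 finally show ?thesis using He_nonneg[of x s] by (cases "He x s = 0") auto
qed

text \<open>The lower bound for the frequency is the one at coincidence points. For the upper bound,
  a frequency above \<open>2*d + ep\<close> at radius \<open>s\<close> would make the height grow
  from \<open>s\<close> to \<open>2*s\<close> faster than the limit allows.\<close>

lemma center_coincidence:
 assumes z: "z ----> x" "!!n. norm (z n) <= 1/8" and x: "norm x < 1/256" and c: "!!n. u n (z n) = v n (z n)"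
  and sr: "0 < s" "s <= r" "r < 1/128" and y: "norm y < 1"
 shows "ue (x + r*.y) = (r/s) powr d*ue (x + s*.y) & ve (x + r*.y) = (r/s) powr d*ve (x + s*.y)"
proof (rule center[OF z _ _ _ _ sr y])
 show "norm x <= 1/8" using x by simp
 show "0 < He x s" if "0 < s" "s < 1/128" for s using He_pos[OF x] that by simp
 fix s :: real assume s: "0 < s" "s < 1/128"
 show "(%n. F n (z n) s) ----> 2*d"
 proof (rule freq_tendsto)
  show "EV n. 2*d - ep <= F n (z n) s" if "0 < ep" for ep
   by (rule freq_lower_at[OF z _ c]) (use x s that He_pos[OF x] in auto)
  fix ep :: real assume ep: "0 < ep"
  have Hp: "0 < He x s" using He_pos[OF x] s by simp
  have b: "norm (z n) + s <= 1/4" "norm (z n) + 2*s <= 1/4" "norm x + s <= 1/4" "norm x + 2*s <= 1/4" "norm (z n) <= 1/2" for n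
   using z(2)[of n] x s by auto
  have "He x (2*s) <= (2*s/s) powr (2*d)*He x s" using s x by (intro He_upper) auto
  also have "... < 2 powr (2*d + ep/2)*He x s" using s ep Hp by simp
  finally have lt: "He x (2*s) < 2 powr (2*d + ep/2)*He x s" .
  have l1: "(%n. H n (z n) (2*s)) ----> He x (2*s)" by (rule conv_H[OF z(1) b(2,4)]) (use s in simp)
  have "(%n. H n (z n) s) ----> He x s" by (rule conv_H[OF z(1) b(1,3)]) (use s in simp)
  hence l2: "(%n. 2 powr (2*d + ep/2)*H n (z n) s) ----> 2 powr (2*d + ep/2)*He x s" by (rule tendsto_mult_left)
  have e1: "EV n. H n (z n) (2*s) < 2 powr (2*d + ep/2)*H n (z n) s"
   using tendsto_diff[OF l2 l1] lt order_tendstoD(1)[of "%n. 2 powr (2*d + ep/2)*H n (z n) s - H n (z n) (2*s)" _ sequentially 0] by simp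
  have e2: "EV n. 3/2*ka n*(2*s)^2 < ep/2" by (rule order_tendstoD(2)[OF kappa_lim]) (use ep in simp)
  show "EV n. F n (z n) s <= 2*d + ep"
   using e1 e2
  proof eventually_elim
   case (elim n)
   have s2: "s <= 2*s" "2*s < 1/2" "|s| < 1/2" using s by auto
   have Hn: "0 < H n (z n) s" using hgt_pos[OF solx[OF b(5)] s2(3)] .
   have "(2*s/s) powr (F n (z n) s - 3/2*ka n*(2*s)^2)*H n (z n) s <= H n (z n) (2*s)"
    by (rule growth_n(2)[OF b(5) s(1) s2(1,2)])
   also note elim(1)
   finally have "2 powr (F n (z n) s - 3/2*ka n*(2*s)^2) < 2 powr (2*d + ep/2)" using Hn s by simp
   hence "F n (z n) s - 3/2*ka n*(2*s)^2 < 2*d + ep/2" by simp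
   thus ?case using elim(2) by linarith
  qed
 qed
qed simp

end

section \<open>Classification of blow-up limits\<close>

lemma C2_powr:
 assumes f: "C2 S f" and pos: "!!x. x : S ==> f x > 0"
 shows "C2 S (%x. f x powr p)"
  "!!x. x : S ==> lap (%x. f x powr p) x = (p*(p - 1)*f x powr (p - 2))*(norm (grad f x))^2 + (p*f x powr (p - 1))*lap f x"
proof -
 let ?d = "%t::real. p*t powr (p - 1)" and ?dd = "%t::real. p*(p - 1)*t powr (p - 2)"
 have 1: "((%t. t powr p) has_real_derivative ?d (f x)) (at (f x))" if "x : S" for x
  using pos[OF that] by (rule has_real_derivative_powr)
 have 2: "(?d has_real_derivative ?dd (f x)) (at (f x))" if "x : S" for x
  using DERIV_cmult[OF has_real_derivative_powr[OF pos[OF that], of "p - 1"], of p] by (simp add: mult.assoc)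
 have 3: "continuous_on (f ` S) ?dd" using pos by (intro continuous_intros) force
 show "C2 S (%x. f x powr p)" using C2_compose(1)[OF f 1 2 3] .
 show "!!x. x : S ==> lap (%x. f x powr p) x = ?dd (f x)*(norm (grad f x))^2 + ?d (f x)*lap f x"
  using C2_compose(2)[OF f 1 2 3] .
qed

lemma power2_powr: "0 < (s::real) ==> (s^2) powr t = s powr (2*t)"
 using powr_powr[of s 2 t] by (simp add: powr_numeral)

text \<open>The homogeneous extension of degree \<open>d\<close> of a function known near \<open>0\<close> only.\<close>

definition hext :: "real => ('a::euclidean_space => real) => 'a => real" where
 "hext d f x = (64*(1 + norm x)) powr d*f ((1/(64*(1 + norm x)))*.x)"

definition homog :: "real => ('a::euclidean_space => real) => bool" where
 "homog d f \<longleftrightarrow> (ALL l w. 0 < l --> l <= 1 --> norm w < 1/32 --> f (l*.w) = l powr d*f w)"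

context
 fixes f :: "'a::euclidean_space => real" and d :: real
 assumes hom: "homog d f" and d: "0 < d"
begin

lemma hom_eq:
 assumes "0 < a" "0 < b" "norm (a*.w) < 1/32" "norm (b*.w) < 1/32"
 shows "a powr (- d)*f (a*.w) = b powr (- d)*f (b*.w)"
proof -
 have *: "a powr (- d)*f (a*.w) = b powr (- d)*f (b*.w)" if "0 < a" "a <= b" "norm (b*.w) < 1/32" for a b
 proof -
  have "f (a*.w) = f ((a/b)*.(b*.w))" using that by simp
  also have "... = (a/b) powr d*f (b*.w)" using that hom[unfolded homog_def, rule_format, of "a/b" "b*.w"] by simp
  also have "(a/b) powr d = a powr d/b powr d" by (rule powr_divide)
  finally show ?thesis using that by (simp add: powr_minus_divide)
 qed
 show ?thesis
 proof (cases "a <= b")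
  case True
  show ?thesis by (rule *[OF assms(1) True assms(4)])
 next
  case False
  thus ?thesis using *[OF assms(2) _ assms(3)] by linarith
 qed
qed

lemma hext_eq:
 assumes "0 < l" "norm (l*.w) < 1/32" shows "hext d f w = l powr (- d)*f (l*.w)"
proof -
 let ?a = "1/(64*(1 + norm w))"
 have p: "0 < 1 + norm w" using norm_ge_zero[of w] by linarith
 have "norm (?a*.w) < 1/32" using p by (simp add: divide_less_eq)
 hence "?a powr (- d)*f (?a*.w) = l powr (- d)*f (l*.w)"
  using assms p by (intro hom_eq) auto
 moreover have "?a powr (- d) = (64*(1 + norm w)) powr d"
  using powr_divide[of 1 "64*(1 + norm w)" d] by (simp add: powr_minus_divide)
 ultimately show ?thesis by (simp add: hext_def)
qed

lemma hext_same: "norm w < 1/32 ==> hext d f w = f w" using hext_eq[of 1 w] by simp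

lemma hext_scale: assumes "0 < t" shows "hext d f (t*.x) = t powr d*hext d f x"
proof -
 let ?l = "1/(64*(1 + norm (t*.x)))"
 have p: "0 < 1 + norm (t*.x)" using norm_ge_zero[of "t*.x"] by linarith
 have n: "norm (?l*.(t*.x)) < 1/32" unfolding norm_scaleR[of ?l] using p by (simp add: divide_less_eq del: norm_scaleR)
 have "hext d f (t*.x) = ?l powr (- d)*f (?l*.(t*.x))" using p by (intro hext_eq n) simp
 moreover have "hext d f x = (?l*t) powr (- d)*f ((?l*t)*.x)" using p assms n by (intro hext_eq) auto
 moreover have "t powr d*(?l*t) powr (- d) = ?l powr (- d)"
  using assms p powr_mult[of ?l t "- d"] by (simp add: powr_minus field_simps)
 ultimately show ?thesis by (simp add: mult.assoc[symmetric])
qed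

lemma hext_0: "hext d f 0 = 0"
proof -
 have "1 < 2 powr d" using d by simp
 moreover have "hext d f 0 = 2 powr d*hext d f 0" using hext_scale[of 2 0] by simp
 ultimately show ?thesis by (metis less_irrefl mult_cancel_right1)
qed

lemma hext_cont: assumes "continuous_on (ball 0 (1/32)) f" shows "continuous_on UNIV (hext d f)"
proof -
 have "isCont (hext d f) x" for x
 proof -
  let ?l = "1/(64*(1 + norm x))"
  have p: "0 < 1 + norm x" using norm_ge_zero[of x] by linarith
  have n: "norm (?l*.y) < 1/32" if "y : ball 0 (2*(1 + norm x))" for y using p that by (simp add: divide_less_eq)
  have "continuous_on (ball 0 (2*(1 + norm x))) (%y. ?l powr (- d)*f (?l*.y))"
   using n by (intro continuous_intros continuous_on_compose2[OF assms]) auto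
  hence "continuous_on (ball 0 (2*(1 + norm x))) (hext d f)"
   by (rule continuous_on_eq) (use hext_eq[of ?l] n p in simp)
  moreover have "x : ball 0 (2*(1 + norm x))" using norm_ge_zero[of x] unfolding mem_ball_0 distrib_left by linarith
  ultimately show ?thesis using open_ball by (simp add: continuous_on_eq_continuous_at del: mem_ball mem_ball_0)
 qed
 thus ?thesis by (simp add: continuous_at_imp_continuous_on)
qed

text \<open>A dilation about \<open>x\<close> followed by the inverse dilation about 0 is a
  translation along \<open>x\<close>. A function homogeneous of the same degree about both points is
  therefore invariant under it; homogeneity about 0 then spreads this from small \<open>q\<close>
  and \<open>ep\<close> to all arguments.\<close>

lemma hext_translate:
 assumes x: "norm x < 1/256"
  and cen: "!!r s y. 0 < s ==> s <= r ==> r < 1/128 ==> norm y < 1 ==> f (x + r*.y) = (r/s) powr d*f (x + s*.y)"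
 shows "hext d f (z + ta*.x) = hext d f z"
proof -
 define et where "et = 1/256 - norm x"
 have et: "0 < et" using x by (simp add: et_def)
 have 1: "hext d f (q - ep*.x) = hext d f q" if q: "norm q < et" and ep: "0 <= ep" "ep < 1/2" for q ep
 proof -
  \<comment> \<open>The factor with \<open>si*ep = si - 1\<close>, so that dilating \<open>q\<close>
    about \<open>x\<close> by \<open>si\<close> gives \<open>si*.(q - ep*.x)\<close>.\<close>
  define si where "si = 1/(1 - ep)"
  have si: "1 <= si" "si < 2" "si*ep = si - 1" using ep by (auto simp: si_def field_simps)
  have qx: "norm (q - x) < 1/256" using norm_triangle_ineq4[of q x] q by (simp add: et_def)
  have e: "x + (si/256)*.(256*.(q - x)) = si*.(q - ep*.x)"
   using si(3) by (simp add: scaleR_diff_right) (simp add: algebra_simps)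
  have "f (x + (si/256)*.(256*.(q - x))) = ((si/256)/(1/256)) powr d*f (x + (1/256)*.(256*.(q - x)))"
   using si qx by (intro cen) (auto simp del: scaleR_diff_right)
  hence f: "f (si*.(q - ep*.x)) = si powr d*f q" unfolding e by (simp add: scaleR_diff_right)
  have "norm (si*.(q - ep*.x)) <= norm x + si*norm (q - x)"
   unfolding e[symmetric] using norm_triangle_ineq[of x "si*.(q - x)"] si by simp
  also have "si*norm (q - x) <= 2*norm (q - x)" using si by (intro mult_right_mono) auto
  finally have n: "norm (si*.(q - ep*.x)) < 1/32" using qx x by linarith
  have "norm q < 1/32" using q norm_ge_zero[of x] unfolding et_def by linarith
  hence "si powr d*hext d f (q - ep*.x) = si powr d*hext d f q"
   using hext_same[OF n] hext_scale[of si "q - ep*.x"] si f hext_same[of q] by simp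
  thus ?thesis using si by simp
 qed
 have 2: "hext d f (z - ta*.x) = hext d f z" if ta: "0 <= ta" for z ta
 proof -
  \<comment> \<open>Scales \<open>z\<close> into the region of the local statement and the
    translation length below 1/2 at the same time.\<close>
  define l where "l = min (et/(2*(1 + norm z))) (1/(4*(1 + ta)))"
  have p: "0 < 1 + norm z" using norm_ge_zero[of z] by linarith
  have l: "0 < l" using et p ta by (simp add: l_def)
  have "l*norm z <= et/(2*(1 + norm z))*norm z" by (intro mult_right_mono) (auto simp: l_def)
  also have "... < et" using p et by (simp add: divide_less_eq)
  finally have a: "norm (l*.z) < et" using l by simp
  have "l*ta <= 1/(4*(1 + ta))*ta" using ta by (intro mult_right_mono) (auto simp: l_def)
  also have "... < 1/2" using ta by (simp add: divide_less_eq)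
  finally have b: "l*ta < 1/2" .
  have "hext d f (l*.(z - ta*.x)) = hext d f (l*.z)"
   using 1[OF a _ b] l ta by (simp add: scaleR_diff_right)
  hence "l powr d*hext d f (z - ta*.x) = l powr d*hext d f z" using hext_scale[OF l] by simp
  thus ?thesis using l by simp
 qed
 show ?thesis
 proof (cases "0 <= ta")
  case True
  show ?thesis using 2[OF True, of "z + ta*.x"] by simp
 next
  case False
  thus ?thesis using 2[of "- ta" z] by simp
 qed
qed

end

definition inv_dirs :: "('a::euclidean_space => real) => ('a => real) => 'a set" where
 "inv_dirs f g = {x. ALL z ta. f (z + ta*.x) = f z & g (z + ta*.x) = g z}"

lemma inv_dirs_swap: "inv_dirs f g = inv_dirs g f" unfolding inv_dirs_def by auto

lemma subspace_inv_dirs: "subspace (inv_dirs f g)"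
 unfolding subspace_def inv_dirs_def
proof (intro conjI ballI allI CollectI)
 fix x y z ta assume "x : {x. ALL z ta. f (z + ta*.x) = f z & g (z + ta*.x) = g z}" "y : {x. ALL z ta. f (z + ta*.x) = f z & g (z + ta*.x) = g z}"
 thus "f (z + ta*.(x + y)) = f z" "g (z + ta*.(x + y)) = g z"
  by (auto simp: scaleR_add_right add.assoc[symmetric])
qed auto

section \<open>The limit away from its invariant directions\<close>

context blowup
begin

abbreviation "L == inv_dirs (hext d ue) (hext d ve)"

lemma hom: "homog d ue" "homog d ve" unfolding homog_def using ue_scale by blast+

lemma ball_sub: "norm x < 1/256 ==> de <= 1/64 ==> ball x de <= B4" "norm x < 1/256 ==> de <= 1/64 ==> ball x de <= ball 0 1"
proof -
 have "norm y <= 1/4" if "norm x < 1/256" "de <= 1/64" "y : ball x de" for y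
  using norm_triangle_ineq2[of y x] that by (simp add: dist_norm norm_minus_commute)
 thus "norm x < 1/256 ==> de <= 1/64 ==> ball x de <= B4" "norm x < 1/256 ==> de <= 1/64 ==> ball x de <= ball 0 1" by fastforce+
qed

lemma sol_ball: "norm x < 1/256 ==> de <= 1/64 ==> Sol (ball x de) (ka n) (be n) (u n) (v n)"
 using Sol_subset[OF sol open_ball ball_sub(2)] .

lemma kappa_small: "0 < de ==> de <= 1/64 ==> ka n*de^2 <= 1"
 using mult_mono[OF ka1[of n], of "de^2" 1] Sol_C2(5)[OF sol] by (simp add: power_le_one)

lemma lim_pt: "y : B4 ==> (%n. u n y) ----> ue y" "y : B4 ==> (%n. v n y) ----> ve y"
 using tendsto_uniform_limitI[OF limu] tendsto_uniform_limitI[OF limv] by auto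

text \<open>A limit of coincidence points is a centre of homogeneity by
  \<open>center_coincidence\<close>, besides the origin, and two centres of homogeneity make the
  connecting direction invariant.\<close>

lemma coincidence_limits_in_L:
 assumes x: "norm x < 1/256" and Z: "!!de. de > 0 ==> \<exists>\<^sub>F n in sequentially. EX z:ball x de. u n z = v n z"
 shows "x : L"
proof -
 let ?P = "%j p. snd p : ball x (1/(16*real (Suc j))) & u (fst p) (snd p) = v (fst p) (snd p)"
 have ex: "EX n z. N < n & ?P j (n, z)" for j N
 proof -
  have "\<exists>\<^sub>F n in sequentially. EX z:ball x (1/(16*real (Suc j))). u n z = v n z" by (rule Z) simp
  then obtain n z where "Suc N <= n" "z : ball x (1/(16*real (Suc j)))" "u n z = v n z"
   unfolding frequently_sequentially by blast
  hence "N < n & ?P j (n, z)" by (simp del: of_nat_Suc)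
  thus ?thesis by blast
 qed
 \<comment> \<open>Indices and points are chosen together, with strictly increasing indices, so that
   the points belong to a subsequence of the blow-up.\<close>
 have "EX f. ALL j. ?P j (f j) & fst (f j) < fst (f (Suc j))"
 proof (rule dependent_nat_choice)
  show "EX p. ?P 0 p" using ex[of 0 0] by blast
  show "EX q. ?P (Suc j) q & fst p < fst q" for p j using ex[of "fst p" "Suc j"] by auto
 qed
 then obtain f where f: "!!j. ?P j (f j)" "!!j. fst (f j) < fst (f (Suc j))" by blast
 let ?k = "%j. fst (f j)" and ?z = "%j. snd (f j)"
 have k: "strict_mono ?k" using f(2) by (simp add: strict_mono_Suc_iff)
 have dz: "dist (?z j) x < 1/16*inverse (real (Suc j))" for j
 proof -
  have "dist (?z j) x < 1/(16*real (Suc j))" using f(1)[of j] by (simp add: dist_commute del: of_nat_Suc)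
  thus ?thesis by (simp only: inverse_eq_divide times_divide_times_eq mult_1)
 qed
 have "(%j. 1/16*inverse (real (Suc j))) ----> 0"
  using tendsto_mult_right_zero[OF LIMSEQ_inverse_real_of_nat] .
 hence "(%j. dist (?z j) x) ----> 0"
  by (rule Lim_null_comparison[rotated]) (use dz in \<open>auto intro!: always_eventually less_imp_le\<close>)
 hence lim: "?z ----> x" using tendsto_dist_iff by blast
 have nz: "norm (?z j) <= 1/8" for j
 proof -
  have "1/16*inverse (real (Suc j)) <= 1/16" by (simp add: inverse_le_1_iff)
  hence "norm (?z j - x) <= 1/16" using dz[of j] unfolding dist_norm by linarith
  thus ?thesis using norm_triangle_ineq2[of "?z j" x] x by linarith
 qed
 note c = blowup.center_coincidence[OF blowup_subseq[OF k] lim nz x]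
 have c': "ue (x + r*.y) = (r/s) powr d*ue (x + s*.y)" "ve (x + r*.y) = (r/s) powr d*ve (x + s*.y)"
  if "0 < s" "s <= r" "r < 1/128" "norm y < 1" for r s y
  using c[OF _ that] f(1) by auto
 show ?thesis
  unfolding inv_dirs_def
  using hext_translate[OF hom(1) d(1) x c'(1)] hext_translate[OF hom(2) d(1) x c'(2)] by auto
qed

lemma not_L_no_coincidence:
 assumes x: "norm x < 1/256" "x ~: L"
 obtains de where "0 < de" "de <= 1/64" "EV n. ALL y:ball x de. u n y ~= v n y"
proof -
 obtain de where de: "de > 0" "EV n. ~ (EX z:ball x de. u n z = v n z)"
 proof -
  obtain de where "de > 0" "~ (\<exists>\<^sub>F n in sequentially. EX z:ball x de. u n z = v n z)"
   using coincidence_limits_in_L[OF x(1)] x(2) by blast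
  thus thesis using that unfolding not_frequently by blast
 qed
 have "EV n. ALL y:ball x (min de (1/64)). u n y ~= v n y"
  using de(2) by eventually_elim auto
 thus thesis using that[of "min de (1/64)"] de(1) by simp
qed

text \<open>The larger component satisfies \<open>lap (u n) y <= La*u n y\<close> with
  \<open>La\<close> independent of \<open>n\<close>, by the Keller-Osserman bound on the other one.
  The mean value inequality then turns a zero of the limit into vanishing near \<open>x\<close>; the
  dominated component vanishes there too, against positivity of the height.\<close>

lemma pos_of_order:
 assumes x: "norm x < 1/256" and de: "0 < de" "de <= 1/64"
  and ord: "\<exists>\<^sub>F n in sequentially. ALL y:ball x de. v n y < u n y"
 shows "0 < ue x"
proof (rule ccontr)
 assume "~ 0 < ue x"
 have xB: "x : B4" using x by simp
 hence ue0: "ue x = 0" using \<open>\<not> 0 < ue x\<close> ue_nonneg(1)[OF xB] by simp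
 define s where "s = de/4"
 define La where "La = ko_const TYPE('a)/de^2 + 2"
 define E where "E = exp (La*s^2/8)*wint 1 (%y::'a. 1)"
 have La: "0 <= La" using ko_const_ge[where 'a='a] by (simp add: La_def)
 have s: "0 < s" "s < de/2" "norm x + s <= 1/4" using de x by (auto simp: s_def)
 have har: "wmean (u n) x s <= u n x*E" if "ALL y:ball x de. v n y < u n y" for n
 proof -
  note sb = sol_ball[OF x de(2), of n]
  have "wmean (u n) x s <= exp (La*s^2/8)*(u n x*wint 1 (%y::'a. 1))"
  proof (rule wmean_le_exp[where R = "de/2"])
   have sub: "ball x (de/2) <= ball x de" using de by auto
   show "C2 (ball x (de/2)) (u n)" using C2_subset[OF Sol_C2(1)[OF sb] _ sub] by simp
   fix y assume y: "y : ball x (de/2)"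
   have yde: "y : ball x de" using y de by auto
   show "0 <= u n y" using Sol_pos(1)[OF sb yde] by simp
   have "be n*(v n y)^2 <= ko_const TYPE('a)/de^2"
    by (rule Sol_keller_osserman[OF sb de(1) kappa_small[OF de]]) (use that y in \<open>auto simp: dist_commute\<close>)
   hence "be n*(v n y)^2*u n y <= ko_const TYPE('a)/de^2*u n y"
    using Sol_pos(1)[OF sb yde] by (intro mult_right_mono) auto
   moreover have "ka n*u n y <= 1*u n y" using Sol_pos(1)[OF sb yde] ka1 by (intro mult_right_mono) auto
   moreover have "lap (u n) y <= be n*u n y*(v n y)^2 + 2*ka n*u n y" using Sol_lap_ge(1)[OF sb yde] by linarith
   ultimately show "lap (u n) y <= La*u n y" unfolding La_def by (simp add: algebra_simps)
  qed (use La s in auto)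
  thus ?thesis by (simp add: E_def mult_ac)
 qed
 have cu: "cont1 (%y. u n (x + s*.y))" for n
  by (rule Sol_cont(1)[OF sol_ball[OF x de(2)]]) (use s de in auto)
 have wl: "(%n. wmean (u n) x s) ----> wmean ue x s"
  unfolding wmean_def
  by (intro wint_tendsto cu comp_cont s comp_lim(1)[OF tendsto_const s(3) s(3)] less_imp_le[OF s(1)])
 have W: "(%n. wmean (u n) x s - u n x*E) ----> wmean ue x s - ue x*E"
  by (intro tendsto_intros wl lim_pt xB)
 have "wmean ue x s <= 0"
 proof (rule ccontr)
  assume "~ wmean ue x s <= 0"
  hence "EV n. 0 < wmean (u n) x s - u n x*E"
   by (intro order_tendstoD(1)[OF W]) (simp add: ue0)
  hence "EV n. ~ (ALL y:ball x de. v n y < u n y)"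
   by eventually_elim (use har in force)
  thus False using ord unfolding not_frequently[symmetric] by simp
 qed
 moreover have nn: "0 <= ue (x + s*.y)" "0 <= ve (x + s*.y)" if "norm y <= 1" for y
  using ue_nonneg in_B4[OF s(3) less_imp_le[OF s(1)] that] by auto
 hence "0 <= wmean ue x s" unfolding wmean_def by (intro wint_nonneg) auto
 ultimately have w0: "wint 1 (%y. ue (x + s*.y)) = 0" by (simp add: wmean_def)
 have u0: "ue (x + s*.y) = 0" if "norm y < 1" for y
  by (rule wint_eq_0_imp[OF comp_cont(1)[OF s(3)] nn(1) w0 that]) (use s in auto)
 have v0: "ve (x + s*.y) = 0" if y: "norm y < 1" for y
 proof (rule ccontr)
  assume "ve (x + s*.y) ~= 0"
  hence "0 < ve (x + s*.y) - ue (x + s*.y)" using nn(2)[of y] y u0[OF y] by simp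
  moreover have yB: "x + s*.y : B4" using in_B4[OF s(3)] s(1) y by simp
  have "(%n. v n (x + s*.y) - u n (x + s*.y)) ----> ve (x + s*.y) - ue (x + s*.y)"
   by (intro tendsto_intros lim_pt yB)
  ultimately have "EV n. 0 < v n (x + s*.y) - u n (x + s*.y)" using order_tendstoD(1) by blast
  moreover have xs: "x + s*.y : ball x de"
   using in_ball_scaled[of s de y x] s de y by simp
  ultimately have "EV n. ~ (ALL y:ball x de. v n y < u n y)"
  proof (elim eventually_mono)
   show "~ (ALL y:ball x de. v n y < u n y)" if "0 < v n (x + s*.y) - u n (x + s*.y)" for n
    using xs that by force
  qed
  thus False using ord unfolding not_frequently[symmetric] by simp
 qed
 have "He x (s/2) = wint 1 (%y::'a. 0)"
  unfolding hgt_def wmean_def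
 proof (rule wint_cong)
  fix y :: 'a assume "norm y <= 1"
  hence "norm ((1/2)*.y) < 1" by simp
  from u0[OF this] v0[OF this] show "(ue (x + (s/2)*.y))^2 + (ve (x + (s/2)*.y))^2 = 0" by simp
 qed
 hence "He x (s/2) = 0" using wint_const[of 1 0, where 'a='a] by simp
 moreover have "0 < He x (s/2)" by (rule He_pos[OF x]) (use s de in auto)
 ultimately show False by simp
qed

lemma frequently_or:
 assumes "EV n. P n \<or> Q n" shows "(\<exists>\<^sub>F n in sequentially. P n) \<or> (\<exists>\<^sub>F n in sequentially. Q n)"
 using assms eventually_frequently[OF sequentially_bot assms] frequently_disj_iff by blast

lemma eventually_ordered:
 assumes x: "norm x < 1/256" and de: "0 < de" "de <= 1/64" and nc: "EV n. ALL y:ball x de. u n y ~= v n y"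
 shows "EV n. (ALL y:ball x de. v n y < u n y) \<or> (ALL y:ball x de. u n y < v n y)"
 using nc by eventually_elim (rule Sol_ordered[OF sol_ball[OF x de(2)]], blast)

lemma positive_off_L:
 assumes x: "norm x < 1/256" "x ~: L" shows "0 < ue x \<or> 0 < ve x"
proof -
 obtain de where de: "0 < de" "de <= 1/64" "EV n. ALL y:ball x de. u n y ~= v n y"
  using not_L_no_coincidence[OF x] .
 from frequently_or[OF eventually_ordered[OF x(1) de]] pos_of_order[OF x(1) de(1,2)]
  blowup.pos_of_order[OF blowup_swap x(1) de(1,2)] show ?thesis by blast
qed

text \<open>Keller-Osserman keeps \<open>be n*(v n y)^2\<close> bounded while \<open>be n\<close>
  tends to infinity.\<close>

lemma dominated_small:
 assumes x: "norm x < 1/256" and de: "0 < de" "de <= 1/64" and ord: "\<exists>\<^sub>F n in sequentially. ALL y:ball x de. v n y < u n y"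
  and y: "dist y x <= de/2"
 shows "ve y = 0"
proof (rule ccontr)
 assume ne: "ve y ~= 0"
 have yb: "y : ball x de" using y de by (simp add: dist_commute)
 hence yB: "y : B4" using ball_sub(1)[OF x de(2)] by blast
 have vy: "0 < ve y" using ne ue_nonneg(2)[OF yB] by simp
 have e1: "EV n. ve y/2 < v n y" by (rule order_tendstoD(1)[OF lim_pt(2)[OF yB]]) (use vy in simp)
 have e2: "EV n. (ko_const TYPE('a)/de^2 + 1)/(ve y/2)^2 <= be n"
  using beinf unfolding filterlim_at_top by blast
 from e1 e2 have "EV n. ~ (ALL y:ball x de. v n y < u n y)"
 proof eventually_elim
  case (elim n)
  show ?case
  proof
   assume o: "ALL y:ball x de. v n y < u n y"
   have "be n*(v n y)^2 <= ko_const TYPE('a)/de^2"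
    by (rule Sol_keller_osserman[OF sol_ball[OF x de(2)] de(1) kappa_small[OF de] _ y]) (use o in auto)
   moreover have "ko_const TYPE('a)/de^2 + 1 <= be n*(ve y/2)^2" using elim(2) vy by (simp add: divide_le_eq)
   moreover have "be n*(ve y/2)^2 <= be n*(v n y)^2"
    using elim(1) vy Sol_C2(4)[OF sol[of n]] by (intro mult_left_mono power_mono) auto
   ultimately show False by linarith
  qed
 qed
 thus False using ord unfolding not_frequently[symmetric] by simp
qed

lemma eventually_dominates:
 assumes x: "norm x < 1/256" and de: "0 < de" "de <= 1/64" and nc: "EV n. ALL y:ball x de. u n y ~= v n y"
  and pos: "0 < ue x"
 shows "EV n. ALL y:ball x de. v n y < u n y"
proof -
 have "~ (\<exists>\<^sub>F n in sequentially. ALL y:ball x de. u n y < v n y)"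
  using blowup.dominated_small[OF blowup_swap x de, of x] pos de by auto
 hence "EV n. ~ (ALL y:ball x de. u n y < v n y)" unfolding not_frequently .
 with eventually_ordered[OF x de nc] show ?thesis by eventually_elim blast
qed

text \<open>Boundedness of \<open>be n*(v n y)^2\<close> alone does not make the coupling small.
  Near a point with \<open>ue x > 0\<close>, however, \<open>u n\<close> stays above a constant
  \<open>c\<close>, so \<open>v n\<close> is a subsolution with absorption of order
  \<open>be n\<close> and decays like \<open>1/be n\<close>. The coupling, quadratic in
  \<open>v n\<close>, is then of order \<open>1/be n\<close>.\<close>

lemma lap_small:
 assumes x: "norm x < 1/256" and de: "0 < de" "de <= 1/64" and ord: "EV n. ALL y:ball x de. v n y < u n y"
  and pos: "0 < ue x"
 obtains rh where "0 < rh" "rh <= de/2" "!!ep. ep > 0 ==> EV n. ALL y:ball x rh. |lap (u n) y| <= ep"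
proof -
 note sub = ball_sub(1)[OF x de(2)]
 have "continuous_on (ball x de) ue" using continuous_on_subset[OF cue sub] .
 hence "isCont ue x" using de by (simp add: continuous_on_eq_continuous_at)
 then obtain e where e: "e > 0" "!!y. dist y x < e ==> dist (ue y) (ue x) < ue x/2"
  using pos unfolding continuous_at_eps_delta by (meson half_gt_zero)
 define rh where "rh = min e de/2"
 have rh: "0 < rh" "2*rh <= e" "2*rh <= de" using e(1) de by (auto simp: rh_def)
 define c where "c = ue x/4"
 have c: "c > 0" using pos by (simp add: c_def)
 have big: "2*c < ue y" if "dist y x < 2*rh" for y
 proof -
  have "|ue y - ue x| < ue x/2" using e(2)[of y] that rh unfolding dist_real_def by linarith
  thus ?thesis unfolding c_def by linarith
 qed
 have "bounded (ue ` B4)" using compact_continuous_image[OF cue compact_cball] compact_imp_bounded by blast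
 then obtain M0 where M0: "!!y. y : B4 ==> |ue y| <= M0" unfolding bounded_iff real_norm_def by blast
 define M where "M = |M0| + c"
 have M: "M > 0" using c by (simp add: M_def)
 define D where "D = 4*DIM('a)*M/(c^2*rh^2)"
 have D: "D >= 0" using M by (simp add: D_def)
 show thesis
 proof (rule that[OF rh(1)])
  show "rh <= de/2" using rh by simp
  fix ep :: real assume ep: "ep > 0"
  have e1: "EV n. ALL y:B4. dist (u n y) (ue y) < c" by (rule uniform_limitD[OF limu c])
  have e2: "EV n. max (4/c^2) (2*M*D^2/ep) <= be n" using beinf unfolding filterlim_at_top by blast
  have e3: "EV n. ka n < ep/(4*M)" by (rule order_tendstoD(2)[OF ka0]) (use ep M in simp)
  show "EV n. ALL y:ball x rh. |lap (u n) y| <= ep"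
   using e1 e2 e3 ord
  proof eventually_elim
   case (elim n)
   note sb = sol_ball[OF x de(2), of n]
   note b0 = Sol_C2(4)[OF sb] and k0 = Sol_C2(5)[OF sb]
   have b1: "4 <= be n*c^2" using elim(2) c by (simp add: divide_le_eq)
   have b2: "2*M*D^2 <= be n*ep" using elim(2) ep by (simp add: divide_le_eq)
   have bd: "c < u n y" "u n y <= M" "v n y <= M" "0 < v n y" if y: "dist y x < 2*rh" for y
   proof -
    have yb: "y : ball x de" using y rh by (simp add: dist_commute)
    have yB: "y : B4" using yb sub by blast
    have "|u n y - ue y| < c" using elim(1) yB by (simp add: dist_real_def)
    thus "c < u n y" "u n y <= M" using big[OF y] M0[OF yB] unfolding M_def by linarith+
    thus "v n y <= M" using elim(4) yb by force
    show "0 < v n y" using Sol_pos(2)[OF sb yb] .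
   qed
   show ?case
   proof
    fix y assume y: "y : ball x rh"
    have yin: "dist z x < 2*rh" if "z : cball y rh" for z
     using that y dist_triangle[of z x y] by (simp add: dist_commute)
    have sub2: "cball y rh <= ball x de" using yin rh by (force simp: dist_commute)
    have "v n y <= 2*DIM('a)*M/((be n*c^2/2)*rh^2)"
    proof (rule subsolution_decay[OF Sol_C2(2)[OF sb] sub2 rh(1)])
     show "v n z <= M" if "z : cball y rh" for z using bd(3)[OF yin[OF that]] .
     show "0 <= M" using M by simp
     show "0 < be n*c^2/2" using b1 by simp
     fix z assume "z : ball y rh"
     hence z: "z : cball y rh" by simp
     note bz = bd[OF yin[OF z]]
     have "be n*c^2 <= be n*(u n z)^2" using bz c b0 by (intro mult_left_mono power_mono) auto
     hence "be n*c^2/2 <= be n*(u n z)^2 - 2*ka n" using b1 ka1[of n] by linarith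
     hence "be n*c^2/2*v n z <= (be n*(u n z)^2 - 2*ka n)*v n z" using bz by (intro mult_right_mono) auto
     also have "... <= lap (v n) z" using Sol_lap_ge(2)[OF sb, of z] z sub2 by (auto simp: left_diff_distrib abs_le_iff)
     finally show "be n*c^2/2*v n z <= lap (v n) z" .
    qed
    also have "... = D/be n" using b0 by (simp add: D_def field_simps)
    finally have vD: "v n y <= D/be n" .
    have yx: "dist y x < 2*rh" "y : ball x de" using y rh by (auto simp: dist_commute)
    note by0 = bd[OF yx(1)]
    have "(v n y)^2 <= (D/be n)^2" using vD by0 by (intro power_mono) auto
    hence "be n*u n y*(v n y)^2 <= be n*M*(D/be n)^2"
     using by0 c b0 M by (intro mult_mono) auto
    also have "... = M*D^2/be n" using b0 by (simp add: power2_eq_square)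
    also have "... <= ep/2" using b2 b0 by (simp add: divide_le_eq mult.commute)
    finally have t1: "be n*u n y*(v n y)^2 <= ep/2" .
    have "2*ka n*u n y <= 2*ka n*M" using by0 k0 by (intro mult_left_mono) auto
    also have "... <= ep/2" using elim(3) M by (simp add: less_divide_eq)
    finally have t2: "2*ka n*u n y <= ep/2" .
    have "0 <= be n*u n y*(v n y)^2" using b0 by0 c by simp
    thus "|lap (u n) y| <= ep" using Sol_lap_ge(1)[OF sb yx(2)] t1 t2 by (simp add: abs_le_iff)
   qed
  qed
 qed
qed

lemma touch_data:
 assumes x: "norm x < 1/256" "x ~: L" "0 < ue x"
 obtains rh where "0 < rh" "rh <= 1/64" "!!y. y : ball x rh ==> ve y = 0"
  "!!ep. ep > 0 ==> EV n. ALL y:ball x rh. |lap (u n) y| <= ep"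
proof -
 obtain de where de: "0 < de" "de <= 1/64" "EV n. ALL y:ball x de. u n y ~= v n y"
  using not_L_no_coincidence[OF x(1,2)] .
 note ord = eventually_dominates[OF x(1) de x(3)]
 obtain rh where rh: "0 < rh" "rh <= de/2" "!!ep. ep > 0 ==> EV n. ALL y:ball x rh. |lap (u n) y| <= ep"
  using lap_small[OF x(1) de(1,2) ord x(3)] by blast
 show thesis
 proof (rule that[OF rh(1) _ _ rh(3)])
  show "rh <= 1/64" using rh de by simp
  show "ve y = 0" if "y : ball x rh" for y
   by (rule dominated_small[OF x(1) de(1,2) eventually_frequently[OF sequentially_bot ord]])
    (use that rh in \<open>auto simp: dist_commute\<close>)
 qed
qed

abbreviation "G x == hext d ue x + hext d ve x"

lemma G_props:
 shows "!!x. 0 <= G x" "!!t x. 0 < t ==> G (t*.x) = t powr d*G x" "G 0 = 0" "continuous_on UNIV G"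
  "!!x. x ~: L ==> 0 < G x" "!!x. norm x < 1/32 ==> G x = ue x + ve x"
proof -
 have sub: "ball 0 (1/32) <= B4" by auto
 show hs: "G (t*.x) = t powr d*G x" if "0 < t" for t x using hext_scale[OF hom(1) d(1) that] hext_scale[OF hom(2) d(1) that] by (simp add: distrib_left)
 show same: "G x = ue x + ve x" if "norm x < 1/32" for x using hext_same[OF hom(1) d(1) that] hext_same[OF hom(2) d(1) that] by simp
 show "G 0 = 0" using hext_0[OF hom(1) d(1)] hext_0[OF hom(2) d(1)] by simp
 show "continuous_on UNIV G"
  by (intro continuous_intros hext_cont hom d continuous_on_subset[OF cue sub] continuous_on_subset[OF cve sub])
 define l where "l x = 1/(512*(1 + norm x))" for x :: 'a
 have p: "0 < 1 + norm x" for x :: 'a using norm_ge_zero[of x] by linarith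
 have l: "0 < l x" "norm (l x*.x) < 1/256" for x using p[of x] by (auto simp: l_def divide_less_eq)
 have G: "l x powr d*G x = ue (l x*.x) + ve (l x*.x)" for x
  using hs[OF l(1)[of x], of x] same[of "l x*.x"] l(2)[of x] by simp
 have lp: "0 < l x powr d" for x using l(1)[of x] by simp
 show "0 <= G x" for x
 proof -
  have "0 <= ue (l x*.x)" "0 <= ve (l x*.x)" using ue_nonneg[of "l x*.x"] l(2)[of x] by auto
  hence "0 <= l x powr d*G x" unfolding G by simp
  thus ?thesis using lp[of x] by (simp add: zero_le_mult_iff)
 qed
 show "0 < G x" if "x ~: L" for x
 proof -
  have "l x*.x ~: L"
  proof
   assume "l x*.x : L"
   hence "(1/l x)*.(l x*.x) : L" using subspace_scale[OF subspace_inv_dirs] by blast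
   thus False using that l(1)[of x] by simp
  qed
  hence "0 < ue (l x*.x) \<or> 0 < ve (l x*.x)" using positive_off_L[OF l(2)] by blast
  moreover have "0 <= ue (l x*.x)" "0 <= ve (l x*.x)" using ue_nonneg[of "l x*.x"] l(2)[of x] by auto
  ultimately have "0 < l x powr d*G x" unfolding G by linarith
  thus ?thesis using lp[of x] by (simp add: zero_less_mult_iff)
 qed
qed

lemma minimum_impossible:
 assumes th: "norm th = 1/512" "!!w. w : L ==> orthogonal th w"
  and min: "!!m. norm m = 1/512 ==> (!!w. w : L ==> orthogonal m w) ==> G th <= G m"
  and pos: "0 < ue th"
 shows False
proof -
 have thL: "th ~: L" using th orthogonal_self[of th] by force
 have thn: "norm th < 1/256" using th(1) by simp
 obtain rh where rh: "0 < rh" "rh <= 1/64" "!!y. y : ball th rh ==> ve y = 0"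
  "!!ep. ep > 0 ==> EV n. ALL y:ball th rh. |lap (u n) y| <= ep"
  using touch_data[OF thn thL pos] by blast
 note sub = ball_sub[OF thn rh(2)]
 have uG: "ue y = G y" if "y : ball th rh" for y
 proof -
  have "norm y < 1/32" using norm_triangle_ineq2[of y th] that rh(2) th(1) by (simp add: dist_norm norm_minus_commute)
  thus ?thesis using G_props(6) rh(3)[OF that] by simp
 qed
 have thb: "th : ball th rh" using rh(1) by simp
 define a where "a = 512*.th"
 have a: "norm a = 1" "th = (1/512)*.a" "th .* a = 1/512" "a .* a = 1"
 proof -
  show "norm a = 1" using th(1) by (simp add: a_def)
  thus "a .* a = 1" by (simp add: norm_eq_1)
  show tha: "th = (1/512)*.a" by (simp add: a_def)
  show "th .* a = 1/512" unfolding tha using \<open>a \<bullet> a = 1\<close> by simp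
 qed
 have aL: "orthogonal a w" if "w : L" for w using th(2)[OF that] by (simp add: a_def orthogonal_def)
 define my where "my = G th*512 powr d"
 have my: "0 < my" "G a = my"
 proof -
  show "0 < my" using G_props(5)[OF thL] by (simp add: my_def)
  show "G a = my" unfolding a_def my_def using G_props(2)[of 512 th] by (simp add: mult.commute)
 qed
 have Gth: "G th = my*(1/512) powr d" by (simp add: my_def powr_divide)
 \<comment> \<open>Reduces values of \<open>G\<close> to the orthogonal complement of
   \<open>L\<close>, where minimality of \<open>th\<close> gives information.\<close>
 have proj: "EX p. (ALL w:L. orthogonal p w) & G x = G p & (ALL e. (ALL w:L. orthogonal e w) --> x .* e = p .* e)" for x
 proof -
  obtain y p where yp: "y : span L" "!!w. w : span L ==> orthogonal p w" "x = y + p"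
   using orthogonal_subspace_decomp_exists[of L x] by blast
  have yL: "y : L" using yp(1) subspace_inv_dirs span_eq_iff by blast
  have "hext d ue (p + 1*.y) = hext d ue p & hext d ve (p + 1*.y) = hext d ve p"
   using yL unfolding inv_dirs_def by blast
  hence "G x = G p" unfolding yp(3) by (simp add: add.commute)
  moreover have "x .* e = p .* e" if "ALL w:L. orthogonal e w" for e
  proof -
   have "y .* e = 0" using that yL unfolding orthogonal_def by (metis inner_commute)
   thus ?thesis unfolding yp(3) by (simp add: inner_add_left)
  qed
  moreover have "ALL w:L. orthogonal p w" using yp(2) span_superset[of L] by blast
  ultimately show ?thesis by blast
 qed
 let ?T = "{x. 0 < x .* a}"
 have oT: "open ?T" by (intro open_Collect_less continuous_intros)
 have thT: "th : ?T" using a by simp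
 have Cu: "C2 (ball 0 1) (u n)" for n using Sol_C2(1)[OF sol] .
 have ul: "uniform_limit (ball th rh) u ue sequentially" using uniform_limit_on_subset[OF limu sub(1)] .
 note Ia = C2_inner[OF oT, where e = a]
 show False
 proof (cases "EX e. norm e = 1 & orthogonal e th & (ALL w:L. orthogonal e w)")
  case True
  then obtain e where e: "norm e = 1" "orthogonal e th" "!!w. w : L ==> orthogonal e w" by blast
  have ea: "e .* a = 0" "e .* e = 1" "th .* e = 0" "a .* e = 0"
   using e by (auto simp: a_def orthogonal_def norm_eq_1 inner_commute)
  \<comment> \<open>The squared length of the projection onto the plane of \<open>a\<close> and
    \<open>e\<close>. Its power \<open>d/2\<close> has Laplacian \<open>d^2\<close> times length to
    the power \<open>d - 2\<close> near \<open>th\<close>, which is positive.\<close>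
  let ?q = "%x. (x .* a)*(x .* a) + (x .* e)*(x .* e)"
  note Ie = C2_inner[OF oT, where e = e]
  note Q1 = C2_mult[OF Ia(1) Ia(1)] and Q2 = C2_mult[OF Ie(1) Ie(1)]
  note Q = C2_add[OF Q1(1) Q2(1)]
  have qp: "0 < ?q x" if "x : ?T" for x using that by (intro add_pos_nonneg) auto
  have P: "C2 ?T (%x. ?q x powr (d/2))" by (rule C2_powr(1)[OF Q(1) qp])
  have l1: "lap (%x. ?q x powr (d/2)) th = (d/2*(d/2 - 1)*?q th powr (d/2 - 2))*(norm (grad ?q th))^2 + (d/2*?q th powr (d/2 - 1))*lap ?q th"
   by (rule C2_powr(2)[OF Q(1) qp thT])
  note Ph = C2_cmult[OF P, where c = my]
  have qth: "?q th = (1/512)^2" using a ea by (simp add: power2_eq_square)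
  have gq: "grad ?q th = (2/512)*.a" unfolding Q(2)[OF thT] Q1(2)[OF thT] Q2(2)[OF thT] Ia(2)[OF thT] Ie(2)[OF thT]
   using a ea by (simp add: scaleR_add_left[symmetric])
  have lq: "lap ?q th = 4" unfolding Q(3)[OF thT] Q1(3)[OF thT] Q2(3)[OF thT] Ia(2,3)[OF thT] Ie(2,3)[OF thT]
   using a ea by simp
  let ?s = "(1/512::real)"
  have powr2: "(?s^2) powr t = ?s powr (2*t)" for t by (rule power2_powr) simp
  have np: "(norm (grad ?q th))^2 = 4*?s powr 2" unfolding gq using a by (simp add: power2_eq_square powr_numeral)
  have "lap (%x. ?q x powr (d/2)) th = (d/2*(d/2 - 1)*?s powr (d - 4))*(4*?s powr 2) + (d/2*?s powr (d - 2))*4"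
  proof -
   have "2*(d/2 - 2) = d - 4" "2*(d/2 - 1) = d - 2" by simp_all
   thus ?thesis unfolding l1 qth lq np powr2 by (simp only:)
  qed
  also have "... = (d/2*(d/2 - 1)*4 + d/2*4)*?s powr (d - 2)"
  proof -
   have "?s powr (d - 4)*?s powr 2 = ?s powr (d - 2)" unfolding powr_add[symmetric] by simp
   thus ?thesis by (simp add: algebra_simps)
  qed
  also have "... = d^2*?s powr (d - 2)" by (simp add: power2_eq_square algebra_simps)
  finally have "lap (%x. ?q x powr (d/2)) th > 0" using d by simp
  hence lap: "lap (%x. my*?q x powr (d/2)) th > 0" unfolding Ph(3)[OF thT] using my(1) by simp
  show False
  proof (rule no_touching_below[OF Cu rh(1) sub(2) ul _ Ph(1) thT _ _ lap])
   show "EV n. ALL y:ball th rh. lap (u n) y <= ep" if "ep > 0" for ep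
    using rh(4)[OF that] by eventually_elim (auto simp: abs_le_iff)
   show "ue th = my*?q th powr (d/2)" unfolding qth powr2 uG[OF thb] Gth by simp
   fix y assume y: "y : ball th rh"
   obtain p where p: "ALL w:L. orthogonal p w" "G y = G p" "!!e. (ALL w:L. orthogonal e w) ==> y .* e = p .* e"
    using proj[of y] by blast
   have "y .* a = p .* a" "y .* e = p .* e" using p(3) aL e(3) by auto
   hence q: "?q y = ?q p" by simp
   \<comment> \<open>Bessel's inequality. Minimality and homogeneity give
     \<open>G p >= my*norm p powr d\<close>, so the barrier stays below the limit, with equality at
     \<open>th\<close>.\<close>
   have qn: "?q p <= (norm p)^2"
   proof -
    let ?r = "p - (p .* a)*.a - (p .* e)*.e"
    have "?r .* ?r = (norm p)^2 - ?q p"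
     unfolding power2_norm_eq_inner inner_diff_left inner_diff_right inner_scaleR_left inner_scaleR_right a(4) ea
     by (simp only: inner_commute[of a p] inner_commute[of e p]) (simp add: algebra_simps)
    thus ?thesis using inner_ge_zero[of ?r] by linarith
   qed
   show "my*?q y powr (d/2) <= ue y"
   proof (cases "p = 0")
    case True
    thus ?thesis unfolding q uG[OF y] p(2) using G_props(3) by simp
   next
    case False
    let ?m = "(1/(512*norm p))*.p"
    have "G th <= G ?m" by (rule min) (use False p(1) in \<open>auto simp: orthogonal_def\<close>)
    moreover have "G p = (512*norm p) powr d*G ?m" using G_props(2)[of "512*norm p" ?m] False by simp
    ultimately have "(512*norm p) powr d*G th <= G p" using mult_left_mono[of "G th" "G ?m" "(512*norm p) powr d"] by simp
    moreover have "(512*norm p) powr d*G th = my*norm p powr d" by (simp add: my_def powr_mult)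
    moreover have "?q p powr (d/2) <= norm p powr d"
    proof -
     have "?q p powr (d/2) <= ((norm p)^2) powr (d/2)" by (intro powr_mono2 qn) (use d in auto)
     also have "... = norm p powr d" using power2_powr[of "norm p" "d/2"] False by simp
     finally show ?thesis .
    qed
    ultimately show ?thesis unfolding q uG[OF y] p(2) using my(1) mult_left_mono[of "?q p powr (d/2)" "norm p powr d" my] by linarith
   qed
  qed
 next
  \<comment> \<open>The complement of \<open>L\<close> is the line spanned by \<open>a\<close>, so
    near \<open>th\<close> the limit equals \<open>my*(x .* a) powr d\<close>. Its negative is
    touched from below by a function whose Laplacian is positive precisely because
    \<open>0 < d\<close> and \<open>d < 1\<close>.\<close>
  case False
  have ap: "0 < x .* a" if "x : ?T" for x using that by simp
  have P: "C2 ?T (%x. (x .* a) powr d)" by (rule C2_powr(1)[OF Ia(1) ap])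
  have l1: "lap (%x. (x .* a) powr d) th = (d*(d - 1)*(th .* a) powr (d - 2))*(norm (grad (%x. x .* a) th))^2 + (d*(th .* a) powr (d - 1))*lap (%x. x .* a) th"
   by (rule C2_powr(2)[OF Ia(1) ap thT])
  note Ph = C2_cmult[OF P, where c = "- my"]
  have "lap (%x. (x .* a) powr d) th = d*(d - 1)*(1/512) powr (d - 2)"
   unfolding l1 using Ia(2,3)[OF thT] a by simp
  hence lap: "lap (%x. - my*(x .* a) powr d) th > 0"
   using Ph(3)[OF thT] my(1) d by (simp add: mult_pos_neg mult_neg_pos mult_less_0_iff)
  have Cm: "C2 (ball 0 1) (%x. (- 1)*u n x)" for n using C2_cmult(1)[OF Cu] .
  have lm: "lap (%x. (- 1)*u n x) y = - lap (u n) y" if "y : ball th rh" for n y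
   using C2_cmult(3)[OF Cu, of y "- 1" n] that sub(2) by auto
  show False
  proof (rule no_touching_below[OF Cm rh(1) sub(2) _ _ Ph(1) thT _ _ lap])
   show "uniform_limit (ball th rh) (%n x. (- 1)*u n x) (%x. - ue x) sequentially"
    using uniform_limit_uminus[OF ul] by simp
   show "EV n. ALL y:ball th rh. lap (%x. (- 1)*u n x) y <= ep" if "ep > 0" for ep
    using rh(4)[OF that] by eventually_elim (use lm in \<open>force simp only: abs_le_iff\<close>)
   have key: "ue y = my*(y .* a) powr d" if y: "y : ball th rh" "y : ?T" for y
   proof -
    obtain p where p: "ALL w:L. orthogonal p w" "G y = G p" "!!e. (ALL w:L. orthogonal e w) ==> y .* e = p .* e"
     using proj[of y] by blast
    have pa: "y .* a = p .* a" using p(3) aL by auto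
    have "p = (p .* a)*.a"
    proof (rule ccontr)
     assume "p ~= (p .* a)*.a"
     hence r0: "p - (p .* a)*.a ~= 0" by simp
     let ?r = "p - (p .* a)*.a"
     have "orthogonal ?r th" unfolding a(2) using a(4) by (simp add: orthogonal_def inner_diff_left)
     moreover have "ALL w:L. orthogonal ?r w" using p(1) aL by (auto simp: orthogonal_def inner_diff_left)
     ultimately have "norm (?r /\<^sub>R norm ?r) = 1 & orthogonal (?r /\<^sub>R norm ?r) th & (ALL w:L. orthogonal (?r /\<^sub>R norm ?r) w)"
      using r0 by (auto simp: orthogonal_def)
     thus False using False by blast
    qed
    hence "G y = G ((p .* a)*.a)" using p(2) by simp
    also have "... = (p .* a) powr d*my" using G_props(2)[of "p .* a" a] y pa my by simp
    finally show ?thesis using uG[OF y(1)] pa by (simp add: mult.commute)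
   qed
   show "- ue th = - my*(th .* a) powr d" using key[OF thb thT] by simp
   show "- my*(y .* a) powr d <= - ue y" if "y : ball th rh" "y : ?T" for y using key[OF that] by simp
  qed
 qed
qed

lemma blowup_impossible: False
proof -
 let ?N = "{m. norm m = 1/512 & (ALL w:L. orthogonal m w)}"
 \<comment> \<open>If every direction were invariant, the limit would equal its value 0 at the
   origin everywhere, against its positive height.\<close>
 have "EX x. x ~: L"
 proof (rule ccontr)
  assume "~ ?thesis"
  hence "hext d ue (0 + 1*.x) = hext d ue 0 & hext d ve (0 + 1*.x) = hext d ve 0" for x
   unfolding inv_dirs_def by blast
  hence G0: "G x = 0" for x using G_props(3) by (metis add_0 scaleR_one)
  have "He 0 (1/64) = wint 1 (%y::'a. 0)"
   unfolding hgt_def wmean_def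
  proof (rule wint_cong)
   fix y :: 'a assume y: "norm y <= 1"
   hence "norm ((1/64)*.y) < 1/32" "(1/64)*.y : B4" by auto
   hence "ue ((1/64)*.y) + ve ((1/64)*.y) = 0" "0 <= ue ((1/64)*.y)" "0 <= ve ((1/64)*.y)"
    using G_props(6)[of "(1/64)*.y"] G0 ue_nonneg by auto
   hence "ue ((1/64)*.y) = 0" "ve ((1/64)*.y) = 0" by linarith+
   thus "(ue (0 + (1/64)*.y))^2 + (ve (0 + (1/64)*.y))^2 = 0" by simp
  qed
  thus False using wint_const[of 1 0, where 'a='a] He0_pos[of "1/64"] by simp
 qed
 then obtain x where x: "x ~: L" by blast
 obtain y p where yp: "y : span L" "!!w. w : span L ==> orthogonal p w" "x = y + p"
  using orthogonal_subspace_decomp_exists[of L x] by blast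
 have "p ~= 0" using x yp(1,3) subspace_inv_dirs span_eq_iff by (metis add.right_neutral)
 hence "(1/(512*norm p))*.p : ?N" using yp(2) span_superset[of L] by (auto simp: orthogonal_def)
 hence ne: "?N ~= {}" by blast
 have "?N = sphere 0 (1/512) \<inter> (\<Inter>w\<in>L. {m. m .* w = 0})" by (auto simp: orthogonal_def)
 moreover have "closed (\<Inter>w\<in>L. {m. m .* w = 0})" by (intro closed_INT ballI closed_Collect_eq continuous_intros)
 ultimately have "compact ?N" using compact_Int_closed[OF compact_sphere] by simp
 moreover have "continuous_on ?N G" using continuous_on_subset[OF G_props(4)] by blast
 ultimately obtain th where th: "th : ?N" "!!m. m : ?N ==> G th <= G m"
  using continuous_attains_inf[OF _ ne] by blast
 have th': "norm th = 1/512" "!!w. w : L ==> orthogonal th w" using th(1) by auto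
 have "th ~: L" using th' orthogonal_self[of th] by force
 then consider "0 < ue th" | "0 < ve th" using positive_off_L[of th] th'(1) by auto
 thus False
 proof cases
  case 1
  show False by (rule minimum_impossible[OF th' _ 1]) (use th(2) in auto)
 next
  case 2
  have sw: "inv_dirs (hext d ve) (hext d ue) = L" by (rule inv_dirs_swap)
  show False
   by (rule blowup.minimum_impossible[OF blowup_swap th'(1) _ _ 2, unfolded sw])
    (use th(2) th'(2) in \<open>auto simp: add.commute\<close>)
 qed
qed

end

section \<open>The frequency bound for every exponent below one\<close>

lemma freq_bound_weaken:
 assumes "freq_bound TYPE('a::euclidean_space) al K ka0" "al' <= al"
 shows "freq_bound TYPE('a) al' K ka0"
 unfolding freq_bound_def
proof (intro allI impI)
 fix x :: 'a and R r ka be u v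
 assume "Sol (ball x R) ka be u v" "0 < r" "r < R" "u x = v x" "K <= be*r^2*hgt u v x r" "ka*r^2 <= ka0"
 hence "2*al <= freq u v x r" using assms(1) unfolding freq_bound_def by blast
 thus "2*al' <= freq u v x r" using assms(2) by linarith
qed

lemma not_freq_bound:
 assumes "~ freq_bound TYPE('a::euclidean_space) a K ka0"
 obtains rh ka be and U V :: "'a::euclidean_space => real"
 where "1 < rh" "Sol (ball 0 rh) ka be U V" "ka <= ka0" "K <= be" "U 0 = V 0" "hgt U V 0 1 = 1" "freq U V 0 1 < 2*a"
proof -
 obtain x :: 'a and R r ka be u v where *: "Sol (ball x R) ka be u v" "0 < r" "r < R" "u x = v x"
  "K <= be*r^2*hgt u v x r" "ka*r^2 <= ka0" "freq u v x r < 2*a"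
  using assms unfolding freq_bound_def by (auto simp: not_le)
 define s where "s = sqrt (hgt u v x r)"
 have h: "0 < hgt u v x r" using hgt_pos[OF *(1), of r] * by simp
 have s: "0 < s" "s^2 = hgt u v x r" using h by (auto simp: s_def)
 have T: "x + r*.y : ball x R" if "y : ball 0 (R/r)" for y
  using that *(2) by (simp add: dist_norm less_divide_eq mult.commute)
 note sol = Sol_rescale[OF *(1,2) s(1) open_ball T]
 have y: "x + r*.(0 + 1*.y) : ball x R" if "norm y <= 1" for y :: 'a
  using in_ball_scaled[of r R y x] that * by simp
 show thesis
 proof (rule that[OF _ sol])
  show "1 < R/r" using * by simp
  show "K <= be*r^2*s^2" using *(5) s by simp
  show "hgt (%y. u (x + r*.y)/s) (%y. v (x + r*.y)/s) 0 1 = 1"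
   using hgt_rescale[OF s(1), of u x r v 0 1] s(2) h by simp
  show "freq (%y. u (x + r*.y)/s) (%y. v (x + r*.y)/s) 0 1 < 2*a"
   using freq_rescale[OF Sol_C2(1,2)[OF *(1)] s(1) y] *(7) by simp
 qed (use * in auto)
qed

lemma equicontinuous_limit:
 fixes u v :: "nat => 'a::euclidean_space => real"
 assumes A: "!!n y. y : cball 0 (1/4) ==> |u n y| <= A & |v n y| <= A" and ga: "0 < ga" and D: "0 < D"
  and eq: "!!n y z. y : cball 0 (1/4) ==> dist y z < 1/16 ==> |u n y - u n z| <= D*dist y z powr ga & |v n y - v n z| <= D*dist y z powr ga"
 obtains ue ve and k :: "nat => nat" where "strict_mono k" "continuous_on (cball 0 (1/4)) ue" "continuous_on (cball 0 (1/4)) ve"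
  "uniform_limit (cball 0 (1/4)) (%n. u (k n)) ue sequentially" "uniform_limit (cball 0 (1/4)) (%n. v (k n)) ve sequentially"
proof -
 have np: "norm (p, q) <= |p| + |q|" for p q :: real using norm_Pair_le[of p q] by simp
 obtain g and k :: "nat => nat" where gk: "continuous_on (cball 0 (1/4)) g" "strict_mono k"
  "!!e. 0 < e ==> EX N. ALL n x. N <= n & x : cball 0 (1/4) --> norm ((u (k n) x, v (k n) x) - g x) < e"
 proof (rule Arzela_Ascoli[of "cball (0::'a) (1/4)" "%n x. (u n x, v n x)" "2*A"])
  show "norm (u n x, v n x) <= 2*A" if "x : cball 0 (1/4)" for n x
   using np[of "u n x" "v n x"] A[OF that, of n] by linarith
  fix x :: 'a and e :: real assume x: "x : cball 0 (1/4)" and e: "0 < e"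
  define de where "de = min (1/16) ((e/(2*D)) powr (1/ga))"
  have ed: "0 < e/(2*D)" using e D by simp
  show "EX d>0. ALL n y. y : cball 0 (1/4) & norm (x - y) < d --> norm ((u n x, v n x) - (u n y, v n y)) < e"
  proof (intro exI conjI allI impI)
   show "0 < de" using e D by (simp add: de_def)
   fix n y assume y: "y : cball 0 (1/4) & norm (x - y) < de"
   have "dist x y powr ga < ((e/(2*D)) powr (1/ga)) powr ga"
    using y ga by (intro powr_less_mono2) (auto simp: de_def dist_norm)
   hence "dist x y powr ga < e/(2*D)" using ed ga by (simp add: powr_powr)
   hence "D*dist x y powr ga < e/2" using D by (simp add: field_simps)
   moreover have "dist x y < 1/16" using y by (simp add: de_def dist_norm)
   ultimately show "norm ((u n x, v n x) - (u n y, v n y)) < e"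
    using eq[OF x, of y n] np[of "u n x - u n y" "v n x - v n y"] unfolding diff_Pair by linarith
  qed
 qed auto
 have ul: "uniform_limit (cball 0 (1/4)) (%n x. (u (k n) x, v (k n) x)) g sequentially"
  unfolding uniform_limit_iff eventually_sequentially dist_norm using gk(3) by blast
 show thesis
 proof (rule that[OF gk(2)])
  show "continuous_on (cball 0 (1/4)) (%x. fst (g x))" "continuous_on (cball 0 (1/4)) (%x. snd (g x))"
   using continuous_on_fst[OF gk(1)] continuous_on_snd[OF gk(1)] .
  show "uniform_limit (cball 0 (1/4)) (%n. u (k n)) (%x. fst (g x)) sequentially"
   using bounded_linear.uniform_limit[OF bounded_linear_fst ul] by simp
  show "uniform_limit (cball 0 (1/4)) (%n. v (k n)) (%x. snd (g x)) sequentially"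
   using bounded_linear.uniform_limit[OF bounded_linear_snd ul] by simp
 qed
qed

text \<open>The supremum \<open>d\<close> of the admissible exponents is positive because a small
  exponent is admissible, and at most \<open>al < 1\<close> if the claim fails. Failure at exponents
  decreasing to \<open>d\<close>, with thresholds tending to infinity and \<open>ka\<close> to 0,
  yields a blow-up sequence.\<close>

theorem freq_bound_all:
 assumes dim: "DIM('a::euclidean_space) <= 4" and al: "al < 1"
 shows "EX K>0. EX ka0>0. freq_bound TYPE('a) al K ka0"
proof (rule ccontr)
 assume neg: "~ ?thesis"
 define A where "A = {a. EX K>0. EX ka0>0. freq_bound TYPE('a) a K ka0}"
 obtain c kas where c: "c > 0" "kas > 0" "kas <= 1" "freq_bound TYPE('a) c 1 kas" using freq_bound_small[OF dim] .
 have cA: "c : A" using c unfolding A_def by (blast intro: zero_less_one)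
 have down: "a' : A" if "a : A" "a' <= a" for a a' using that freq_bound_weaken unfolding A_def by blast
 have alA: "al ~: A" using neg by (simp add: A_def)
 have upal: "a <= al" if "a : A" for a using down[OF that, of al] alA by linarith
 have bA: "bdd_above A" using upal by (rule bdd_aboveI)
 define d where "d = Sup A"
 have d: "0 < d" "d < 1" using cSup_upper[OF cA bA] cSup_least[of A al] upal cA c(1) al unfolding d_def by fastforce+
 have low: "EX K ka0. ka0 > 0 & freq_bound TYPE('a) (d - ep) K ka0" if "0 < ep" for ep
 proof -
  obtain a where "a : A" "d - ep < a" using less_cSup_iff[of A "d - ep"] cA bA \<open>0 < ep\<close> unfolding d_def by auto
  hence "d - ep : A" using down by simp
  thus ?thesis unfolding A_def by blast
 qed
 let ?e = "%n. inverse (real (Suc n))"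
 have nfb: "~ freq_bound TYPE('a) (d + ?e n) (real (Suc n)) (min kas (?e n))" for n
 proof
  assume fb: "freq_bound TYPE('a) (d + ?e n) (real (Suc n)) (min kas (?e n))"
  have "real (Suc n) > 0" "min kas (?e n) > 0" "0 < ?e n" using c(2) by auto
  hence "d + ?e n : A" "0 < ?e n" using fb unfolding A_def by blast+
  thus False using cSup_upper[OF _ bA] unfolding d_def by fastforce
 qed
 have "EX q. case q of (rh, ka, be, U, V) => 1 < rh & Sol (ball (0::'a) rh) ka be U V & ka <= min kas (?e n) & real (Suc n) <= be & U 0 = V 0 &
   hgt U V 0 1 = 1 & freq U V 0 1 < 2*(d + ?e n)" for n
 proof -
  obtain rh ka be and U V :: "'a => real" where *: "1 < rh" "Sol (ball 0 rh) ka be U V" "ka <= min kas (?e n)" "real (Suc n) <= be" "U 0 = V 0"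
   "hgt U V 0 1 = 1" "freq U V 0 1 < 2*(d + ?e n)"
   using not_freq_bound[OF nfb[of n]] .
  show ?thesis by (rule exI[of _ "(rh, ka, be, U, V)"]) (use * in simp)
 qed
 hence "ALL n. EX q. case q of (rh, ka, be, U, V) => 1 < rh & Sol (ball (0::'a) rh) ka be U V & ka <= min kas (?e n) & real (Suc n) <= be & U 0 = V 0 &
   hgt U V 0 1 = 1 & freq U V 0 1 < 2*(d + ?e n)" by blast
 from choice[OF this] obtain q where q: "!!n. case q n of (rh, ka, be, U, V) => 1 < rh & Sol (ball (0::'a) rh) ka be U V & ka <= min kas (?e n) & real (Suc n) <= be & U 0 = V 0 &
   hgt U V 0 1 = 1 & freq U V 0 1 < 2*(d + ?e n)" by blast
 define rh where "rh n = fst (q n)" for n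
 define ka where "ka n = fst (snd (q n))" for n
 define be where "be n = fst (snd (snd (q n)))" for n
 define u where "u n = fst (snd (snd (snd (q n))))" for n
 define v where "v n = snd (snd (snd (snd (q n))))" for n
 have Q: "1 < rh n" "Sol (ball 0 (rh n)) (ka n) (be n) (u n) (v n)" "ka n <= kas" "ka n <= ?e n" "real (Suc n) <= be n" "u n 0 = v n 0"
   "hgt (u n) (v n) 0 1 = 1" "freq (u n) (v n) 0 1 < 2*(d + ?e n)" for n
  using q[of n] unfolding rh_def ka_def be_def u_def v_def by (auto split: prod.splits)
 have k0: "0 <= ka n" "ka n <= 1" for n using Sol_C2(5)[OF Q(2)] Q(3)[of n] c(3) by auto
 define S where "S = sup_const TYPE('a)"
 have S: "S >= 1" unfolding S_def by (rule sup_const_ge)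
 have bd: "u n y <= S" "v n y <= S" if "norm y <= 1/2" for n y
  using Sol_sup_bound[OF Q(2) _ Q(1), of n y] that k0 Q(7) by (auto simp: S_def)
 have sub: "ball x (1/4) <= ball 0 (rh n)" "!!y. y : ball x (1/4) ==> norm y <= 1/2" if "x : cball 0 (1/4)" for x :: 'a and n
 proof -
  show *: "norm y <= 1/2" if "y : ball x (1/4)" for y
   using norm_triangle_ineq2[of y x] that \<open>x \<in> cball 0 (1/4)\<close> by (simp add: dist_norm norm_minus_commute)
  show "ball x (1/4) <= ball 0 (rh n)" using * Q(1)[of n] by fastforce
 qed
 \<comment> \<open>Only this possibly tiny exponent is available for equicontinuity, which suffices
   for Arzela-Ascoli.\<close>
 define ga where "ga = min c 1"
 have ga: "0 < ga" "ga <= 1" using c by (auto simp: ga_def)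
 have "freq_bound TYPE('a) ga 1 kas" by (rule freq_bound_weaken[OF c(4)]) (simp add: ga_def)
 then obtain C where C: "C > 0" "holder_est TYPE('a) ga kas C"
  using holder_est_of_freq_bound[OF dim _ ga _ c(3), of 1] by auto
 define D where "D = C*S*4 powr ga"
 have D: "0 < D" using C S by (simp add: D_def)
 have eq: "|u n y - u n z| <= D*dist y z powr ga & |v n y - v n z| <= D*dist y z powr ga"
  if y: "y : cball 0 (1/4)" and yz: "dist y z < 1/16" for n y z
 proof -
  have sol: "Sol (ball y (1/4)) (ka n) (be n) (u n) (v n)" using Sol_subset[OF Q(2) open_ball sub(1)[OF y]] .
  have kk: "ka n*(1/4)^2 <= kas" using Q(3)[of n] k0(1)[of n] by (simp add: power2_eq_square)
  have b: "u n w <= S & v n w <= S" if "w : ball y (1/4)" for w using bd[OF sub(2)[OF y that]] by simp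
  have in1: "y : ball y ((1/4)/4)" "z : ball y ((1/4)/4)" using yz by auto
  have S0: "0 < S" using S by simp
  note h = holder_est_scaled[OF C(2) sol _ kk S0 b in1]
  have "(dist y z/(1/4)) powr ga = 4 powr ga*dist y z powr ga" using powr_mult[of 4 "dist y z" ga] by (simp add: mult.commute)
  thus ?thesis using h by (simp add: D_def mult.assoc)
 qed
 have bd4: "|u n y| <= S & |v n y| <= S" if "y : cball 0 (1/4)" for n y
 proof -
  have "norm y <= 1/2" "y : ball 0 (rh n)" using that Q(1)[of n] by auto
  thus ?thesis using bd[of y n] Sol_pos[OF Q(2), of y n] by auto
 qed
 obtain ue ve k where lim: "strict_mono (k :: nat => nat)" "continuous_on (cball 0 (1/4)) ue" "continuous_on (cball 0 (1/4)) ve"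
  "uniform_limit (cball 0 (1/4)) (%n. u (k n)) ue sequentially" "uniform_limit (cball 0 (1/4)) (%n. v (k n)) ve sequentially"
  by (rule equicontinuous_limit[of u S v ga D, OF _ ga(1) D]) (use bd4 eq in blast)+
 have fr: "freq (u n) (v n) 0 s <= 2*d + 2*?e n + 3/2*?e n" if s: "0 < s" "s <= 1" for n s
 proof -
  have "0 <= 3/2*ka n*s^2" using k0 by simp
  thus ?thesis using freq_almost_mono[OF Q(2) dim s Q(1), of n] Q(4)[of n] Q(8)[of n] unfolding distrib_left power_one mult_1_right by linarith
 qed
 have e1: "?e n <= 1" for n by (simp add: inverse_le_1_iff)
 have ek: "(%n. ?e (k n)) ----> 0" using LIMSEQ_subseq_LIMSEQ[OF LIMSEQ_inverse_real_of_nat lim(1)] by (simp add: o_def)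
 have "blowup (%n. u (k n)) (%n. v (k n)) (%n. ka (k n)) (%n. be (k n)) ue ve d"
  unfolding blowup_def
 proof (intro conjI allI impI)
  show "Sol (ball 0 1) (ka (k n)) (be (k n)) (u (k n)) (v (k n))" for n
   by (rule Sol_subset[OF Q(2)]) (use Q(1)[of "k n"] in auto)
  show "(%n. ka (k n)) ----> 0"
   by (rule tendsto_sandwich[OF _ _ tendsto_const ek]) (use k0 Q(4) in \<open>auto intro!: always_eventually\<close>)
  show "filterlim (%n. be (k n)) at_top sequentially"
  proof (rule filterlim_at_top_mono[OF filterlim_real_sequentially])
   show "EV n. real n <= be (k n)"
   proof (intro always_eventually allI)
    fix n
    have "real n <= real (Suc (k n))" using seq_suble[OF lim(1), of n] by simp
    thus "real n <= be (k n)" using Q(5)[of "k n"] by linarith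
   qed
  qed
  show "EV n. freq (u (k n)) (v (k n)) 0 s <= 2*d + ep" if s: "0 < s" "s < 1" "0 < ep" for s ep
  proof -
   have "EV n. ?e (k n) < ep/4" by (rule order_tendstoD(2)[OF ek]) (use s in simp)
   thus ?thesis
   proof eventually_elim
    case (elim n)
    thus ?case using fr[OF s(1) less_imp_le[OF s(2)], of "k n"] s(3) by linarith
   qed
  qed
  show "s^6 <= hgt (u (k n)) (v (k n)) 0 s" if s: "0 < s" "s < 1" for s n
  proof -
   \<comment> \<open>The frequency at radius at most 1 is below \<open>2*d + 2 + 3/2\<close>, and
     \<open>d < 1\<close>; hence the power 6 in the nondegeneracy condition.\<close>
   have "freq (u (k n)) (v (k n)) 0 t <= 6" if "s <= t" "t <= 1" for t
    using fr[of t "k n"] e1[of "k n"] d that s by linarith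
   hence "hgt (u (k n)) (v (k n)) 0 1 <= (1/s) powr 6*hgt (u (k n)) (v (k n)) 0 s"
    by (rule hgt_growth(2)[OF Q(2) dim s(1) less_imp_le[OF s(2)] Q(1)])
   also have "(1/s) powr 6 = 1/s^6" using s by (simp add: powr_numeral power_divide)
   finally show ?thesis using s Q(7)[of "k n"] by (simp add: field_simps)
  qed
 qed (use dim d lim k0 Q low in auto)
 thus False by (rule blowup.blowup_impossible)
qed

theorem holder_est_all:
 assumes dim: "DIM('a::euclidean_space) <= 4" and al: "0 < al" "al < 1"
 obtains C ka0 where "C > 0" "0 < ka0" "ka0 <= 1" "holder_est TYPE('a) al ka0 C"
proof -
 obtain K ka1 where K: "K > 0" "ka1 > 0" "freq_bound TYPE('a) al K ka1" using freq_bound_all[OF dim al(2)] by blast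
 have "freq_bound TYPE('a) al K (min ka1 1)" using K(3) unfolding freq_bound_def by auto
 then obtain C where "C > 0" "holder_est TYPE('a) al (min ka1 1) C"
  using holder_est_of_freq_bound[OF dim _ al(1) less_imp_le[OF al(2)] K(1), of "min ka1 1"] by auto
 thus thesis using that[of C "min ka1 1"] K(2) by simp
qed

section \<open>Smooth functions and bumps\<close>

lemma Ck_on_cong:
 assumes "open S" shows "(!!x. x : S ==> f x = g x) ==> Ck_on k S f ==> Ck_on k S g"
proof (induction k arbitrary: f g)
 case 0
 thus ?case using continuous_on_cong[of S S f g] by simp
next
 case (Suc k)
 have D: "(g has_derivative frechet_derivative f (at x)) (at x)" if "x : S" for x
  using Suc.prems(2) that has_derivative_transform_within_open[OF _ assms that Suc.prems(1)] by (auto simp: frechet_derivative_works)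
 have "frechet_derivative f (at x) = frechet_derivative g (at x)" if "x : S" for x
  using frechet_derivative_at[OF D[OF that]] .
 thus ?case using Suc.prems(2) Suc.IH[of "%x. frechet_derivative f (at x) b" "%x. frechet_derivative g (at x) b" for b] D
  by (auto simp: differentiable_def)
qed

lemma Ck_on_SucI:
 assumes "open S" "!!x. x : S ==> (f has_derivative D x) (at x)" "!!b. b : Basis ==> Ck_on k S (%x. D x b)"
 shows "Ck_on (Suc k) S f"
proof -
 have "Ck_on k S (%x. frechet_derivative f (at x) b)" if "b : Basis" for b
  using Ck_on_cong[OF assms(1) _ assms(3)[OF that]] frechet_derivative_at[OF assms(2)] by simp
 thus ?thesis using assms(2) by (auto simp: differentiable_def)
qed

lemma Ck_on_SucD:
 assumes "Ck_on (Suc k) S f"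
 shows "!!x. x : S ==> (f has_derivative frechet_derivative f (at x)) (at x)" "!!b. b : Basis ==> Ck_on k S (%x. frechet_derivative f (at x) b)"
 using assms by (auto simp: frechet_derivative_works)

lemma Ck_on_Suc_imp: "Ck_on (Suc k) S f ==> Ck_on k S f"
proof (induction k arbitrary: f)
 case 0
 hence "isCont f x" if "x : S" for x using that Ck_on_SucD(1) has_derivative_continuous by blast
 thus ?case by (simp add: continuous_at_imp_continuous_on)
next
 case (Suc k)
 show ?case using Suc.prems Suc.IH by (simp only: Ck_on.simps(2)[of "Suc k"] Ck_on.simps(2)[of k S f]) blast
qed

lemma Ck_on_const: "open S ==> Ck_on k S (%x. c)"
 by (induction k arbitrary: c) (auto intro!: Ck_on_SucI[where D = "%x h. 0"])

lemma Ck_on_inner: "open S ==> Ck_on k S (%x. x .* e)"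
proof (cases k)
 case (Suc j)
 thus "open S ==> Ck_on k S (%x. x .* e)"
  by (auto simp del: Ck_on.simps intro!: Ck_on_SucI[where D = "%x h. h .* e"] Ck_on_const derivative_eq_intros)
qed (auto intro!: continuous_intros)

lemma Ck_on_add:
 assumes "open S" shows "Ck_on k S f ==> Ck_on k S g ==> Ck_on k S (%x. f x + g x)"
proof (induction k arbitrary: f g)
 case (Suc k)
 show ?case
  by (rule Ck_on_SucI[OF assms has_derivative_add[OF Ck_on_SucD(1)[OF Suc.prems(1)] Ck_on_SucD(1)[OF Suc.prems(2)]]])
   (use Suc.IH Ck_on_SucD(2)[OF Suc.prems(1)] Ck_on_SucD(2)[OF Suc.prems(2)] in auto)
qed (auto intro: continuous_intros)

lemma Ck_on_mult:
 assumes "open S" shows "Ck_on k S f ==> Ck_on k S g ==> Ck_on k S (%x. f x*g x)"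
proof (induction k arbitrary: f g)
 case (Suc k)
 show ?case
  by (rule Ck_on_SucI[OF assms has_derivative_mult[OF Ck_on_SucD(1)[OF Suc.prems(1)] Ck_on_SucD(1)[OF Suc.prems(2)]]])
   (use Suc.IH Ck_on_SucD(2)[OF Suc.prems(1)] Ck_on_SucD(2)[OF Suc.prems(2)] Suc.prems[THEN Ck_on_Suc_imp] in \<open>auto intro!: Ck_on_add assms\<close>)
qed (auto intro: continuous_intros)

text \<open>Carrying the whole sequence of derivatives lets the induction for compositions pass from
  \<open>G j\<close> to \<open>G (Suc j)\<close>.\<close>

definition smooth1 :: "(real => real) => bool" where
 "smooth1 g \<longleftrightarrow> (EX G. G 0 = g & (ALL k t. (G k has_real_derivative G (Suc k) t) (at t)))"

lemma Ck_on_compose: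
 assumes "open S" "smooth1 g" "Ck_on k S f" shows "Ck_on k S (%x. g (f x))"
proof -
 obtain G where G: "G 0 = g" "!!k t. (G k has_real_derivative G (Suc k) t) (at t)" using assms(2) unfolding smooth1_def by blast
 have "Ck_on k S f ==> Ck_on k S (%x. G j (f x))" for j
 proof (induction k arbitrary: j)
  case 0
  have "continuous_on UNIV (G j)" by (intro DERIV_continuous_on) (use G(2) in blast)
  thus ?case using 0 by (auto intro: continuous_on_compose2)
 next
  case (Suc k)
  note f = Ck_on_SucD[OF Suc.prems]
  show ?case
   by (rule Ck_on_SucI[OF assms(1) has_derivative_compose[OF f(1) G(2)[of j, unfolded has_field_derivative_def]]])
    (auto intro!: Ck_on_mult Suc.IH f(2) assms(1) Ck_on_Suc_imp[OF Suc.prems])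
 qed
 from this[of 0] assms(3) G(1) show ?thesis by simp
qed

lemma Ck_on_local:
 assumes "!!x. x : S ==> EX T. open T & x : T & Ck_on k T f" shows "Ck_on k S f"
 using assms
proof (induction k arbitrary: f)
 case 0
 have "isCont f x" if "x : S" for x using 0[OF that] continuous_on_eq_continuous_at by auto
 thus ?case by (simp add: continuous_at_imp_continuous_on)
next
 case (Suc k)
 show ?case
  unfolding Ck_on.simps
 proof (intro conjI ballI)
  show "f differentiable at x" if "x : S" for x using Suc.prems[OF that] by auto
  show "Ck_on k S (%x. frechet_derivative f (at x) b)" if "b : Basis" for b
   by (rule Suc.IH) (use Suc.prems that in fastforce)
 qed
qed

lemma Ck_on_norm2: "open S ==> Ck_on k S (%x. (norm (x - p))^2)"
proof (cases k)
 case (Suc j)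
 assume S: "open S"
 have "((%x. (norm (x - p))^2) has_derivative (%h. 2*((x - p) .* h))) (at x)" for x
  unfolding power2_norm_eq_inner by (auto intro!: derivative_eq_intros simp: inner_commute)
 moreover have "Ck_on j S (%x. 2*((x - p) .* b))" for b
  using Ck_on_mult[OF S Ck_on_const[OF S] Ck_on_add[OF S Ck_on_inner[OF S] Ck_on_const[OF S]], of j 2 b "- (p .* b)"]
  by (simp add: inner_diff_left)
 ultimately show ?thesis unfolding Suc using Ck_on_SucI[OF S, of "%x. (norm (x - p))^2" "%x h. 2*((x - p) .* h)" j] by blast
qed (auto intro!: continuous_intros)

lemma Ck_on_C2:
 assumes S: "open S" and f: "Ck_on 2 S f"
 shows "C2 S f" "!!x b. x : S ==> frechet_derivative f (at x) b = grad f x .* b"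
  "!!x. x : S ==> lap f x = (SUM b:Basis. frechet_derivative (%y. frechet_derivative f (at y) b) (at x) b)"
proof -
 let ?D = "%b x. frechet_derivative f (at x) b"
 let ?G = "%x. SUM b:Basis. ?D b x*.b" and ?K = "%x h. SUM b:Basis. frechet_derivative (?D b) (at x) h*.b"
 note f1 = Ck_on_SucD[OF f[unfolded numeral_2_eq_2]]
 note d2 = Ck_on_SucD(1)[OF f1(2)] and c2 = Ck_on_SucD(2)[OF f1(2), unfolded Ck_on.simps]
 have lin: "L h = (SUM c:Basis. (h .* c)*L c)" if "linear L" for L :: "'a => real" and h
 proof -
  have "L h = L (SUM c:Basis. (h .* c)*.c)" by (simp add: euclidean_representation)
  thus ?thesis using that by (simp add: linear_sum linear_scale)
 qed
 have Gb: "?D h x = ?G x .* h" if "x : S" for x h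
  using lin[OF has_derivative_linear[OF f1(1)[OF that]], of h] unfolding inner_sum_left inner_scaleR_left by (simp add: mult.commute inner_commute[of h])
 have 1: "(f has_derivative (%h. ?G x .* h)) (at x)" if "x : S" for x
  using f1(1)[OF that] Gb[OF that] by (metis (no_types, lifting) ext)
 have 2: "(?G has_derivative ?K x) (at x)" if "x : S" for x
  by (intro has_derivative_sum has_derivative_scaleR_left d2 that)
 have 3: "continuous_on S (%x. ?K x h)" for h
 proof -
  have "continuous_on S (%x. frechet_derivative (?D b) (at x) h)" if b: "b : Basis" for b
  proof (rule continuous_on_eq)
   show "continuous_on S (%x. SUM c:Basis. (h .* c)*frechet_derivative (?D b) (at x) c)" by (intro continuous_intros c2 b)
   show "!!x. x : S ==> (SUM c:Basis. (h .* c)*frechet_derivative (?D b) (at x) c) = frechet_derivative (?D b) (at x) h"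
    using lin[OF has_derivative_linear[OF d2[OF b]]] by simp
  qed
  thus ?thesis by (intro continuous_intros)
 qed
 note A = C2I[OF S 1 2 3]
 show "C2 S f" by (rule A)
 show "frechet_derivative f (at x) b = grad f x .* b" if "x : S" for x b using A(2) Gb that by metis
 show "lap f x = (SUM b:Basis. frechet_derivative (?D b) (at x) b)" if "x : S" for x
  by (simp add: lap_def A(3)[OF _ _ that] inner_sum_left inner_Basis if_distrib cong: if_cong)
qed

text \<open>These functions are closed under differentiation: the polynomial \<open>p\<close>
  becomes \<open>p - pderiv p\<close> times the square of the variable. Smoothness of the classical
  exponential bump follows by iteration, with one limit at 0 for all orders.\<close>

definition flat :: "real poly => real => real" where
 "flat p t = (if 0 < t then poly p (1/t)*exp (- (1/t)) else 0)"

lemma flat_lim: "(flat p ---> 0) (at_right 0)"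
proof -
 have "((%s::real. SUM i<=degree p. coeff p i*(s^i/exp s)) ---> 0) at_top"
  by (intro tendsto_null_sum tendsto_mult_right_zero tendsto_power_div_exp_0)
 hence "((%s. poly p s*exp (- s)) ---> 0) at_top"
  by (simp add: poly_altdef sum_distrib_right exp_minus divide_inverse mult.assoc)
 from filterlim_compose[OF this filterlim_inverse_at_top_right]
 have "((%t. poly p (inverse t)*exp (- inverse t)) ---> 0) (at_right 0)" .
 moreover have "\<forall>\<^sub>F t in at_right 0. poly p (inverse t)*exp (- inverse t) = flat p t"
  using eventually_at_right_less[of "0::real"] by eventually_elim (simp add: flat_def inverse_eq_divide)
 ultimately show ?thesis using tendsto_cong by fast
qed

lemma flat_deriv: "(flat p has_real_derivative flat (pCons 0 (pCons 0 (p - pderiv p))) t) (at t)"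
proof -
 consider "t < 0" | "t = 0" | "0 < t" by linarith
 thus ?thesis
 proof cases
  case 1
  have "((%t. 0) has_real_derivative 0) (at t)" by simp
  hence "(flat p has_real_derivative 0) (at t)"
   by (rule has_field_derivative_transform_within[where d = "- t"]) (use 1 in \<open>auto simp: flat_def dist_real_def\<close>)
  thus ?thesis using 1 by (simp add: flat_def)
 next
  case 2
  have "\<forall>\<^sub>F h in at_right 0. flat (pCons 0 p) h = (flat p (0 + h) - flat p 0)/h"
   using eventually_at_right_less[of "0::real"] by eventually_elim (simp add: flat_def)
  with flat_lim[of "pCons 0 p"] have R: "((%h. (flat p (0 + h) - flat p 0)/h) ---> 0) (at_right 0)" using tendsto_cong by fast
  have "\<forall>\<^sub>F h in at_left (0::real). 0 = (flat p (0 + h) - flat p 0)/h"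
   using eventually_at_left_real[of "-1" 0] by (auto elim!: eventually_mono simp: flat_def)
  hence "((%h. (flat p (0 + h) - flat p 0)/h) ---> 0) (at_left 0)" by (rule tendsto_eventually[OF eventually_mono]) simp
  with R have "(flat p has_real_derivative 0) (at 0)"
   unfolding has_field_derivative_iff by (simp add: filterlim_split_at_real)
  thus ?thesis using 2 by (simp add: flat_def)
 next
  case 3
  have "((%t. poly p (1/t)*exp (- (1/t))) has_real_derivative flat (pCons 0 (pCons 0 (p - pderiv p))) t) (at t)"
   using 3 by (auto intro!: derivative_eq_intros DERIV_chain2[OF poly_DERIV] simp: flat_def field_simps power2_eq_square)
  thus ?thesis
   by (rule has_field_derivative_transform_within[where d = t]) (use 3 in \<open>auto simp: flat_def dist_real_def abs_less_iff\<close>)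
 qed
qed

abbreviation "bump == flat 1"
abbreviation "bump' == flat (pCons 0 (pCons 0 1))"

lemma smooth1_bump: "smooth1 bump"
proof -
 define P where "P k = ((%p. pCons 0 (pCons 0 (p - pderiv p))) ^^ k) (1 :: real poly)" for k :: nat
 have "flat (P 0) = bump & (ALL k t. (flat (P k) has_real_derivative flat (P (Suc k)) t) (at t))"
  using flat_deriv by (simp add: P_def)
 thus ?thesis unfolding smooth1_def by (intro exI[of _ "%k. flat (P k)"]) simp
qed

lemma bump_deriv: "(bump has_real_derivative bump' t) (at t)" using flat_deriv[of 1 t] by simp

lemma bump_range: "0 <= bump t" "bump t <= 1" "bump t = 0 \<longleftrightarrow> t <= 0" "0 < t ==> 0 < bump t" by (auto simp: flat_def)

lemma bump'_range: "0 <= bump' t" "bump' t <= 2"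
proof -
 show "0 <= bump' t" by (auto simp: flat_def)
 have "bump' t <= 2" if "0 < t"
 proof -
  have "(1/t)^2/2 <= exp (1/t)" using exp_lower_Taylor_quadratic[of "1/t"] divide_nonneg_pos[of 1 t] that by linarith
  hence "(1/t)^2*exp (- (1/t)) <= 2" by (simp add: exp_minus divide_inverse[symmetric] divide_le_eq)
  thus ?thesis using that by (simp add: flat_def power2_eq_square mult.assoc)
 qed
 thus "bump' t <= 2" by (cases "0 < t") (auto simp: flat_def)
qed

lemma bump_lipschitz: "|bump s - bump t| <= 2*|s - t|"
proof -
 have "norm (bump s - bump t) <= 2*norm (s - t)"
  by (rule field_differentiable_bound[of UNIV bump bump']) (use bump_deriv bump'_range in auto)
 thus ?thesis by simp
qed

lemma smooth1_exp: "smooth1 (%t. exp (c*t))"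
 unfolding smooth1_def
proof (intro exI[of _ "%k t. c^k*exp (c*t)"] conjI allI)
 show "((%t. c^k*exp (c*t)) has_real_derivative c^Suc k*exp (c*t)) (at t)" for k t
  by (auto intro!: derivative_eq_intros)
qed simp

section \<open>Test functions and mollification\<close>

lemma Ck_on_translate: "Ck_on k UNIV f ==> Ck_on k UNIV (%y. f (y + a))"
proof (induction k arbitrary: f)
 case (Suc k)
 have "((%y. f (y + a)) has_derivative (%h. frechet_derivative f (at (x + a)) h)) (at x)" for x
  by (rule has_derivative_compose[OF _ Ck_on_SucD(1)[OF Suc.prems UNIV_I]]) (auto intro!: derivative_eq_intros)
 thus ?case using Ck_on_SucI[OF open_UNIV, of "%y. f (y + a)" "%x. frechet_derivative f (at (x + a))" k]
   Suc.IH[OF Ck_on_SucD(2)[OF Suc.prems]] by blast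
next
 case 0
 hence "continuous_on UNIV f" by simp
 moreover have "continuous_on UNIV (%y. y + a)" by (intro continuous_intros)
 ultimately show ?case using continuous_on_compose2[of UNIV f UNIV "%y. y + a"] by simp
qed

definition supp :: "('a::euclidean_space => real) => 'a set" where "supp f = closure {x. f x ~= 0}"

lemma notin_supp: "x ~: supp f ==> f x = 0"
 unfolding supp_def using closure_subset[of "{x. f x ~= 0}"] by auto

lemma testD:
 assumes "ph : test_functions Om"
 shows "Ck_on k UNIV ph" "C2 UNIV ph" "continuous_on UNIV ph" "!!b. frechet_derivative ph (at x) b = grad ph x .* b"
  "x ~: supp ph ==> ph x = 0 & grad ph x = 0" "compact (supp ph)" "supp ph <= Om"
proof -
 show C: "Ck_on k UNIV ph" for k using assms by (simp add: test_functions_def smooth_on_def)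
 show C2: "C2 UNIV ph" "!!b. frechet_derivative ph (at x) b = grad ph x .* b" for x using Ck_on_C2[OF open_UNIV C] by auto
 show "continuous_on UNIV ph" using C[of 0] by simp
 show "compact (supp ph)" "supp ph <= Om" using assms by (auto simp: test_functions_def supp_def)
 show "ph x = 0 & grad ph x = 0" if x: "x ~: supp ph" for x
 proof -
  have "((%x. 0::real) has_derivative (%h. 0)) (at x)" by simp
  moreover have "open (- supp ph)" by (simp add: supp_def open_Compl)
  moreover have "x : - supp ph" using x by simp
  moreover have "0 = ph y" if "y : - supp ph" for y using notin_supp[of y ph] that by simp
  ultimately have "(ph has_derivative (%h. 0)) (at x)" by (rule has_derivative_transform_within_open)
  hence "grad ph x = 0" using grad_eqI[of ph 0 x] by simp
  thus ?thesis using notin_supp[OF x] by simp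
 qed
qed

lemma testI:
 assumes "!!k. Ck_on k UNIV py" "!!x. x ~: K ==> py x = 0" "compact K" "K <= Om"
 shows "py : test_functions Om"
proof -
 have "supp py <= K" unfolding supp_def using assms(2) by (intro closure_minimal compact_imp_closed assms(3)) auto
 moreover from this have "compact (supp py)"
  using bounded_subset[OF compact_imp_bounded[OF assms(3)]] by (simp add: supp_def compact_eq_bounded_closed)
 ultimately show ?thesis using assms(1,4) unfolding test_functions_def smooth_on_def supp_def by auto
qed

lemma test_deriv:
 assumes "ph : test_functions Om" "b : Basis" shows "(%x. grad ph x .* b) : test_functions Om"
proof (rule testI[OF _ _ testD(6,7)[OF assms(1)]])
 show "Ck_on k UNIV (%x. grad ph x .* b)" for k
  using Ck_on_SucD(2)[OF testD(1)[OF assms(1)] assms(2), of k] testD(4)[OF assms(1)] by simp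
 show "grad ph x .* b = 0" if "x ~: supp ph" for x using testD(5)[OF assms(1) that] by simp
qed

lemma test_mult:
 assumes "ph : test_functions Om" "!!k. Ck_on k UNIV py" shows "(%x. ph x*py x) : test_functions Om"
proof (rule testI[OF _ _ testD(6,7)[OF assms(1)]])
 show "Ck_on k UNIV (%x. ph x*py x)" for k using Ck_on_mult[OF open_UNIV testD(1)[OF assms(1)] assms(2)] .
 show "ph x*py x = 0" if "x ~: supp ph" for x using notin_supp[OF that] by simp
qed

lemma test_translate:
 assumes "g : test_functions UNIV" "!!y. g (y - x) ~= 0 ==> y : K" "compact K" "K <= Om"
 shows "(%y. g (y - x)) : test_functions Om"
proof (rule testI[OF _ _ assms(3,4)])
 show "Ck_on k UNIV (%y. g (y - x))" for k using Ck_on_translate[OF testD(1)[OF assms(1)], of k "- x"] by simp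
qed (use assms(2) in blast)

lemma test_lap:
 assumes "ph : test_functions Om" shows "lap ph x = (SUM b:Basis. grad (%y. grad ph y .* b) x .* b)"
proof -
 have "(%y. frechet_derivative ph (at y) b) = (%y. grad ph y .* b)" for b using testD(4)[OF assms] by blast
 thus ?thesis using Ck_on_C2(3)[OF open_UNIV testD(1)[OF assms] UNIV_I, of x] testD(4)[OF test_deriv[OF assms]] by simp
qed

lemma cc_bounded:
 assumes "compact K" "continuous_on UNIV g" "!!x. x ~: K ==> g x = 0"
 obtains B where "!!x :: 'a::euclidean_space. |g x| <= (B::real)"
proof -
 have "bounded (g ` K)" using assms compact_continuous_image continuous_on_subset compact_imp_bounded by (metis subset_UNIV)
 then obtain B where "!!x. x : K ==> |g x| <= B" unfolding bounded_iff real_norm_def by blast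
 hence "|g x| <= |B|" for x using assms(3)[of x] by (cases "x : K") (auto intro: order_trans[OF _ abs_ge_self])
 thus thesis by (rule that)
qed

lemma continuous_lebesgue: "continuous_on UNIV g ==> (g :: 'a::euclidean_space => real) : borel_measurable lebesgue"
 by (intro measurable_completion) (simp add: borel_measurable_continuous_onI)

lemma cc_integrable:
 assumes "compact K" "continuous_on UNIV g" "!!x::'a::euclidean_space. x ~: K ==> g x = (0::real)"
 shows "integrable lebesgue g" "(LINT x|lebesgue. g x) = (LINT x|lborel. g x)"
proof -
 have "(%x. indicator K x*.g x) = g" using assms(3) by (auto simp: indicator_def fun_eq_iff)
 hence "integrable lborel g" using borel_integrable_compact[OF assms(1) continuous_on_subset[OF assms(2)]] by simp
 moreover have "g : borel_measurable lborel" using assms(2) by (simp add: borel_measurable_continuous_onI)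
 ultimately show "integrable lebesgue g" "(LINT x|lebesgue. g x) = (LINT x|lborel. g x)"
  by (simp_all add: integrable_completion integral_completion)
qed

lemma integrable_mult_bounded:
 assumes "integrable M f" "g : borel_measurable M" "!!x. |g x| <= (B::real)"
 shows "integrable M (%x. g x*f x :: real)"
proof (rule Bochner_Integration.integrable_bound[of M "%x. B*f x"])
 show "AE x in M. norm (g x*f x) <= norm (B*f x)"
 proof (intro AE_I2)
  fix x show "norm (g x*f x) <= norm (B*f x)"
   using mult_right_mono[OF order_trans[OF assms(3)[of x] abs_ge_self[of B]], of "|f x|"] by (simp add: abs_mult)
 qed
qed (use assms in auto)

lemma integral_abs_bound_le:
 fixes f g :: "'b => real"
 assumes "integrable M f" "integrable M g" "!!x. |f x| <= g x" shows "|LINT x|M. f x| <= (LINT x|M. g x)"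
 by (rule order_trans[OF integral_abs_bound integral_mono]) (use assms in auto)

lemma test_integrable:
 assumes "ph : test_functions Om" shows "integrable lebesgue ph" "(LINT x|lebesgue. ph x) = (LINT x|lborel. ph x)"
 using cc_integrable[OF testD(6,3)[OF assms]] notin_supp[of _ ph] by blast+

lemma test_grad_integral: assumes "ph : test_functions Om" "b : Basis" shows "(LINT x|lebesgue. grad ph x .* b) = 0"
proof -
 have C: "C2 UNIV ph" using testD(2)[OF assms(1)] .
 obtain R where R: "!!x. x : supp ph ==> norm x <= R"
  using compact_imp_bounded[OF testD(6)[OF assms(1)]] unfolding bounded_iff by blast
 have z: "ph x = 0 & grad ph x = 0" if "norm x > R" for x using R[of x] that testD(5)[OF assms(1), of x] by linarith
 have "(LINT x|lborel. grad ph x .* b) = 0"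
  by (rule integral_derivative_eq_0[OF C2_grad[OF C UNIV_I] C2_cont_grad[OF C], where R = R])
   (use z in auto)
 thus ?thesis using test_integrable(2)[OF test_deriv[OF assms]] by simp
qed

lemma test_by_parts:
 assumes "ph : test_functions Om" "!!k. Ck_on k UNIV py" "b : Basis"
 shows "(LINT x|lebesgue. ph x*(grad py x .* b)) = - (LINT x|lebesgue. (grad ph x .* b)*py x)"
proof -
 note C = Ck_on_C2(1)[OF open_UNIV assms(2)]
 have g: "grad (%x. ph x*py x) x .* b = ph x*(grad py x .* b) + (grad ph x .* b)*py x" for x
  by (simp add: C2_mult(2)[OF testD(2)[OF assms(1)] C UNIV_I] inner_add_left)
 have "Ck_on k UNIV (%x. grad py x .* b)" for k
  using Ck_on_SucD(2)[OF assms(2)[of "Suc k"] assms(3)] Ck_on_C2(2)[OF open_UNIV assms(2) UNIV_I] by simp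
 hence "(LINT x|lebesgue. ph x*(grad py x .* b) + (grad ph x .* b)*py x) = (LINT x|lebesgue. ph x*(grad py x .* b)) + (LINT x|lebesgue. (grad ph x .* b)*py x)"
  by (intro Bochner_Integration.integral_add test_integrable(1)[OF test_mult[OF assms(1)]] test_integrable(1)[OF test_mult[OF test_deriv[OF assms(1,3)] assms(2)]])
 thus ?thesis using test_grad_integral[OF test_mult[OF assms(1,2)] assms(3)] by (simp add: g)
qed

text \<open>The argument is \<open>y - x\<close>, opposite to the usual convolution, so that the
  translate of \<open>g\<close> is itself the test function entering the weak equation; first
  derivatives in \<open>x\<close> then carry a minus sign.\<close>

definition conv :: "('a::euclidean_space => real) => ('a => real) => 'a => real" where
 "conv g f x = (LINT y|lebesgue. g (y - x)*f y)"

context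
 fixes f :: "'a::euclidean_space => real"
 assumes f: "integrable lebesgue f"
begin

lemma conv_integrable: assumes "g : test_functions UNIV" shows "integrable lebesgue (%y. g (y - x)*f y)"
proof -
 obtain B where "!!x. |g x| <= B" using cc_bounded[OF testD(6,3)[OF assms] notin_supp[of _ g]] by blast
 thus ?thesis
  by (intro integrable_mult_bounded[OF f continuous_lebesgue, where B = B] continuous_on_compose2[OF testD(3)[OF assms]] continuous_intros) auto
qed

text \<open>The gradient of \<open>g\<close> is uniformly continuous, by compact support, so the
  first order Taylor remainder of \<open>g\<close> is small uniformly in the base point. It is then
  integrated against the merely integrable \<open>f\<close>.\<close>

lemma conv_has_derivative:
 assumes g: "g : test_functions UNIV"
 shows "(conv g f has_derivative (%h. (SUM b:Basis. - conv (%z. grad g z .* b) f x*.b) .* h)) (at x)"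
proof -
 define I where "I = (LINT y|lebesgue. |f y| )"
 have I: "0 <= I" by (simp add: I_def)
 let ?L = "%h. (SUM b:Basis. - conv (%z. grad g z .* b) f x*.b) .* h"
 have ig: "integrable lebesgue (%y. (grad g (y - x) .* b)*f y)" if "b : Basis" for b
  by (rule conv_integrable[OF test_deriv[OF g that]])
 have gh: "(grad g z .* h)*c = (SUM b:Basis. (h .* b)*((grad g z .* b)*c))" for z h c
  by (subst euclidean_inner) (simp add: sum_distrib_right sum_distrib_left mult_ac)
 have gi: "(%y. (grad g (y - x) .* h)*f y) = (%y. SUM b:Basis. (h .* b)*((grad g (y - x) .* b)*f y))" for h by (intro ext gh)
 have L1: "(LINT y|lebesgue. (grad g (y - x) .* h)*f y) = (SUM b:Basis. (h .* b)*(LINT y|lebesgue. (grad g (y - x) .* b)*f y))" for h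
  by (subst gi) (use ig in \<open>simp add: integral_sum\<close>)
 have L2: "?L h = - (SUM b:Basis. (h .* b)*(LINT y|lebesgue. (grad g (y - x) .* b)*f y))" for h
  unfolding conv_def inner_sum_left sum_negf[symmetric] by (intro sum.cong) (auto simp: inner_commute[of _ h])
 have L: "?L h = - (LINT y|lebesgue. (grad g (y - x) .* h)*f y)" for h
  by (rule trans[OF L2 arg_cong[where f = uminus, OF L1[symmetric]]])
 have Li: "integrable lebesgue (%y. (grad g (y - x) .* h)*f y)" for h
  by (subst gi) (use ig in auto)
 show ?thesis
  unfolding has_derivative_at_alt
 proof (intro conjI allI impI)
  show "bounded_linear ?L" by (rule bounded_linear_inner_right)
  fix e :: real assume e: "0 < e"
  define e' where "e' = e/(I + 1)"
  have e': "0 < e'" "e'*I <= e" using e I by (auto simp: e'_def field_simps)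
  have cg: "continuous_on UNIV (grad g)" using C2_cont_grad[OF testD(2)[OF g]] .
  define K where "K = supp g"
  have K: "compact K" "!!z. z ~: K ==> grad g z = 0" using testD(5,6)[OF g] by (auto simp: K_def)
  define S where "S = {x + y |x y. x : K & y : cball 0 1}"
  have S: "w : S" if "z : K" "dist w z <= 1" for w z
  proof -
   have "w = z + (w - z) & z : K & w - z : cball 0 1" using that by (simp add: dist_norm norm_minus_commute)
   thus ?thesis unfolding S_def by blast
  qed
  have "compact S" unfolding S_def by (rule compact_sums[OF K(1) compact_cball])
  from compact_uniformly_continuous[OF continuous_on_subset[OF cg subset_UNIV] this]
  obtain d where d: "d > 0" "!!z z'. z : S ==> z' : S ==> dist z' z < d ==> dist (grad g z') (grad g z) < e'"
   using e'(1) unfolding uniformly_continuous_on_def by metis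
  have uc: "norm (grad g z' - grad g z) <= e'" if "dist z' z < min d 1" for z z'
  proof (cases "z : K \<or> z' : K")
   case True
   hence "z : S" "z' : S" using that S[of z z] S[of z z'] S[of z' z] S[of z' z'] by (auto simp: dist_commute)
   thus ?thesis using d(2)[of z z'] that by (simp add: dist_norm)
  qed (use K(2) e' in auto)
  have lin: "|g (z + k) - g z - grad g z .* k| <= e'*norm k" if k: "norm k < min d 1" for z k
  proof -
   have "norm ((g (z + k) - grad g z .* (z + k)) - (g z - grad g z .* z)) <= e'*norm ((z + k) - z)"
   proof (rule differentiable_bound[of "ball z (min d 1)" "%w. g w - grad g z .* w" "%w h. (grad g w - grad g z) .* h"])
    show "((%w. g w - grad g z .* w) has_derivative (%h. (grad g w - grad g z) .* h)) (at w within ball z (min d 1))" for w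
     unfolding inner_diff_left
     by (intro has_derivative_diff has_derivative_at_withinI[OF C2_grad[OF testD(2)[OF g] UNIV_I]] has_derivative_inner_right has_derivative_ident)
    show "onorm (%h. (grad g w - grad g z) .* h) <= e'" if "w : ball z (min d 1)" for w
    proof (rule onorm_le)
     have "norm (grad g w - grad g z) <= e'" using uc[of w z] that by (simp add: dist_commute)
     thus "norm ((grad g w - grad g z) .* h) <= e'*norm h" for h
      using Cauchy_Schwarz_ineq2[of "grad g w - grad g z" h] mult_right_mono[of "norm (grad g w - grad g z)" e' "norm h"] by simp
    qed
   qed (use k d in \<open>auto simp: dist_norm\<close>)
   thus ?thesis by (simp add: inner_add_right algebra_simps)
  qed
  show "EX de>0. ALL y. norm (y - x) < de --> norm (conv g f y - conv g f x - ?L (y - x)) <= e*norm (y - x)"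
  proof (intro exI[of _ "min d 1"] conjI allI impI)
   fix x' assume x': "norm (x' - x) < min d 1"
   let ?k = "x' - x"
   let ?E = "%y. (g ((y - x) + (- ?k)) - g (y - x) - grad g (y - x) .* (- ?k))*f y"
   have e: "(y - x) + (- ?k) = y - x'" for y by simp
   have E: "?E = (%y. g (y - x')*f y - g (y - x)*f y + (grad g (y - x) .* ?k)*f y)"
    unfolding e inner_minus_right by (simp only: left_diff_distrib diff_minus_eq_add distrib_right)
   have iE: "integrable lebesgue ?E" unfolding E using conv_integrable[OF g] Li[of ?k] by auto
   have "(LINT y|lebesgue. ?E y) = conv g f x' - conv g f x - ?L ?k"
    unfolding E L unfolding conv_def using conv_integrable[OF g] Li[of ?k] by simp
   hence "conv g f x' - conv g f x - ?L ?k = (LINT y|lebesgue. ?E y)" by (rule sym)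
   also have "|...| <= (LINT y|lebesgue. e'*norm ?k*|f y| )"
   proof (rule integral_abs_bound_le[OF iE])
    show "|(g ((y - x) + (- ?k)) - g (y - x) - grad g (y - x) .* (- ?k))*f y| <= e'*norm ?k*|f y|" for y
     using mult_right_mono[OF lin[of "- ?k" "y - x"], of "|f y|"] x' by (simp add: abs_mult norm_minus_commute)
   qed (use f in auto)
   also have "... = (e'*I)*norm ?k" by (simp add: I_def)
   also have "... <= e*norm ?k" using e' by (intro mult_right_mono) auto
   finally show "norm (conv g f x' - conv g f x - ?L ?k) <= e*norm ?k" by simp
  qed (use d in auto)
 qed
qed

lemma conv_C2:
 assumes g: "g : test_functions UNIV"
 shows "C2 UNIV (conv g f)" "!!x b. b : Basis ==> grad (conv g f) x .* b = - conv (%z. grad g z .* b) f x"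
  "!!x. lap (conv g f) x = conv (lap g) f x"
proof -
 let ?g = "%b z. grad g z .* b" and ?gg = "%b c z. grad (%z. grad g z .* b) z .* c"
 let ?G = "%x. SUM b:Basis. - conv (?g b) f x*.b"
 let ?K = "%x h. SUM b:Basis. - ((SUM c:Basis. - conv (?gg b c) f x*.c) .* h)*.b"
 note t1 = test_deriv[OF g] and t2 = test_deriv[OF test_deriv[OF g]]
 have 1: "(conv g f has_derivative (%h. ?G x .* h)) (at x)" for x by (rule conv_has_derivative[OF g])
 have 2: "(?G has_derivative ?K x) (at x)" for x
  by (intro has_derivative_sum has_derivative_scaleR_left has_derivative_minus conv_has_derivative t1)
 have "continuous_on UNIV (conv (?gg b c) f)" if "b : Basis" "c : Basis" for b c
  using has_derivative_continuous[OF conv_has_derivative[OF t2[OF that]]] by (intro continuous_at_imp_continuous_on) blast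
 hence 3: "continuous_on UNIV (%x. ?K x h)" for h unfolding inner_sum_left by (intro continuous_intros) auto
 note A = C2I[OF open_UNIV 1 2 3]
 show "C2 UNIV (conv g f)" by (fact A)
 show "grad (conv g f) x .* b = - conv (?g b) f x" if "b : Basis" for x b
  using A(2) that by (simp add: inner_sum_left inner_Basis if_distrib cong: if_cong)
 have "lap (conv g f) x = (SUM b:Basis. conv (?gg b b) f x)" for x
  by (simp add: lap_def A(3) inner_sum_left inner_Basis if_distrib cong: if_cong)
 also have "(SUM b:Basis. conv (?gg b b) f x) = conv (lap g) f x" for x
  unfolding conv_def test_lap[OF g] sum_distrib_right by (subst Bochner_Integration.integral_sum) (auto intro!: conv_integrable t2)
 finally show "!!x. lap (conv g f) x = conv (lap g) f x" .
qed

end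

definition bump_mass :: "'a::euclidean_space itself => real" where
 "bump_mass _ = (LINT y:cball (0::'a) 1|lborel. bump (1 - (norm y)^2))"

text \<open>The support of the mollifier is a ball inscribed in the cube \<open>cbox 0 ((2*s)*.One)\<close>, because the
 differentiation theorem of the library averages over cubes with a corner at the point.\<close>

definition moll :: "real => 'a::euclidean_space => real" where
 "moll s y = bump (1 - (norm (y - s*.One))^2/s^2)/(s^DIM('a)*bump_mass TYPE('a))"

lemma flat_nonpos: "t <= 0 ==> flat p t = 0" by (simp add: flat_def)

lemma bump_mass_pos: "0 < bump_mass TYPE('a::euclidean_space)"
proof -
 have c: "continuous_on T (%y::'a. bump (1 - (norm y)^2))" for T
  by (intro continuous_on_compose2[OF DERIV_continuous_on[of UNIV bump bump']] continuous_intros) (auto simp: bump_deriv)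
 have "0 < (LINT y:cball (0::'a) (1/2)|lborel. bump (1 - (norm y)^2))"
 proof (rule set_integral_pos[OF c])
  fix y :: 'a assume "y : cball 0 (1/2)"
  hence "(norm y)^2 <= (1/2)^2" by (intro power_mono) auto
  also have "... < (1::real)" by (simp add: power2_eq_square)
  finally show "0 < bump (1 - (norm y)^2)" by (intro bump_range(4)) simp
 qed simp
 also have "... <= bump_mass TYPE('a)"
  unfolding bump_mass_def set_lebesgue_integral_def
  by (intro integral_mono borel_integrable_compact compact_cball c) (auto simp: indicator_def bump_range)
 finally show ?thesis .
qed

lemma moll_props:
 fixes y :: "'a::euclidean_space"
 assumes s: "0 < s"
 shows "moll s : test_functions (UNIV :: 'a set)" "0 <= moll s y" "moll s y <= 1/(s^DIM('a)*bump_mass TYPE('a))"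
  "moll s y ~= 0 ==> y : cball (s*.One) s" "norm (grad (moll s) y) <= 4/(s*(s^DIM('a)*bump_mass TYPE('a)))"
  "grad (moll s) y ~= 0 ==> y : cball (s*.One) s"
  "(LINT y|lebesgue. moll s (y::'a)) = 1"
proof -
 let ?m = "s^DIM('a)*bump_mass TYPE('a)" and ?p = "s*.One :: 'a"
 have m: "0 < ?m" using s bump_mass_pos[where 'a='a] by simp
 let ?q = "%y. 1 + (- 1/s^2)*(norm (y - ?p))^2"
 have q: "1 - (norm (y - ?p))^2/s^2 = ?q y" for y by simp
 have me: "moll s = (%y. (1/?m)*bump (?q y))" unfolding moll_def[abs_def] by simp
 have C: "Ck_on k UNIV (moll s :: 'a => real)" for k
 proof -
  have "Ck_on k UNIV ?q" using Ck_on_add[OF open_UNIV Ck_on_const Ck_on_mult[OF open_UNIV Ck_on_const Ck_on_norm2]] by blast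
  from Ck_on_mult[OF open_UNIV Ck_on_const Ck_on_compose[OF open_UNIV smooth1_bump this]] show ?thesis unfolding me by blast
 qed
 show z: "moll s y ~= 0 ==> y : cball ?p s" for y :: 'a
 proof -
  assume "moll s y ~= 0"
  hence "~ 1 - (norm (y - ?p))^2/s^2 <= 0" unfolding moll_def using bump_range(3) by auto
  hence "(norm (y - ?p))^2 <= s^2" using s by (simp add: field_simps)
  thus ?thesis using s by (simp add: dist_norm norm_minus_commute power2_le_iff_abs_le)
 qed
 show T: "moll s : test_functions (UNIV :: 'a set)" using z by (intro testI[OF C _ compact_cball[of ?p s]]) auto
 show "0 <= moll s y" "moll s y <= 1/?m" for y :: 'a
  unfolding moll_def using m bump_range(1,2) by (auto intro!: divide_right_mono)
 have D: "(moll s has_derivative (%h. ((1/?m)*(bump' (?q y)*(- 2/s^2)))*.(y - ?p) .* h)) (at y)" for y :: 'a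
 proof -
  have "(?q has_derivative (%h. (- 2/s^2)*((y - ?p) .* h))) (at y)"
   using has_derivative_add[OF has_derivative_const[of 1] has_derivative_mult_right[OF C2_grad[OF C2_norm2(1)[OF open_UNIV] UNIV_I], of "- 1/s^2" ?p y]]
    C2_norm2(2)[OF open_UNIV UNIV_I, of ?p y] by simp
  from has_derivative_mult_right[OF has_derivative_compose[OF this bump_deriv[unfolded has_field_derivative_def]], of "1/?m"]
  show ?thesis unfolding me by (simp add: mult_ac)
 qed
 have G: "grad (moll s) y = ((1/?m)*(bump' (?q y)*(- 2/s^2)))*.(y - ?p)" for y :: 'a using grad_eqI[OF D] .
 have qz: "bump' (?q y) = 0" if "y ~: cball ?p s" for y
 proof -
  have "s^2 <= (norm (y - ?p))^2" using that s by (intro power_mono) (auto simp: dist_norm norm_minus_commute)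
  hence "?q y <= 0" using s by (simp add: field_simps)
  thus ?thesis by (rule flat_nonpos)
 qed
 show "grad (moll s) y ~= 0 ==> y : cball ?p s" for y :: 'a using qz[of y] unfolding G by fastforce
 show "norm (grad (moll s) y) <= 4/(s*?m)" for y :: 'a
 proof (cases "y : cball ?p s")
  case True
  have "norm (grad (moll s) y) = (1/?m)*(bump' (?q y)*(2/s^2))*norm (y - ?p)"
  proof -
   have "0 <= (1/?m)*(bump' (?q y)*(2/s^2))" using m bump'_range(1)[of "?q y"] by (intro mult_nonneg_nonneg) auto
   moreover have "(1/?m)*(bump' (?q y)*(- 2/s^2)) = - ((1/?m)*(bump' (?q y)*(2/s^2)))" by simp
   ultimately show ?thesis unfolding G norm_scaleR by (simp only: abs_minus_cancel abs_of_nonneg)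
  qed
  also have "... <= (1/?m)*(2*(2/s^2))*s"
   using True m bump'_range[of "?q y"] s by (intro mult_mono mult_nonneg_nonneg) (auto simp: dist_norm norm_minus_commute)
  also have "... = 4/(s*?m)" using s by (simp add: power2_eq_square)
  finally show ?thesis .
 next
  case False
  hence "grad (moll s) y = 0" unfolding G using qz by simp
  thus ?thesis using s m by simp
 qed
 have "(LINT y|lborel. moll s (y::'a)) = (LINT y:(%y. ?p + s*.y) ` cball 0 1|lborel. moll s y)"
  unfolding set_lebesgue_integral_def
 proof (intro Bochner_Integration.integral_cong refl)
  fix y :: 'a
  show "moll s y = indicat_real ((%y. ?p + s*.y) ` cball 0 1) y*.moll s y"
   unfolding image_affine_cball[OF s] using z[of y] by (auto simp: indicator_def)
 qed
 also have "... = s^DIM('a)*(LINT y:cball 0 1|lborel. moll s (?p + s*.y))" using set_integral_affine[OF s, of "cball 0 1" "moll s" ?p] s by simp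
 also have "(LINT y:cball (0::'a) 1|lborel. moll s (?p + s*.y)) = (LINT y:cball (0::'a) 1|lborel. bump (1 - (norm y)^2))/?m"
  using s by (simp add: moll_def power_mult_distrib)
 finally show "(LINT y|lebesgue. moll s (y::'a)) = 1"
  unfolding test_integrable(2)[OF T] bump_mass_def[of "TYPE('a)", symmetric] times_divide_eq_right using m by (metis divide_self less_irrefl)
qed

lemma moll_box: "0 < s ==> moll s (y - x) ~= 0 \<or> grad (moll s) (y - x) ~= 0 ==> y : cbox x (x + (2*s)*.One)"
proof -
 assume s: "0 < s" and "moll s (y - x) ~= 0 \<or> grad (moll s) (y - x) ~= 0"
 hence n: "norm (y - x - s*.One) <= s" using moll_props(4,6)[OF s, of "y - x"] by (auto simp: dist_norm norm_minus_commute)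
 have "|(y - x - s*.One) .* b| <= s" if "b : Basis" for b using Basis_le_norm[OF that] n order_trans by blast
 hence "|y .* b - x .* b - s| <= s" if "b : Basis" for b using that by (simp add: inner_diff_left)
 thus ?thesis unfolding mem_box by (auto simp: inner_add_left abs_le_iff) (fastforce simp: algebra_simps)+
qed

lemma moll_shift: assumes "0 < s" shows "(LINT y|lebesgue. moll s (y - x :: 'a::euclidean_space)) = 1" "integrable lebesgue (%y. moll s (y - x))"
proof -
 have t: "(%y. moll s (y - x)) : test_functions UNIV"
  using test_translate[OF moll_props(1)[OF assms], of x "cbox x (x + (2*s)*.One)" UNIV] moll_box[OF assms] compact_cbox by blast
 show "integrable lebesgue (%y. moll s (y - x))" using test_integrable(1)[OF t] .
 show "(LINT y|lebesgue. moll s (y - x :: 'a)) = 1"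
  using test_integrable(2)[OF t] test_integrable(2)[OF moll_props(1)[OF assms, where 'a='a]] moll_props(7)[OF assms, where 'a='a]
   set_integral_translate[where f = "moll s" and x = "- x"] by (simp add: add.commute)
qed

text \<open>The differentiation theorem is applied to \<open>|f y - q|\<close> for all rational
  \<open>q\<close> at once. Off a null set, a rational \<open>q\<close> close to \<open>f x\<close>
  shows that the average of \<open>|f y - f x|\<close> over small cubes tends to 0, and the
  mollifier is bounded by a constant multiple of the normalised indicator of such a cube.\<close>

lemma mollify_tendsto:
 fixes f :: "'a::euclidean_space => real"
 assumes f: "integrable lebesgue f"
 shows "AE x in lebesgue. ((%s. conv (moll s) f x) ---> f x) (at_right 0)"
proof -
 let ?h = "%q y. |f y - q|" and ?B = "%x h. cbox x (x + h*.One :: 'a)"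
 have ic: "set_integrable lebesgue (cbox a b) (%y::'a. q)" for a b and q :: real
  unfolding set_integrable_def
  by (rule integrable_real_indicator[THEN integrable_scaleR_left]) (use emeasure_bounded_finite[OF bounded_cbox, of a b] in auto)
 have sh: "set_integrable lebesgue (cbox a b) (?h q)" for q a b
  unfolding set_integrable_def
 proof -
  have "integrable lebesgue (%y. indicat_real (cbox a b) y*.f y)" by (rule integrable_mult_indicator[OF _ f]) simp
  moreover have "integrable lebesgue (%y. indicat_real (cbox a b) y*.q)" using ic unfolding set_integrable_def .
  ultimately have "integrable lebesgue (%y. |indicat_real (cbox a b) y*.f y - indicat_real (cbox a b) y*.q| )"
   by (intro integrable_abs Bochner_Integration.integrable_diff)
  thus "integrable lebesgue (%y. indicat_real (cbox a b) y*.|f y - q| )"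
   by (rule back_subst[of "integrable lebesgue"]) (auto simp: indicator_def)
 qed
 have "EX N. negligible N & (ALL x e. x ~: N --> 0 < e --> (EX d>0. ALL h. 0 < h & h < d --> norm (integral (?B x h) (?h q) /\<^sub>R h^DIM('a) - ?h q x) < e))" for q
  using integrable_ccontinuous_explicit[OF set_lebesgue_integral_eq_integral(1)[OF sh[of _ _ q]]] by metis
 then obtain N where N: "!!q. negligible (N q)" "!!q x e. x ~: N q ==> 0 < e ==> (EX d>0. ALL h. 0 < h & h < d --> norm (integral (?B x h) (?h q) /\<^sub>R h^DIM('a) - ?h q x) < e)"
  by metis
 have "negligible (\<Union> (N ` \<rat>))" using N(1) by (intro negligible_countable_Union countable_image countable_rat) auto
 hence "AE x in lebesgue. x ~: \<Union> (N ` \<rat>)" unfolding negligible_iff_null_sets by (rule AE_not_in)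
 thus ?thesis
 proof eventually_elim
  case (elim x)
  \<comment> \<open>The supremum bound of the mollifier times the volume of the cube of side
    \<open>2*s\<close>.\<close>
  define C where "C = 2^DIM('a)/bump_mass TYPE('a)"
  have C: "0 < C" using bump_mass_pos[where 'a='a] by (simp add: C_def)
  show ?case
  proof (rule tendstoI)
   fix e :: real assume e: "0 < e"
   define e' where "e' = e/(4*C)"
   have e': "0 < e'" "C*(3*e') < e" using e C by (auto simp: e'_def)
   obtain q where q: "q : \<rat>" "f x < q" "q < f x + e'" using Rats_dense_in_real[of "f x" "f x + e'"] e' by auto
   obtain d where d: "d > 0" "!!h. 0 < h ==> h < d ==> norm (integral (?B x h) (?h q) /\<^sub>R h^DIM('a) - ?h q x) < e'"
    using N(2)[of x q e'] elim q(1) e'(1) by blast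
   have "dist (conv (moll s) f x) (f x) < e" if s: "0 < s" "s < d/2" for s
   proof -
    let ?m = "s^DIM('a)*bump_mass TYPE('a)"
    have m: "0 < ?m" using s bump_mass_pos[where 'a='a] by simp
    note ci = conv_integrable[OF f moll_props(1)[OF s(1)]]
    have "conv (moll s) f x - f x = (LINT y|lebesgue. moll s (y - x)*(f y - f x))"
     unfolding conv_def using moll_shift[OF s(1), of x] ci by (simp add: right_diff_distrib)
    also have "|...| <= (LINT y|lebesgue. (1/?m)*(indicat_real (?B x (2*s)) y*.(?h q y + e')))"
    proof (rule integral_abs_bound_le)
     show "integrable lebesgue (%y. moll s (y - x)*(f y - f x))" using moll_shift(2)[OF s(1), of x] ci by (simp add: right_diff_distrib)
     have "set_integrable lebesgue (?B x (2*s)) (%y. ?h q y + e')" by (intro set_integral_add sh) auto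
     thus "integrable lebesgue (%y. (1/?m)*(indicat_real (?B x (2*s)) y*.(?h q y + e')))" by (simp add: set_integrable_def)
     fix y
     have "|f y - f x| <= ?h q y + e'" using q by linarith
     hence "moll s (y - x)*|f y - f x| <= (1/?m)*(?h q y + e')" using moll_props(2,3)[OF s(1), of "y - x"] m by (intro mult_mono) auto
     thus "|moll s (y - x)*(f y - f x)| <= (1/?m)*(indicat_real (?B x (2*s)) y*.(?h q y + e'))"
      using moll_box[OF s(1), of y x] moll_props(2)[OF s(1), of "y - x"]
      by (cases "moll s (y - x) = 0") (use \<open>\<bar>f y - f x\<bar> \<le> ?h q y + e'\<close> m in \<open>auto simp: abs_mult indicator_def\<close>)
    qed
    also have "... = (1/?m)*(integral (?B x (2*s)) (?h q) + e'*(2*s)^DIM('a))"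
    proof -
     have "(LINT y:?B x (2*s)|lebesgue. ?h q y + e') = (LINT y:?B x (2*s)|lebesgue. ?h q y) + (LINT y:?B x (2*s)|lebesgue. e')"
      by (intro set_integral_add sh) auto
     moreover have "(LINT y:?B x (2*s)|lebesgue. e') = e'*(2*s)^DIM('a)"
      using s set_lebesgue_integral_eq_integral(2)[of "?B x (2*s)" "%y. e'"] ic[of x "x + (2*s)*.One" e']
      by (simp add: content_cbox_if box_eq_empty inner_add_left mult.commute)
     ultimately show ?thesis using set_lebesgue_integral_eq_integral(2)[OF sh] by (simp add: set_lebesgue_integral_def)
    qed
    also have "... = C*(integral (?B x (2*s)) (?h q) /\<^sub>R (2*s)^DIM('a) + e')"
     using s bump_mass_pos[where 'a='a] by (simp add: C_def field_simps)
    also have "... <= C*(3*e')"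
     using d(2)[of "2*s"] s q C by (intro mult_left_mono) (auto simp: abs_less_iff)
    also have "... < e" by (rule e')
    finally show ?thesis by (simp add: dist_real_def)
   qed
   thus "\<forall>\<^sub>F s in at_right 0. dist (conv (moll s) f x) (f x) < e"
    unfolding eventually_at_right_field using d(1) by (intro exI[of _ "d/2"]) auto
  qed
 qed
qed

section \<open>Interior regularity of bounded weak solutions\<close>

text \<open>Interpolation: the gradient estimate for a difference gives
  \<open>A/rh + 2*B*rh\<close>. First \<open>rh\<close> is taken small against the bound on the
  Laplacians, then uniform closeness makes \<open>A\<close> small against \<open>rh\<close>.\<close>

lemma grad_Cauchy:
 fixes w :: "nat => 'a::euclidean_space => real"
 assumes C: "!!n. C2 UNIV (w n)" and U: "uniformly_Cauchy_on (ball x0 r) w" and r: "0 < r"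
  and B: "!!n x. n0 <= n ==> x : ball x0 r ==> |lap (w n) x| <= B"
 shows "uniformly_Cauchy_on (ball x0 (r/2)) (%n. grad (w n))"
proof (rule uniformly_Cauchy_onI)
 fix e :: real assume e: "0 < e"
 let ?c = "lip_const TYPE('a)"
 have c: "0 < ?c" by (rule lip_const_pos)
 have B0: "0 <= B" using B[of n0 x0] r by (auto intro: order_trans[OF abs_ge_zero])
 obtain D where D: "B <= D" "0 < D" using B0 by (intro that[of "B + 1"]) auto
 define rh where "rh = min (r/6) (e/(8*?c*D))"
 have rh: "0 < rh" "3*rh <= r/2" using r e c D by (auto simp: rh_def)
 have "?c*(2*B*rh) <= ?c*(2*D*(e/(8*?c*D)))"
  using c D B0 rh by (intro mult_left_mono mult_mono) (auto simp: rh_def)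
 hence b: "?c*(2*B*rh) <= e/4" using c D by (simp add: field_simps)
 define A where "A = e*rh/(4*?c)"
 have A: "0 < A" "?c*(A/rh) = e/4" using e rh c by (auto simp: A_def)
 obtain M where M: "!!x m n. x : ball x0 r ==> M <= m ==> M <= n ==> dist (w m x) (w n x) < A"
  using U A(1) unfolding uniformly_Cauchy_on_def by blast
 show "EX M. ALL x:ball x0 (r/2). ALL m>=M. ALL n>=M. dist (grad (w m) x) (grad (w n) x) < e"
 proof (intro exI[of _ "max M n0"] ballI allI impI)
  fix x m n assume x: "x : ball x0 (r/2)" and mn: "max M n0 <= m" "max M n0 <= n"
  have sub: "y : ball x0 r" if "y : ball x (3*rh)" for y
   using x that rh dist_triangle[of x0 y x] by simp
  note D = C2_diff[OF C[of m] C[of n]]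
  have "norm (grad (%x. w m x - w n x) x) <= ?c*(A/rh + (2*B)*rh)"
  proof (rule gradient_estimate[OF C2_subset[OF D(1)] _ _ rh(1)])
   fix y assume "y : ball x (3*rh)"
   note y = sub[OF this]
   show "|w m y - w n y| <= A" using M[OF y] mn by (simp add: dist_real_def less_imp_le)
   show "|lap (%x. w m x - w n x) y| <= 2*B" using B[OF _ y, of m] B[OF _ y, of n] mn D(3)[OF UNIV_I, of y] by simp
  qed auto
  also have "... <= e/2" unfolding distrib_left using add_mono[OF eq_refl[OF A(2)] b] by simp
  finally show "dist (grad (w m) x) (grad (w n) x) < e" using e D(2)[OF UNIV_I, of x] by (simp add: dist_norm)
 qed
qed

lemma norm_cbox_le:
 fixes t :: real
 assumes "y : cbox x (x + t*.One)" shows "norm (y - x :: 'a::euclidean_space) <= real DIM('a)*t"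
proof -
 have "|(y - x) .* b| <= t" if "b : Basis" for b
  using assms that unfolding mem_box by (auto simp: inner_diff_left inner_add_left abs_le_iff dest!: bspec[of _ _ b])
 hence "(SUM b:Basis. |(y - x) .* b| ) <= (SUM b:(Basis::'a set). t)" by (rule sum_mono)
 thus ?thesis using norm_le_l1[of "y - x"] by simp
qed

lemma C1_limit:
 fixes f :: "nat => 'a::euclidean_space => real"
 assumes f: "!!n x. (f n has_derivative (%h. G n x .* h)) (at x)" and cG: "!!n. continuous_on UNIV (G n)"
  and U: "uniformly_Cauchy_on (ball x0 r) G" and l: "!!x. x : ball x0 r ==> (%n. f n x) ----> l x"
 obtains Q where "!!x. x : ball x0 r ==> (l has_derivative (%h. Q x .* h)) (at x)" "continuous_on (ball x0 r) Q"
  "!!x. x : ball x0 r ==> (%n. G n x) ----> Q x"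
proof -
 obtain Q where Q: "uniform_limit (ball x0 r) G Q sequentially"
  using Cauchy_uniformly_convergent[OF U] unfolding uniformly_convergent_on_def by blast
 have D: "(l has_derivative (%h. Q x .* h)) (at x)" if x: "x : ball x0 r" for x
 proof -
  have "EX g. ALL x:ball x0 r. (%n. f n x) ----> g x & (g has_derivative (%h. Q x .* h)) (at x within ball x0 r)"
  proof (rule has_derivative_sequence[OF convex_ball has_derivative_at_withinI[OF f] _ x l[OF x]])
   fix e :: real assume "0 < e"
   from uniform_limitD[OF Q this]
   show "EV n. ALL x:ball x0 r. ALL h. norm (G n x .* h - Q x .* h) <= e*norm h"
   proof eventually_elim
    case (elim n)
    show ?case
    proof (intro ballI allI)
     fix x h assume "x : ball x0 r"
     hence "norm (G n x - Q x) <= e" using elim by (auto simp: dist_norm less_imp_le)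
     thus "norm (G n x .* h - Q x .* h) <= e*norm h"
      using Cauchy_Schwarz_ineq2[of "G n x - Q x" h] mult_right_mono[of "norm (G n x - Q x)" e "norm h"] by (simp add: inner_diff_left)
    qed
   qed
  qed
  then obtain g where g: "!!x. x : ball x0 r ==> (%n. f n x) ----> g x" "(g has_derivative (%h. Q x .* h)) (at x within ball x0 r)" using x by blast
  have "g y = l y" if "y : ball x0 r" for y using LIMSEQ_unique[OF g(1)[OF that] l[OF that]] .
  thus ?thesis using has_derivative_transform_within_open[OF _ open_ball x, of g _ UNIV l] g(2) x by (simp add: at_within_open[OF x])
 qed
 show thesis
  by (rule that[OF D uniform_limit_theorem[OF always_eventually Q] tendsto_uniform_limitI[OF Q]])
   (use continuous_on_subset[OF cG] in auto)
qed

text \<open>The function \<open>g\<close> stands for the mollifier itself or for a component of its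
  gradient; both live in the same cube.\<close>

lemma conv_moll_bound:
 fixes f :: "'a::euclidean_space => real"
 assumes f: "integrable lebesgue f" and g: "g : test_functions UNIV" and s: "0 < s"
  and gb: "!!y. g y ~= 0 ==> moll s y ~= 0 \<or> grad (moll s) y ~= 0" "!!y. |g y| <= C"
  and b: "AE y in lebesgue. y : cbox x (x + (2*s)*.One) --> |f y - c| <= A"
 shows "|LINT y|lebesgue. g (y - x)*(f y - c)| <= C*A*(2*s)^DIM('a)" "integrable lebesgue (%y. g (y - x)*(f y - c))"
proof -
 let ?B = "cbox x (x + (2*s)*.One)"
 have "(%y. g (y - x)) : test_functions UNIV" using test_translate[OF g, of x ?B UNIV] moll_box[OF s gb(1)] compact_cbox by blast
 thus i: "integrable lebesgue (%y. g (y - x)*(f y - c))"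
  unfolding right_diff_distrib
  by (intro Bochner_Integration.integrable_diff conv_integrable[OF f g] integrable_mult_left test_integrable(1))
 have iB: "integrable lebesgue (%y. C*A*indicat_real ?B y)"
  using emeasure_bounded_finite[OF bounded_cbox, of x "x + (2*s)*.One"] by (intro integrable_mult_right integrable_real_indicator) auto
 have "|LINT y|lebesgue. g (y - x)*(f y - c)| <= (LINT y|lebesgue. C*A*indicat_real ?B y)"
 proof (rule order_trans[OF integral_abs_bound integral_mono_AE])
  show "AE y in lebesgue. |g (y - x)*(f y - c)| <= C*A*indicat_real ?B y"
   using b
  proof eventually_elim
   case (elim y)
   show ?case
   proof (cases "g (y - x) = 0 \<or> y ~: ?B")
    case True
    hence "g (y - x) = 0" using moll_box[OF s gb(1)] by blast
    moreover have "0 <= C*A" if "y : ?B" using elim that gb(2)[of 0] by (intro mult_nonneg_nonneg) auto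
    ultimately show ?thesis by (auto simp: indicator_def)
   next
    case False
    thus ?thesis using elim gb(2)[of "y - x"] by (auto simp: abs_mult intro!: mult_mono)
   qed
  qed
 qed (use i iB in auto)
 also have "... = C*A*(2*s)^DIM('a)"
  using s by (simp add: content_cbox_if box_eq_empty inner_add_left)
 finally show "|LINT y|lebesgue. g (y - x)*(f y - c)| <= C*A*(2*s)^DIM('a)" .
qed

section \<open>Distributional solutions of a Poisson equation\<close>

context
 fixes u F :: "'a::euclidean_space => real" and Om :: "'a set"
 assumes u: "integrable lebesgue u" and F: "integrable lebesgue F"
  and eqn: "ALL ph:test_functions Om. (LINT y|lebesgue. u y*lap ph y) = - (LINT y|lebesgue. F y*ph y)"
begin

lemma conv_lap:
 assumes g: "g : test_functions UNIV" and s: "0 < s" "cbox x (x + (2*s)*.One) <= Om"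
  and gb: "!!y. g y ~= 0 ==> moll s y ~= 0 \<or> grad (moll s) y ~= 0"
 shows "lap (conv g u) x = - conv g F x"
proof -
 have t: "(%y. g (y - x)) : test_functions Om" using test_translate[OF g _ compact_cbox s(2)] moll_box[OF s(1) gb] by blast
 have "lap (%y. g (y - x)) y = lap g (y - x)" for y
  using C2_affine(3)[OF testD(2)[OF g] open_UNIV, of "- x" 1 y] by simp
 thus ?thesis using bspec[OF eqn t] unfolding conv_C2(3)[OF u g] conv_def by (simp add: mult.commute)
qed

definition ms :: "nat => 'a => real" where "ms n = conv (moll (inverse (Suc n))) u"

text \<open>A pointwise representative given by one formula, so that statements on different balls
  concern the same function; where the mollifications do not converge its value is
  arbitrary.\<close>

definition rep :: "'a => real" where "rep x = lim (%n. ms n x)"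

lemma rep_ae: "AE x in lebesgue. (%n. ms n x) ----> u x & rep x = u x"
 using mollify_tendsto[OF u]
proof eventually_elim
 case (elim x)
 have "filterlim (%n. inverse (real (Suc n))) (at_right 0) sequentially"
  using LIMSEQ_inverse_real_of_nat by (auto simp: filterlim_at)
 from filterlim_compose[OF elim this] have "(%n. ms n x) ----> u x" by (simp add: ms_def)
 thus ?case by (simp add: rep_def limI)
qed

lemma boxes:
 assumes r: "0 < r"
 obtains n0 where "!!n x. n0 <= n ==> x : ball x0 r ==> cbox x (x + (2*inverse (Suc n))*.One) <= ball (x0::'a) (2*r)"
proof -
 obtain n0 where n0: "2*real DIM('a)/r < real n0" using reals_Archimedean2 by blast
 show thesis
 proof (rule that[of n0], intro subsetI)
  fix n x y assume n: "n0 <= n" and x: "x : ball x0 r" and y: "y : cbox x (x + (2*inverse (Suc n))*.One)"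
  have "norm (y - x) <= DIM('a)*(2*inverse (Suc n))" by (rule norm_cbox_le[OF y])
  also have "... = 2*DIM('a)/real (Suc n)" by (simp add: divide_inverse)
  also have "... < r"
  proof -
   have "2*real DIM('a)/r < real (Suc n)" using n0 n by simp
   thus ?thesis using r by (simp add: divide_less_eq mult.commute)
  qed
  finally show "y : ball x0 (2*r)" using x dist_triangle[of x0 y x] by (simp add: dist_norm norm_minus_commute)
 qed
qed

lemma ms_C2: "C2 UNIV (ms n)" unfolding ms_def by (rule conv_C2(1)[OF u moll_props(1)]) simp

text \<open>Mollifications of a bounded function with bounded distributional Laplacian are uniformly
  Lipschitz on smaller balls. Together with almost everywhere convergence, hence convergence on a
  dense set, this makes them uniformly Cauchy.\<close>

lemma regular1:
 assumes Mu: "AE y in lebesgue. y : Om --> |u y| <= M" and KF: "AE y in lebesgue. y : Om --> |F y| <= K"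
  and r: "0 < r" "ball x0 (2*r) <= Om"
 obtains n0 B Lip where "!!n x. n0 <= n ==> x : ball x0 r ==> |lap (ms n) x| <= B"
  "uniformly_Cauchy_on (ball x0 (r/2)) ms" "!!x. x : ball x0 (r/2) ==> (%n. ms n x) ----> rep x"
  "!!x y. x : ball x0 (r/2) ==> y : ball x0 (r/2) ==> |rep x - rep y| <= Lip*norm (x - y)"
proof -
 obtain n0 where n0: "!!n x. n0 <= n ==> x : ball x0 r ==> cbox x (x + (2*inverse (Suc n))*.One) <= ball x0 (2*r)"
  using boxes[OF r(1)] by metis
 define c where "c = 2^DIM('a)/bump_mass TYPE('a)"
 have cb: "|conv (moll (inverse (Suc n))) f x| <= c*A"
  if "integrable lebesgue f" "AE y in lebesgue. y : Om --> |f y| <= A" "n0 <= n" "x : ball x0 r" for n f A x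
 proof -
  let ?s = "inverse (real (Suc n))"
  have s: "0 < ?s" by simp
  note m = moll_props[OF s, where 'a='a]
  have "AE y in lebesgue. y : cbox x (x + (2*?s)*.One) --> |f y - 0| <= A"
   using that(2) by eventually_elim (use n0[OF that(3,4)] r in auto)
  from conv_moll_bound(1)[OF that(1) m(1) s _ _ this, of "1/(?s^DIM('a)*bump_mass TYPE('a))"] m(2,3)
  have "|conv (moll ?s) f x| <= 1/(?s^DIM('a)*bump_mass TYPE('a))*A*(2*?s)^DIM('a)" by (simp add: conv_def)
  also have "... = c*A" using s unfolding c_def power_mult_distrib by (simp del: of_nat_Suc inverse_eq_divide)
  finally show ?thesis .
 qed
 have lapb: "|lap (ms n) x| <= c*K" if "n0 <= n" "x : ball x0 r" for n x
 proof -
  have "cbox x (x + (2*inverse (Suc n))*.One) <= Om" using n0[OF that] r(2) by blast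
  hence "lap (ms n) x = - conv (moll (inverse (Suc n))) F x"
   unfolding ms_def by (intro conv_lap moll_props(1)) auto
  thus ?thesis using cb[OF F KF that] by simp
 qed
 define Lip where "Lip = lip_const TYPE('a)*(c*M/(r/6) + c*K*(r/6))"
 have lip: "|ms n x - ms n y| <= Lip*norm (x - y)" if n: "n0 <= n" and xy: "x : ball x0 (r/2)" "y : ball x0 (r/2)" for n x y
 proof -
  have "norm (ms n x - ms n y) <= Lip*norm (x - y)"
  proof (rule differentiable_bound[OF convex_ball has_derivative_at_withinI[OF C2_grad[OF ms_C2 UNIV_I]] _ xy])
   fix z assume z: "z : ball x0 (r/2)"
   have sub: "w : ball x0 r" if "w : ball z (3*(r/6))" for w using z that dist_triangle[of x0 w z] by simp
   have "norm (grad (ms n) z) <= Lip"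
    unfolding Lip_def
    by (rule gradient_estimate[OF C2_subset[OF ms_C2]]) (use r sub n cb[OF u Mu n] lapb in \<open>auto simp: ms_def\<close>)
   thus "onorm (%h. grad (ms n) z .* h) <= Lip"
    by (intro onorm_le) (metis Cauchy_Schwarz_ineq2 mult_right_mono norm_ge_zero order_trans real_norm_def)
  qed
  thus ?thesis by simp
 qed
 have Cau: "uniformly_Cauchy_on (ball x0 (r/2)) ms"
 proof (rule uniformly_Cauchy_onI)
  fix e :: real assume e: "0 < e"
  define de where "de = e/(4*( |Lip| + 1))"
  have de: "0 < de" "Lip*de <= e/4"
  proof -
   show "0 < de" using e by (simp add: de_def add_nonneg_pos)
   hence "Lip*de <= ( |Lip| + 1)*de" by (intro mult_right_mono) auto
   also have "... = e/4" unfolding de_def by (simp add: field_simps add_nonneg_pos)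
   finally show "Lip*de <= e/4" .
  qed
  \<comment> \<open>Finitely many of these convergence points form a net of mesh \<open>de\<close>,
    since a ball free of them would be negligible; the common Lipschitz constant transfers closeness
    from the net to all points.\<close>
  define Gd where "Gd = {x : ball x0 (r/2). (%n. ms n x) ----> u x}"
  have near: "EX p:Gd. dist x p < de" if x: "x : cball x0 (r/2)" for x
  proof -
   have "x : closure (ball x0 (r/2))" using x r by simp
   hence ne: "ball x de \<inter> ball x0 (r/2) ~= {}" using de(1) unfolding closure_approachable by (force simp: dist_commute)
   have "~ negligible (ball x de \<inter> ball x0 (r/2))" using open_not_negligible[OF open_Int[OF open_ball open_ball] ne] .
   moreover have "negligible (ball x de \<inter> ball x0 (r/2))" if "Gd \<inter> ball x de = {}"
   proof -
    have "AE y in lebesgue. y ~: ball x de \<inter> ball x0 (r/2)" using rep_ae by eventually_elim (use that Gd_def in auto)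
    thus ?thesis unfolding negligible_iff_null_sets by (intro AE_iff_null_sets[THEN iffD2]) auto
   qed
   ultimately have "Gd \<inter> ball x de ~= {}" by blast
   thus ?thesis by auto
  qed
  have "compact (cball x0 (r/2))" by simp
  then obtain P where P: "P <= Gd" "finite P" "cball x0 (r/2) <= (UN p:P. ball p de)"
   by (rule compactE_image[where C = Gd and f = "%p. ball p de"]) (use near in \<open>auto simp: dist_commute\<close>)
  have "ALL p:P. EX N. ALL m>=N. ALL n>=N. dist (ms m p) (ms n p) < e/4"
  proof
   fix p assume "p : P"
   hence "Cauchy (%n. ms n p)" using P(1) LIMSEQ_imp_Cauchy unfolding Gd_def by blast
   thus "EX N. ALL m>=N. ALL n>=N. dist (ms m p) (ms n p) < e/4" using e unfolding Cauchy_def by (meson zero_less_divide_iff zero_less_numeral)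
  qed
  then obtain N where N: "!!p m n. p : P ==> N p <= m ==> N p <= n ==> dist (ms m p) (ms n p) < e/4" by metis
  show "EX N. ALL x:ball x0 (r/2). ALL m>=N. ALL n>=N. dist (ms m x) (ms n x) < e"
  proof (intro exI[of _ "n0 + (SUM p:P. N p)"] ballI allI impI)
   fix x m n assume x: "x : ball x0 (r/2)" and mn: "n0 + (SUM p:P. N p) <= m" "n0 + (SUM p:P. N p) <= n"
   obtain p where p: "p : P" "dist x p < de" using P(3) x by (force simp: dist_commute)
   have Np: "N p <= (SUM p:P. N p)" using member_le_sum[OF p(1), of N] P(2) by simp
   have pb: "p : ball x0 (r/2)" using p P(1) by (auto simp: Gd_def)
   have "0 <= Lip*norm (x - p)" using lip[of n0, OF _ x pb] by linarith
   hence "Lip*norm (x - p) <= e/4"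
    using de(2) p(2) e mult_left_mono[of "norm (x - p)" de Lip] mult_nonpos_nonneg[of Lip "norm (x - p)"]
    by (cases "0 <= Lip") (auto simp: dist_norm)
   hence "dist (ms k x) (ms k p) <= e/4" if "n0 <= k" for k using lip[OF that x pb] by (simp add: dist_real_def)
   hence "dist (ms m x) (ms m p) <= e/4" "dist (ms n x) (ms n p) <= e/4" using mn by auto
   moreover have "dist (ms m p) (ms n p) < e/4" using N[OF p(1)] mn Np by simp
   ultimately show "dist (ms m x) (ms n x) < e" unfolding dist_real_def by linarith
  qed
 qed
 have lim: "(%n. ms n x) ----> rep x" if "x : ball x0 (r/2)" for x
 proof -
  have "Cauchy (%n. ms n x)" using Cau that unfolding uniformly_Cauchy_on_def Cauchy_def by blast
  thus ?thesis unfolding rep_def using Cauchy_convergent convergent_LIMSEQ_iff by blast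
 qed
 have "|rep x - rep y| <= Lip*norm (x - y)" if "x : ball x0 (r/2)" "y : ball x0 (r/2)" for x y
  by (rule LIMSEQ_le_const2[OF tendsto_rabs[OF tendsto_diff[OF lim[OF that(1)] lim[OF that(2)]]]]) (use lip[OF _ that] in blast)
 thus thesis using that[OF lapb Cau lim] by blast
qed

text \<open>A Lipschitz right-hand side keeps even the Laplacians of the first derivatives of the
  mollifications bounded. Interpolation applied to the mollifications and again to their derivatives
  gives uniform convergence of gradients and of second derivatives.\<close>

lemma regular2:
 assumes Mu: "AE y in lebesgue. y : Om --> |u y| <= M" and KF: "AE y in lebesgue. y : Om --> |F y| <= K"
  and r: "0 < r" "ball x0 (2*r) <= Om" and H: "AE y in lebesgue. y : ball x0 (2*r) --> F y = H y"
  and L: "!!x y. x : ball x0 (2*r) ==> y : ball x0 (2*r) ==> |H x - H y| <= Lip*norm (x - y)"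
 shows "C2 (ball x0 (r/8)) rep" "!!x. x : ball x0 (r/8) ==> lap rep x = - H x"
proof -
 obtain n1 where n1: "!!n x. n1 <= n ==> x : ball x0 r ==> cbox x (x + (2*inverse (Suc n))*.One) <= ball x0 (2*r)"
  using boxes[OF r(1)] by metis
 obtain n0 B where n0: "!!n x. n0 <= n ==> x : ball x0 r ==> |lap (ms n) x| <= B"
  and Cau: "uniformly_Cauchy_on (ball x0 (r/2)) ms" and lim: "!!x. x : ball x0 (r/2) ==> (%n. ms n x) ----> rep x"
  using regular1[OF Mu KF r] by metis
 let ?s = "%n. inverse (real (Suc n))" and ?g = "%b n z. grad (moll (inverse (real (Suc n)))) z .* b"
 let ?V = "%b n. conv (?g b n) u"
 have s: "0 < ?s n" for n by simp
 have g: "?g b n : test_functions UNIV" if "b : Basis" for b n by (rule test_deriv[OF moll_props(1)[OF s] that])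
 have L0: "0 <= |Lip|" by simp
 have osc: "AE y in lebesgue. y : cbox x (x + (2*?s n)*.One) --> |F y - H x| <= |Lip|*(2*DIM('a)*?s n)"
  if nx: "n1 <= n" "x : ball x0 r" for n x
  using H
 proof eventually_elim
  case (elim y)
  show ?case
  proof
   assume y: "y : cbox x (x + (2*?s n)*.One)"
   have "norm (y - x) <= 2*DIM('a)*?s n" using norm_cbox_le[OF y] by (simp add: mult_ac)
   moreover have yb: "y : ball x0 (2*r)" "x : ball x0 (2*r)" using y n1[OF nx] nx r by auto
   hence "|F y - H x| <= |Lip|*norm (y - x)" using elim L[OF yb] mult_right_mono[OF abs_ge_self[of Lip], of "norm (y - x)"] by auto
   ultimately show "|F y - H x| <= |Lip|*(2*DIM('a)*?s n)" using mult_left_mono[OF _ L0] order_trans by blast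
  qed
 qed
 define c where "c = 2^DIM('a)/bump_mass TYPE('a)"
 have inOm: "cbox x (x + (2*?s n)*.One) <= Om" if "n1 <= n" "x : ball x0 r" for n x using n1[OF that] r(2) by blast
 have lapV: "|lap (?V b n) x| <= c*(8*|Lip|*DIM('a))" if b: "b : Basis" and nx: "n1 <= n" "x : ball x0 r" for b n x
 proof -
  have e1: "lap (?V b n) x = - conv (?g b n) F x" by (rule conv_lap[OF g[OF b] s inOm[OF nx]]) auto
  \<comment> \<open>A derivative of the mollifier has integral 0, so the constant \<open>H x\<close>
    may be subtracted from \<open>F\<close>; the oscillation of order \<open>?s n\<close> then
    compensates the factor \<open>1/?s n\<close> in the gradient of the mollifier.\<close>
  have e2: "(LINT y|lebesgue. ?g b n (y - x)*H x) = 0"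
  proof -
   have t: "(%y. moll (?s n) (y - x)) : test_functions UNIV"
    using test_translate[OF moll_props(1)[OF s[of n]], of x "cbox x (x + (2*?s n)*.One)" UNIV] moll_box[OF s] compact_cbox by blast
   have "grad (%y. moll (?s n) (y - x)) y = grad (moll (?s n)) (y - x)" for y
    using C2_affine(2)[OF testD(2)[OF moll_props(1)[OF s[of n]]] open_UNIV, where x = "- x" and r = 1 and y = y] by simp
   thus ?thesis using test_grad_integral[OF t b] by simp
  qed
  have e3: "|LINT y|lebesgue. ?g b n (y - x)*(F y - H x)| <= (4/(?s n*(?s n^DIM('a)*bump_mass TYPE('a))))*( |Lip|*(2*DIM('a)*?s n))*(2*?s n)^DIM('a)"
   and e4: "integrable lebesgue (%y. ?g b n (y - x)*(F y - H x))"
   by (rule conv_moll_bound[OF F g[OF b] s _ _ osc[OF nx]], force,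
     rule order_trans[OF Basis_le_norm[OF b] moll_props(5)[OF s]])+
  have e5: "(4/(?s n*(?s n^DIM('a)*bump_mass TYPE('a))))*( |Lip|*(2*DIM('a)*?s n))*(2*?s n)^DIM('a) = c*(8*|Lip|*DIM('a))"
   unfolding c_def power_mult_distrib by (simp del: of_nat_Suc inverse_eq_divide)
  have e6: "(LINT y|lebesgue. ?g b n (y - x)*(F y - H x)) = conv (?g b n) F x - (LINT y|lebesgue. ?g b n (y - x)*H x)"
  proof -
   have i: "integrable lebesgue (%y. ?g b n (y - x)*F y)" by (rule conv_integrable[OF F g[OF b]])
   have "integrable lebesgue (%y. ?g b n (y - x)*F y - ?g b n (y - x)*(F y - H x))" using i e4 by (intro Bochner_Integration.integrable_diff)
   hence "integrable lebesgue (%y. ?g b n (y - x)*H x)" by (simp add: right_diff_distrib)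
   thus ?thesis using i by (simp add: conv_def right_diff_distrib)
  qed
  show ?thesis unfolding e1 abs_minus_cancel using e3[unfolded e6 e2 e5 diff_0_right] .
 qed
 have CV: "C2 UNIV (?V b n)" if "b : Basis" for b n by (rule conv_C2(1)[OF u g[OF that]])
 have G: "grad (ms n) x .* b = - ?V b n x" if "b : Basis" for n x b
  unfolding ms_def by (rule conv_C2(2)[OF u moll_props(1)[OF s] that])
 have Gv: "grad (ms n) x = (SUM b:Basis. - ?V b n x*.b)" for n x
  by (subst euclidean_representation[symmetric]) (intro sum.cong refl, simp add: G)
 have r4: "0 < r/2" "0 < r/4" using r by auto
 have sub: "x : ball x0 r" if "x : ball x0 (r/2) \<or> x : ball x0 (r/4) \<or> x : ball x0 (r/8)" for x using that r by auto
 have C1: "uniformly_Cauchy_on (ball x0 (r/4)) (%n. grad (ms n))"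
  using grad_Cauchy[OF ms_C2 Cau r4(1), of n0 B] n0 sub by simp
 have C1V: "uniformly_Cauchy_on (ball x0 (r/4)) (?V b)" if b: "b : Basis" for b
  unfolding uniformly_Cauchy_on_def
 proof (intro allI impI)
  fix e :: real assume "0 < e"
  then obtain N where N: "!!x m n. x : ball x0 (r/4) ==> N <= m ==> N <= n ==> dist (grad (ms m) x) (grad (ms n) x) < e"
   using C1 unfolding uniformly_Cauchy_on_def by blast
  have "dist (?V b m x) (?V b n x) <= dist (grad (ms m) x) (grad (ms n) x)" for m n x
  proof -
   have "dist (?V b m x) (?V b n x) = |(grad (ms m) x - grad (ms n) x) .* b|"
    unfolding inner_diff_left G[OF b] by (simp add: dist_real_def abs_minus_commute)
   thus ?thesis using Basis_le_norm[OF b] by (simp add: dist_norm)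
  qed
  thus "EX M. ALL x:ball x0 (r/4). ALL m>=M. ALL n>=M. dist (?V b m x) (?V b n x) < e" using N by (meson le_less_trans)
 qed
 have C2V: "uniformly_Cauchy_on (ball x0 (r/8)) (%n. grad (?V b n))" if b: "b : Basis" for b
 proof -
  have "uniformly_Cauchy_on (ball x0 (r/4/2)) (%n. grad (?V b n))"
   by (rule grad_Cauchy[OF CV[OF b] C1V[OF b] r4(2) lapV[OF b]]) (use sub in auto)
  thus ?thesis by simp
 qed
 have "EX P. ALL x:ball x0 (r/4). (%n. ?V b n x) ----> P x" if b: "b : Basis" for b
 proof -
  obtain l where l: "uniform_limit (ball x0 (r/4)) (?V b) l sequentially"
   using Cauchy_uniformly_convergent[OF C1V[OF b]] unfolding uniformly_convergent_on_def by blast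
  show ?thesis using tendsto_uniform_limitI[OF l] by blast
 qed
 then obtain P where P: "!!b x. b : Basis ==> x : ball x0 (r/4) ==> (%n. ?V b n x) ----> P b x" by metis
 have r84: "x : ball x0 (r/4)" if "x : ball x0 (r/8)" for x using that r by auto
 have "EX Q. (ALL x:ball x0 (r/8). (P b has_derivative (%h. Q x .* h)) (at x) & (%n. grad (?V b n) x) ----> Q x) & continuous_on (ball x0 (r/8)) Q" if b: "b : Basis" for b
  using C1_limit[OF C2_grad[OF CV[OF b] UNIV_I] C2_cont_grad[OF CV[OF b]] C2V[OF b] P[OF b r84]] by metis
 then obtain Q where Q: "!!b x. b : Basis ==> x : ball x0 (r/8) ==> (P b has_derivative (%h. Q b x .* h)) (at x)"
  "!!b x. b : Basis ==> x : ball x0 (r/8) ==> (%n. grad (?V b n) x) ----> Q b x" "!!b. b : Basis ==> continuous_on (ball x0 (r/8)) (Q b)"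
  by metis
 have lim4: "(%n. ms n x) ----> rep x" if "x : ball x0 (r/4)" for x using lim that r by auto
 obtain R where R: "!!x. x : ball x0 (r/4) ==> (rep has_derivative (%h. R x .* h)) (at x)" "!!x. x : ball x0 (r/4) ==> (%n. grad (ms n) x) ----> R x"
  using C1_limit[OF C2_grad[OF ms_C2 UNIV_I] C2_cont_grad[OF ms_C2] C1 lim4] by metis
 let ?G = "%x. SUM b:Basis. - P b x*.b" and ?K = "%x h. SUM b:Basis. - (Q b x .* h)*.b"
 have RG: "R x = ?G x" if x: "x : ball x0 (r/4)" for x
 proof (rule LIMSEQ_unique[OF R(2)[OF x]])
  show "(%n. grad (ms n) x) ----> ?G x" unfolding Gv by (intro tendsto_intros P x)
 qed
 have 1: "(rep has_derivative (%h. ?G x .* h)) (at x)" if "x : ball x0 (r/8)" for x using R(1)[OF r84[OF that]] RG[OF r84[OF that]] by simp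
 have 2: "(?G has_derivative ?K x) (at x)" if "x : ball x0 (r/8)" for x
  by (intro has_derivative_sum has_derivative_scaleR_left has_derivative_minus Q(1) that)
 have 3: "continuous_on (ball x0 (r/8)) (%x. ?K x h)" for h by (intro continuous_intros Q(3))
 note A = C2I[OF open_ball 1 2 3]
 show "C2 (ball x0 (r/8)) rep" by (rule A)
 fix x assume x: "x : ball x0 (r/8)"
 note xr = sub[of x]
 have "lap rep x = (SUM b:Basis. - (Q b x .* b))"
  unfolding lap_def by (subst A(3)[OF _ _ x]; assumption?) (simp add: inner_sum_left inner_Basis if_distrib cong: if_cong)
 moreover have "(%n. SUM b:Basis. - (grad (?V b n) x .* b)) ----> (SUM b:Basis. - (Q b x .* b))"
  by (intro tendsto_intros Q(2) x)
 moreover have "(SUM b:Basis. - (grad (?V b n) x .* b)) = lap (ms n) x" for n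
 proof -
  have "- (grad (?V b n) x .* b) = grad (%y. grad (ms n) y .* b) x .* b" if "b : Basis" for b
   using C2_cmult(2)[OF CV[OF that] UNIV_I, of "- 1" n x] G[OF that] by simp
  moreover have "grad (%y. grad (ms n) y .* b) x .* b = hess (ms n) x b .* b" for b
  proof -
   have "((%y. grad (ms n) y .* b) has_derivative (%h. hess (ms n) x h .* b)) (at x)"
    by (rule has_derivative_inner_left[OF C2_hess[OF ms_C2 UNIV_I]])
   moreover have "(%h. hess (ms n) x h .* b) = (%h. hess (ms n) x b .* h)" using hess_symmetric[OF ms_C2 UNIV_I] by blast
   ultimately show ?thesis using grad_eqI by metis
  qed
  ultimately show ?thesis by (simp add: lap_def)
 qed
 moreover have "(%n. lap (ms n) x) ----> - H x"
 proof (rule LIM_zero_cancel, rule Lim_null_comparison)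
  have "(%n. (c*|Lip|*(2*DIM('a)))*?s n) ----> 0" using tendsto_mult_right_zero[OF LIMSEQ_inverse_real_of_nat] .
  thus "(%n. (c*|Lip|*(2*DIM('a)))*?s n) ----> 0" .
  show "EV n. norm (lap (ms n) x - - H x) <= (c*|Lip|*(2*DIM('a)))*?s n"
   using eventually_ge_at_top[of n1]
  proof eventually_elim
   case (elim n)
   have xb: "x : ball x0 r" using xr x by blast
   have l: "lap (ms n) x = - conv (moll (?s n)) F x" unfolding ms_def by (rule conv_lap[OF moll_props(1)[OF s] s inOm[OF elim xb]]) auto
   have b: "|moll (?s n) y| <= 1/(?s n^DIM('a)*bump_mass TYPE('a))" for y :: 'a using moll_props(2,3)[OF s, of n y] by simp
   note cm = conv_moll_bound[OF F moll_props(1)[OF s] s _ b osc[OF elim xb]]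
   have "(LINT y|lebesgue. moll (?s n) (y - x)*(F y - H x)) = conv (moll (?s n)) F x - H x"
    unfolding conv_def using conv_integrable[OF F moll_props(1)[OF s], of n x] moll_shift[OF s, of n x] by (simp add: right_diff_distrib)
   hence "|conv (moll (?s n)) F x - H x| <= 1/(?s n^DIM('a)*bump_mass TYPE('a))*( |Lip|*(2*DIM('a)*?s n))*(2*?s n)^DIM('a)"
    using cm(1) by simp
   also have "... = (c*|Lip|*(2*DIM('a)))*?s n"
    unfolding c_def power_mult_distrib by (simp del: of_nat_Suc inverse_eq_divide)
   finally show ?case unfolding l by simp
  qed
 qed
 ultimately show "lap rep x = - H x" using LIMSEQ_unique by simp
qed

end

section \<open>Weak formulations and comparison\<close>

lemma ae_imp_all:
 fixes f :: "'a::euclidean_space => real"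
 assumes S: "open S" and c: "continuous_on S f" and ae: "AE x in lebesgue. x : S --> f x <= 0" and x: "x : S"
 shows "f x <= 0"
proof (rule ccontr)
 assume "~ f x <= 0"
 let ?T = "S \<inter> f -` {0<..}"
 have "open ?T" using continuous_open_preimage[OF c S, of "{0<..}"] by simp
 moreover have "x : ?T" using x \<open>\<not> f x \<le> 0\<close> by simp
 ultimately have "~ negligible ?T" using open_not_negligible by blast
 moreover have "AE y in lebesgue. y ~: ?T" using ae by eventually_elim auto
 hence "negligible ?T"
  unfolding negligible_iff_null_sets using AE_iff_null_sets[of ?T lebesgue] \<open>open ?T\<close> by auto
 ultimately show False by simp
qed

locale bounded_open =
 fixes Om :: "'a::euclidean_space set"
 assumes o: "open Om" and b: "bounded Om"
begin

abbreviation "M == lebesgue_on Om"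
abbreviation "T == test_functions Om"

lemma sets: "Om : sets lebesgue" using o by simp

lemma AE_M: "(AE x in M. P x) \<longleftrightarrow> (AE x in lebesgue. x : Om --> P x)"
 by (rule AE_restrict_space_iff) (simp add: sets)

lemma int_M: "(LINT x|M. f x) = (LINT x|lebesgue. indicator Om x*.f x :: real)"
 by (rule integral_restrict_space) (simp add: sets)

lemma int_test: "ph : T ==> (LINT x|M. h x*ph x) = (LINT x|lebesgue. h x*ph x)"
 unfolding int_M using notin_supp[of _ ph] testD(7)[of ph Om]
 by (intro Bochner_Integration.integral_cong refl) (auto simp: indicator_def)

lemma integrable_M: "integrable M f \<longleftrightarrow> integrable lebesgue (%x. indicator Om x*f x :: real)"
 using integrable_restrict_space[of Om lebesgue f] sets by simp

lemma fin: "finite_measure M"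
 by (rule finite_measure_lebesgue_on) (simp add: b o bounded_set_imp_lmeasurable)

lemma cont_M: "continuous_on UNIV f ==> f : borel_measurable M" for f :: "'a => 'b::euclidean_space"
 using continuous_imp_measurable_on_sets_lebesgue[OF continuous_on_subset sets] by blast

lemma bdd_int: assumes "f : borel_measurable M" "AE x in M. |f x| <= B" shows "integrable M (f :: 'a => real)"
 using finite_measure.integrable_const_bound[OF fin _ assms(1), of B] assms(2) unfolding real_norm_def by blast

lemma L2_int: "f : L2 Om ==> integrable M f" for f :: "'a => 'b::euclidean_space"
proof (rule Bochner_Integration.integrable_bound[where f = "%x. 1 + (norm (f x))^2"])
 assume f: "f : L2 Om"
 thus "integrable M (%x. 1 + (norm (f x))^2)"
  unfolding L2_def by (intro Bochner_Integration.integrable_add finite_measure.integrable_const[OF fin]) auto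
 show "f : borel_measurable M" using f by (simp add: L2_def)
 have "t <= 1 + t^2" for t :: real
  using zero_le_power2[of "t - 1"] zero_le_power2[of t] unfolding power2_diff power_one mult_1_right by linarith
 thus "AE x in M. norm (f x) <= norm (1 + (norm (f x))^2)" by simp
qed

lemma L2_diff: "f : L2 Om ==> g : L2 Om ==> (%x. f x - g x) : L2 Om" for f g :: "'a => 'b::euclidean_space"
proof -
 assume *: "f : L2 Om" "g : L2 Om"
 have "integrable M (%x. (norm (f x - g x))^2)"
 proof (rule Bochner_Integration.integrable_bound[where f = "%x. 2*(norm (f x))^2 + 2*(norm (g x))^2"])
  have "(norm (p - q))^2 <= 2*(norm p)^2 + 2*(norm q)^2" for p q :: 'b
   using zero_le_power2[of "norm (p + q)"] by (simp add: power2_norm_eq_inner algebra_simps inner_commute)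
  thus "AE x in M. norm ((norm (f x - g x))^2) <= norm (2*(norm (f x))^2 + 2*(norm (g x))^2)" by simp
 qed (use * in \<open>auto simp: L2_def\<close>)
 thus ?thesis using * unfolding L2_def by (auto intro: borel_measurable_diff)
qed

lemma bounded_L2:
 fixes f :: "'a => 'b::euclidean_space"
 assumes "continuous_on UNIV f" "!!x. norm (f x) <= B" shows "f : L2 Om"
proof -
 have "|(norm (f x))\<^sup>2| <= B^2" for x using power_mono[OF assms(2) norm_ge_zero, of x 2] by simp
 thus ?thesis using cont_M[OF assms(1)] by (auto simp: L2_def intro!: bdd_int[where B = "B^2"])
qed

lemma test_bounds: assumes "ph : test_functions U" obtains B where "!!x. |ph x| <= B" "!!x. norm (grad ph x) <= B"
proof -
 obtain B1 where "!!x. |ph x| <= B1" using cc_bounded[OF testD(6,3)[OF assms]] notin_supp[of _ ph] by blast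
 moreover have "!!x. x ~: supp ph ==> norm (grad ph x) = 0" using testD(5)[OF assms] by simp
 then obtain B2 where "!!x. |norm (grad ph x)| <= B2"
  using cc_bounded[OF testD(6)[OF assms] continuous_on_norm[OF C2_cont_grad[OF testD(2)[OF assms]]]] by blast
 ultimately have "!!x. |ph x| <= max B1 B2" "!!x. norm (grad ph x) <= max B1 B2" by (simp_all add: le_max_iff_disj)
 thus thesis by (rule that)
qed

lemma mult_test_int: "integrable M f ==> ph : test_functions U ==> integrable M (%x. f x*ph x :: real)"
 using test_bounds[of ph U] integrable_mult_bounded[of M f ph] cont_M[OF testD(3)] by (simp add: mult.commute) metis

text \<open>Translates of the mollifier are admissible test functions for small parameter, and the
  tested integrals converge to \<open>h x\<close> almost everywhere.\<close>

lemma FLCV: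
 assumes h: "integrable M h" and z: "!!ph. ph : T ==> (LINT x|M. h x*ph x) = 0"
 shows "AE x in M. h x = 0"
proof -
 let ?f = "%x. indicator Om x*h x"
 have f: "integrable lebesgue ?f" using h integrable_M by simp
 show ?thesis
  unfolding AE_M
  using mollify_tendsto[OF f]
 proof eventually_elim
  case (elim x)
  show ?case
  proof
   assume x: "x : Om"
   then obtain e where e: "e > 0" "ball x e <= Om" using o openE by blast
   have "conv (moll s) ?f x = 0" if s: "0 < s" "s < e/(2*DIM('a))" for s
   proof -
    have "norm (y - x) < e" if "y : cbox x (x + (2*s)*.One)" for y
     using norm_cbox_le[OF that] s by (simp add: field_simps)
    hence "cbox x (x + (2*s)*.One) <= Om" using e by (force simp: dist_norm norm_minus_commute)
    hence t: "(%y. moll s (y - x)) : T"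
     using test_translate[OF moll_props(1)[OF s(1)] _ compact_cbox] moll_box[OF s(1)] by blast
    show ?thesis using z[OF t] unfolding conv_def int_M by (simp add: mult_ac)
   qed
   hence "\<forall>\<^sub>F s in at_right 0. conv (moll s) ?f x = 0"
    unfolding eventually_at_right_field using e(1) by (intro exI[of _ "e/(2*DIM('a))"]) auto
   hence "((%s. conv (moll s) ?f x) ---> 0) (at_right 0)" by (rule tendsto_eventually)
   from tendsto_unique[OF _ elim this] show "h x = 0" using x by simp
  qed
 qed
qed

section \<open>Weak gradients and the weak equation tested by smooth functions\<close>

lemma wg:
 assumes "is_weak_grad Om u g"
 shows "g : L2 Om" "integrable M (%x. g x .* b)" "!!ph b. ph : T ==> b : Basis ==> (LINT x|M. u x*(grad ph x .* b)) = - (LINT x|M. (g x .* b)*ph x)"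
 using assms L2_int[of g] testD(4)[of _ Om] unfolding is_weak_grad_def by auto

lemma wgI:
 assumes "g : L2 Om" "!!ph b. ph : T ==> b : Basis ==> (LINT x|M. u x*(grad ph x .* b)) = - (LINT x|M. (g x .* b)*ph x)"
 shows "is_weak_grad Om u g"
 using assms testD(4)[of _ Om] unfolding is_weak_grad_def by auto

lemma wg_unique:
 assumes g: "is_weak_grad Om u g" and h: "is_weak_grad Om u h" shows "AE x in M. g x = h x"
proof -
 have "AE x in M. g x .* b - h x .* b = 0" if b: "b : Basis" for b
 proof (rule FLCV)
  show "integrable M (%x. g x .* b - h x .* b)" using wg(2)[OF g] wg(2)[OF h] by simp
  show "(LINT x|M. (g x .* b - h x .* b)*ph x) = 0" if "ph : T" for ph
   using wg(3)[OF g that b] wg(3)[OF h that b] mult_test_int[OF wg(2)[OF g] that] mult_test_int[OF wg(2)[OF h] that]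
   by (simp add: left_diff_distrib)
 qed
 hence "AE x in M. ALL b:Basis. g x .* b - h x .* b = 0" by (simp add: AE_finite_all)
 thus ?thesis by eventually_elim (auto intro: euclidean_eqI)
qed

lemma wg_diff:
 assumes "u : L2 Om" "w : L2 Om" "is_weak_grad Om u g" "is_weak_grad Om w h"
 shows "is_weak_grad Om (%x. u x - w x) (%x. g x - h x)"
proof (rule wgI[OF L2_diff[OF wg(1)[OF assms(3)] wg(1)[OF assms(4)]]])
 show "(LINT x|M. (u x - w x)*(grad ph x .* b)) = - (LINT x|M. ((g x - h x) .* b)*ph x)" if "ph : T" "b : Basis" for ph b
  using wg(3)[OF assms(3) that] wg(3)[OF assms(4) that] mult_test_int[OF wg(2)[OF assms(3)] that(1), of b] mult_test_int[OF wg(2)[OF assms(4)] that(1), of b]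
   mult_test_int[OF L2_int[OF assms(1)] test_deriv[OF that]] mult_test_int[OF L2_int[OF assms(2)] test_deriv[OF that]]
  by (simp add: left_diff_distrib inner_diff_left)
qed

lemma test_wg: assumes "ph : T" shows "is_weak_grad Om ph (grad ph)" "ph : L2 Om" "grad ph : L2 Om"
proof -
 obtain B where B: "!!x. |ph x| <= B" "!!x. norm (grad ph x) <= B" using test_bounds[OF assms] by blast
 show "ph : L2 Om" "grad ph : L2 Om"
  using B bounded_L2[OF testD(3)[OF assms], of B] bounded_L2[OF C2_cont_grad[OF testD(2)[OF assms]], of B] by auto
 thus "is_weak_grad Om ph (grad ph)"
  using test_by_parts[OF assms testD(1)] int_test[OF test_deriv] int_test by (intro wgI) auto
qed

lemma weak_grad_test: "ph : T ==> AE x in M. weak_grad Om ph x = grad ph x"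
 using wg_unique[OF someI[of "is_weak_grad Om ph", folded weak_grad_def, OF test_wg(1)] test_wg(1)] .

lemma H1_D: "u : H1 Om ==> u : L2 Om & is_weak_grad Om u (weak_grad Om u)"
 unfolding H1_def weak_grad_def using someI_ex[of "is_weak_grad Om u"] by blast

lemma H1_norm_ge:
 assumes "ph : T" "u : H1 Om"
 shows "(LINT x|M. (ph x - u x)^2) + (LINT x|M. (norm (grad ph x - weak_grad Om u x))^2) = (H1_norm Om (%x. ph x - u x))^2"
proof -
 note u = H1_D[OF assms(2)]
 let ?w = "%x. ph x - u x"
 have d: "is_weak_grad Om ?w (%x. grad ph x - weak_grad Om u x)" using wg_diff[OF test_wg(2)[OF assms(1)] _ test_wg(1)[OF assms(1)]] u by blast
 have w: "is_weak_grad Om ?w (weak_grad Om ?w)" using someI[of "is_weak_grad Om ?w", OF d] unfolding weak_grad_def .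
 have "(LINT x|M. (norm (weak_grad Om ?w x))^2) = (LINT x|M. (norm (grad ph x - weak_grad Om u x))^2)"
 proof (rule integral_cong_AE)
  show "AE x in M. (norm (weak_grad Om ?w x))^2 = (norm (grad ph x - weak_grad Om u x))^2" using wg_unique[OF w d] by eventually_elim simp
 qed (use wg(1)[OF w] wg(1)[OF d] in \<open>auto simp: L2_def\<close>)
 thus ?thesis unfolding H1_norm_def by (simp add: add_nonneg_nonneg)
qed

lemma test_H1_0: assumes "ph : T" shows "ph : H1_0 Om"
proof -
 have h: "ph : H1 Om" using test_wg[OF assms] unfolding H1_def by auto
 have "(LINT x|M. (norm (grad ph x - weak_grad Om ph x))^2) = (LINT x|M. 0)"
 proof (rule integral_cong_AE)
  show "AE x in M. (norm (grad ph x - weak_grad Om ph x))^2 = 0" using weak_grad_test[OF assms] by eventually_elim simp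
 qed (use wg(1)[OF conjunct2[OF H1_D[OF h]]] test_wg(3)[OF assms] in \<open>auto simp: L2_def\<close>)
 hence "H1_norm Om (%x. ph x - ph x) = 0" using H1_norm_ge[OF assms h] by simp
 thus ?thesis unfolding H1_0_def using h assms by (auto intro!: exI[of _ "%n. ph"])
qed

lemma H1_0_D: "u : H1_0 Om ==> u : H1 Om & u : L2 Om & is_weak_grad Om u (weak_grad Om u)"
 using H1_D unfolding H1_0_def by blast

lemma weak_eq:
 assumes u: "weak_solution Om c f u" and ph: "ph : T"
 shows "(LINT x|M. weak_grad Om u x .* grad ph x) = (LINT x|M. (f x - c*u x)*ph x)"
  "(LINT x|M. u x*lap ph x) = - (LINT x|M. (f x - c*u x)*ph x)"
proof -
 let ?g = "weak_grad Om u"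
 have uH: "u : L2 Om" "is_weak_grad Om u ?g" using H1_0_D u unfolding weak_solution_def by blast+
 note g = wg[OF uH(2)]
 have f: "integrable M (%x. f x*ph x)" "(LINT x|M. ?g x .* weak_grad Om ph x + c*u x*ph x) = (LINT x|M. f x*ph x)"
  using u test_H1_0[OF ph] unfolding weak_solution_def by blast+
 have ib: "integrable M (%x. (?g x .* b)*(grad ph x .* b))" if "b : Basis" for b by (rule mult_test_int[OF g(2) test_deriv[OF ph that]])
 have gs: "?g x .* grad ph x = (SUM b:Basis. (?g x .* b)*(grad ph x .* b))" for x by (rule euclidean_inner)
 have i1: "integrable M (%x. ?g x .* grad ph x)" unfolding gs using ib by auto
 have i2: "integrable M (%x. c*u x*ph x)" using mult_test_int[OF integrable_mult_right[OF L2_int[OF uH(1)], of c] ph] .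
 have "(LINT x|M. ?g x .* weak_grad Om ph x + c*u x*ph x) = (LINT x|M. ?g x .* grad ph x + c*u x*ph x)"
 proof (rule integral_cong_AE)
  have m: "weak_grad Om ph : borel_measurable M" "?g : borel_measurable M" "grad ph : borel_measurable M" "(%x. c*u x*ph x) : borel_measurable M"
   using wg(1) H1_0_D[OF test_H1_0[OF ph]] g(1) test_wg(3)[OF ph] i2 by (auto simp: L2_def)
  thus "(%x. ?g x .* weak_grad Om ph x + c*u x*ph x) : borel_measurable M" "(%x. ?g x .* grad ph x + c*u x*ph x) : borel_measurable M" by measurable
  show "AE x in M. ?g x .* weak_grad Om ph x + c*u x*ph x = ?g x .* grad ph x + c*u x*ph x" using weak_grad_test[OF ph] by eventually_elim simp
 qed
 thus 1: "(LINT x|M. ?g x .* grad ph x) = (LINT x|M. (f x - c*u x)*ph x)" using f i1 i2 by (simp add: left_diff_distrib)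
 have "(LINT x|M. u x*lap ph x) = (SUM b:Basis. LINT x|M. u x*(grad (%y. grad ph y .* b) x .* b))"
  unfolding test_lap[OF ph] sum_distrib_left
  by (rule Bochner_Integration.integral_sum) (rule mult_test_int[OF L2_int[OF uH(1)] test_deriv[OF test_deriv[OF ph]]])
 also have "... = - (SUM b:Basis. LINT x|M. (?g x .* b)*(grad ph x .* b))" unfolding sum_negf[symmetric] by (intro sum.cong refl g(3) test_deriv[OF ph])
 also have "(SUM b:Basis. LINT x|M. (?g x .* b)*(grad ph x .* b)) = (LINT x|M. ?g x .* grad ph x)"
  unfolding gs using ib by (rule Bochner_Integration.integral_sum[symmetric])
 finally show "(LINT x|M. u x*lap ph x) = - (LINT x|M. (f x - c*u x)*ph x)" using 1 by simp
qed

text \<open>The factor 1 is written as the derivative of \<open>x .* e\<close> in direction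
  \<open>e\<close> and integrated by parts against \<open>th x*th x\<close>; on a bounded set
  \<open>x .* e\<close> is at most \<open>R\<close>, and Young's inequality absorbs half of the left
  side.\<close>

lemma poincare: obtains C where "C > 0" "!!th. th : T ==> (LINT x|M. (th x)^2) <= C*(LINT x|M. (norm (grad th x))^2)"
proof -
 obtain R where R: "R > 0" "!!x. x : Om ==> norm x <= R" using b bounded_pos by blast
 obtain e :: 'a where e: "e : Basis" using nonempty_Basis by blast
 have "(LINT x|M. (th x)^2) <= (4*R^2)*(LINT x|M. (norm (grad th x))^2)" if th: "th : T" for th
 proof -
  note C = testD(2)[OF th] and t2 = test_mult[OF th testD(1)[OF th]]
  have x: "grad (%x. x .* e) x .* e = 1" for x using C2_inner(2)[OF open_UNIV UNIV_I, of e x] e by simp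
  have g2: "grad (%x. th x*th x) x .* e = 2*th x*(grad th x .* e)" for x using C2_mult(2)[OF C C UNIV_I, of x] by (simp add: inner_add_left)
  have t3: "(%x. (grad (%x. th x*th x) x .* e)*(x .* e)) : T"
   using test_mult[OF test_deriv[OF t2 e] Ck_on_inner[OF open_UNIV]] .
  have i: "integrable M (%x. (th x)^2)" "integrable M (%x. (norm (grad th x))^2)" using test_wg(2,3)[OF th] by (auto simp: L2_def)
  have "(LINT x|M. (th x)^2) = (LINT x|M. 1*(th x*th x))" by (simp add: power2_eq_square)
  also have "... = (LINT x|lebesgue. th x*th x*(grad (%x. x .* e) x .* e))" unfolding x int_test[OF t2] by simp
  also have "... = - (LINT x|lebesgue. (grad (%x. th x*th x) x .* e)*(x .* e))"
   by (rule test_by_parts[OF t2 Ck_on_inner[OF open_UNIV] e])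
  also have "... = (LINT x|M. - ((grad (%x. th x*th x) x .* e)*(x .* e)))" using int_test[OF t3, of "%x. 1"] by simp
  also have "... <= (LINT x|M. (th x)^2/2 + 2*R^2*(norm (grad th x))^2)"
  proof (rule integral_mono)
   show "integrable M (%x. - ((grad (%x. th x*th x) x .* e)*(x .* e)))" using L2_int[OF test_wg(2)[OF t3]] by simp
   fix x assume "x : space M"
   hence n: "|x .* e| <= R" "|grad th x .* e| <= norm (grad th x)" using Basis_le_norm[OF e] R(2)[of x] by (auto intro: order_trans)
   have "|(grad th x .* e)*(x .* e)| <= norm (grad th x)*R" unfolding abs_mult using n by (intro mult_mono) auto
   hence a: "((grad th x .* e)*(x .* e))^2 <= (norm (grad th x)*R)^2" by (rule abs_le_square_iff[THEN iffD1, OF order_trans]) simp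
   have "- ((grad (%x. th x*th x) x .* e)*(x .* e)) = - 2*th x*((grad th x .* e)*(x .* e))" unfolding g2 by simp
   also have "... <= (th x)^2/2 + 2*((grad th x .* e)*(x .* e))^2"
    using zero_le_power2[of "th x + 2*((grad th x .* e)*(x .* e))"] by (simp add: power2_sum power_mult_distrib)
   finally show "- ((grad (%x. th x*th x) x .* e)*(x .* e)) <= (th x)^2/2 + 2*R^2*(norm (grad th x))^2"
    using a unfolding power_mult_distrib[of "norm (grad th x)" R] mult.commute[of "(norm (grad th x))^2"] by linarith
  qed (use i in auto)
  also have "... = (LINT x|M. (th x)^2)/2 + 2*R^2*(LINT x|M. (norm (grad th x))^2)" using i by simp
  finally show ?thesis by simp
 qed
 thus thesis using that[of "4*R^2"] R(1) by simp
qed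

text \<open>The bump replaces the positive part of \<open>ph - py\<close> and keeps the test
  function smooth. Since \<open>py >= 0\<close> in \<open>Om\<close>, it vanishes wherever
  \<open>ph\<close> does, so the support stays compact in \<open>Om\<close>.\<close>

lemma comparison_test:
 assumes ph: "ph : T" and py: "!!k. Ck_on k UNIV py" "!!x. x : Om ==> 0 <= py x"
 obtains th where "th : T" "!!x. x : Om ==> th x = bump (ph x - py x)" "!!x. x : Om ==> grad th x = bump' (ph x - py x)*.(grad ph x - grad py x)"
proof -
 define th where "th x = (if x : Om then bump (ph x - py x) else 0)" for x
 let ?z = "%x. ph x + (-1)*py x"
 have z: "Ck_on k UNIV ?z" for k using Ck_on_add[OF open_UNIV testD(1)[OF ph] Ck_on_mult[OF open_UNIV Ck_on_const[OF open_UNIV, of k "- 1"] py(1)]] .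
 have b0: "th x = 0" if "x ~: supp ph" for x using notin_supp[OF that] py(2)[of x] by (auto simp: th_def intro: flat_nonpos)
 have "EX U. open U & x : U & Ck_on k U th" for k x
 proof (cases "x : Om")
  case True
  have "Ck_on k Om ?z" by (rule Ck_on_local) (use z in blast)
  from Ck_on_cong[OF o _ Ck_on_compose[OF o smooth1_bump this], of th] show ?thesis using True o by (auto simp: th_def)
 next
  case False
  have "open (- supp ph)" by (simp add: supp_def open_Compl)
  moreover have "Ck_on k (- supp ph) th" by (rule Ck_on_cong[OF _ _ Ck_on_const[of _ _ 0]]) (use b0 \<open>open (- supp ph)\<close> in auto)
  moreover have "x : - supp ph" using False testD(7)[OF ph] by blast
  ultimately show ?thesis by blast
 qed
 hence "Ck_on k UNIV th" for k by (intro Ck_on_local) blast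
 hence t: "th : T" using b0 by (intro testI[OF _ _ testD(6,7)[OF ph]]) auto
 show thesis
 proof (rule that[OF t])
  show "th x = bump (ph x - py x)" if "x : Om" for x using that by (simp add: th_def)
  show "grad th x = bump' (ph x - py x)*.(grad ph x - grad py x)" if x: "x : Om" for x
  proof (rule grad_eqI)
   have "((%x. ph x - py x) has_derivative (%h. grad ph x .* h - grad py x .* h)) (at x)"
    by (intro has_derivative_diff C2_grad[OF testD(2)[OF ph] UNIV_I] C2_grad[OF Ck_on_C2(1)[OF open_UNIV py(1)] UNIV_I])
   from has_derivative_compose[OF this bump_deriv[unfolded has_field_derivative_def]]
   have "((%x. bump (ph x - py x)) has_derivative (%h. bump' (ph x - py x)*.(grad ph x - grad py x) .* h)) (at x)" by (simp add: inner_diff_left)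
   from has_derivative_transform_within_open[OF this o x, of th]
   show "(th has_derivative (%h. bump' (ph x - py x)*.(grad ph x - grad py x) .* h)) (at x)" by (simp add: th_def)
  qed
 qed
qed

text \<open>The equation and the barrier inequality are both tested with the bump of
  \<open>ph n - py\<close>, where \<open>ph n\<close> approximates \<open>u\<close> in the Sobolev
  norm. Poincare's inequality bounds the test function by its gradient, and the error of using
  \<open>ph n\<close> instead of \<open>u\<close> is the squared Sobolev distance, which tends to
  0.\<close>

lemma comparison:
 assumes u: "weak_solution Om c f u" and K: "AE x in M. f x - c*u x <= K" and iF: "integrable M (%x. f x - c*u x)"
  and py: "!!k. Ck_on k UNIV py" "!!x. x : Om ==> 0 <= py x" "!!x. x : Om ==> lap py x <= - K"
 shows "AE x in M. u x <= py x"
proof -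
 let ?g = "weak_grad Om u"
 have uH: "u : H1 Om" "u : L2 Om" "is_weak_grad Om u ?g" using H1_0_D u unfolding weak_solution_def by blast+
 obtain ph where ph: "!!n. ph n : T" and lim: "(%n. H1_norm Om (%x. ph n x - u x)) ----> 0"
  using u unfolding weak_solution_def H1_0_def by blast
 obtain C where C: "C > 0" "!!th. th : T ==> (LINT x|M. (th x)^2) <= C*(LINT x|M. (norm (grad th x))^2)" using poincare by blast
 have Kb: "Ck_on k UNIV (%x. grad py x .* b)" if "b : Basis" for k b
  using Ck_on_SucD(2)[OF py(1)[of "Suc k"] that] Ck_on_C2(2)[OF open_UNIV py(1) UNIV_I] by simp
 have lappy: "lap py x = (SUM b:Basis. grad (%y. grad py y .* b) x .* b)" for x
  using Ck_on_C2(3)[OF open_UNIV py(1) UNIV_I, of x] Ck_on_C2(2)[OF open_UNIV py(1) UNIV_I] Ck_on_C2(2)[OF open_UNIV Kb UNIV_I] by simp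
 let ?w = "%x. bump (u x - py x)"
 have mw: "?w : borel_measurable M"
 proof -
  have "continuous_on UNIV bump" by (rule DERIV_continuous_on) (use bump_deriv in blast)
  moreover have "(%x. u x - py x) : borel_measurable M" using uH(2) cont_M[of py] py(1)[of 0] by (auto simp: L2_def)
  ultimately show ?thesis using measurable_compose[OF _ borel_measurable_continuous_onI] by blast
 qed
 have iw: "integrable M (%x. (?w x)^2)"
  by (rule bdd_int[where B = 1]) (use mw bump_range(1,2) in \<open>auto simp: power_le_one\<close>)
 have key: "(LINT x|M. (?w x)^2) <= (8*C + 8)*(H1_norm Om (%x. ph n x - u x))^2" for n
 proof -
  obtain th where th: "th : T" "!!x. x : Om ==> th x = bump (ph n x - py x)"
   "!!x. x : Om ==> grad th x = bump' (ph n x - py x)*.(grad (ph n) x - grad py x)"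
   using comparison_test[OF ph py(1,2)] by metis
  have d2: "(%x. ph n x - u x) : L2 Om" "(%x. grad (ph n) x - ?g x) : L2 Om"
   using L2_diff test_wg(2,3)[OF ph] uH(2) wg(1)[OF uH(3)] by auto
  have i: "integrable M (%x. (th x)^2)" "integrable M (%x. (norm (grad th x))^2)" "integrable M (%x. (ph n x - u x)^2)" "integrable M (%x. (norm (grad (ph n) x - ?g x))^2)"
   using test_wg(2,3)[OF th(1)] d2 by (auto simp: L2_def)
  have ig: "integrable M (%x. h x .* grad th x)" if "!!b. integrable M (%x. h x .* b)" for h
   by (subst euclidean_inner) (auto intro!: mult_test_int[OF that test_deriv[OF th(1)]])
  have ipy: "integrable M (%x. grad py x .* grad th x)"
   by (subst euclidean_inner, subst mult.commute) (auto intro!: L2_int[OF test_wg(2)[OF test_mult[OF test_deriv[OF th(1)] Kb]]])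
  have ith: "integrable M th" by (rule L2_int[OF test_wg(2)[OF th(1)]])
  have p1: "(LINT x|M. ?g x .* grad th x) <= K*(LINT x|M. th x)"
  proof -
   have "(LINT x|M. (f x - c*u x)*th x) <= (LINT x|M. K*th x)"
   proof (rule integral_mono_AE)
    have sp: "AE x in M. x : Om" by (simp add: AE_M)
    show "AE x in M. (f x - c*u x)*th x <= K*th x"
     using K sp by eventually_elim (auto intro!: mult_right_mono simp: th(2) bump_range)
   qed (use mult_test_int[OF iF th(1)] ith in auto)
   thus ?thesis using weak_eq(1)[OF u th(1)] by simp
  qed
  have p2: "K*(LINT x|M. th x) <= (LINT x|M. grad py x .* grad th x)"
  proof -
   have tb: "integrable M (%x. th x*(grad (%y. grad py y .* b) x .* b))" "integrable M (%x. (grad th x .* b)*(grad py x .* b))"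
    "(LINT x|M. th x*(grad (%y. grad py y .* b) x .* b)) = - (LINT x|M. (grad th x .* b)*(grad py x .* b))" if b: "b : Basis" for b
   proof -
    have "Ck_on k UNIV (%x. grad (%y. grad py y .* b) x .* b)" for k
     using Ck_on_SucD(2)[OF Kb[OF b, of "Suc k"] b] Ck_on_C2(2)[OF open_UNIV Kb[OF b] UNIV_I] by simp
    hence t1: "(%x. th x*(grad (%y. grad py y .* b) x .* b)) : T" by (rule test_mult[OF th(1)])
    have t2: "(%x. (grad th x .* b)*(grad py x .* b)) : T" by (rule test_mult[OF test_deriv[OF th(1) b] Kb[OF b]])
    show "integrable M (%x. th x*(grad (%y. grad py y .* b) x .* b))" "integrable M (%x. (grad th x .* b)*(grad py x .* b))"
     using L2_int[OF test_wg(2)] t1 t2 by auto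
    show "(LINT x|M. th x*(grad (%y. grad py y .* b) x .* b)) = - (LINT x|M. (grad th x .* b)*(grad py x .* b))"
     using test_by_parts[OF th(1) Kb[OF b] b] int_test[OF t1, of "%x. 1"] int_test[OF t2, of "%x. 1"] by simp
   qed
   have l: "(%x. th x*lap py x) = (%x. SUM b:Basis. th x*(grad (%y. grad py y .* b) x .* b))" by (simp add: lappy sum_distrib_left)
   have l': "(%x. grad py x .* grad th x) = (%x. SUM b:Basis. (grad th x .* b)*(grad py x .* b))" by (subst inner_commute, subst euclidean_inner) simp
   have il: "integrable M (%x. th x*lap py x)" unfolding l using tb(1) by auto
   have "(LINT x|M. th x*lap py x) = - (LINT x|M. grad py x .* grad th x)"
    unfolding l l' using tb by (simp add: Bochner_Integration.integral_sum sum_negf)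
   moreover have "(LINT x|M. th x*lap py x) <= (LINT x|M. - K*th x)"
   proof (rule integral_mono[OF il])
    fix x assume "x : space M"
    hence x: "x : Om" by simp
    have "0 <= th x" using th(2)[OF x] bump_range(1) by simp
    from mult_left_mono[OF py(3)[OF x] this] show "th x*lap py x <= - K*th x" by (simp add: mult.commute)
   qed (use ith in auto)
   ultimately show ?thesis by simp
  qed
  have "(LINT x|M. (norm (grad th x))^2)/4 - (LINT x|M. (norm (grad (ph n) x - ?g x))^2) = (LINT x|M. (norm (grad th x))^2/4 - (norm (grad (ph n) x - ?g x))^2)" using i by simp
  also have "... <= (LINT x|M. ?g x .* grad th x - grad py x .* grad th x)"
  proof (rule integral_mono)
   show "integrable M (%x. ?g x .* grad th x - grad py x .* grad th x)" using ig[OF wg(2)[OF uH(3)]] ipy by auto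
   fix x assume "x : space M"
   hence x: "x : Om" by simp
   define be where "be = bump' (ph n x - py x)"
   have be: "0 <= be" "be <= 2" unfolding be_def by (rule bump'_range)+
   let ?a = "?g x - grad py x" and ?b = "grad (ph n) x - grad py x"
   have t: "grad th x = be*.?b" using th(3)[OF x] by (simp add: be_def)
   have n: "(norm (grad (ph n) x - ?g x))^2 = ?a .* ?a - 2*(?a .* ?b) + ?b .* ?b"
    unfolding power2_norm_eq_inner by (simp add: algebra_simps inner_commute)
   have "(norm (grad th x))^2 = be*(be*(?b .* ?b))" unfolding t power2_norm_eq_inner by simp
   also have "... <= be*(2*(?b .* ?b))" using be by (intro mult_left_mono mult_right_mono) auto
   finally have 1: "(norm (grad th x))^2 <= 2*(be*(?b .* ?b))" by simp
   have "be*(norm (grad (ph n) x - ?g x))^2 <= 2*(norm (grad (ph n) x - ?g x))^2" using be by (intro mult_right_mono) auto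
   \<comment> \<open>Polarisation bounds the mixed product \<open>?a .* ?b\<close>, the only one the
     equation controls, from below by half of \<open>?b .* ?b\<close> minus half of the
     approximation error.\<close>
   moreover have "be*(norm (grad (ph n) x - ?g x))^2 = be*(?a .* ?a) - 2*(be*(?a .* ?b)) + be*(?b .* ?b)" unfolding n by (simp only: distrib_left right_diff_distrib mult.left_commute)
   moreover have "0 <= be*(?a .* ?a)" using be by simp
   moreover have "?g x .* grad th x - grad py x .* grad th x = be*(?a .* ?b)" unfolding t inner_scaleR_right by (simp only: inner_diff_left right_diff_distrib)
   ultimately show "(norm (grad th x))^2/4 - (norm (grad (ph n) x - ?g x))^2 <= ?g x .* grad th x - grad py x .* grad th x" using 1 by linarith
  qed (use i in auto)
  also have "... <= 0" using p1 p2 ig[OF wg(2)[OF uH(3)]] ipy by simp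
  finally have e: "(LINT x|M. (norm (grad th x))^2) <= 4*(LINT x|M. (norm (grad (ph n) x - ?g x))^2)" by simp
  have "(LINT x|M. (?w x)^2) <= (LINT x|M. 2*(th x)^2 + 8*(ph n x - u x)^2)"
  proof (rule integral_mono[OF iw])
   fix x assume "x : space M"
   hence "|?w x - th x| <= 2*|ph n x - u x|" using bump_lipschitz[of "u x - py x" "ph n x - py x"] th(2)[of x] by (simp add: abs_minus_commute)
   hence "(?w x - th x)^2 <= (2*(ph n x - u x))^2" by (intro abs_le_square_iff[THEN iffD1]) (simp only: abs_mult abs_numeral)
   moreover have "(?w x)^2 <= 2*(th x)^2 + 2*(?w x - th x)^2" using zero_le_power2[of "?w x - 2*th x"] by (simp add: power2_diff power_mult_distrib)
   moreover have "(2*(ph n x - u x))^2 = 4*(ph n x - u x)^2" by (simp only: power_mult_distrib) simp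
   ultimately show "(?w x)^2 <= 2*(th x)^2 + 8*(ph n x - u x)^2" by linarith
  qed (use i in auto)
  also have "... = 2*(LINT x|M. (th x)^2) + 8*(LINT x|M. (ph n x - u x)^2)" using i by simp
  also have "... <= 2*(C*(4*(LINT x|M. (norm (grad (ph n) x - ?g x))^2))) + 8*(LINT x|M. (ph n x - u x)^2)"
   using C(2)[OF th(1)] mult_left_mono[OF e less_imp_le[OF C(1)]] by linarith
  also have "... <= (8*C + 8)*(H1_norm Om (%x. ph n x - u x))^2"
   unfolding H1_norm_ge[OF ph uH(1), symmetric] using C(1) by (simp add: algebra_simps)
  finally show ?thesis .
 qed
 have "(LINT x|M. (?w x)^2) <= (8*C + 8)*0^2"
  by (rule LIMSEQ_le_const[OF tendsto_mult_left[OF tendsto_power[OF lim]]]) (use key in blast)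
 hence "(LINT x|M. (?w x)^2) = 0" using Bochner_Integration.integral_nonneg[of M "%x. (?w x)^2"] by (intro antisym) auto
 hence "AE x in M. (?w x)^2 = 0" using integral_nonneg_eq_0_iff_AE[OF iw] by simp
 thus ?thesis by eventually_elim (simp add: bump_range(3))
qed

end

section \<open>Exterior balls and barriers\<close>

lemma C2_taylor:
 fixes ga :: "'a::euclidean_space => real"
 assumes C: "C2 UNIV ga"
 obtains m where "0 < m" "!!a b. a : cball p R ==> b : cball p R ==> |ga b - ga a - grad ga a .* (b - a)| <= m*(norm (b - a))^2"
proof -
 have "EX B. ALL x:cball p R. norm (hess ga x c) <= B" for c
 proof -
  have "continuous_on (cball p R) (%x. hess ga x c)" using continuous_on_subset[OF C2_cont_hess[OF C]] by blast
  hence "bounded ((%x. hess ga x c) ` cball p R)" using compact_continuous_image compact_cball compact_imp_bounded by blast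
  thus ?thesis unfolding bounded_iff by blast
 qed
 then obtain B where B: "!!c x. x : cball p R ==> norm (hess ga x c) <= B c" by metis
 define m where "m = (SUM c:Basis. |B c| ) + 1"
 have m: "0 < m" by (simp add: m_def add_nonneg_pos sum_nonneg)
 have on: "onorm (hess ga x) <= m" if x: "x : cball p R" for x
 proof (rule onorm_le)
  fix h
  have lin: "linear (hess ga x)" using has_derivative_linear[OF C2_hess[OF C UNIV_I]] .
  have "hess ga x h = (SUM c:Basis. (h .* c)*.hess ga x c)"
   by (subst euclidean_representation[symmetric, of h]) (simp add: linear_sum[OF lin] linear_scale[OF lin])
  also have "norm ... <= (SUM c:Basis. norm h*|B c| )"
   using B[OF x] Basis_le_norm by (intro sum_norm_le) (auto intro!: mult_mono order_trans[OF B[OF x] abs_ge_self])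
  also have "... <= m*norm h" unfolding sum_distrib_left[symmetric] m_def using norm_ge_zero[of h] by (simp add: algebra_simps)
  finally show "norm (hess ga x h) <= m*norm h" .
 qed
 show thesis
 proof (rule that[OF m])
  fix a b assume ab: "a : cball p R" "b : cball p R"
  let ?S = "cball p R \<inter> cball a (norm (b - a))"
  have S: "convex ?S" "a : ?S" "b : ?S" using ab by (auto simp: convex_Int dist_norm norm_minus_commute)
  have gl: "norm (grad ga z - grad ga a) <= m*norm (z - a)" if "z : cball p R" for z
   by (rule differentiable_bound[OF convex_cball has_derivative_at_withinI[OF C2_hess[OF C UNIV_I]] on that ab(1)])
  have "norm ((ga b - grad ga a .* b) - (ga a - grad ga a .* a)) <= (m*norm (b - a))*norm (b - a)"
  proof (rule differentiable_bound[OF S(1) _ _ S(3,2), where f = "%w. ga w - grad ga a .* w" and f' = "%w h. (grad ga w - grad ga a) .* h"])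
   show "((%w. ga w - grad ga a .* w) has_derivative (%h. (grad ga w - grad ga a) .* h)) (at w within ?S)" for w
    unfolding inner_diff_left
    by (intro has_derivative_diff has_derivative_at_withinI[OF C2_grad[OF C UNIV_I]] has_derivative_inner_right has_derivative_ident)
   show "onorm (%h. (grad ga w - grad ga a) .* h) <= m*norm (b - a)" if w: "w : ?S" for w
   proof (rule onorm_le)
    have "norm (w - a) <= norm (b - a)" using w by (simp add: dist_norm norm_minus_commute)
    from order_trans[OF gl mult_left_mono[OF this less_imp_le[OF m]]]
    have "norm (grad ga w - grad ga a) <= m*norm (b - a)" using w by blast
    thus "norm ((grad ga w - grad ga a) .* h) <= m*norm (b - a)*norm h" for h
     using Cauchy_Schwarz_ineq2[of "grad ga w - grad ga a" h] mult_right_mono[of "norm (grad ga w - grad ga a)" _ "norm h"] by fastforce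
   qed
  qed
  thus "|ga b - ga a - grad ga a .* (b - a)| <= m*(norm (b - a))^2"
   by (simp add: inner_diff_right power2_eq_square algebra_simps)
 qed
qed

text \<open>The graph function lies above its tangent plane up to \<open>m\<close> times the squared
  distance, so a ball of radius at most \<open>1/(2*m)\<close> tangent from the other side stays
  below the graph. The bound \<open>r/8\<close> keeps it inside the chart.\<close>

lemma exterior_ball_local:
 fixes Om :: "'a::euclidean_space set"
 assumes o: "open Om" and r: "0 < r" and e: "norm e = 1" and ga: "C2 UNIV ga"
  and Om: "Om \<inter> ball x0 r = {x : ball x0 r. x .* e > ga (x - (x .* e)*.e)}"
 obtains rh0 where "0 < rh0" "!!x rh. x : frontier Om ==> x : ball x0 (r/2) ==> 0 < rh ==> rh <= rh0 ==> EX y. dist x y = rh & ball y rh \<inter> Om = {}"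
proof -
 have ee: "e .* e = 1" using e by (simp add: norm_eq_1)
 define P where "P x = x - (x .* e)*.e" for x :: 'a
 have Pn: "norm (P x) <= norm x" for x
 proof -
  have "(norm (P x))^2 = (norm x)^2 - (x .* e)^2"
   unfolding P_def power2_norm_eq_inner by (simp add: inner_diff_left inner_diff_right ee inner_commute power2_eq_square)
  thus ?thesis by (intro power2_le_imp_le[OF _ norm_ge_zero]) simp
 qed
 have Pd: "P x - P y = P (x - y)" for x y by (simp add: P_def inner_diff_left scaleR_diff_left)
 obtain m where m: "0 < m" "!!a b. a : cball (P x0) r ==> b : cball (P x0) r ==> |ga b - ga a - grad ga a .* (b - a)| <= m*(norm (b - a))^2"
  using C2_taylor[OF ga] by blast
 have Pb: "P x : cball (P x0) r" if "x : ball x0 r" for x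
  using Pn[of "x0 - x"] that by (simp add: dist_norm Pd)
 have mem: "x : Om \<longleftrightarrow> ga (P x) < x .* e" if "x : ball x0 r" for x using Om that unfolding P_def by blast
 have cG: "continuous_on (ball x0 r) (%x. ga (P x) - x .* e)"
  unfolding P_def by (intro continuous_intros continuous_on_compose2[OF C2_cont[OF ga]]) auto
 define rh0 where "rh0 = min (r/8) (1/(2*m))"
 show thesis
 proof (rule that[of rh0])
  show "0 < rh0" using r m by (simp add: rh0_def)
  fix x1 rh assume x1: "x1 : frontier Om" "x1 : ball x0 (r/2)" and rh: "0 < rh" "rh <= rh0"
  have x1r: "x1 : ball x0 r" using x1(2) r by simp
  have x1Om: "x1 ~: Om" "x1 : closure Om" using x1(1) o by (auto simp: frontier_def interior_open)
  have "~ x1 .* e < ga (P x1)"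
  proof
   assume "x1 .* e < ga (P x1)"
   hence "x1 : ball x0 r \<inter> (%x. ga (P x) - x .* e) -` {0<..}" using x1r by simp
   moreover have "open (ball x0 r \<inter> (%x. ga (P x) - x .* e) -` {0<..})" by (rule continuous_open_preimage[OF cG]) auto
   ultimately have "(ball x0 r \<inter> (%x. ga (P x) - x .* e) -` {0<..}) \<inter> Om ~= {}"
    using x1Om(2) open_Int_closure_eq_empty by blast
   then obtain z where "z : Om" "z : ball x0 r" "z .* e < ga (P z)" by auto
   thus False using mem[of z] by simp
  qed
  hence eq: "x1 .* e = ga (P x1)" using mem[OF x1r] x1Om(1) by simp
  \<comment> \<open>The outward normal, not normalised; its component along \<open>e\<close> is -1,
    so its norm is at least 1.\<close>
  define nu where "nu = P (grad ga (P x1)) - e"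
  have nuk: "nu .* k = grad ga (P x1) .* P k - k .* e" for k
   unfolding nu_def P_def by (simp add: inner_diff_left inner_diff_right inner_commute)
  have "nu .* e = - 1" unfolding nuk P_def by (simp add: ee)
  hence nu: "1 <= norm nu" using Cauchy_Schwarz_ineq2[of nu e] e by simp
  define n where "n = nu /\<^sub>R norm nu"
  have n: "norm n = 1" "nu = norm nu*.n"
 proof -
  have "norm nu ~= 0" using nu by linarith
  thus "norm n = 1" "nu = norm nu*.n" by (auto simp: n_def)
 qed
  show "EX y. dist x1 y = rh & ball y rh \<inter> Om = {}"
  proof (intro exI[of _ "x1 + rh*.n"] conjI)
   show "dist x1 (x1 + rh*.n) = rh" using n rh by (simp add: dist_norm)
   show "ball (x1 + rh*.n) rh \<inter> Om = {}"
   proof (rule ccontr)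
    assume "~ ?thesis"
    then obtain x where x: "x : Om" "dist (x1 + rh*.n) x < rh" by auto
    let ?k = "x - x1"
    have kn: "norm (?k - rh*.n) < rh" using x(2) by (simp add: dist_norm norm_minus_commute algebra_simps)
    have "norm ?k < 2*rh" using norm_triangle_sub[of ?k "rh*.n"] kn n rh by simp
    hence "norm (x - x0) < r" using rh x1(2) norm_triangle_ineq[of ?k "x1 - x0"] by (simp add: rh0_def dist_norm norm_minus_commute)
    hence xr: "x : ball x0 r" by (simp add: dist_norm norm_minus_commute)
    have "(norm (?k - rh*.n))^2 < rh^2" using kn by (intro power_strict_mono) auto
    moreover have "(norm (?k - rh*.n))^2 = (norm ?k)^2 - 2*rh*(n .* ?k) + rh^2"
     using n(1) unfolding power2_norm_eq_inner norm_eq_1 by (simp add: inner_diff_left inner_diff_right inner_commute power2_eq_square)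
    ultimately have kk: "(norm ?k)^2 < 2*rh*(n .* ?k)" by simp
    hence nk: "0 < n .* ?k" using rh(1) by (smt (verit) mult_nonneg_nonpos zero_le_power2)
    have "2*rh*m <= 1" using rh(2) m(1) by (simp add: rh0_def le_divide_eq)
    have "m*(norm ?k)^2 < m*(2*rh*(n .* ?k))" using kk m(1) by simp
    also have "... = (2*rh*m)*(n .* ?k)" by simp
    also have "... <= 1*(n .* ?k)" using \<open>2 * rh * m \<le> 1\<close> nk by (intro mult_right_mono) auto
    also have "... <= norm nu*(n .* ?k)" using nu nk by (intro mult_right_mono) auto
    also have "... = nu .* ?k" by (subst (2) n(2)) simp
    finally have k1: "m*(norm ?k)^2 < nu .* ?k" .
    have "m*(norm (P x - P x1))^2 <= m*(norm ?k)^2" unfolding Pd using Pn[of ?k] m(1) by (intro mult_left_mono power_mono) auto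
    hence "ga (P x) >= ga (P x1) + grad ga (P x1) .* P ?k - m*(norm ?k)^2"
     using m(2)[OF Pb[OF x1r] Pb[OF xr]] unfolding Pd by linarith
    moreover have "ga (P x) < x .* e" using mem[OF xr] x(1) by simp
    ultimately show False using k1 eq unfolding nuk by (simp add: inner_diff_left)
   qed
  qed
 qed
qed

lemma exterior_ball:
 fixes Om :: "'a::euclidean_space set"
 assumes "open Om" "bounded Om" "smooth_boundary Om"
 obtains rh where "0 < rh" "!!x. x : frontier Om ==> EX y. dist x y = rh & ball y rh \<inter> Om = {}"
proof -
 have "EX r rh0. 0 < r & 0 < rh0 & (ALL x rh. x : frontier Om --> x : ball x0 r --> 0 < rh --> rh <= rh0 --> (EX y. dist x y = rh & ball y rh \<inter> Om = {}))"
  if x0: "x0 : frontier Om" for x0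
 proof -
  obtain r e ga where r: "r > 0" "norm e = 1" "smooth_on UNIV ga" "Om \<inter> ball x0 r = {x : ball x0 r. x .* e > ga (x - (x .* e)*.e)}"
   using assms(3) x0 unfolding smooth_boundary_def by meson
  have "C2 UNIV ga" using Ck_on_C2(1)[OF open_UNIV] r(3) unfolding smooth_on_def by blast
  then obtain rh0 where "0 < rh0" "!!x rh. x : frontier Om ==> x : ball x0 (r/2) ==> 0 < rh ==> rh <= rh0 ==> EX y. dist x y = rh & ball y rh \<inter> Om = {}"
   using exterior_ball_local[OF assms(1) r(1,2) _ r(4)] by metis
  thus ?thesis using r(1) by (intro exI[of _ "r/2"] exI[of _ rh0]) auto
 qed
 then obtain r rh0 where r: "!!x0. x0 : frontier Om ==> 0 < r x0 & 0 < rh0 x0"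
  "!!x0 x rh. x0 : frontier Om ==> x : frontier Om ==> x : ball x0 (r x0) ==> 0 < rh ==> rh <= rh0 x0 ==> EX y. dist x y = rh & ball y rh \<inter> Om = {}"
  by metis
 have "compact (frontier Om)" using assms(2) by (rule compact_frontier_bounded)
 then obtain F where F: "F <= frontier Om" "finite F" "frontier Om <= (UN x:F. ball x (r x))"
  by (rule compactE_image[where C = "frontier Om" and f = "%x. ball x (r x)"]) (use r(1) in auto)
 let ?rh = "Min (insert 1 (rh0 ` F))"
 have rh: "0 < ?rh" using F(1,2) r(1) by (subst Min_gr_iff) auto
 show thesis
 proof (rule that[OF rh])
  fix x assume x: "x : frontier Om"
  then obtain x0 where x0: "x0 : F" "x : ball x0 (r x0)" using F(3) by blast
  have "?rh <= rh0 x0" using F(2) x0(1) by (intro Min_le) auto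
  thus "EX y. dist x y = ?rh & ball y ?rh \<inter> Om = {}" using r(2)[OF _ x x0(2) rh] x0(1) F(1) by blast
 qed
qed

text \<open>The function is \<open>A*(1 - exp (- (ta*((norm (x - y0))^2 - rh^2))))\<close>, zero on
  the sphere of the exterior ball. The choice \<open>ta*rh^2 = DIM('a)\<close> makes the quadratic
  term in the Laplacian outweigh the linear one outside that ball, and \<open>A\<close> normalises
  the Laplacian to at most \<open>- K\<close>.\<close>

lemma barrier:
 fixes y0 x1 :: "'a::euclidean_space" and Om :: "'a set"
 assumes rh: "0 < rh" "dist x1 y0 = rh" "ball y0 rh \<inter> Om = {}" and D: "!!x. x : Om ==> dist x y0 <= D" and K: "0 < K"
 defines "ta == DIM('a)/rh^2" defines "A == K*exp (ta*D^2)*rh^2/(2*(real DIM('a))^2)"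
 shows "EX py. (ALL k. Ck_on k UNIV py) & (ALL x:Om. 0 <= py x & lap py x <= - K & py x <= A*ta*(D + rh)*dist x x1)"
proof -
 define N where "N = real DIM('a)"
 have N: "0 < N" by (simp add: N_def)
 have ta: "0 < ta" "ta*rh^2 = N" using rh(1) N by (auto simp: ta_def N_def)
 have A: "0 < A" using K rh(1) by (simp add: A_def)
 let ?f = "%x. (norm (x - y0))^2" and ?c = "- (A*exp (ta*rh^2))"
 let ?E = "%t. exp (- ta*t)"
 define py where "py x = A + ?c*?E (?f x)" for x
 have CE: "Ck_on k UNIV (%x. ?c*?E (?f x))" for k
  by (rule Ck_on_mult[OF open_UNIV Ck_on_const[OF open_UNIV] Ck_on_compose[OF open_UNIV smooth1_exp Ck_on_norm2[OF open_UNIV]]])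
 have C: "Ck_on k UNIV py" for k unfolding py_def[abs_def] by (rule Ck_on_add[OF open_UNIV Ck_on_const[OF open_UNIV] CE])
 note C2f = C2_norm2[OF open_UNIV, where a = y0]
 have d1: "(?E has_real_derivative - ta*?E t) (at t)" and d2: "((%t. - ta*?E t) has_real_derivative ta\<^sup>2*?E t) (at t)" for t
  by (auto intro!: derivative_eq_intros simp: power2_eq_square)
 have cE: "continuous_on (range ?f) (%t. ta^2*?E t)" by (intro continuous_intros)
 have "lap (%x. ?E (?f x)) x = ta^2*?E (?f x)*(norm (grad ?f x))^2 + (- ta*?E (?f x))*lap ?f x" for x
  by (rule C2_compose(2)[OF C2f(1) d1 d2 cE UNIV_I])
 moreover have "(norm (grad ?f x))^2 = 4*?f x" for x unfolding C2f(2)[OF UNIV_I] by (simp add: power_mult_distrib)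
 moreover have "lap ?f x = 2*N" for x unfolding C2f(3)[OF UNIV_I] N_def by simp
 ultimately have lE: "lap (%x. ?E (?f x)) x = ?E (?f x)*(4*ta^2*?f x - 2*ta*N)" for x by (simp add: algebra_simps)
 have lap: "lap py x = ?c*(?E (?f x)*(4*ta^2*?f x - 2*ta*N))" for x
  unfolding py_def[abs_def]
  using C2_add(3)[OF C2_const(1)[OF open_UNIV] Ck_on_C2(1)[OF open_UNIV CE] UNIV_I, of A x] C2_const(3)[OF open_UNIV UNIV_I, of A x]
   C2_cmult(3)[OF C2_compose(1)[OF C2f(1) d1 d2 cE] UNIV_I, of ?c x] lE by simp
 have bounds: "rh^2 <= ?f x" "?f x <= D^2" "?f x - rh^2 <= (D + rh)*dist x x1" if x: "x : Om" for x
 proof -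
  have 1: "rh <= norm (x - y0)" using x rh(3) by (force simp: dist_norm norm_minus_commute not_less)
  have 2: "norm (x - y0) <= D" using D[OF x] by (simp add: dist_norm)
  show "rh^2 <= ?f x" "?f x <= D^2" using 1 2 rh(1) by (auto intro: power_mono)
  have "?f x - rh^2 = (norm (x - y0) + rh)*(norm (x - y0) - rh)" by (simp add: power2_eq_square algebra_simps)
  also have "... <= (D + rh)*dist x x1"
   using 1 2 rh(1,2) norm_triangle_ineq[of "x - x1" "x1 - y0"] by (intro mult_mono) (auto simp: dist_norm)
  finally show "?f x - rh^2 <= (D + rh)*dist x x1" .
 qed
 have pf: "py x = A*(1 - exp (- (ta*(?f x - rh^2))))" for x
  unfolding py_def by (simp add: right_diff_distrib mult.assoc exp_add[symmetric])
 show ?thesis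
 proof (intro exI[of _ py] conjI allI ballI C)
  fix x assume x: "x : Om"
  note b = bounds[OF x]
  have "0 <= ta*(?f x - rh^2)" using b ta by simp
  thus "0 <= py x" unfolding pf using A by simp
  have "1 - exp (- (ta*(?f x - rh^2))) <= ta*(?f x - rh^2)" using exp_ge_add_one_self[of "- (ta*(?f x - rh^2))"] by linarith
  also have "... <= ta*((D + rh)*dist x x1)" using b(3) ta(1) by (intro mult_left_mono) auto
  finally have "py x <= A*(ta*((D + rh)*dist x x1))" unfolding pf using A by (intro mult_left_mono) auto
  thus "py x <= A*ta*(D + rh)*dist x x1" by (simp add: mult.assoc)
  have "2*N^2/rh^2 <= 4*ta^2*?f x - 2*ta*N"
  proof -
   have "4*ta^2*rh^2 <= 4*ta^2*?f x" using b(1) by (intro mult_left_mono) auto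
   moreover have "4*ta^2*rh^2 = 4*ta*N" unfolding ta(2)[symmetric] by (simp add: power2_eq_square)
   moreover have "ta*N = N^2/rh^2" by (simp add: ta_def N_def power2_eq_square)
   ultimately show ?thesis by linarith
  qed
  hence "exp (ta*rh^2)*?E (?f x)*(2*N^2/rh^2) <= exp (ta*rh^2)*?E (?f x)*(4*ta^2*?f x - 2*ta*N)" by (intro mult_left_mono) auto
  moreover have "exp (- (ta*D^2)) <= exp (ta*rh^2)*?E (?f x)"
  proof -
   have "ta*?f x <= ta*D^2" using b(2) ta(1) by (intro mult_left_mono) auto
   hence "- (ta*D^2) <= ta*rh^2 + - ta*?f x" using ta(2) N unfolding mult_minus_left by linarith
   thus ?thesis unfolding exp_add[symmetric] exp_le_cancel_iff .
  qed
  hence "exp (- (ta*D^2))*(2*N^2/rh^2) <= exp (ta*rh^2)*?E (?f x)*(2*N^2/rh^2)" by (intro mult_right_mono) auto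
  ultimately have "A*(exp (- (ta*D^2))*(2*N^2/rh^2)) <= A*(exp (ta*rh^2)*?E (?f x)*(4*ta^2*?f x - 2*ta*N))"
   using A by (intro mult_left_mono) auto
  moreover have "A*(exp (- (ta*D^2))*(2*N^2/rh^2)) = K" using rh(1) N by (simp add: A_def N_def exp_minus)
  ultimately show "lap py x <= - K" unfolding lap by simp
 qed
qed

section \<open>From weak solutions to the uniform estimate\<close>

lemma C2_local:
 assumes "open S" "!!x. x : S ==> EX T. x : T & C2 T f" shows "C2 S f"
proof -
 have *: "f differentiable (at x) & grad f differentiable (at x) & isCont (%x. hess f x h) x" if x: "x : S" for x h
 proof -
  obtain T where T: "x : T" "C2 T f" using assms(2)[OF x] by blast
  hence "isCont (%x. hess f x h) x" using C2_cont_hess[OF T(2)] C2_open[OF T(2)] by (simp add: continuous_on_eq_continuous_at)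
  thus ?thesis using T unfolding C2_def by blast
 qed
 show ?thesis unfolding C2_def using assms(1) * by (auto intro!: continuous_at_imp_continuous_on)
qed

lemma cubic_lipschitz:
 fixes a b a' b' :: real
 assumes B: "|a| <= B" "|b| <= B" "|a'| <= B" "|b'| <= B" and t: "|a - a'| <= t" "|b - b'| <= t"
 shows "|(w*a^3 - be*a*b^2 - c*a) - (w*a'^3 - be*a'*b'^2 - c*a')| <= (3*|w|*B^2 + 3*|be|*B^2 + |c| )*t"
proof -
 have B0: "0 <= B" "0 <= t" using B(1) t(1) by auto
 have p: "|x*y| <= B^2" if "|x| <= B" "|y| <= B" for x y
  using mult_mono[OF that B0(1)] by (simp add: abs_mult power2_eq_square)
 have 1: "|a^3 - a'^3| <= t*(3*B^2)"
 proof -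
  have "a^3 - a'^3 = (a - a')*(a*a + a*a' + a'*a')" by (simp add: power3_eq_cube algebra_simps)
  moreover have "|a*a + a*a' + a'*a'| <= 3*B^2" using p[of a a] p[of a a'] p[of a' a'] B by linarith
  ultimately show ?thesis using mult_mono[OF t(1) _ B0(2)] by (simp add: abs_mult)
 qed
 have 2: "|a*b^2 - a'*b'^2| <= t*(3*B^2)"
 proof -
  have "a*b^2 - a'*b'^2 = (a - a')*(b*b) + (b - b')*(a'*b + a'*b')" by (simp add: power2_eq_square algebra_simps)
  moreover have "|(a - a')*(b*b)| <= t*B^2" unfolding abs_mult[of "a - a'"] using p[of b b] B by (intro mult_mono[OF t(1) _ B0(2)]) auto
  moreover have "|a'*b + a'*b'| <= 2*B^2" using p[of a' b] p[of a' b'] B by linarith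
  hence "|(b - b')*(a'*b + a'*b')| <= t*(2*B^2)" unfolding abs_mult[of "b - b'"] by (intro mult_mono[OF t(2) _ B0(2)]) auto
  ultimately show ?thesis by linarith
 qed
 have "(w*a^3 - be*a*b^2 - c*a) - (w*a'^3 - be*a'*b'^2 - c*a') = w*(a^3 - a'^3) - be*(a*b^2 - a'*b'^2) - c*(a - a')"
  by (simp add: algebra_simps)
 also have "|...| <= |w|*|a^3 - a'^3| + |be|*|a*b^2 - a'*b'^2| + |c|*|a - a'|" unfolding abs_mult[symmetric] by linarith
 also have "... <= |w|*(t*(3*B^2)) + |be|*(t*(3*B^2)) + |c|*t" using 1 2 t(1) by (intro add_mono mult_left_mono) auto
 finally show ?thesis by (simp add: algebra_simps)
qed

context bounded_open
begin

abbreviation "ext u x == indicator Om x*u x :: real"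
abbreviation "R u == rep (ext u)"
abbreviation "rhs w be c u v x == w*u x^3 - be*u x*(v x)^2 - c*u x :: real"
abbreviation "wsol w be c u v == weak_solution Om c (%x. w*u x^3 - be*u x*(v x)^2) u"

text \<open>The upper bound drops the coupling, which has the favourable sign, and is therefore
  uniform in \<open>be\<close>; it feeds the barrier. The two-sided bound depends on
  \<open>be\<close> and serves only qualitative regularity.\<close>

lemma rhs_bound:
 assumes "v : borel_measurable M" "u : borel_measurable M" and m: "AE x in M. 0 < u x & 0 < v x & u x <= m & v x <= m" and be: "0 < be" "0 <= m"
 shows "AE x in M. rhs w be c u v x <= |w|*m^3 + |c|*m"
  "AE x in M. |rhs w be c u v x| <= |w|*m^3 + be*m^3 + |c|*m" "integrable M (rhs w be c u v)"
proof -
 have *: "|w*a^3 - c*a| <= |w|*m^3 + |c|*m" "0 <= be*a*b^2" "be*a*b^2 <= be*m^3"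
  if "0 < a" "0 < b" "a <= m" "b <= m" for a b :: real
 proof -
  have "|w*a^3| <= |w|*m^3" "|c*a| <= |c|*m" unfolding abs_mult using that by (intro mult_left_mono power_mono; simp)+
  thus "|w*a^3 - c*a| <= |w|*m^3 + |c|*m" by linarith
  show "0 <= be*a*b^2" using that be by simp
  have "a*b^2 <= m*m^2" using that by (intro mult_mono power_mono) auto
  thus "be*a*b^2 <= be*m^3" using be by (simp add: power3_eq_cube power2_eq_square mult.assoc)
 qed
 show "AE x in M. rhs w be c u v x <= |w|*m^3 + |c|*m"
  using m
 proof eventually_elim
  case (elim x) show ?case using *[of "u x" "v x"] elim by linarith
 qed
 show ae: "AE x in M. |rhs w be c u v x| <= |w|*m^3 + be*m^3 + |c|*m"
  using m
 proof eventually_elim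
  case (elim x) show ?case using *[of "u x" "v x"] elim by linarith
 qed
 have "rhs w be c u v : borel_measurable M" using assms(1,2) by measurable
 thus "integrable M (rhs w be c u v)" using bdd_int ae by blast
qed

context
 fixes u v :: "'a => real" and w be c m :: real
 assumes sol: "wsol w be c u v" and mv: "v : borel_measurable M"
  and pm: "AE x in M. 0 < u x & 0 < v x & u x <= m & v x <= m" and be: "0 < be" "0 <= m"
begin

lemma uL2: "u : L2 Om" "u : borel_measurable M"
 using H1_0_D[of u] sol unfolding weak_solution_def by (auto simp: L2_def)

lemma eq_data:
 shows "integrable lebesgue (ext u)" "integrable lebesgue (ext (rhs w be c u v))"
  "ALL ph:T. (LINT y|lebesgue. ext u y*lap ph y) = - (LINT y|lebesgue. ext (rhs w be c u v) y*ph y)"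
  "AE y in lebesgue. y : Om --> |ext u y| <= m" "EX K. AE y in lebesgue. y : Om --> |ext (rhs w be c u v) y| <= K"
proof -
 note r = rhs_bound[OF mv uL2(2) pm be, of w c]
 show "integrable lebesgue (ext u)" "integrable lebesgue (ext (rhs w be c u v))" using integrable_M L2_int[OF uL2(1)] r(3) by auto
 show "ALL ph:T. (LINT y|lebesgue. ext u y*lap ph y) = - (LINT y|lebesgue. ext (rhs w be c u v) y*ph y)"
  using weak_eq(2)[OF sol] unfolding int_M by (simp add: mult_ac)
 show "AE y in lebesgue. y : Om --> |ext u y| <= m" using pm unfolding AE_M by eventually_elim auto
 show "EX K. AE y in lebesgue. y : Om --> |ext (rhs w be c u v) y| <= K"
  using r(2) unfolding AE_M by (intro exI) (auto elim!: eventually_mono)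
qed

lemma R_ae: "AE x in M. R u x = u x"
 unfolding AE_M using rep_ae[OF eq_data(1-3)] by eventually_elim auto

lemma R_lipschitz: "ALL x0:Om. EX r L. 0 < r & ball x0 r <= Om & (ALL x:ball x0 r. ALL y:ball x0 r. |R u x - R u y| <= L*norm (x - y))"
proof
 fix x0 assume "x0 : Om"
 then obtain e where e: "e > 0" "ball x0 e <= Om" using o openE by blast
 obtain K where K: "AE y in lebesgue. y : Om --> |ext (rhs w be c u v) y| <= K" using eq_data(5) by blast
 have r: "0 < e/2" "ball x0 (2*(e/2)) <= Om" using e by auto
 obtain Lip where "!!x y. x : ball x0 (e/2/2) ==> y : ball x0 (e/2/2) ==> |R u x - R u y| <= Lip*norm (x - y)"
  by (rule regular1[OF eq_data(1-4) K r]) (rule that, blast)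
 moreover have "ball x0 (e/2/2) <= Om" using e by (intro subset_trans[OF subset_ball e(2)]) auto
 ultimately show "EX r L. 0 < r & ball x0 r <= Om & (ALL x:ball x0 r. ALL y:ball x0 r. |R u x - R u y| <= L*norm (x - y))"
  using e(1) by (intro exI[of _ "e/2/2"] exI[of _ Lip]) auto
qed

text \<open>Once the representatives of both components are locally Lipschitz, so is the right-hand
  side, and the second regularity step applies. The data on \<open>v\<close> enter as assumptions so
  that the lemma can be used for either component.\<close>

lemma R_C2:
 assumes rv: "AE x in M. R v x = v x"
  and lv: "ALL x0:Om. EX r L. 0 < r & ball x0 r <= Om & (ALL x:ball x0 r. ALL y:ball x0 r. |R v x - R v y| <= L*norm (x - y))"
 shows "C2 Om (R u)" "ALL x:Om. lap (R u) x = - rhs w be c (R u) (R v) x"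
proof -
 have *: "EX e>0. C2 (ball x0 e) (R u) & lap (R u) x0 = - rhs w be c (R u) (R v) x0" if x0: "x0 : Om" for x0
 proof -
  obtain r1 L1 where r1: "0 < r1" "ball x0 r1 <= Om" "!!x y. x : ball x0 r1 ==> y : ball x0 r1 ==> |R u x - R u y| <= L1*norm (x - y)"
   using bspec[OF R_lipschitz x0] by blast
  obtain r2 L2 where r2: "0 < r2" "ball x0 r2 <= Om" "!!x y. x : ball x0 r2 ==> y : ball x0 r2 ==> |R v x - R v y| <= L2*norm (x - y)"
   using bspec[OF lv x0] by blast
  define r where "r = min r1 r2/2"
  have r: "0 < r" "2*r <= r1" "2*r <= r2" using r1 r2 by (auto simp: r_def)
  have rsub: "x : ball x0 r1" "x : ball x0 r2" if "x : ball x0 (2*r)" for x using that r by auto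
  define L where "L = |L1| + |L2|"
  have L: "|R u x - R u y| <= L*norm (x - y)" "|R v x - R v y| <= L*norm (x - y)" if "x : ball x0 (2*r)" "y : ball x0 (2*r)" for x y
   using that
   by (intro order_trans[OF r1(3)] order_trans[OF r2(3)] mult_right_mono; simp add: rsub L_def del: mem_ball)+
  define B where "B = |R u x0| + |R v x0| + L*(2*r)"
  have B: "|R u x| <= B" "|R v x| <= B" if x: "x : ball x0 (2*r)" for x
  proof -
   have "L*norm (x - x0) <= L*(2*r)" using x by (intro mult_left_mono) (auto simp: L_def dist_norm norm_minus_commute)
   thus "|R u x| <= B" "|R v x| <= B" using L[OF x, of x0] r(1) unfolding B_def by auto
  qed
  have H: "AE y in lebesgue. y : ball x0 (2*r) --> ext (rhs w be c u v) y = rhs w be c (R u) (R v) y"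
   using R_ae rv unfolding AE_M
  proof eventually_elim
   case (elim y)
   thus ?case using rsub(1)[of y] r1(2) by (auto simp del: mem_ball)
  qed
  have HL: "|rhs w be c (R u) (R v) x - rhs w be c (R u) (R v) y| <= (3*|w|*B^2 + 3*|be|*B^2 + |c| )*L*norm (x - y)"
   if "x : ball x0 (2*r)" "y : ball x0 (2*r)" for x y
   using cubic_lipschitz[OF B[OF that(1)] B[OF that(2)] L[OF that], of w be c] by (simp add: mult.assoc)
  obtain K where K: "AE y in lebesgue. y : Om --> |ext (rhs w be c u v) y| <= K" using eq_data(5) by blast
  have sub: "ball x0 (2*r) <= Om" using rsub(1) r1(2) by blast
  note reg = regular2[OF eq_data(1-4) K r(1) sub H HL]
  show ?thesis using reg(1) reg(2)[of x0] r(1) by (intro exI[of _ "r/8"]) auto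
 qed
 show "C2 Om (R u)" by (rule C2_local[OF o]) (use * centre_in_ball in blast)
 show "ALL x:Om. lap (R u) x = - rhs w be c (R u) (R v) x" using * by blast
qed

text \<open>Comparison gives the barrier bound almost everywhere, continuity everywhere. The
  constant involves only \<open>K\<close>, \<open>D\<close> and the radius of the exterior ball,
  hence is uniform in \<open>be\<close>.\<close>

lemma R_boundary:
 assumes C: "C2 Om (R u)" and x1: "x1 : frontier Om" and rh: "0 < rh" "dist x1 y0 = rh" "ball y0 rh \<inter> Om = {}" and D: "ALL x:Om. dist x y0 <= D"
  and K: "0 < K" "|w|*m^3 + |c|*m <= K" and x: "x : Om"
 defines "ta == DIM('a)/rh^2" defines "A == K*exp (ta*D^2)*rh^2/(2*(real DIM('a))^2)"
 shows "R u x <= A*ta*(D + rh)*dist x x1"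
proof -
 note rb = rhs_bound[OF mv uL2(2) pm be, of w c]
 obtain py where py: "!!k. Ck_on k UNIV py" "!!x. x : Om ==> 0 <= py x" "!!x. x : Om ==> lap py x <= - K"
  "!!x. x : Om ==> py x <= A*ta*(D + rh)*dist x x1"
  using barrier[OF rh _ K(1), of D] D unfolding ta_def A_def by blast
 have "AE x in M. rhs w be c u v x <= K" using rb(1) by eventually_elim (use K in auto)
 hence "AE x in M. u x <= py x" by (rule comparison[OF sol _ rb(3) py(1-3)])
 hence ae: "AE x in lebesgue. x : Om --> R u x - py x <= 0" using R_ae unfolding AE_M by eventually_elim auto
 have "continuous_on Om py" using continuous_on_subset[of UNIV py] py(1)[of 0] by simp
 hence "R u x - py x <= 0" by (intro ae_imp_all[OF o _ ae x] continuous_intros C2_cont[OF C])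
 thus ?thesis using py(4)[OF x] by linarith
qed

lemma R_range: assumes C: "C2 Om (R u)" and x: "x : Om" shows "0 <= R u x" "R u x <= m"
proof -
 have "AE x in lebesgue. x : Om --> - R u x <= 0" "AE x in lebesgue. x : Om --> R u x - m <= 0"
  using pm R_ae unfolding AE_M by (eventually_elim, auto)+
 moreover have "continuous_on Om (%x. - R u x)" "continuous_on Om (%x. R u x - m)" by (intro continuous_intros C2_cont[OF C])+
 ultimately have "- R u x <= 0" "R u x - m <= 0" using ae_imp_all[OF o _ _ x] by blast+
 thus "0 <= R u x" "R u x <= m" by auto
qed

text \<open>Almost everywhere positivity leaves single zeros open. At a zero, the mean value
  inequality for \<open>lap (R u) y <= La*R u y\<close> would make the function vanish on a ball,
  which is not negligible; \<open>La\<close> may depend on \<open>be\<close> here.\<close>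

lemma R_pos:
 assumes C: "C2 Om (R u)" and vm: "ALL x:Om. 0 <= R v x & R v x <= m"
  and eq: "ALL x:Om. lap (R u) x = - rhs w be c (R u) (R v) x" and x: "x : Om"
 shows "0 < R u x"
proof (rule ccontr)
 assume "~ 0 < R u x"
 hence u0: "R u x = 0" using R_range[OF C x] by simp
 obtain e where e: "e > 0" "ball x e <= Om" using x o openE by blast
 define La where "La = |w|*m^2 + be*m^2 + |c|"
 have L: "lap (R u) y <= La*R u y" if y: "y : ball x e" for y
 proof -
  have yOm: "y : Om" using y e by blast
  note uy = R_range[OF C yOm] and vy = bspec[OF vm yOm]
  have "- w*(R u y)^2 <= |w|*m^2" "be*(R v y)^2 <= be*m^2" using uy vy be by (intro mult_mono power_mono; simp)+
  hence "- w*(R u y)^2 + be*(R v y)^2 + c <= La" unfolding La_def by linarith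
  from mult_right_mono[OF this uy(1)] show ?thesis unfolding bspec[OF eq yOm] by (simp add: algebra_simps power2_eq_square power3_eq_cube)
 qed
 have La: "0 <= La" using be by (simp add: La_def)
 have Ce: "C2 (ball x e) (R u)" by (rule C2_subset[OF C open_ball e(2)])
 have nn: "0 <= R u y" if "y : ball x e" for y using R_range(1)[OF C] that e by blast
 have "wmean (R u) x (e/2) <= exp (La*(e/2)^2/8)*(R u x*wint 1 (%y::'a. 1))"
  by (rule wmean_le_exp[OF Ce nn L La]) (use e in auto)
 hence w: "wint 1 (%y. R u (x + (e/2)*.y)) <= 0" using u0 by (simp add: wmean_def)
 have inb: "x + (e/2)*.y : ball x e" if "norm y <= 1" for y using in_ball_scaled[of "e/2" e y x] that e by simp
 have cu: "cont1 (%y. R u (x + (e/2)*.y))"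
  by (intro continuous_on_compose2[OF C2_cont[OF Ce]] continuous_intros) (use inb in auto)
 have "wint 1 (%y. R u (x + (e/2)*.y)) = 0" using w wint_nonneg[of "%y. R u (x + (e/2)*.y)" 1] nn[OF inb] by force
 hence z: "R u (x + (e/2)*.y) = 0" if "norm y < 1" for y using wint_eq_0_imp[OF cu _ _ that] nn[OF inb] by simp
 have zz: "R u y = 0" if "y : ball x (e/2)" for y
  using z[of "(2/e)*.(y - x)"] that e(1) by (simp add: dist_norm norm_minus_commute)
 have "AE y in lebesgue. y ~: ball x (e/2)"
  using pm R_ae unfolding AE_M
 proof eventually_elim
  case (elim y)
  thus ?case using zz[of y] e by (auto simp: subset_iff)
 qed
 hence "negligible (ball x (e/2))" unfolding negligible_iff_null_sets by (intro AE_iff_null_sets[THEN iffD2]) auto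
 thus False using open_not_negligible[OF open_ball] e(1) by (metis centre_in_ball empty_iff half_gt_zero)
qed

end

text \<open>On a ball reaching from \<open>x\<close> to the boundary, of radius \<open>d\<close>,
  the values are at most \<open>B2*d\<close> by linear decay. The scaled interior estimate thus
  loses only \<open>d/d powr al\<close>, which is at most 1. Points farther apart than a quarter of
  this radius are handled by the linear decay of each value.\<close>

lemma zero_extension_holder:
 assumes he: "holder_est TYPE('a) al ka0 C" and C: "0 < C" and al: "0 < al" "al <= 1" and sol: "Sol Om ka be U V"
  and m: "0 < m" "!!x. x : Om ==> U x <= m & V x <= m" and d0: "0 < d0" "d0 <= 1" "ka*d0^2 <= ka0"
  and C1: "0 < C1" "!!x x1. x : Om ==> x1 : frontier Om ==> U x <= C1*dist x x1 & V x <= C1*dist x x1"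
 defines "B2 == 2*C1 + m/d0"
 shows "|(if x : Om then U x else 0) - (if y : Om then U y else 0)| <= (C*B2 + 4*B2 + m)*dist x y powr al" (is "|?u x - ?u y| <= ?K*_")
proof -
 have B2: "0 < B2" using C1(1) m(1) d0(1) by (simp add: B2_def add_pos_pos)
 have near: "EX d. 0 < d & U x <= B2*d & (ALL y. dist x y < d/4 --> y : Om & |U x - U y| <= C*B2*dist x y powr al)" if x: "x : Om" for x
 proof -
  let ?F = "frontier Om"
  have "Om ~= UNIV" using b not_bounded_UNIV by metis
  hence F: "closed ?F" "?F ~= {}" using x frontier_eq_empty[of Om] by (auto simp: frontier_closed)
  obtain x1 where x1: "x1 : ?F" "infdist x ?F = dist x x1" using infdist_attains_inf[OF F] by metis
  have pos: "0 < dist x x1" using x1(1) x o by (auto simp: frontier_def interior_open)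
  define d where "d = min (dist x x1) d0"
  have d: "0 < d" "d <= 1" using pos d0 by (auto simp: d_def)
  have sub: "ball x d <= Om"
  proof (rule ccontr)
   assume "~ ball x d <= Om"
   moreover have "ball x d \<inter> Om ~= {}" using x d centre_in_ball[of x d] by blast
   ultimately have "ball x d \<inter> ?F ~= {}" by (intro connected_Int_frontier) auto
   then obtain p where "p : ?F" "dist x p < d" by auto
   thus False using infdist_le[of p ?F x] x1(2) by (simp add: d_def)
  qed
  have A: "U y <= B2*d & V y <= B2*d" if y: "y : ball x d" for y
  proof (cases "dist x x1 <= d0")
   case True
   hence dd: "d = dist x x1" by (simp add: d_def)
   have "dist y x1 <= 2*d" using dist_triangle[of y x1 x] y by (simp add: dd dist_commute)
   from mult_left_mono[OF this less_imp_le[OF C1(1)]] have "U y <= 2*C1*d & V y <= 2*C1*d"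
    using C1(2)[of y x1] x1(1) y sub by fastforce
   moreover have "2*C1*d <= B2*d" using d m d0 by (intro mult_right_mono) (auto simp: B2_def)
   ultimately show ?thesis by linarith
  next
   case False
   hence dd: "d = d0" by (simp add: d_def)
   have "m = m/d0*d" using d0 by (simp add: dd)
   also have "... <= B2*d" using d C1 by (intro mult_right_mono) (auto simp: B2_def)
   finally show ?thesis using m(2)[of y] y sub by fastforce
  qed
  have "ka*d^2 <= ka*d0^2" using Sol_C2(5)[OF sol] d by (intro mult_left_mono power_mono) (auto simp: d_def)
  hence k: "ka*d^2 <= ka0" using d0 by linarith
  have "y : Om & |U x - U y| <= C*B2*dist x y powr al" if y: "dist x y < d/4" for y
  proof
   show "y : Om" using y d sub by auto
   have "|U x - U y| <= C*(B2*d)*(dist x y/d) powr al"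
    by (rule holder_est_scaled(1)[OF he Sol_subset[OF sol open_ball sub] d(1) k _ A]) (use y d B2 in auto)
   also have "... = C*B2*(d/d powr al)*dist x y powr al" using d by (simp add: powr_divide)
   also have "... <= C*B2*1*dist x y powr al"
   proof (intro mult_right_mono mult_left_mono)
    have "d powr 1 <= d powr al" using d al powr_mono'[of al 1 d] by simp
    thus "d/d powr al <= 1" using d by simp
   qed (use C B2 in auto)
   finally show "|U x - U y| <= C*B2*dist x y powr al" by simp
  qed
  thus ?thesis using d A[of x] by auto
 qed
 have Upos: "0 < U x" if "x : Om" for x using Sol_pos(1)[OF sol that] .
 have K: "C*B2*dist x y powr al <= ?K*dist x y powr al" "4*B2*dist x y powr al <= ?K*dist x y powr al" "m*dist x y powr al <= ?K*dist x y powr al"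
  using C B2 m by (intro mult_right_mono; simp)+
 consider "x : Om" "y : Om" "|U x - U y| <= C*B2*dist x y powr al" | "?u x <= 4*B2*dist x y" "?u y <= 4*B2*dist x y"
 proof (cases "EX p q. {p, q} = {x, y} & p : Om & |U p - U q| <= C*B2*dist p q powr al & q : Om")
  case True
  thus ?thesis using that(1) by (auto simp: doubleton_eq_iff dist_commute abs_minus_commute)
 next
  case False
  \<comment> \<open>The failed case means that neither point lies in the other's interior region, so
    \<open>d\<close> is at most four times their distance.\<close>
  have "?u p <= 4*B2*dist p q" if pq: "{p, q} = {x, y}" for p q
  proof (cases "p : Om")
   case True
   then obtain d where d: "0 < d" "U p <= B2*d" "dist p q < d/4 ==> q : Om & |U p - U q| <= C*B2*dist p q powr al" using near by blast
   have "~ dist p q < d/4" using False d(3) True pq by blast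
   hence "B2*d <= B2*(4*dist p q)" using B2 by (intro mult_left_mono) auto
   thus ?thesis using d(2) True by simp
  qed (use B2 in auto)
  from this[of x y] this[of y x] show ?thesis using that(2) by (simp add: dist_commute insert_commute)
 qed
 thus ?thesis
 proof cases
  case 1
  thus ?thesis using K by simp
 next
  case 2
  have u0: "0 <= ?u x" "0 <= ?u y" "?u x <= m" "?u y <= m" using Upos[of x] Upos[of y] m(2)[of x] m(2)[of y] m(1) by (auto intro: less_imp_le)
  show ?thesis
  proof (cases "dist x y <= 1")
   case True
   have "dist x y powr 1 <= dist x y powr al" using al True powr_mono'[of al 1 "dist x y"] by simp
   hence "4*B2*dist x y <= 4*B2*dist x y powr al" using B2 by (intro mult_left_mono) auto
   thus ?thesis using 2 u0 K(2) by linarith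
  next
   case False
   hence "1 <= dist x y powr al" using al by (simp add: ge_one_powr_ge_zero)
   hence "m*1 <= m*dist x y powr al" using m by (intro mult_left_mono) auto
   thus ?thesis using u0 K(3) by linarith
  qed
 qed
qed

end

lemma holder_norm_le:
 fixes u v :: "'a::euclidean_space => real"
 assumes "0 <= A" "0 <= B" and m: "!!x. |u x| <= A & |v x| <= A"
  and h: "!!x y. |u x - u y| <= B*dist x y powr al & |v x - v y| <= B*dist x y powr al"
 shows "holder_norm K al (%x. (u x, v x)) <= ennreal (2*A + 2*B)"
proof -
 have np: "norm (p, q) <= |p| + |q|" for p q :: real using norm_Pair_le[of p q] by simp
 have "(SUP x\<in>K. ennreal (norm (u x, v x))) <= ennreal (2*A)"
 proof (rule SUP_least, rule ennreal_leI)
  fix x show "norm (u x, v x) <= 2*A" using np[of "u x" "v x"] m[of x] by linarith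
 qed
 moreover have "(SUP (x, y) \<in> {(x, y). x : K & y : K & x ~= y}. ennreal (norm ((u x, v x) - (u y, v y))/dist x y powr al)) <= ennreal (2*B)"
 proof (rule SUP_least, clarify, rule ennreal_leI)
  fix x y :: 'a assume "x ~= y"
  hence "0 < dist x y powr al" by simp
  moreover have "norm ((u x, v x) - (u y, v y)) <= 2*B*dist x y powr al"
   using np[of "u x - u y" "v x - v y"] h[of x y] unfolding diff_Pair by linarith
  ultimately show "norm ((u x, v x) - (u y, v y))/dist x y powr al <= 2*B" by (simp add: divide_le_eq)
 qed
 ultimately have "holder_norm K al (%x. (u x, v x)) <= ennreal (2*A) + ennreal (2*B)" unfolding holder_norm_def by (rule add_mono)
 thus ?thesis using assms(1,2) by (simp add: ennreal_plus)
qed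

theorem theorem1p1:
  fixes \<Omega> :: "(real ^ 'n) set"
    and \<omega>\<^sub>1 \<omega>\<^sub>2 :: real
    and lam mu :: "real \<Rightarrow> real"
    and u v :: "real \<Rightarrow> real ^ 'n \<Rightarrow> real"
  assumes dim: "CARD('n) \<in> {2, 3}"
    and domain: "smooth_bounded_domain \<Omega>"
    and lam_bounded: "bounded (lam ` {0<..})"
    and mu_bounded: "bounded (mu ` {0<..})"
    and u_solution: "\<And>\<beta>. \<beta> > 0 \<Longrightarrow> weak_solution \<Omega> (lam \<beta>)
          (\<lambda>x. \<omega>\<^sub>1 * u \<beta> x ^ 3 - \<beta> * u \<beta> x * (v \<beta> x)\<^sup>2) (u \<beta>)"
    and v_solution: "\<And>\<beta>. \<beta> > 0 \<Longrightarrow> weak_solution \<Omega> (mu \<beta>)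
          (\<lambda>x. \<omega>\<^sub>2 * v \<beta> x ^ 3 - \<beta> * (u \<beta> x)\<^sup>2 * v \<beta> x) (v \<beta>)"
    and positive: "\<And>\<beta>. \<beta> > 0 \<Longrightarrow> AE x in lebesgue_on \<Omega>. u \<beta> x > 0 \<and> v \<beta> x > 0"
    and uniformly_bounded:
      "\<exists>M. \<forall>\<beta>>0. AE x in lebesgue_on \<Omega>. \<bar>u \<beta> x\<bar> \<le> M \<and> \<bar>v \<beta> x\<bar> \<le> M"
  shows "\<forall>\<alpha>\<in>{0<..<1}. \<exists>C>0. \<forall>\<beta>>0. \<exists>u' v'.
           (AE x in lebesgue_on \<Omega>. u' x = u \<beta> x \<and> v' x = v \<beta> x) \<and>
           holder_norm (closure \<Omega>) \<alpha> (\<lambda>x. (u' x, v' x)) \<le> ennreal C"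
proof
 fix \<alpha> :: real assume "\<alpha> : {0<..<1}"
 hence \<alpha>: "0 < \<alpha>" "\<alpha> < 1" by auto
 have O: "open \<Omega>" "bounded \<Omega>" "smooth_boundary \<Omega>" using domain unfolding smooth_bounded_domain_def by auto
 interpret bounded_open \<Omega> by unfold_locales (rule O)+
 have "DIM(real ^ 'n) <= 4" using dim by auto
 then obtain C \<kappa>0 where C: "C > 0" "0 < \<kappa>0" "\<kappa>0 <= 1" "holder_est TYPE(real ^ 'n) \<alpha> \<kappa>0 C" using holder_est_all[OF _ \<alpha>] by blast
 obtain \<rho> where \<rho>: "0 < \<rho>" "!!x. x : frontier \<Omega> ==> EX y. dist x y = \<rho> & ball y \<rho> \<inter> \<Omega> = {}" using exterior_ball[OF O] by blast
 obtain r0 where r0: "!!x. x : closure \<Omega> ==> norm x <= r0" using bounded_closure[OF O(2)] unfolding bounded_iff by blast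
 define D where "D = 2*|r0| + \<rho>"
 obtain m0 where m0: "!!\<beta>. \<beta> > 0 ==> AE x in M. |u \<beta> x| <= m0 & |v \<beta> x| <= m0" using uniformly_bounded by blast
 define m where "m = |m0| + 1"
 have m: "0 < m" "0 <= m" by (auto simp: m_def)
 obtain l1 l2 where l: "!!\<beta>. \<beta> > 0 ==> |lam \<beta>| <= l1" "!!\<beta>. \<beta> > 0 ==> |mu \<beta>| <= l2"
  using lam_bounded mu_bounded unfolding bounded_iff by auto
 define \<Lambda> where "\<Lambda> = |l1| + |l2|"
 define \<omega> where "\<omega> = |\<omega>\<^sub>1| + |\<omega>\<^sub>2|"
 define \<kappa> where "\<kappa> = \<Lambda> + \<omega> * m^2"
 define K where "K = \<omega> * m^3 + \<Lambda> * m + 1"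
 have nn: "0 <= \<Lambda>" "0 <= \<omega>" "0 <= \<kappa>" "0 < K" using m by (auto simp: \<Lambda>_def \<omega>_def \<kappa>_def K_def add_nonneg_pos)
 \<comment> \<open>The interior estimate requires \<open>\<kappa>*d^2 <= \<kappa>0\<close>, so the
   balls used must have radius at most \<open>d0\<close>, even far from the boundary.\<close>
 define d0 where "d0 = min 1 (sqrt (\<kappa>0/(\<kappa> + 1)))"
 have d0: "0 < d0" "d0 <= 1" "\<kappa> * d0^2 <= \<kappa>0"
 proof -
  show "0 < d0" "d0 <= 1" using C nn by (auto simp: d0_def)
  have "d0^2 <= (sqrt (\<kappa>0/(\<kappa> + 1)))^2" using \<open>0 < d0\<close> by (intro power_mono) (auto simp: d0_def)
  hence "d0^2 <= \<kappa>0/(\<kappa> + 1)" using C nn by simp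
  from mult_left_mono[OF this nn(3)] have "\<kappa> * d0^2 <= \<kappa> / (\<kappa> + 1)*\<kappa>0" by simp
  also have "... <= 1*\<kappa>0" using nn C by (intro mult_right_mono) auto
  finally show "\<kappa> * d0^2 <= \<kappa>0" by simp
 qed
 define C1 where "C1 = (K*exp (DIM(real ^ 'n)/\<rho>\<^sup>2*D^2)*\<rho>\<^sup>2/(2*(real DIM(real ^ 'n))^2))*(DIM(real ^ 'n)/\<rho>\<^sup>2)*(D + \<rho>)"
 have C1: "0 < C1" using nn \<rho>(1) unfolding C1_def by (intro mult_pos_pos divide_pos_pos) (auto simp: D_def)
 define H where "H = C*(2*C1 + m/d0) + 4*(2*C1 + m/d0) + m"
 have H: "0 < H" unfolding H_def using C C1 m d0 by (intro add_pos_pos mult_pos_pos divide_pos_pos) auto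
 show "EX C>0. ALL \<beta>>0. EX u' v'. (AE x in M. u' x = u \<beta> x & v' x = v \<beta> x) & holder_norm (closure \<Omega>) \<alpha> (%x. (u' x, v' x)) <= ennreal C"
 proof (intro exI[of _ "2*m + 2*H"] conjI allI impI)
  show "0 < 2*m + 2*H" using m H by simp
  fix \<beta> :: real assume \<beta>: "0 < \<beta>"
  let ?u = "u \<beta>" and ?v = "v \<beta>"
  have su: "wsol \<omega>\<^sub>1 \<beta> (lam \<beta>) ?u ?v" by (rule u_solution[OF \<beta>])
  have sv: "wsol \<omega>\<^sub>2 \<beta> (mu \<beta>) ?v ?u" using v_solution[OF \<beta>] by (simp add: mult_ac)
  have pu: "AE x in M. 0 < ?u x & 0 < ?v x & ?u x <= m & ?v x <= m" using positive[OF \<beta>] m0[OF \<beta>] by eventually_elim (auto simp: m_def)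
  hence pv: "AE x in M. 0 < ?v x & 0 < ?u x & ?v x <= m & ?u x <= m" by eventually_elim auto
  have mu: "?u : borel_measurable M" "?v : borel_measurable M" using H1_0_D su sv unfolding weak_solution_def L2_def by blast+
  note A = su mu(2) pu \<beta> m(2) and B = sv mu(1) pv \<beta> m(2)
  define U V where "U = R ?u" and "V = R ?v"
  note ae = R_ae[OF A, folded U_def] R_ae[OF B, folded V_def]
  note CU = R_C2[OF A R_ae[OF B] R_lipschitz[OF B], folded U_def V_def] and CV = R_C2[OF B R_ae[OF A] R_lipschitz[OF A], folded U_def V_def]
  note rU = R_range[OF A, folded U_def, OF CU(1)] and rV = R_range[OF B, folded V_def, OF CV(1)]
  have U0: "0 < U x" "0 < V x" if "x : \<Omega>" for x
   using R_pos[OF A, folded U_def V_def, OF CU(1) _ CU(2) that] R_pos[OF B, folded U_def V_def, OF CV(1) _ CV(2) that] rU rV by blast+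
  have lm: "|lam \<beta>| <= \<Lambda>" "|mu \<beta>| <= \<Lambda>" using l[OF \<beta>] by (auto simp: \<Lambda>_def)
  have om: "|\<omega>\<^sub>1| <= \<omega>" "|\<omega>\<^sub>2| <= \<omega>" by (auto simp: \<omega>_def)
  have S: "Sol \<Omega> \<kappa> \<beta> U V"
  \<comment> \<open>The class \<open>Sol\<close> prescribes the Laplacian itself, so the cubic
    coefficients change sign.\<close>
  proof (rule SolI[where a = "lam \<beta>" and b = "- \<omega>\<^sub>1" and a' = "mu \<beta>" and b' = "- \<omega>\<^sub>2"])
   have "0 <= \<omega> * m^2" using nn by simp
   thus "|lam \<beta>| <= \<kappa>" "|mu \<beta>| <= \<kappa>" using lm by (auto simp: \<kappa>_def)
   have "|p|*q^2 <= \<kappa>" if "|p| <= \<omega>" "0 < q" "q <= m" for p q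
   proof -
    have "|p|*q^2 <= \<omega> * m^2" using that by (intro mult_mono power_mono) auto
    thus ?thesis using nn by (simp add: \<kappa>_def)
   qed
   thus "|- \<omega>\<^sub>1|*(U x)^2 <= \<kappa>" "|- \<omega>\<^sub>2|*(V x)^2 <= \<kappa>" if "x : \<Omega>" for x
    using om U0[OF that] rU[OF that] rV[OF that] by simp_all
  qed (use CU CV U0 \<beta> in \<open>auto simp: algebra_simps\<close>)
  have bdry: "U x <= C1*dist x x1 & V x <= C1*dist x x1" if x: "x : \<Omega>" "x1 : frontier \<Omega>" for x x1
  proof -
   obtain y0 where y0: "dist x1 y0 = \<rho>" "ball y0 \<rho> \<inter> \<Omega> = {}" using \<rho>(2)[OF x(2)] by blast
   have D: "ALL z:\<Omega>. dist z y0 <= D"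
   proof
    fix z assume "z : \<Omega>"
    hence "norm z <= r0" "norm x1 <= r0" using r0 closure_subset[of \<Omega>] x(2) by (auto simp: frontier_def)
    thus "dist z y0 <= D" using dist_triangle[of z y0 x1] y0(1) norm_triangle_ineq4[of z x1] unfolding D_def dist_norm by linarith
   qed
   have "|\<omega>\<^sub>1|*m^3 <= \<omega> * m^3" "|\<omega>\<^sub>2|*m^3 <= \<omega> * m^3" "|lam \<beta>|*m <= \<Lambda> * m" "|mu \<beta>|*m <= \<Lambda> * m"
    using om lm m by (intro mult_right_mono; simp)+
   hence K: "|\<omega>\<^sub>1|*m^3 + |lam \<beta>|*m <= K" "|\<omega>\<^sub>2|*m^3 + |mu \<beta>|*m <= K" by (auto simp: K_def)
   show ?thesis
    using R_boundary[OF A, folded U_def, OF CU(1) x(2) \<rho>(1) y0 D nn(4) K(1) x(1)]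
     R_boundary[OF B, folded V_def, OF CV(1) x(2) \<rho>(1) y0 D nn(4) K(2) x(1)] unfolding C1_def by blast
  qed
  \<comment> \<open>Zero is the continuous boundary value by linear decay, so this extension is the
    representative on the closed domain.\<close>
  let ?U = "%x. if x : \<Omega> then U x else 0" and ?V = "%x. if x : \<Omega> then V x else 0"
  have hU: "|?U x - ?U y| <= H*dist x y powr \<alpha>" "|?V x - ?V y| <= H*dist x y powr \<alpha>" for x y
   using zero_extension_holder[OF C(4,1) \<alpha>(1) less_imp_le[OF \<alpha>(2)] S m(1) _ d0 C1 bdry, of x y]
    zero_extension_holder[OF C(4,1) \<alpha>(1) less_imp_le[OF \<alpha>(2)] Sol_sym[OF S] m(1) _ d0 C1, of x y] bdry rU rV unfolding H_def by auto
  have "holder_norm (closure \<Omega>) \<alpha> (%x. (?U x, ?V x)) <= ennreal (2*m + 2*H)"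
   by (rule holder_norm_le) (use m H hU rU rV in auto)
  moreover have "AE x in M. ?U x = ?u x & ?V x = ?v x" using ae unfolding AE_M by eventually_elim auto
  ultimately show "EX u' v'. (AE x in M. u' x = ?u x & v' x = ?v x) & holder_norm (closure \<Omega>) \<alpha> (%x. (u' x, v' x)) <= ennreal (2*m + 2*H)"
   by (intro exI[of _ ?U] exI[of _ ?V] conjI)
 qed
qed

end
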